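(* Let $\Bbbk$ be an infinite field, let $L\subset \mathbb{A}^n$ be a $d$-dimensional linear space (a vector subspace of $\Bbbk^n$) and let $\widetilde{L} \subset (\mathbb{P}^1)^n$ be the closure of $L$ induced by the embedding $\mathbb{A}^n \hookrightarrow (\mathbb{P}^1)^n$. Let $M$ be the matroid of $L$; it has rank $r=n-d$. Then: (a) The homogenized cocircuits of $I(L)$ minimally generate the ideal $I(\widetilde{L})$. (b) The homogenized cocircuits of $I(L)$ form a universal Gröbner basis for $I(\widetilde{L})$, which is reduced under any term order. (c) The $\mathbb{Z}^n$-multidegree of $\widetilde{L}$ is $\sum_{B} t_{b_1}\cdots t_{b_{r}}$, summing over all bases $B = \{b_1,\ldots, b_{r}\}$ of $M$. (d) The bidegree of $\widetilde{L}$ is $t^r h_{M}(s/t)$, where $h_M$ is the $h$-polynomial of $M$. (e) There are at most $r!\cdot b$ distinct initial ideals of $I(\widetilde{L})$, where $b$ is the number of bases of $M$. (f) For every monomial term order $<$, the initial ideal $\mathrm{in}_< I(\widetilde{L})$ is the Stanley–Reisner ideal of the external activity complex $B_<(M^* )$ of the dual matroid $M^*$. Its primary decomposition is $$\mathrm{in}_< I(\widetilde{L}) = \bigcap_{B \text{ basis of } M} \left\langle \, x_e \, : \, e \in IA_<(B)\, , \; y_e \, : \, e \in IP_<(B) \right\rangle,$$ where $B = IA_<(B)\sqcup IP_<(B)$ is the partition of $B$ into internally active and internally passive elements with respect to $<$.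
   Context: Closure. Fix coordinates on $\mathbb{A}^n=\mathbb{A}^1\times\cdots\times\mathbb{A}^1$; adding one point at infinity to each factor gives $\mathbb{A}^n\hookrightarrow(\mathbb{P}^1)^n$, and $\widetilde L$ is the scheme-theoretic closure of $L$. The $i$-th $\mathbb{P}^1$ has homogeneous coordinates $x_i,y_i$ with affine coordinate $x_i/y_i$. With $I(L)\subset\Bbbk[x_1,\dots,x_n]$ the ideal of $L$, one has $I(\widetilde L)=(f^h: f\in I(L))\subset S=\Bbbk[x_1,\ldots,x_n,y_1,\ldots,y_n]$, where $f^h$ is obtained by substituting $x_i\mapsto x_i/y_i$ in $f$ and clearing denominators. Matroid and cocircuits. If $A$ is an $(n-d)\times n$ matrix whose rows, as linear forms, generate $I(L)$, then $M$ is the matroid on $[n]$ whose bases are the sets of $n-d$ linearly independent columns of $A$. The cocircuits of $M$ (circuits of the dual matroid $M^*$) are exactly the inclusion-minimal supports of nonzero linear forms in $I(L)$; for each cocircuit $D$ there is a linear form $f_D=\sum_{i\in D}a_ix_i\in I(L)$ with support $D$, unique up to scalar, also called a cocircuit of $I(L)$. The homogenized cocircuits are the $f_D^h=\sum_{i\in D}a_i x_i\prod_{j\in D\setminus i}y_j$, one for each cocircuit $D$ (polynomials are considered up to nonzero scalars). A universal Gröbner basis is a set that is a Gröbner basis for every term order. Multidegree. For $X\subset(\mathbb{P}^1)^n$ of codimension $r$ and an $r$-subset $\Delta=\{i_1,\dots,i_r\}\subset[n]$ let $Z_\Delta=\prod_{i\in\Delta}(\mathbb{P}^1)_i\times\prod_{i\notin\Delta}q_i$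 with $q_i\in(\mathbb{P}^1)_i$ general points, and let $m(Z_\Delta,X)$ be the number of points of $Z_\Delta\cap X$ counted with multiplicity. The $\mathbb{Z}^n$-multidegree of $X$ is $\sum_{\Delta}m(Z_\Delta,X)t_{i_1}\cdots t_{i_r}$. Bidegree. $S$ is also graded by $\mathrm{bideg}\,x_i=(1,0)$, $\mathrm{bideg}\,y_i=(0,1)$, for which $I(\widetilde L)$ is homogeneous. The bidegree of $\widetilde L$ is the multidegree (in the sense of Miller–Sturmfels) of $S/I(\widetilde L)$ in this $\mathbb{Z}^2$-grading, a homogeneous polynomial in $s,t$: if $K(s,t)=\sum_{i,(a,b)}(-1)^i\beta_{i,(a,b)}(S/I(\widetilde L))s^at^b$ is the K-polynomial, it is the sum of the terms of total degree $r=\operatorname{codim}$ in $K(1-s,1-t)$. For instance a prime generated by $p$ of the $x$-variables and $q$ of the $y$-variables has bidegree $s^pt^q$. $h$-polynomial. If $f_i$ is the number of independent sets of size $i$ of $M$, then $h_M(x)=\sum_{i=0}^r f_i(x-1)^{r-i}$. Order on $[n]$. A term order $<$ on $S$ induces a linear order, also denoted $<$, on $[n]$: $i<j$ whenever $x_iy_j>x_jy_i$ in the term order. Activities are taken with respect to this order. Activities. For a basis $B$ of a matroid $N$ on $E$ and $e\in B$, the fundamental cocircuit $D(B,e)$ is the unique cocircuit contained in $(E\setminus B)\cup e$; $e$ is internally active in $B$ if $e$ is the smallest element of $D(B,e)$, otherwise internally passive; $IA_<(B)$, $IP_<(B)$ denote the sets of such elements. For $e\notin B$, the fundamental circuit $C(B,e)$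 is the unique circuit contained in $B\cup e$; $e$ is externally active if it is the smallest element of $C(B,e)$, otherwise externally passive; $EA_<(B)$, $EP_<(B)$ denote the sets of such elements. External activity complex. For a matroid $N$ on $E$ with linear order $<$, $B_<(N)$ is the simplicial complex on $\{x_e,y_e:e\in E\}$ whose facets are the sets $\{x_e: e\in B\cup EP_<(B)\}\cup\{y_e:e\in B\cup EA_<(B)\}$ for the bases $B$ of $N$. The Stanley–Reisner ideal of a complex is generated by the squarefree monomials of its non-faces. *)

theory Defs
  imports
    "HOL-Library.Poly_Mapping"
    "HOL-Computational_Algebra.Polynomial"
    "HOL-Algebra.Algebraic_Closure_Type"
    "HOL-Analysis.Cartesian_Space"
begin

section \<open>Multivariate polynomials and ideals\<close>

type_synonym 'v mon = "'v \<Rightarrow>\<^sub>0 nat"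
type_synonym ('v, 'a) mpoly = "'v mon \<Rightarrow>\<^sub>0 'a"

definition monom_of :: "'v mon \<Rightarrow> ('v, 'a::zero_neq_one) mpoly"
  where "monom_of m = Poly_Mapping.single m 1"

definition Var :: "'v \<Rightarrow> ('v, 'a::zero_neq_one) mpoly"
  where "Var v = monom_of (Poly_Mapping.single v 1)"

definition Const :: "'a \<Rightarrow> ('v, 'a::zero) mpoly"
  where "Const c = Poly_Mapping.single 0 c"

text \<open>Apply \<open>h\<close> to the coefficients and substitute \<open>s v\<close> for the variable \<open>v\<close>.\<close>

definition mpoly_eval ::
    "('a::zero \<Rightarrow> 'b::comm_ring_1) \<Rightarrow> ('v \<Rightarrow> 'b) \<Rightarrow> ('v, 'a) mpoly \<Rightarrow> 'b"
  where "mpoly_eval h s f =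
    (\<Sum>m\<in>Poly_Mapping.keys f.
       h (Poly_Mapping.lookup f m) *
       (\<Prod>v\<in>Poly_Mapping.keys m. s v ^ Poly_Mapping.lookup m v))"

definition mon_degree :: "'v mon \<Rightarrow> nat"
  where "mon_degree m = (\<Sum>v\<in>Poly_Mapping.keys m. Poly_Mapping.lookup m v)"

definition degree_part :: "nat \<Rightarrow> ('v, 'a::comm_monoid_add) mpoly \<Rightarrow> ('v, 'a) mpoly"
  where "degree_part r f =
    (\<Sum>m | m \<in> Poly_Mapping.keys f \<and> mon_degree m = r.
       Poly_Mapping.single m (Poly_Mapping.lookup f m))"

abbreviation is_ideal :: "'a::comm_ring_1 set \<Rightarrow> bool"
  where "is_ideal \<equiv> module.subspace (*)"

abbreviation ideal_gen :: "'a::comm_ring_1 set \<Rightarrow> 'a set"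
  where "ideal_gen \<equiv> module.span (*)"

definition minimally_generates :: "'a::comm_ring_1 set \<Rightarrow> 'a set \<Rightarrow> bool"
  where "minimally_generates G I \<longleftrightarrow>
    ideal_gen G = I \<and> (\<forall>G'. G' \<subset> G \<longrightarrow> ideal_gen G' \<noteq> I)"

definition is_prime_ideal :: "'a::comm_ring_1 set \<Rightarrow> bool"
  where "is_prime_ideal P \<longleftrightarrow>
    is_ideal P \<and> P \<noteq> UNIV \<and> (\<forall>a b. a * b \<in> P \<longrightarrow> a \<in> P \<or> b \<in> P)"

definition is_primary_ideal :: "'a::comm_ring_1 set \<Rightarrow> bool"
  where "is_primary_ideal Q \<longleftrightarrow>
    is_ideal Q \<and> Q \<noteq> UNIV \<and> (\<forall>a b. a * b \<in> Q \<longrightarrow> a \<in> Q \<or> (\<exists>k. b ^ k \<in> Q))"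

definition ideal_radical :: "'a::comm_ring_1 set \<Rightarrow> 'a set"
  where "ideal_radical Q = {a. \<exists>k. a ^ k \<in> Q}"

definition minimal_primary_decomposition :: "'a::comm_ring_1 set \<Rightarrow> 'a set set \<Rightarrow> bool"
  where "minimal_primary_decomposition I \<Q> \<longleftrightarrow>
    finite \<Q> \<and> (\<forall>Q\<in>\<Q>. is_primary_ideal Q) \<and> \<Inter>\<Q> = I \<and>
    (\<forall>Q\<in>\<Q>. \<Inter>(\<Q> - {Q}) \<noteq> I) \<and> inj_on ideal_radical \<Q>"

text \<open>In a Noetherian ring all the suprema and infima below are attained.\<close>

definition prime_height :: "'a::comm_ring_1 set \<Rightarrow> nat"
  where "prime_height P = Sup {l. \<exists>C :: nat \<Rightarrow> 'a set.
    (\<forall>i\<le>l. is_prime_ideal (C i)) \<and> (\<forall>i<l. C i \<subset> C (Suc i)) \<and> C l = P}"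

definition codim :: "'a::comm_ring_1 set \<Rightarrow> nat"
  where "codim I = Inf {prime_height P | P. is_prime_ideal P \<and> I \<subseteq> P}"

section \<open>Term orders, initial ideals and Groebner bases\<close>

text \<open>An order is given by its reflexive relation: \<open>tle a b\<close> means that \<open>a\<close> is at most \<open>b\<close>.\<close>

definition term_order :: "('v mon \<Rightarrow> 'v mon \<Rightarrow> bool) \<Rightarrow> bool"
  where "term_order tle \<longleftrightarrow>
    (\<forall>a b. tle a b \<or> tle b a) \<and>
    (\<forall>a b. tle a b \<longrightarrow> tle b a \<longrightarrow> a = b) \<and>
    (\<forall>a b c. tle a b \<longrightarrow> tle b c \<longrightarrow> tle a c) \<and>
    (\<forall>a. tle 0 a) \<and>
    (\<forall>a b c. tle a b \<longrightarrow> tle (a + c) (b + c))"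

definition lead_mon :: "('v mon \<Rightarrow> 'v mon \<Rightarrow> bool) \<Rightarrow> ('v, 'a::zero) mpoly \<Rightarrow> 'v mon"
  where "lead_mon tle f =
    (THE m. m \<in> Poly_Mapping.keys f \<and> (\<forall>m'\<in>Poly_Mapping.keys f. tle m' m))"

definition lead_ideal ::
    "('v mon \<Rightarrow> 'v mon \<Rightarrow> bool) \<Rightarrow> ('v, 'a::field) mpoly set \<Rightarrow> ('v, 'a) mpoly set"
  where "lead_ideal tle F = ideal_gen {monom_of (lead_mon tle f) | f. f \<in> F \<and> f \<noteq> 0}"

text \<open>When \<open>F\<close> is an ideal \<open>I\<close>, this is the initial ideal of \<open>I\<close>.\<close>

abbreviation "initial_ideal \<equiv> lead_ideal"

definition groebner_basis ::
    "('v mon \<Rightarrow> 'v mon \<Rightarrow> bool) \<Rightarrow> ('v, 'a::field) mpoly set \<Rightarrow> ('v, 'a) mpoly set \<Rightarrow> bool"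
  where "groebner_basis tle G I \<longleftrightarrow>
    finite G \<and> G \<subseteq> I \<and> lead_ideal tle G = initial_ideal tle I"

definition universal_groebner_basis ::
    "('v, 'a::field) mpoly set \<Rightarrow> ('v, 'a) mpoly set \<Rightarrow> bool"
  where "universal_groebner_basis G I \<longleftrightarrow> (\<forall>tle. term_order tle \<longrightarrow> groebner_basis tle G I)"

text \<open>Polynomials are considered up to nonzero scalars, so the usual requirement that the
  leading coefficients be 1 (which depends on the term order) is dropped.\<close>

definition reduced_groebner_basis ::
    "('v mon \<Rightarrow> 'v mon \<Rightarrow> bool) \<Rightarrow> ('v, 'a::field) mpoly set \<Rightarrow> ('v, 'a) mpoly set \<Rightarrow> bool"
  where "reduced_groebner_basis tle G I \<longleftrightarrow>
    groebner_basis tle G I \<and> 0 \<notin> G \<and>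
    (\<forall>g\<in>G. \<forall>m\<in>Poly_Mapping.keys g. monom_of m \<notin> lead_ideal tle (G - {g}))"

section \<open>Matroids on the ground set \<open>UNIV\<close>, given by their bases\<close>

definition matroid :: "'e::finite set set \<Rightarrow> bool"
  where "matroid M \<longleftrightarrow> M \<noteq> {} \<and>
    (\<forall>B1\<in>M. \<forall>B2\<in>M. \<forall>e\<in>B1 - B2. \<exists>f\<in>B2 - B1. insert f (B1 - {e}) \<in> M)"

definition indep_sets :: "'e::finite set set \<Rightarrow> 'e set set"
  where "indep_sets M = {I. \<exists>B\<in>M. I \<subseteq> B}"

definition matroid_rank :: "'e::finite set set \<Rightarrow> nat"
  where "matroid_rank M = Max (card ` indep_sets M)"

definition circuits :: "'e::finite set set \<Rightarrow> 'e set set"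
  where "circuits M = {C. C \<notin> indep_sets M \<and> (\<forall>C'. C' \<subset> C \<longrightarrow> C' \<in> indep_sets M)}"

definition dual_matroid :: "'e::finite set set \<Rightarrow> 'e set set"
  where "dual_matroid M = {- B | B. B \<in> M}"

definition cocircuits :: "'e::finite set set \<Rightarrow> 'e set set"
  where "cocircuits M = circuits (dual_matroid M)"

definition h_polynomial :: "'e::finite set set \<Rightarrow> int poly"
  where "h_polynomial M =
    (\<Sum>i\<le>matroid_rank M.
       of_nat (card {I \<in> indep_sets M. card I = i}) * [:-1, 1:] ^ (matroid_rank M - i))"

definition fund_cocircuit :: "'e::finite set set \<Rightarrow> 'e set \<Rightarrow> 'e \<Rightarrow> 'e set"
  where "fund_cocircuit M B e = (THE D. D \<in> cocircuits M \<and> D \<subseteq> insert e (- B))"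

definition fund_circuit :: "'e::finite set set \<Rightarrow> 'e set \<Rightarrow> 'e \<Rightarrow> 'e set"
  where "fund_circuit M B e = (THE C. C \<in> circuits M \<and> C \<subseteq> insert e B)"

text \<open>In the following, \<open>ls\<close> is a strict linear order on the ground set.\<close>

definition is_smallest :: "('e \<Rightarrow> 'e \<Rightarrow> bool) \<Rightarrow> 'e \<Rightarrow> 'e set \<Rightarrow> bool"
  where "is_smallest ls e D \<longleftrightarrow> e \<in> D \<and> (\<forall>j\<in>D. j \<noteq> e \<longrightarrow> ls e j)"

definition int_active :: "('e::finite \<Rightarrow> 'e \<Rightarrow> bool) \<Rightarrow> 'e set set \<Rightarrow> 'e set \<Rightarrow> 'e set"
  where "int_active ls M B = {e \<in> B. is_smallest ls e (fund_cocircuit M B e)}"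

definition int_passive :: "('e::finite \<Rightarrow> 'e \<Rightarrow> bool) \<Rightarrow> 'e set set \<Rightarrow> 'e set \<Rightarrow> 'e set"
  where "int_passive ls M B = {e \<in> B. \<not> is_smallest ls e (fund_cocircuit M B e)}"

definition ext_active :: "('e::finite \<Rightarrow> 'e \<Rightarrow> bool) \<Rightarrow> 'e set set \<Rightarrow> 'e set \<Rightarrow> 'e set"
  where "ext_active ls M B = {e. e \<notin> B \<and> is_smallest ls e (fund_circuit M B e)}"

definition ext_passive :: "('e::finite \<Rightarrow> 'e \<Rightarrow> bool) \<Rightarrow> 'e set set \<Rightarrow> 'e set \<Rightarrow> 'e set"
  where "ext_passive ls M B = {e. e \<notin> B \<and> \<not> is_smallest ls e (fund_circuit M B e)}"

section \<open>The coordinate ring of the product of projective lines\<close>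

datatype 'n hvar = xv 'n | yv 'n

instance hvar :: (finite) finite
proof
  have "(UNIV :: 'a::finite hvar set) = range xv \<union> range yv"
    by (metis UNIV_eq_I UnCI hvar.exhaust rangeI)
  then show "finite (UNIV :: 'a::finite hvar set)"
    by (metis finite_Un finite_code finite_imageI)
qed

definition var_degree :: "'v \<Rightarrow> ('v, 'a::zero) mpoly \<Rightarrow> nat"
  where "var_degree i f = Max (insert 0 ((\<lambda>m. Poly_Mapping.lookup m i) ` Poly_Mapping.keys f))"

text \<open>Substituting \<open>x\<^sub>i / y\<^sub>i\<close> for \<open>x\<^sub>i\<close> in \<open>f\<close> and multiplying by the least common denominator
  \<open>\<Prod>\<^sub>i y\<^sub>i ^ deg\<^sub>i f\<close>, where \<open>deg\<^sub>i\<close> is the degree in \<open>x\<^sub>i\<close>.\<close>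

definition homogenize :: "('n::finite, 'a::comm_ring_1) mpoly \<Rightarrow> ('n hvar, 'a) mpoly"
  where "homogenize f =
    (\<Sum>m\<in>Poly_Mapping.keys f. Const (Poly_Mapping.lookup f m) *
       (\<Prod>i\<in>UNIV. Var (xv i) ^ Poly_Mapping.lookup m i *
                  Var (yv i) ^ (var_degree i f - Poly_Mapping.lookup m i)))"

definition vanishing_ideal :: "('a::field ^ 'n) set \<Rightarrow> ('n::finite, 'a) mpoly set"
  where "vanishing_ideal L = {f. \<forall>v\<in>L. mpoly_eval id (($) v) f = 0}"

text \<open>The multihomogeneous ideal of the scheme-theoretic closure of \<open>L\<close> in the product of
  projective lines.\<close>

definition closure_ideal :: "('a::field ^ 'n) set \<Rightarrow> ('n::finite hvar, 'a) mpoly set"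
  where "closure_ideal L = ideal_gen (homogenize ` vanishing_ideal L)"

definition linear_form :: "'a::comm_ring_1 ^ 'n \<Rightarrow> ('n::finite, 'a) mpoly"
  where "linear_form a = (\<Sum>i\<in>UNIV. Const (a $ i) * Var i)"

text \<open>The matrix with rows \<open>A 0, \<dots>, A (r - 1)\<close>; rows are indexed by natural numbers because
  there may be none.\<close>

definition column_matroid :: "nat \<Rightarrow> (nat \<Rightarrow> 'a::field ^ 'n) \<Rightarrow> 'n::finite set set"
  where "column_matroid r A = {B. card B = r \<and>
    (\<forall>c. (\<forall>i<r. (\<Sum>j\<in>B. c j * A i $ j) = 0) \<longrightarrow> (\<forall>j\<in>B. c j = 0))}"

text \<open>\<open>a D\<close> is the coefficient vector of a cocircuit \<open>f\<^sub>D\<close> of \<open>I(L)\<close>, one for each cocircuit \<open>D\<close>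
  of the matroid.\<close>

definition cocircuit_forms ::
    "('a::field ^ 'n) set \<Rightarrow> 'n::finite set set \<Rightarrow> ('n set \<Rightarrow> 'a ^ 'n) \<Rightarrow> bool"
  where "cocircuit_forms L M a \<longleftrightarrow>
    (\<forall>D\<in>cocircuits M. linear_form (a D) \<in> vanishing_ideal L \<and> {i. a D $ i \<noteq> 0} = D)"

definition homogenized_cocircuits ::
    "'n::finite set set \<Rightarrow> ('n set \<Rightarrow> 'a::field ^ 'n) \<Rightarrow> ('n hvar, 'a) mpoly set"
  where "homogenized_cocircuits M a = {homogenize (linear_form (a D)) | D. D \<in> cocircuits M}"

section \<open>Multidegree\<close>

text \<open>Points of the projective line, with normalized homogeneous coordinates \<open>[a : 1]\<close> and
  \<open>[1 : 0]\<close>.\<close>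

datatype 'f P1 = Fin 'f | Infty

fun hcoord :: "('n \<Rightarrow> 'f::field P1) \<Rightarrow> 'n hvar \<Rightarrow> 'f"
  where
    "hcoord p (xv i) = (case p i of Fin a \<Rightarrow> a | Infty \<Rightarrow> 1)"
  | "hcoord p (yv i) = (case p i of Fin a \<Rightarrow> 1 | Infty \<Rightarrow> 0)"

text \<open>The ideal of the intersection of the scheme of \<open>I\<close> with \<open>Z\<^sub>\<Delta>\<close>, where only the \<open>q i\<close> with
  \<open>i \<notin> \<Delta>\<close> matter.\<close>

definition section_ideal ::
    "('n hvar, 'k::field) mpoly set \<Rightarrow> 'n set \<Rightarrow> ('n \<Rightarrow> 'k P1) \<Rightarrow> ('n hvar, 'k) mpoly set"
  where "section_ideal I \<Delta> q = ideal_gen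
    (I \<union> {Const (hcoord q (yv i)) * Var (xv i) - Const (hcoord q (xv i)) * Var (yv i) | i. i \<notin> \<Delta>})"

definition geometric_points ::
    "('n hvar, 'k::field) mpoly set \<Rightarrow> ('n \<Rightarrow> 'k alg_closure P1) set"
  where "geometric_points J = {p. \<forall>f\<in>J. mpoly_eval to_ac (hcoord p) f = 0}"

text \<open>Coordinates on the affine chart around \<open>p\<close>, translated so that \<open>p\<close> becomes the origin.\<close>

fun local_coord :: "('n \<Rightarrow> 'f::field P1) \<Rightarrow> 'n hvar \<Rightarrow> ('n, 'f) mpoly"
  where
    "local_coord p (xv i) = (case p i of Fin a \<Rightarrow> Var i + Const a | Infty \<Rightarrow> 1)"
  | "local_coord p (yv i) = (case p i of Fin a \<Rightarrow> 1 | Infty \<Rightarrow> Var i)"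

text \<open>The kernel of the map from the coordinate ring of this chart to the local ring at \<open>p\<close> of the
  scheme of \<open>J\<close> (over the algebraic closure). If \<open>p\<close> is an isolated point of this scheme, then
  this map is surjective.\<close>

definition local_kernel ::
    "('n hvar, 'k::field) mpoly set \<Rightarrow> ('n \<Rightarrow> 'k alg_closure P1) \<Rightarrow> ('n, 'k alg_closure) mpoly set"
  where "local_kernel J p = {f. \<exists>u. Poly_Mapping.lookup u 0 \<noteq> 0 \<and>
    u * f \<in> ideal_gen (mpoly_eval (\<lambda>c. Const (to_ac c)) (local_coord p) ` J)}"

definition quotient_dim :: "('v, 'f::field) mpoly set \<Rightarrow> nat"
  where "quotient_dim V = (THE d. \<exists>B. finite B \<and> card B = d \<and>
    \<not> module.dependent (\<lambda>c f. Const c * f) B \<and>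
    module.span (\<lambda>c f. Const c * f) B \<inter> V = {0} \<and>
    (\<forall>f. \<exists>g\<in>module.span (\<lambda>c f. Const c * f) B. f - g \<in> V))"

definition point_multiplicity ::
    "('n hvar, 'k::field) mpoly set \<Rightarrow> ('n \<Rightarrow> 'k alg_closure P1) \<Rightarrow> nat"
  where "point_multiplicity J p = quotient_dim (local_kernel J p)"

definition multihomogeneous :: "('n hvar, 'k::zero) mpoly \<Rightarrow> bool"
  where "multihomogeneous g \<longleftrightarrow> (\<exists>e. \<forall>m\<in>Poly_Mapping.keys g. \<forall>i.
    Poly_Mapping.lookup m (xv i) + Poly_Mapping.lookup m (yv i) = e i)"

text \<open>The number \<open>m(Z\<^sub>\<Delta>, X)\<close> for the scheme \<open>X\<close> of \<open>I\<close>. The points \<open>q i\<close> with \<open>i \<notin> \<Delta>\<close> are general: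
  the count is required on some nonempty basic open set \<open>g \<noteq> 0\<close> of the product of the
  corresponding projective lines.\<close>

definition section_number :: "('n hvar, 'k::field) mpoly set \<Rightarrow> 'n set \<Rightarrow> nat"
  where "section_number I \<Delta> = (THE N. \<exists>g :: ('n hvar, 'k) mpoly.
    g \<noteq> 0 \<and> multihomogeneous g \<and>
    (\<forall>m\<in>Poly_Mapping.keys g. Poly_Mapping.keys m \<subseteq> xv ` (- \<Delta>) \<union> yv ` (- \<Delta>)) \<and>
    (\<forall>q. mpoly_eval id (hcoord q) g \<noteq> 0 \<longrightarrow>
       finite (geometric_points (section_ideal I \<Delta> q)) \<and>
       (\<Sum>p\<in>geometric_points (section_ideal I \<Delta> q).
          point_multiplicity (section_ideal I \<Delta> q) p) = N))"

definition multidegree :: "('n::finite hvar, 'k::field) mpoly set \<Rightarrow> ('n, int) mpoly"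
  where "multidegree I =
    (\<Sum>\<Delta> | card \<Delta> = codim I. of_nat (section_number I \<Delta>) * (\<Prod>i\<in>\<Delta>. Var i))"

section \<open>Bidegree\<close>

definition bideg :: "'n::finite hvar mon \<Rightarrow> nat \<times> nat"
  where "bideg m =
    (\<Sum>i\<in>UNIV. Poly_Mapping.lookup m (xv i), \<Sum>i\<in>UNIV. Poly_Mapping.lookup m (yv i))"

text \<open>A sequence of free modules \<open>F\<^sub>i\<close> with basis elements \<open>j < rk i\<close> in bidegree \<open>dg i j\<close>; the
  augmentation of \<open>F\<^sub>0\<close> sends basis element \<open>j\<close> to the class of \<open>aug j\<close>, and \<open>dif i j k\<close> are the
  entries of the matrix of the differential from \<open>F\<^sub>i\<^sub>+\<^sub>1\<close> to \<open>F\<^sub>i\<close>.\<close>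

record (overloaded) ('n, 'k) free_complex =
  rk :: "nat \<Rightarrow> nat"
  dg :: "nat \<Rightarrow> nat \<Rightarrow> nat \<times> nat"
  aug :: "nat \<Rightarrow> ('n hvar, 'k) mpoly"
  dif :: "nat \<Rightarrow> nat \<Rightarrow> nat \<Rightarrow> ('n hvar, 'k) mpoly"

text \<open>The graded minimal free resolutions of \<open>S / I\<close>. They exist for every bihomogeneous \<open>I\<close> and
  are unique up to isomorphism.\<close>

definition minimal_free_resolution ::
    "('n::finite hvar, 'k::field) mpoly set \<Rightarrow> ('n, 'k) free_complex \<Rightarrow> bool"
  where "minimal_free_resolution I F \<longleftrightarrow>
    \<comment> \<open>the augmentation and the differentials are homogeneous of degree 0\<close>
    (\<forall>j<rk F 0. \<forall>m\<in>Poly_Mapping.keys (aug F j). bideg m = dg F 0 j) \<and>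
    (\<forall>i. \<forall>j<rk F i. \<forall>k<rk F (Suc i). \<forall>m\<in>Poly_Mapping.keys (dif F i j k).
       dg F i j + bideg m = dg F (Suc i) k) \<and>
    (\<forall>f. \<exists>v. f - (\<Sum>j<rk F 0. v j * aug F j) \<in> I) \<and>
    (\<forall>v. (\<Sum>j<rk F 0. v j * aug F j) \<in> I \<longleftrightarrow>
       (\<exists>w. \<forall>j<rk F 0. v j = (\<Sum>k<rk F 1. dif F 0 j k * w k))) \<and>
    (\<forall>i v. (\<forall>j<rk F i. (\<Sum>k<rk F (Suc i). dif F i j k * v k) = 0) \<longleftrightarrow>
       (\<exists>w. \<forall>k<rk F (Suc i). v k = (\<Sum>l<rk F (Suc (Suc i)). dif F (Suc i) k l * w l))) \<and>
    \<comment> \<open>minimality: the matrix entries have no constant term\<close>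
    (\<forall>i. \<forall>j<rk F i. \<forall>k<rk F (Suc i). Poly_Mapping.lookup (dif F i j k) 0 = 0)"

definition betti :: "('n::finite hvar, 'k::field) mpoly set \<Rightarrow> nat \<Rightarrow> nat \<times> nat \<Rightarrow> nat"
  where "betti I i d =
    (let F = (SOME F. minimal_free_resolution I F) in card {j. j < rk F i \<and> dg F i j = d})"

datatype st = S_var | T_var

text \<open>The coefficient of \<open>s\<^sup>a t\<^sup>b\<close> is the alternating sum over \<open>i\<close> of the Betti numbers in
  bidegree \<open>(a, b)\<close>.\<close>

definition K_polynomial :: "('n::finite hvar, 'k::field) mpoly set \<Rightarrow> (st, int) mpoly"
  where "K_polynomial I = Abs_poly_mapping (\<lambda>m.
    Sum_any (\<lambda>i. (- 1) ^ i *
      int (betti I i (Poly_Mapping.lookup m S_var, Poly_Mapping.lookup m T_var))))"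

definition bidegree :: "('n::finite hvar, 'k::field) mpoly set \<Rightarrow> (st, int) mpoly"
  where "bidegree I =
    degree_part (codim I) (mpoly_eval Const (\<lambda>v. 1 - Var v) (K_polynomial I))"

text \<open>The polynomial \<open>t\<^sup>r h(s/t)\<close>, for \<open>h\<close> of degree at most \<open>r\<close>.\<close>

definition homogenize_st :: "nat \<Rightarrow> int poly \<Rightarrow> (st, int) mpoly"
  where "homogenize_st r h = (\<Sum>k\<le>r. Const (coeff h k) * Var S_var ^ k * Var T_var ^ (r - k))"

section \<open>The external activity complex\<close>

text \<open>The order on the ground set induced by a term order: \<open>i < j\<close> whenever
  \<open>x\<^sub>i y\<^sub>j > x\<^sub>j y\<^sub>i\<close>.\<close>

definition induced_less :: "('n hvar mon \<Rightarrow> 'n hvar mon \<Rightarrow> bool) \<Rightarrow> 'n \<Rightarrow> 'n \<Rightarrow> bool"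
  where "induced_less tle i j \<longleftrightarrow>
    (let a = Poly_Mapping.single (xv i) 1 + Poly_Mapping.single (yv j) 1;
         b = Poly_Mapping.single (xv j) 1 + Poly_Mapping.single (yv i) 1
     in tle b a \<and> a \<noteq> b)"

definition ext_activity_complex ::
    "('n::finite \<Rightarrow> 'n \<Rightarrow> bool) \<Rightarrow> 'n set set \<Rightarrow> 'n hvar set set"
  where "ext_activity_complex ls N =
    {\<sigma>. \<exists>B\<in>N. \<sigma> \<subseteq> xv ` (B \<union> ext_passive ls N B) \<union> yv ` (B \<union> ext_active ls N B)}"

definition stanley_reisner_ideal :: "'v::finite set set \<Rightarrow> ('v, 'k::field) mpoly set"
  where "stanley_reisner_ideal \<C> = ideal_gen {\<Prod>v\<in>\<sigma>. Var v | \<sigma>. \<sigma> \<notin> \<C>}"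

definition activity_ideal ::
    "('n::finite \<Rightarrow> 'n \<Rightarrow> bool) \<Rightarrow> 'n set set \<Rightarrow> 'n set \<Rightarrow> ('n hvar, 'k::field) mpoly set"
  where "activity_ideal ls M B =
    ideal_gen (Var ` (xv ` int_active ls M B \<union> yv ` int_passive ls M B))"

end

theory Submission
  imports Defs "HOL-Library.Function_Algebras"
begin

text \<open>
  Let \<open>V\<close> be the space of linear forms that vanish on \<open>L\<close>. A basis of the matroid is a set \<open>B\<close> of
  coordinates such that the coefficients in \<open>B\<close> of a form in \<open>V\<close> can be prescribed arbitrarily and
  determine the form; a cocircuit is a minimal support of a nonzero form in \<open>V\<close>. For a linear order
  on the coordinates, a monomial in the variables \<open>x\<^sub>i\<close>, \<open>y\<^sub>i\<close> is called standard if it is not divisible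
  by any of the monomials \<open>x\<^sub>i \<Prod>y\<^sub>j\<close>, where \<open>i\<close> is the smallest element of the support of a nonzero
  form in \<open>V\<close> and \<open>j\<close> runs over the other elements of this support. The proof rests on three facts
  about standard monomials.

  They are linearly independent modulo the ideal of the closure. This is
  \<open>standard_monomials_independent\<close>, proved by induction on the multidegree. Let \<open>e\<close> be the largest
  coordinate that occurs. On the hyperplane \<open>v\<^sub>e = 0\<close> only the monomials without \<open>x\<^sub>e\<close> survive, and
  they are standard for the smaller linear space; the other monomials are divisible by \<open>v\<^sub>e\<close>.

  Every polynomial is congruent to a combination of standard monomials modulo the homogenized
  cocircuits (\<open>reduce_polynomial\<close>). For the linear order that a term order induces on the coordinates,
  the monomial \<open>x\<^sub>i \<Prod>y\<^sub>j\<close> above is the leading monomial of the homogenized form.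

  The support of a standard monomial avoids \<open>x\<^sub>b\<close> for the internally active and \<open>y\<^sub>b\<close> for the
  internally passive elements \<open>b\<close> of some basis, and this property characterizes standard monomials
  (\<open>standard_basis_exists\<close> and \<open>standard_iff_basis\<close>, by deletion and contraction of the largest
  coordinate).

  The first two facts show that the homogenized cocircuits generate the ideal of the closure and are
  a Groebner basis for every term order (\<open>closure_generators\<close>, \<open>initial_ideal_closure\<close>). Since the
  supports of different cocircuits are incomparable, this Groebner basis is reduced and the
  generators are minimal. The third fact is the primary decomposition of the initial ideal
  (\<open>nonstd_ideal_decomposition\<close>), which also identifies it as a Stanley-Reisner ideal. The smallest
  elements of the supports of the forms in \<open>V\<close> constitute a basis of the matroid, and the initial
  ideal depends only on this basis and on the order of its elements (\<open>initial_ideals_bound\<close>); this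
  gives at most \<open>r!\<close> initial ideals for each basis.

  The codimension of the closure is \<open>r\<close>: lower bounds for the dimension of its coordinate ring come
  from the standard monomials, and upper bounds from the chain of the closures of larger linear
  spaces (\<open>codim_torus_ideal\<close>). The linear spaces that fix the coordinates outside a set \<open>\<Delta>\<close> of \<open>r\<close>
  elements meet the closure transversally in one point if \<open>\<Delta>\<close> is a basis, and in general not at all
  if \<open>\<Delta>\<close> is dependent (\<open>section_number_basis\<close>, \<open>section_number_dependent\<close>). This is the multidegree.

  For the bidegree, minimal free resolutions exist by the Hilbert basis theorem, and their Euler
  characteristic in every bidegree relates the Betti numbers to the Hilbert function, which counts
  standard monomials (\<open>hilbert_function_resolution\<close>). Grouping these by supports gives an explicit
  K-polynomial, and after the substitution \<open>s \<mapsto> 1 - s\<close>, \<open>t \<mapsto> 1 - t\<close> the terms of lowest degree come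
  from the maximal supports, one for each basis (\<open>K_polynomial_torus_ideal\<close>, \<open>bidegree_torus_ideal\<close>).
  The basis \<open>B\<close> contributes \<open>s\<close> to the number of its internally active elements times \<open>t\<close> to the
  number of its internally passive elements, and the sum of these terms is the h-polynomial because
  the intervals from the passive part of a basis to the basis partition the independent sets
  (\<open>h_polynomial_activity\<close>).
\<close>

section \<open>Polynomials\<close>

interpretation ideal: Modules.module "(*) :: 'a::comm_ring_1 \<Rightarrow> 'a \<Rightarrow> 'a"
  by unfold_locales (simp_all add: algebra_simps)

declare ideal.scale_scale [simp del]

lemma ideal_gen_mult_left:
  fixes f g :: "'a::comm_ring_1"
  shows "f \<in> ideal_gen S \<Longrightarrow> g * f \<in> ideal_gen S"
  by (rule ideal.span_scale)

lemma ideal_gen_least: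
  fixes S :: "'a::comm_ring_1 set"
  assumes "S \<subseteq> T" "0 \<in> T" "\<And>a b. a \<in> T \<Longrightarrow> b \<in> T \<Longrightarrow> a + b \<in> T" "\<And>a b. b \<in> T \<Longrightarrow> a * b \<in> T"
  shows "ideal_gen S \<subseteq> T"
  using assms by (intro ideal.span_minimal ideal.subspaceI) auto

lemma mpoly_expand:
  fixes f :: "('v, 'a::comm_monoid_add) mpoly"
  shows "f = (\<Sum>m\<in>Poly_Mapping.keys f. Poly_Mapping.single m (Poly_Mapping.lookup f m))"
proof (rule poly_mapping_eqI)
  fix k
  have "Poly_Mapping.lookup (\<Sum>m\<in>Poly_Mapping.keys f. Poly_Mapping.single m (Poly_Mapping.lookup f m)) k
      = (\<Sum>m\<in>Poly_Mapping.keys f. if m = k then Poly_Mapping.lookup f m else 0)"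
    by (simp add: lookup_sum lookup_single when_def)
  also have "\<dots> = Poly_Mapping.lookup f k"
    by (simp add: in_keys_iff)
  finally show "Poly_Mapping.lookup f k = Poly_Mapping.lookup
      (\<Sum>m\<in>Poly_Mapping.keys f. Poly_Mapping.single m (Poly_Mapping.lookup f m)) k" by simp
qed

lemma mpoly_induct [case_names zero single add]:
  fixes f :: "('v, 'a::comm_monoid_add) mpoly"
  assumes "P 0" "\<And>m c. P (Poly_Mapping.single m c)" "\<And>f g. P f \<Longrightarrow> P g \<Longrightarrow> P (f + g)"
  shows "P f"
proof -
  have "P (\<Sum>m\<in>A. Poly_Mapping.single m (Poly_Mapping.lookup f m))" if "finite A" for A
    using that by induction (auto intro: assms)
  from this[of "Poly_Mapping.keys f"] show ?thesis
    by (subst mpoly_expand) simp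
qed

text \<open>Only the coefficients at multiples of \<open>a\<close> can be nonzero; the truncated difference \<open>k - a\<close> is the
  quotient monomial there.\<close>

lemma lookup_single_mult:
  fixes f :: "('v, 'a::comm_ring_1) mpoly"
  shows "Poly_Mapping.lookup (Poly_Mapping.single a c * f) k =
    (if \<exists>m. k = a + m then c * Poly_Mapping.lookup f (k - a) else 0)"
proof (induction f rule: mpoly_induct)
  case (single m b)
  show ?case
  proof (cases "\<exists>m'. k = a + m'")
    case True
    then obtain m' where "k = a + m'" by blast
    then show ?thesis by (auto simp: mult_single lookup_single when_def)
  next
    case False
    then have "a + m \<noteq> k" by metis
    with False show ?thesis by (simp add: mult_single lookup_single when_def)
  qed
qed (auto simp: lookup_add algebra_simps)

lemma lookup_single_mult_add [simp]:
  fixes f :: "('v, 'a::comm_ring_1) mpoly"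
  shows "Poly_Mapping.lookup (Poly_Mapping.single a c * f) (a + m) = c * Poly_Mapping.lookup f m"
  by (auto simp: lookup_single_mult)

lemma lookup_Const_mult [simp]:
  fixes f :: "('v, 'a::comm_ring_1) mpoly"
  shows "Poly_Mapping.lookup (Const c * f) m = c * Poly_Mapping.lookup f m"
  unfolding Const_def by (simp add: lookup_single_mult)

lemma keys_monom_of [simp]: "Poly_Mapping.keys (monom_of m :: ('v, 'a::zero_neq_one) mpoly) = {m}"
  by (simp add: monom_of_def)

lemma monom_of_add: "monom_of (a + b) = (monom_of a * monom_of b :: ('v, 'a::comm_ring_1) mpoly)"
  by (simp add: monom_of_def mult_single)

lemma monom_of_0 [simp]: "monom_of 0 = 1"
  by (simp add: monom_of_def)

lemma single_eq_Const_monom: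
  "Poly_Mapping.single m (c::'a::comm_ring_1) = Const c * monom_of m"
  by (simp add: Const_def monom_of_def mult_single)

lemma monom_of_sum:
  "monom_of (sum g A) = (\<Prod>a\<in>A. monom_of (g a) :: ('v, 'a::comm_ring_1) mpoly)"
  by (induction A rule: infinite_finite_induct) (auto simp: monom_of_add)

lemma Const_add: "Const (a + b) = Const a + Const b"
  and Const_mult: "Const (a * b :: 'a::comm_ring_1) = Const a * Const b"
  and Const_0 [simp]: "Const 0 = 0"
  and Const_1 [simp]: "Const 1 = (1 :: ('v, 'b::comm_ring_1) mpoly)"
  by (simp_all add: Const_def single_add mult_single)

lemma Const_minus: "Const (- a) = - (Const a :: ('v, 'a::comm_ring_1) mpoly)"
  by (simp add: Const_def single_uminus)

lemma Const_sum: "Const (sum g A) = (\<Sum>a\<in>A. Const (g a) :: ('v, 'a::comm_ring_1) mpoly)"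
  by (induction A rule: infinite_finite_induct) (simp_all add: Const_add)

lemma mpoly_expand_monom:
  fixes f :: "('v, 'a::comm_ring_1) mpoly"
  shows "f = (\<Sum>m\<in>Poly_Mapping.keys f. Const (Poly_Mapping.lookup f m) * monom_of m)"
  using mpoly_expand[of f] by (simp add: single_eq_Const_monom)

text \<open>The value of a monomial at the point \<open>s\<close>.\<close>

definition mev :: "('v \<Rightarrow> 'b::comm_ring_1) \<Rightarrow> 'v mon \<Rightarrow> 'b"
  where "mev s m = (\<Prod>v\<in>Poly_Mapping.keys m. s v ^ Poly_Mapping.lookup m v)"

lemma mev_superset:
  assumes "finite A" "Poly_Mapping.keys m \<subseteq> A"
  shows "mev s m = (\<Prod>v\<in>A. s v ^ Poly_Mapping.lookup m v)"
  unfolding mev_def by (rule prod.mono_neutral_left) (use assms in \<open>auto simp: in_keys_iff\<close>)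

lemma mev_add: "mev s (a + b) = mev s a * mev s b"
proof -
  let ?A = "Poly_Mapping.keys a \<union> Poly_Mapping.keys b"
  have "mev s (a + b) = (\<Prod>v\<in>?A. s v ^ Poly_Mapping.lookup (a + b) v)"
    using keys_add[of a b] by (intro mev_superset) auto
  also have "\<dots> = (\<Prod>v\<in>?A. s v ^ Poly_Mapping.lookup a v) * (\<Prod>v\<in>?A. s v ^ Poly_Mapping.lookup b v)"
    by (simp add: lookup_add power_add prod.distrib)
  also have "\<dots> = mev s a * mev s b"
    by (simp add: mev_superset[of ?A])
  finally show ?thesis .
qed

lemma mev_0 [simp]: "mev s 0 = 1"
  by (simp add: mev_def)

lemma mev_single [simp]: "mev s (Poly_Mapping.single v k) = s v ^ k"
  by (auto simp: mev_def)

lemma mev_finite: "mev s (m :: 'v::finite mon) = (\<Prod>v\<in>UNIV. s v ^ Poly_Mapping.lookup m v)"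
  by (rule mev_superset) auto

text \<open>The maps that are applied to the coefficients in \<open>mpoly_eval\<close>; the instances are \<open>id\<close>, \<open>Const\<close>, the
  embedding of the field into its algebraic closure, and compositions of these.\<close>

locale coeff_hom =
  fixes h :: "'a::comm_ring_1 \<Rightarrow> 'b::comm_ring_1"
  assumes hom_0: "h 0 = 0" and hom_1: "h 1 = 1"
    and hom_add: "\<And>a b. h (a + b) = h a + h b" and hom_mult: "\<And>a b. h (a * b) = h a * h b"
begin

lemma hom_minus: "h (- a) = - h a"
proof -
  have "h (- a) + h a = h (- a + a)" by (simp only: hom_add)
  then show ?thesis by (simp add: hom_0 eq_neg_iff_add_eq_0)
qed

lemma hom_diff: "h (a - b) = h a - h b"
  using hom_add[of a "- b"] hom_minus by simp

lemma hom_sum: "h (sum g A) = (\<Sum>a\<in>A. h (g a))"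
  by (induction A rule: infinite_finite_induct) (auto simp: hom_0 hom_add)

lemma hom_prod: "h (prod g A) = (\<Prod>a\<in>A. h (g a))"
  by (induction A rule: infinite_finite_induct) (auto simp: hom_1 hom_mult)

lemma hom_power: "h (a ^ k) = h a ^ k"
  by (induction k) (auto simp: hom_1 hom_mult)

lemma eval_superset:
  assumes "finite A" "Poly_Mapping.keys f \<subseteq> A"
  shows "mpoly_eval h s f = (\<Sum>m\<in>A. h (Poly_Mapping.lookup f m) * mev s m)"
  unfolding mpoly_eval_def mev_def
  by (rule sum.mono_neutral_left) (use assms in \<open>auto simp: in_keys_iff hom_0\<close>)

lemma eval_0 [simp]: "mpoly_eval h s 0 = 0"
  by (simp add: mpoly_eval_def)

lemma eval_single: "mpoly_eval h s (Poly_Mapping.single m c) = h c * mev s m"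
  by (subst eval_superset[of "{m}"]) auto

lemma eval_add: "mpoly_eval h s (f + g) = mpoly_eval h s f + mpoly_eval h s g"
proof -
  let ?A = "Poly_Mapping.keys f \<union> Poly_Mapping.keys g"
  have "mpoly_eval h s (f + g) = (\<Sum>m\<in>?A. h (Poly_Mapping.lookup (f + g) m) * mev s m)"
    using keys_add[of f g] by (intro eval_superset) auto
  also have "\<dots> = mpoly_eval h s f + mpoly_eval h s g"
    by (simp add: lookup_add hom_add distrib_right sum.distrib eval_superset[of ?A])
  finally show ?thesis .
qed

lemma eval_mult: "mpoly_eval h s (f * g) = mpoly_eval h s f * mpoly_eval h s g"
proof (induction f rule: mpoly_induct)
  case (single m c)
  show ?case
  proof (induction g rule: mpoly_induct)
    case (single m' c')
    show ?case
      unfolding mult_single eval_single mev_add hom_mult by (simp only: mult_ac)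
  next
    case zero
    show ?case by simp
  next
    case (add f g)
    then show ?case by (simp only: eval_add distrib_left)
  qed
next
  case zero
  show ?case by simp
next
  case (add f g)
  then show ?case by (simp only: eval_add distrib_right)
qed

lemma eval_Const [simp]: "mpoly_eval h s (Const c) = h c"
  by (simp add: Const_def eval_single)

lemma eval_monom_of [simp]: "mpoly_eval h s (monom_of m) = mev s m"
  by (simp add: monom_of_def eval_single hom_1)

lemma eval_Var [simp]: "mpoly_eval h s (Var v) = s v"
  by (simp add: Var_def)

lemma eval_1 [simp]: "mpoly_eval h s 1 = 1"
  using eval_Const[of s 1] by (simp add: hom_1)

lemma coeff_hom_eval: "coeff_hom (mpoly_eval h s)"
  by (rule coeff_hom.intro) (rule eval_0 eval_1 eval_add eval_mult)+

lemmas eval_minus = coeff_hom.hom_minus[OF coeff_hom_eval]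
  and eval_diff = coeff_hom.hom_diff[OF coeff_hom_eval]
  and eval_sum = coeff_hom.hom_sum[OF coeff_hom_eval]
  and eval_prod = coeff_hom.hom_prod[OF coeff_hom_eval]
  and eval_power = coeff_hom.hom_power[OF coeff_hom_eval]

end

lemma coeff_hom_id: "coeff_hom id" by unfold_locales auto

interpretation id_hom: coeff_hom "id :: 'a::comm_ring_1 \<Rightarrow> 'a" by (rule coeff_hom_id)

interpretation Const_hom: coeff_hom "Const :: 'a::comm_ring_1 \<Rightarrow> ('v, 'a) mpoly"
  by unfold_locales (auto simp: Const_add Const_mult)

lemma coeff_hom_comp: "coeff_hom g \<Longrightarrow> coeff_hom h \<Longrightarrow> coeff_hom (\<lambda>x. g (h x))"
  by (auto simp: coeff_hom_def)

lemma hom_mpoly_eval: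
  assumes "coeff_hom g" "coeff_hom h"
  shows "g (mpoly_eval h s f) = mpoly_eval (\<lambda>x. g (h x)) (\<lambda>v. g (s v)) f"
  unfolding mpoly_eval_def
  by (simp add: coeff_hom.hom_sum[OF assms(1)] coeff_hom.hom_mult[OF assms(1)]
      coeff_hom.hom_prod[OF assms(1)] coeff_hom.hom_power[OF assms(1)])

text \<open>The part of a polynomial supported on the monomials that satisfy \<open>P\<close>, used for graded components
  and for splitting off the multiples of a variable.\<close>

definition mfilter :: "('v mon \<Rightarrow> bool) \<Rightarrow> ('v, 'a::comm_monoid_add) mpoly \<Rightarrow> ('v, 'a) mpoly"
  where "mfilter P f = (\<Sum>m\<in>{m\<in>Poly_Mapping.keys f. P m}. Poly_Mapping.single m (Poly_Mapping.lookup f m))"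

lemma lookup_mfilter: "Poly_Mapping.lookup (mfilter P f) m = (if P m then Poly_Mapping.lookup f m else 0)"
proof -
  have "Poly_Mapping.lookup (mfilter P f) m
    = (\<Sum>k\<in>{k\<in>Poly_Mapping.keys f. P k}. if k = m then Poly_Mapping.lookup f k else 0)"
    by (simp add: mfilter_def lookup_sum lookup_single when_def)
  then show ?thesis by (simp add: in_keys_iff)
qed

lemma keys_mfilter: "Poly_Mapping.keys (mfilter P f) = {m\<in>Poly_Mapping.keys f. P m}"
  by (auto simp: in_keys_iff lookup_mfilter split: if_splits)

lemma mfilter_add: "mfilter P (f + g) = mfilter P f + mfilter P g"
  by (rule poly_mapping_eqI) (auto simp: lookup_mfilter lookup_add)

lemma mfilter_0 [simp]: "mfilter P 0 = 0"
  by (simp add: mfilter_def)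

lemma mfilter_sum: "mfilter P (sum g A) = (\<Sum>a\<in>A. mfilter P (g a))"
  by (induction A rule: infinite_finite_induct) (auto simp: mfilter_add)

lemma mfilter_single: "mfilter P (Poly_Mapping.single m c) = (if P m then Poly_Mapping.single m c else 0)"
  by (rule poly_mapping_eqI) (auto simp: lookup_mfilter lookup_single when_def)

lemma mfilter_id: "(\<And>m. m \<in> Poly_Mapping.keys f \<Longrightarrow> P m) \<Longrightarrow> mfilter P f = f"
  by (rule poly_mapping_eqI) (auto simp: lookup_mfilter in_keys_iff)

lemma mfilter_eq_0: "(\<And>m. m \<in> Poly_Mapping.keys f \<Longrightarrow> \<not> P m) \<Longrightarrow> mfilter P f = 0"
  by (rule poly_mapping_eqI) (auto simp: lookup_mfilter in_keys_iff)

definition mdvd :: "'v mon \<Rightarrow> 'v mon \<Rightarrow> bool"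
  where "mdvd a b \<longleftrightarrow> (\<exists>c. b = a + c)"

lemma mdvd_iff: "mdvd a b \<longleftrightarrow> (\<forall>v. Poly_Mapping.lookup a v \<le> Poly_Mapping.lookup b v)"
proof
  assume "\<forall>v. Poly_Mapping.lookup a v \<le> Poly_Mapping.lookup b v"
  then have "b = a + (b - a)" by (intro poly_mapping_eqI) (simp add: lookup_add lookup_minus)
  then show "mdvd a b" unfolding mdvd_def by blast
qed (auto simp: mdvd_def lookup_add)

lemma mdvd_refl [simp]: "mdvd a a"
  and mdvd_trans: "mdvd a b \<Longrightarrow> mdvd b c \<Longrightarrow> mdvd a c"
  and mdvd_add: "mdvd a (a + c)"
  by (auto simp: mdvd_iff lookup_add intro: order_trans)

text \<open>The polynomials all of whose monomials are divisible by an element of \<open>T\<close> form an ideal, and a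
  polynomial of this kind is a combination of the generators term by term.\<close>

lemma monomial_ideal_membership:
  fixes T :: "'v mon set" and f :: "('v, 'a::comm_ring_1) mpoly"
  shows "f \<in> ideal_gen (monom_of ` T) \<longleftrightarrow> (\<forall>k\<in>Poly_Mapping.keys f. \<exists>m\<in>T. mdvd m k)"
proof
  let ?J = "{f :: ('v, 'a) mpoly. \<forall>k\<in>Poly_Mapping.keys f. \<exists>m\<in>T. mdvd m k}"
  have "ideal_gen (monom_of ` T) \<subseteq> ?J"
  proof (rule ideal_gen_least)
    show "a + b \<in> ?J" if "a \<in> ?J" "b \<in> ?J" for a b
      using that keys_add[of a b] by blast
    show "a * b \<in> ?J" if "b \<in> ?J" for a b
    proof clarify
      fix k assume "k \<in> Poly_Mapping.keys (a * b)"
      then obtain x y where k: "k = x + y" "y \<in> Poly_Mapping.keys b" using keys_mult[of a b] by blast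
      with that obtain m where "m \<in> T" "mdvd m y" by blast
      then show "\<exists>m\<in>T. mdvd m k" using k mdvd_trans[OF _ mdvd_add[of y x]] by (metis add.commute)
    qed
  qed (auto intro: mdvd_refl)
  then show "f \<in> ideal_gen (monom_of ` T) \<Longrightarrow> \<forall>k\<in>Poly_Mapping.keys f. \<exists>m\<in>T. mdvd m k" by blast
next
  assume *: "\<forall>k\<in>Poly_Mapping.keys f. \<exists>m\<in>T. mdvd m k"
  have "Const (Poly_Mapping.lookup f k) * monom_of k \<in> ideal_gen (monom_of ` T :: ('v, 'a) mpoly set)"
    if k: "k \<in> Poly_Mapping.keys f" for k
  proof -
    obtain m c where "m \<in> T" "k = m + c" using * k unfolding mdvd_def by blast
    then have "Const (Poly_Mapping.lookup f k) * monom_of k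
        = (Const (Poly_Mapping.lookup f k) * monom_of c) * monom_of m"
      by (simp add: monom_of_add mult_ac)
    with \<open>m \<in> T\<close> show ?thesis
      by (simp only:) (intro ideal_gen_mult_left ideal.span_base imageI)
  qed
  then have "(\<Sum>k\<in>Poly_Mapping.keys f. Const (Poly_Mapping.lookup f k) * monom_of k)
      \<in> ideal_gen (monom_of ` T :: ('v, 'a) mpoly set)"
    by (intro ideal.span_sum)
  then show "f \<in> ideal_gen (monom_of ` T)" by (subst mpoly_expand_monom)
qed

no_notation fps_nth (infixl "$" 75)

section \<open>Coordinate bases of a linear subspace\<close>

text \<open>The restrictions to \<open>V\<close> of the coordinate functions in \<open>I\<close> are linearly independent, stated by means of
  a dual family of vectors; \<open>coord_basis\<close> says that they form a basis of the dual space.\<close>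

definition coord_indep :: "('k::field ^ 'n) set \<Rightarrow> 'n set \<Rightarrow> bool"
  where "coord_indep V I \<longleftrightarrow> (\<forall>b\<in>I. \<exists>f\<in>V. f $ b = 1 \<and> (\<forall>c\<in>I - {b}. f $ c = 0))"

definition coord_basis :: "('k::field ^ 'n) set \<Rightarrow> 'n set \<Rightarrow> bool"
  where "coord_basis V B \<longleftrightarrow> coord_indep V B \<and> (\<forall>f\<in>V. (\<forall>b\<in>B. f $ b = 0) \<longrightarrow> f = 0)"

definition supp :: "'k::zero ^ 'n \<Rightarrow> 'n set"
  where "supp f = {i. f $ i \<noteq> 0}"

definition dual_vec :: "('k::field ^ 'n) set \<Rightarrow> 'n set \<Rightarrow> 'n \<Rightarrow> 'k ^ 'n"
  where "dual_vec V B b = (SOME f. f \<in> V \<and> f $ b = 1 \<and> (\<forall>c\<in>B - {b}. f $ c = 0))"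

lemma dual_vec:
  assumes "coord_indep V B" "b \<in> B"
  shows "dual_vec V B b \<in> V" "dual_vec V B b $ b = 1" "\<And>c. c \<in> B \<Longrightarrow> c \<noteq> b \<Longrightarrow> dual_vec V B b $ c = 0"
proof -
  have "\<exists>f. f \<in> V \<and> f $ b = 1 \<and> (\<forall>c\<in>B - {b}. f $ c = 0)"
    using assms unfolding coord_indep_def by blast
  from someI_ex[OF this] show "dual_vec V B b \<in> V" "dual_vec V B b $ b = 1"
    "\<And>c. c \<in> B \<Longrightarrow> c \<noteq> b \<Longrightarrow> dual_vec V B b $ c = 0"
    unfolding dual_vec_def by auto
qed

text \<open>The dual family solves the interpolation problem of finding a vector of \<open>V\<close> with prescribed
  coordinates in \<open>B\<close>.\<close>

lemma coord_interpolation: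
  fixes V :: "('k::field ^ 'n::finite) set"
  assumes V: "vec.subspace V" and B: "coord_indep V B"
  shows "(\<Sum>b\<in>B. w b *s dual_vec V B b) \<in> V"
    and "c \<in> B \<Longrightarrow> (\<Sum>b\<in>B. w b *s dual_vec V B b) $ c = w c"
proof -
  show "(\<Sum>b\<in>B. w b *s dual_vec V B b) \<in> V"
    using V dual_vec(1)[OF B] by (intro vec.subspace_sum vec.subspace_scale) auto
  show "(\<Sum>b\<in>B. w b *s dual_vec V B b) $ c = w c" if "c \<in> B"
  proof -
    have "(\<Sum>b\<in>B. w b *s dual_vec V B b) $ c = (\<Sum>b\<in>B. if b = c then w b else 0)"
      unfolding sum_component by (intro sum.cong) (use dual_vec[OF B] that in auto)
    then show ?thesis using that by simp
  qed
qed

lemma coord_basis_eq: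
  fixes V :: "('k::field ^ 'n::finite) set"
  assumes V: "vec.subspace V" and B: "coord_basis V B" and "f \<in> V" "g \<in> V"
    and "\<And>b. b \<in> B \<Longrightarrow> f $ b = g $ b"
  shows "f = g"
proof -
  have "f - g \<in> V" using V assms(3,4) by (rule vec.subspace_diff)
  moreover have "\<forall>b\<in>B. (f - g) $ b = 0" using assms(5) by simp
  ultimately have "f - g = 0" using B unfolding coord_basis_def by blast
  then show ?thesis by simp
qed

lemma coord_basis_expand:
  fixes V :: "('k::field ^ 'n::finite) set"
  assumes V: "vec.subspace V" and B: "coord_basis V B" and f: "f \<in> V"
  shows "f = (\<Sum>b\<in>B. (f $ b) *s dual_vec V B b)"
  using B coord_interpolation[OF V, of B] unfolding coord_basis_def
  by (intro coord_basis_eq[OF V B f]) auto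

lemma dual_vec_unique:
  fixes V :: "('k::field ^ 'n::finite) set"
  assumes V: "vec.subspace V" and B: "coord_basis V B" and "b \<in> B"
    and "f \<in> V" "f $ b = 1" "\<And>c. c \<in> B \<Longrightarrow> c \<noteq> b \<Longrightarrow> f $ c = 0"
  shows "f = dual_vec V B b"
  using dual_vec[of V B b] B assms
  by (intro coord_basis_eq[OF V B]) (auto simp: coord_basis_def, metis)

lemma coord_indep_dim:
  fixes V :: "('k::field ^ 'n::finite) set"
  assumes V: "vec.subspace V" and B: "coord_indep V B"
  shows "vec.independent (dual_vec V B ` B)" "card (dual_vec V B ` B) = card B"
proof -
  have inj: "inj_on (dual_vec V B) B"
    by (rule inj_onI) (metis dual_vec(2,3)[OF B] zero_neq_one)
  then show "card (dual_vec V B ` B) = card B" by (rule card_image)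
  show "vec.independent (dual_vec V B ` B)"
  proof (rule vec.independent_if_scalars_zero)
    fix u v assume 0: "(\<Sum>x\<in>dual_vec V B ` B. u x *s x) = 0" and v: "v \<in> dual_vec V B ` B"
    then obtain c where c: "c \<in> B" "v = dual_vec V B c" by blast
    have "(\<Sum>b\<in>B. u (dual_vec V B b) *s dual_vec V B b) = 0"
      using 0 by (simp add: sum.reindex[OF inj])
    then have "(\<Sum>b\<in>B. u (dual_vec V B b) *s dual_vec V B b) $ c = 0" by simp
    moreover have "(\<Sum>b\<in>B. u (dual_vec V B b) *s dual_vec V B b) $ c
        = (\<Sum>b\<in>B. if b = c then u (dual_vec V B b) else 0)"
      unfolding sum_component by (intro sum.cong) (use dual_vec[OF B] c in auto)
    ultimately show "u v = 0" using c by simp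
  qed simp
qed

lemma coord_basis_card:
  fixes V :: "('k::field ^ 'n::finite) set"
  assumes V: "vec.subspace V" and B: "coord_basis V B"
  shows "vec.dim V = card B"
proof -
  have B': "coord_indep V B" using B by (simp add: coord_basis_def)
  have "V \<subseteq> vec.span (dual_vec V B ` B)"
  proof
    fix f assume "f \<in> V"
    from coord_basis_expand[OF V B this] show "f \<in> vec.span (dual_vec V B ` B)"
      by (metis (no_types, lifting) image_eqI vec.span_base vec.span_scale vec.span_sum)
  qed
  then show ?thesis
    using coord_indep_dim[OF V B'] dual_vec(1)[OF B']
    by (intro vec.dim_unique[of "dual_vec V B ` B"]) auto
qed

text \<open>The dual family of \<open>B\<close> consists of \<open>dim V\<close> independent vectors, so it spans \<open>V\<close>.\<close>

lemma coord_basis_from_card: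
  fixes V :: "('k::field ^ 'n::finite) set"
  assumes V: "vec.subspace V" and B: "coord_indep V B" and c: "card B = vec.dim V"
  shows "coord_basis V B"
  unfolding coord_basis_def
proof (intro conjI ballI impI B)
  fix f assume f: "f \<in> V" and 0: "\<forall>b\<in>B. f $ b = 0"
  have "V \<subseteq> vec.span (dual_vec V B ` B)"
    using coord_indep_dim[OF V B] dual_vec(1)[OF B] c
    by (intro vec.card_ge_dim_independent) auto
  then have "f \<in> vec.span (dual_vec V B ` B)" using f by blast
  then obtain u where u: "f = (\<Sum>x\<in>dual_vec V B ` B. u x *s x)"
    by (auto simp: vec.span_finite)
  have inj: "inj_on (dual_vec V B) B"
    by (rule inj_onI) (metis dual_vec(2,3)[OF B] zero_neq_one)
  have u': "f = (\<Sum>b\<in>B. u (dual_vec V B b) *s dual_vec V B b)"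
    using u by (simp add: sum.reindex[OF inj])
  have "u (dual_vec V B c) = 0" if "c \<in> B" for c
  proof -
    have "f $ c = (\<Sum>b\<in>B. if b = c then u (dual_vec V B b) else 0)"
      unfolding u' sum_component by (intro sum.cong) (use dual_vec[OF B] that in auto)
    then show ?thesis using 0 that by simp
  qed
  then show "f = 0" using u' by simp
qed

text \<open>One step of Gaussian elimination: the dual vector of \<open>b\<close>, scaled to have coordinate 1 at \<open>j\<close>, becomes
  the dual vector of \<open>j\<close> and is used to clear this coordinate in the others.\<close>

lemma coord_basis_exchange:
  fixes V :: "('k::field ^ 'n::finite) set"
  assumes V: "vec.subspace V" and B: "coord_basis V B" and b: "b \<in> B"
    and j: "j \<notin> B" "dual_vec V B b $ j \<noteq> 0"
  shows "coord_basis V (insert j (B - {b}))"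
proof -
  have B': "coord_indep V B" using B by (simp add: coord_basis_def)
  define g where "g = inverse (dual_vec V B b $ j) *s dual_vec V B b"
  have g: "g \<in> V" "g $ j = 1" "\<And>c. c \<in> B - {b} \<Longrightarrow> g $ c = 0"
    using j dual_vec[OF B' b] V unfolding g_def by (auto intro: vec.subspace_scale)
  show ?thesis
    unfolding coord_basis_def coord_indep_def
  proof (intro conjI ballI impI)
    fix c assume c: "c \<in> insert j (B - {b})"
    show "\<exists>f\<in>V. f $ c = 1 \<and> (\<forall>d\<in>insert j (B - {b}) - {c}. f $ d = 0)"
    proof (cases "c = j")
      case True then show ?thesis using g by (intro bexI[of _ g]) auto
    next
      case False
      then have cB: "c \<in> B" "c \<noteq> b" using c by auto
      let ?f = "dual_vec V B c - (dual_vec V B c $ j) *s g"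
      have "?f \<in> V" using V g dual_vec(1)[OF B' cB(1)]
        by (intro vec.subspace_diff vec.subspace_scale)
      moreover have "?f $ c = 1" using g cB dual_vec[OF B' cB(1)] by simp
      moreover have "?f $ d = 0" if "d \<in> insert j (B - {b}) - {c}" for d
        using that g dual_vec[OF B' cB(1)] by auto
      ultimately show ?thesis by blast
    qed
  next
    fix f assume f: "f \<in> V" and 0: "\<forall>c\<in>insert j (B - {b}). f $ c = 0"
    have "f = (f $ b) *s dual_vec V B b"
      using 0 dual_vec[OF B' b] V f
      by (intro coord_basis_eq[OF V B f]) (auto intro: vec.subspace_scale, metis DiffI mult_cancel_left2 singletonD mult_zero_right)
    moreover have "f $ j = 0" using 0 by simp
    ultimately have "f $ b = 0" using j by (metis mult_eq_0_iff vector_smult_component)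
    then show "f = 0" using \<open>f = _\<close> by (metis vector_smult_lzero)
  qed
qed

section \<open>Standard pairs and activities\<close>

definition strict_linear_order :: "('e \<Rightarrow> 'e \<Rightarrow> bool) \<Rightarrow> bool"
  where "strict_linear_order ls \<longleftrightarrow> (\<forall>i. \<not> ls i i) \<and> (\<forall>i j k. ls i j \<longrightarrow> ls j k \<longrightarrow> ls i k) \<and>
    (\<forall>i j. i = j \<or> ls i j \<or> ls j i)"

lemma strict_linear_orderD:
  assumes "strict_linear_order ls"
  shows "\<not> ls i i" "ls i j \<Longrightarrow> ls j k \<Longrightarrow> ls i k" "i \<noteq> j \<Longrightarrow> \<not> ls i j \<Longrightarrow> ls j i" "ls i j \<Longrightarrow> \<not> ls j i"
  using assms unfolding strict_linear_order_def by metis+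

lemma strict_linear_order_max:
  assumes "strict_linear_order ls" "finite E" "E \<noteq> {}"
  obtains e where "e \<in> E" "\<And>x. x \<in> E \<Longrightarrow> x \<noteq> e \<Longrightarrow> ls x e"
proof -
  have "\<exists>e\<in>E. \<forall>x\<in>E. x \<noteq> e \<longrightarrow> ls x e"
    using assms(2,3)
  proof (induction E rule: finite_ne_induct)
    case (insert x F)
    then obtain e where e: "e \<in> F" "\<forall>x\<in>F. x \<noteq> e \<longrightarrow> ls x e" by blast
    show ?case
    proof (cases "ls x e")
      case True then show ?thesis using e by auto
    next
      case False
      then have "ls e x" using e insert strict_linear_orderD(3)[OF assms(1)] by metis
      then show ?thesis using e strict_linear_orderD(2)[OF assms(1)] by (metis insertE insertI1)
    qed
  qed simp
  then show ?thesis using that by blast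
qed

text \<open>The deletion and contraction arguments below remove the largest element of the ground set, because
  removing it does not change which element of a support is the smallest, unless it is the only one.\<close>

lemma largest_element_induct [consumes 2, case_names empty insert]:
  assumes "strict_linear_order ls" "finite E" "P {}"
    and "\<And>e E. finite E \<Longrightarrow> e \<notin> E \<Longrightarrow> (\<And>x. x \<in> E \<Longrightarrow> ls x e) \<Longrightarrow> P E \<Longrightarrow> P (insert e E)"
  shows "P E"
  using assms(2)
proof (induction "card E" arbitrary: E)
  case 0 then show ?case using assms(3) by simp
next
  case (Suc n)
  then have "E \<noteq> {}" by auto
  then obtain e where e: "e \<in> E" "\<And>x. x \<in> E \<Longrightarrow> x \<noteq> e \<Longrightarrow> ls x e"
    using strict_linear_order_max[OF assms(1)] Suc by metis
  then have "P (insert e (E - {e}))" using Suc by (intro assms(4)) auto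
  then show ?case using e by (simp add: insert_absorb)
qed

text \<open>If \<open>i\<close> is the smallest element of the support of a form, then \<open>x\<^sub>i \<Prod>y\<^sub>j\<close>, with \<open>j\<close> running over the other
  elements, is the leading monomial of the homogenized form for every term order that induces \<open>ls\<close>.\<close>

definition initial_in :: "('n \<Rightarrow> 'n \<Rightarrow> bool) \<Rightarrow> 'k::zero ^ 'n \<Rightarrow> 'n \<Rightarrow> bool"
  where "initial_in ls f i \<longleftrightarrow> f $ i \<noteq> 0 \<and> (\<forall>j. f $ j \<noteq> 0 \<longrightarrow> j \<noteq> i \<longrightarrow> ls i j)"

text \<open>\<open>Sx\<close> and \<open>Sy\<close> are the sets of indices \<open>i\<close> for which \<open>x\<^sub>i\<close> and \<open>y\<^sub>i\<close> divide a monomial. The pair is standard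
  if the monomial is not divisible by the leading monomial \<open>x\<^sub>i \<Prod>y\<^sub>j\<close> of any homogenized form in \<open>V\<close>.\<close>

definition standard :: "('n \<Rightarrow> 'n \<Rightarrow> bool) \<Rightarrow> ('k::zero ^ 'n) set \<Rightarrow> 'n set \<Rightarrow> 'n set \<Rightarrow> bool"
  where "standard ls V Sx Sy \<longleftrightarrow> \<not> (\<exists>f\<in>V. \<exists>i\<in>Sx. initial_in ls f i \<and> supp f \<subseteq> insert i Sy)"

text \<open>Internal activity, expressed by the vector whose support is the fundamental cocircuit.\<close>

definition active :: "('n \<Rightarrow> 'n \<Rightarrow> bool) \<Rightarrow> ('k::field ^ 'n) set \<Rightarrow> 'n set \<Rightarrow> 'n \<Rightarrow> bool"
  where "active ls V B b \<longleftrightarrow>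
    (\<exists>f\<in>V. f $ b = 1 \<and> (\<forall>c\<in>B - {b}. f $ c = 0) \<and> initial_in ls f b)"

lemma active_iff:
  fixes V :: "('k::field ^ 'n::finite) set"
  assumes "vec.subspace V" "coord_basis V B" "b \<in> B"
  shows "active ls V B b \<longleftrightarrow> initial_in ls (dual_vec V B b) b"
  using dual_vec_unique[OF assms] dual_vec[of V B b] assms
  unfolding active_def coord_basis_def by (metis DiffD1 DiffD2 DiffI singletonD singletonI)

text \<open>For a space \<open>V\<close> of linear forms, setting the coefficient at \<open>e\<close> to 0 deletes \<open>e\<close> from the matroid when
  no form is supported on \<open>e\<close> alone, and \<open>{f\<in>V. f $ e = 0}\<close> contracts \<open>e\<close>.\<close>

definition erase :: "'n \<Rightarrow> 'k::zero ^ 'n \<Rightarrow> 'k ^ 'n"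
  where "erase e f = (\<chi> i. if i = e then 0 else f $ i)"

lemma erase_nth [simp]: "erase e f $ i = (if i = e then 0 else f $ i)"
  by (simp add: erase_def)

lemma subspace_contract: "vec.subspace V \<Longrightarrow> vec.subspace {f\<in>V. f $ e = 0}"
  by (auto simp: vec.subspace_def)

lemma subspace_erase:
  fixes V :: "('k::field ^ 'n::finite) set"
  assumes "vec.subspace V"
  shows "vec.subspace (erase e ` V)"
proof -
  have "Vector_Spaces.linear (*s) (*s) (erase e :: 'k ^ 'n \<Rightarrow> _)"
    by unfold_locales (auto simp: vec_eq_iff algebra_simps)
  then show ?thesis
    using assms by (rule vec.linear_subspace_image)
qed

lemma coord_basis_contract:
  fixes V :: "('k::field ^ 'n::finite) set"
  assumes V: "vec.subspace V" and B: "coord_basis {f\<in>V. f $ e = 0} B" and e: "e \<notin> B"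
    and g: "g \<in> V" "g $ e \<noteq> 0"
  shows "coord_basis V (insert e B)"
proof -
  have V0: "vec.subspace {f\<in>V. f $ e = 0}" using V by (rule subspace_contract)
  have B': "coord_indep {f\<in>V. f $ e = 0} B" using B by (simp add: coord_basis_def)
  obtain h where h: "h \<in> {f\<in>V. f $ e = 0}" "\<And>b. b \<in> B \<Longrightarrow> h $ b = g $ b"
    using coord_interpolation[OF V0 B', where w = "\<lambda>b. g $ b"] by blast
  show ?thesis
    unfolding coord_basis_def coord_indep_def
  proof (intro conjI ballI impI)
    fix c assume c: "c \<in> insert e B"
    show "\<exists>f\<in>V. f $ c = 1 \<and> (\<forall>d\<in>insert e B - {c}. f $ d = 0)"
    proof (cases "c = e")
      case True
      let ?f = "inverse (g $ e) *s (g - h)"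
      have "?f \<in> V" using V g h by (intro vec.subspace_scale vec.subspace_diff) auto
      then show ?thesis using g h True by (intro bexI[of _ ?f]) auto
    next
      case False
      with c have c: "c \<in> B" by blast
      show ?thesis using dual_vec[OF B' c] by (intro bexI[of _ "dual_vec {f\<in>V. f $ e = 0} B c"]) auto
    qed
  next
    fix f assume "f \<in> V" "\<forall>b\<in>insert e B. f $ b = 0"
    then show "f = 0" using B unfolding coord_basis_def by auto
  qed
qed

lemma coord_basis_erase:
  fixes V :: "('k::field ^ 'n::finite) set"
  assumes V: "vec.subspace V" and B: "coord_basis (erase e ` V) B" and e: "e \<notin> B"
    and ax: "axis e 1 \<notin> V"
  shows "coord_basis V B"
  unfolding coord_basis_def coord_indep_def
proof (intro conjI ballI impI)
  fix b assume b: "b \<in> B"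
  then obtain f where "f \<in> V" "erase e f $ b = 1" "\<forall>c\<in>B - {b}. erase e f $ c = 0"
    using B unfolding coord_basis_def coord_indep_def by blast
  then show "\<exists>f\<in>V. f $ b = 1 \<and> (\<forall>c\<in>B - {b}. f $ c = 0)"
    using e by (intro bexI[of _ f]) (auto split: if_splits)
next
  fix f assume f: "f \<in> V" "\<forall>b\<in>B. f $ b = 0"
  then have 0: "erase e f = 0" using B unfolding coord_basis_def by auto
  have f0: "f $ i = 0" if "i \<noteq> e" for i
    using arg_cong[OF 0, of "\<lambda>x. x $ i"] that by simp
  have f': "f = (f $ e) *s axis e 1"
    using f0 by (simp add: vec_eq_iff axis_def)
  have "f $ e = 0"
  proof (rule ccontr)
    assume "f $ e \<noteq> 0"
    then have "axis e 1 = inverse (f $ e) *s f" by (subst f') (simp add: vector_smult_assoc)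
    then show False using ax V f by (metis vec.subspace_scale)
  qed
  then show "f = 0" using f' by (metis vector_smult_lzero)
qed

text \<open>Induction over deletion and contraction of the largest element \<open>e\<close>. The element \<open>e\<close> is active in a basis
  that contains it only if the unit vector at \<open>e\<close> lies in \<open>V\<close>, and then \<open>e \<notin> Sx\<close> because the pair is
  standard. So \<open>e\<close> may join the basis if it is forced to be active or if it is not in \<open>Sy\<close>. Otherwise
  \<open>e \<in> Sy\<close>, so \<open>e\<close> imposes no condition on supports, and the basis can be chosen without \<open>e\<close>.\<close>

lemma standard_basis_exists_aux:
  fixes V :: "('k::field ^ 'n::finite) set"
  assumes ls: "strict_linear_order ls" and "vec.subspace V" "\<And>f. f \<in> V \<Longrightarrow> supp f \<subseteq> E"
    and "standard ls V Sx Sy"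
  shows "\<exists>B\<subseteq>E. coord_basis V B \<and> (\<forall>b\<in>B \<inter> Sx. \<not> active ls V B b) \<and> (\<forall>b\<in>B \<inter> Sy. active ls V B b)"
proof -
  have "finite E" by simp
  with ls show ?thesis using assms(2-4)
  proof (induction E arbitrary: V rule: largest_element_induct)
    case empty
    then have "f = 0" if "f \<in> V" for f using that by (auto simp: supp_def vec_eq_iff)
    then have "coord_basis V {}" by (auto simp: coord_basis_def coord_indep_def)
    then show ?case by auto
  next
    case (insert e E)
    note V = insert.prems(1)
    have sub: "i = e \<or> i \<in> E" if "f \<in> V" "f $ i \<noteq> 0" for f i
      using insert.prems(2)[OF that(1)] that(2) by (auto simp: supp_def)
    have lse: "ls i e" if "f \<in> V" "f $ i \<noteq> 0" "i \<noteq> e" for f i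
      using sub[OF that(1,2)] that(3) insert.hyps(3) by blast
    show ?case
    proof (cases "\<forall>f\<in>V. f $ e = 0")
      case True
      then have "\<And>f. f \<in> V \<Longrightarrow> supp f \<subseteq> E" using sub by (fastforce simp: supp_def)
      from insert.IH[OF V this insert.prems(3)] show ?thesis by blast
    next
      case False
      then obtain g where g: "g \<in> V" "g $ e \<noteq> 0" by blast
      show ?thesis
      proof (cases "axis e 1 \<in> V \<or> e \<notin> Sy")
        case True
        \<comment> \<open>\<open>e\<close> joins the basis; it is active exactly if the unit vector at \<open>e\<close> lies in \<open>V\<close>\<close>
        let ?W = "{f\<in>V. f $ e = 0}"
        have W1: "supp f \<subseteq> E" if "f \<in> ?W" for f
          using that sub by (fastforce simp: supp_def)
        have W2: "standard ls ?W Sx Sy"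
          using insert.prems(3) unfolding standard_def by blast
        obtain B where B: "B \<subseteq> E" "coord_basis ?W B"
          "\<forall>b\<in>B \<inter> Sx. \<not> active ls ?W B b" "\<forall>b\<in>B \<inter> Sy. active ls ?W B b"
          using insert.IH[OF subspace_contract[OF V] W1 W2] by blast
        have eB: "e \<notin> B" using B insert.hyps by blast
        have cb: "coord_basis V (insert e B)"
          by (rule coord_basis_contract[OF V B(2) eB g])
        have act: "active ls V (insert e B) b \<longleftrightarrow> active ls ?W B b" if "b \<in> B" for b
          using that eB unfolding active_def by auto
        have acte: "active ls V (insert e B) e \<longleftrightarrow> axis e 1 \<in> V"
        proof
          assume "active ls V (insert e B) e"
          then obtain f where f: "f \<in> V" "f $ e = 1" "initial_in ls f e"
            unfolding active_def by blast
          have "f $ i = 0" if "i \<noteq> e" for i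
            using lse[OF f(1) _ that] f(3) that strict_linear_orderD(4)[OF ls]
            unfolding initial_in_def by blast
          then have "f = axis e 1" using f by (auto simp: vec_eq_iff axis_def)
          then show "axis e 1 \<in> V" using f by simp
        next
          assume "axis e 1 \<in> V"
          then show "active ls V (insert e B) e"
            using eB unfolding active_def initial_in_def
            by (intro bexI[of _ "axis e 1"]) (auto simp: axis_def)
        qed
        have "e \<notin> Sx" if "axis e 1 \<in> V"
        proof
          assume "e \<in> Sx"
          moreover have "initial_in ls (axis e 1 :: 'k ^ 'n) e" "supp (axis e 1 :: 'k ^ 'n) \<subseteq> insert e Sy"
            by (auto simp: initial_in_def supp_def axis_def)
          ultimately show False using that insert.prems(3) unfolding standard_def by blast
        qed
        then have "\<forall>b\<in>insert e B \<inter> Sx. \<not> active ls V (insert e B) b"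
          using B act acte by auto
        moreover have "\<forall>b\<in>insert e B \<inter> Sy. active ls V (insert e B) b"
          using B act acte True by auto
        ultimately show ?thesis using cb B(1) by (intro exI[of _ "insert e B"]) auto
      next
        case ax: False
        \<comment> \<open>\<open>e\<close> stays outside; being the largest element, it does not affect activities\<close>
        let ?W = "erase e ` V"
        have W1: "supp f \<subseteq> E" if "f \<in> ?W" for f
        proof -
          from that obtain h where h: "h \<in> V" "f = erase e h" by blast
          show ?thesis
          proof
            fix j assume "j \<in> supp f"
            then have "j \<noteq> e" "h $ j \<noteq> 0" using h by (auto simp: supp_def split: if_splits)
            then show "j \<in> E" using sub[OF h(1)] by blast
          qed
        qed
        have W2: "standard ls ?W Sx Sy"
          unfolding standard_def
        proof clarify
          fix f i assume f: "f \<in> V" "i \<in> Sx" "initial_in ls (erase e f) i" "supp (erase e f) \<subseteq> insert i Sy"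
          then have i: "i \<noteq> e" "f $ i \<noteq> 0" by (auto simp: initial_in_def split: if_splits)
          have "initial_in ls f i"
            using f(3) i lse[OF f(1)] unfolding initial_in_def erase_nth by metis
          moreover have "supp f \<subseteq> insert i Sy"
          proof
            fix j assume "j \<in> supp f"
            then have "j = e \<or> j \<in> supp (erase e f)" by (simp add: supp_def)
            then show "j \<in> insert i Sy" using f(4) ax by blast
          qed
          ultimately show False using f insert.prems(3) unfolding standard_def by blast
        qed
        obtain B where B: "B \<subseteq> E" "coord_basis ?W B"
          "\<forall>b\<in>B \<inter> Sx. \<not> active ls ?W B b" "\<forall>b\<in>B \<inter> Sy. active ls ?W B b"
          using insert.IH[OF subspace_erase[OF V] W1 W2] by blast
        have eB: "e \<notin> B" using B insert.hyps by blast
        have cb: "coord_basis V B"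
          using coord_basis_erase[OF V B(2) eB] ax by blast
        have act: "active ls V B b \<longleftrightarrow> active ls ?W B b" if b: "b \<in> B" for b
        proof -
          have b': "b \<noteq> e" "ls b e" using b eB B(1) insert.hyps(3) by blast+
          have i1: "initial_in ls (erase e f) b \<longleftrightarrow> initial_in ls f b" for f :: "'k ^ 'n"
            using b' unfolding initial_in_def erase_nth by metis
          have i2: "(\<forall>c\<in>B - {b}. erase e f $ c = 0) \<longleftrightarrow> (\<forall>c\<in>B - {b}. f $ c = 0)" for f :: "'k ^ 'n"
            using eB by (intro ball_cong) auto
          have i3: "erase e f $ b = f $ b" for f :: "'k ^ 'n" using b' by simp
          have i4: "(f $ b = 1 \<and> (\<forall>c\<in>B - {b}. f $ c = 0) \<and> initial_in ls f b) \<longleftrightarrow>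
            (erase e f $ b = 1 \<and> (\<forall>c\<in>B - {b}. erase e f $ c = 0) \<and> initial_in ls (erase e f) b)" for f :: "'k ^ 'n"
            by (simp only: i1 i2 i3)
          have "active ls V B b \<longleftrightarrow> (\<exists>f\<in>V. erase e f $ b = 1 \<and> (\<forall>c\<in>B - {b}. erase e f $ c = 0) \<and>
              initial_in ls (erase e f) b)"
            unfolding active_def by (intro bex_cong refl) (rule i4)
          then show ?thesis unfolding active_def by (simp only: bex_simps)
        qed
        show ?thesis using cb B act by (intro exI[of _ B]) auto
      qed
    qed
  qed
qed

lemma standard_basis_exists:
  fixes V :: "('k::field ^ 'n::finite) set"
  assumes "strict_linear_order ls" "vec.subspace V" "standard ls V Sx Sy"
  obtains B where "coord_basis V B" "\<And>b. b \<in> B \<Longrightarrow> b \<in> Sx \<Longrightarrow> \<not> active ls V B b"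
    "\<And>b. b \<in> B \<Longrightarrow> b \<in> Sy \<Longrightarrow> active ls V B b"
  using standard_basis_exists_aux[OF assms(1,2) _ assms(3), of UNIV] by auto

text \<open>If \<open>f\<close> violates standardness at its smallest element \<open>i\<close>, expand \<open>f\<close> in the dual family of \<open>B\<close>. Every
  dual vector that occurs, except possibly the one at \<open>i\<close>, belongs to an element of \<open>Sy\<close>, which is active,
  so its support starts at an element after \<open>i\<close>. Then the coordinate at \<open>i\<close> (if \<open>i \<notin> B\<close>), or at an element
  of the support of the dual vector at \<open>i\<close> before \<open>i\<close> (if \<open>i \<in> B\<close>), cannot cancel.\<close>

lemma standard_iff_basis:
  fixes V :: "('k::field ^ 'n::finite) set"
  assumes ls: "strict_linear_order ls" and V: "vec.subspace V" and B: "coord_basis V B"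
    and Sx: "\<And>b. b \<in> B \<Longrightarrow> b \<in> Sx \<Longrightarrow> \<not> active ls V B b"
    and Sy: "\<And>b. b \<in> B \<Longrightarrow> b \<in> Sy \<Longrightarrow> active ls V B b"
  shows "standard ls V Sx Sy"
  unfolding standard_def
proof clarify
  fix f i assume f: "f \<in> V" and i: "i \<in> Sx" "initial_in ls f i" and s: "supp f \<subseteq> insert i Sy"
  have B': "coord_indep V B" using B by (simp add: coord_basis_def)
  let ?d = "dual_vec V B"
  have ex: "f $ j = (\<Sum>b\<in>B. f $ b * ?d b $ j)" for j
    by (subst coord_basis_expand[OF V B f]) (simp add: sum_component)
  have actv: "initial_in ls (?d b) b" if "b \<in> B" "f $ b \<noteq> 0" "b \<noteq> i" for b
  proof -
    have "b \<in> Sy" using s that by (auto simp: supp_def)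
    then show ?thesis using Sy[OF that(1)] active_iff[OF V B that(1)] by blast
  qed
  show False
  proof (cases "i \<in> B")
    case True
    then have "\<not> initial_in ls (?d i) i" using Sx i active_iff[OF V B] by blast
    then obtain j where j: "?d i $ j \<noteq> 0" "j \<noteq> i" "\<not> ls i j"
      using dual_vec(2)[OF B' True] by (auto simp: initial_in_def)
    have jB: "j \<notin> B" using dual_vec(3)[OF B' True] j by blast
    have "f $ j = 0" using i(2) j by (auto simp: initial_in_def)
    then have "0 = f $ i * ?d i $ j + (\<Sum>b\<in>B - {i}. f $ b * ?d b $ j)"
      using ex[of j] sum.remove[of B i "\<lambda>b. f $ b * ?d b $ j"] True by simp
    moreover have "f $ i * ?d i $ j \<noteq> 0" using j i(2) by (simp add: initial_in_def)
    ultimately have "(\<Sum>b\<in>B - {i}. f $ b * ?d b $ j) \<noteq> 0" by (metis add_cancel_left_right)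
    then obtain b where b: "b \<in> B - {i}" "f $ b * ?d b $ j \<noteq> 0" by (rule sum.not_neutral_contains_not_neutral)
    then have "ls b j" using actv[of b] jB unfolding initial_in_def by auto
    moreover have "ls i b" using b i(2) unfolding initial_in_def by auto
    ultimately show False using j strict_linear_orderD(2)[OF ls] by blast
  next
    case False
    have "f $ i \<noteq> 0" using i(2) by (simp add: initial_in_def)
    then have "(\<Sum>b\<in>B. f $ b * ?d b $ i) \<noteq> 0" using ex[of i] by metis
    then obtain b where b: "b \<in> B" "f $ b * ?d b $ i \<noteq> 0"
      by (rule sum.not_neutral_contains_not_neutral)
    then have "ls b i" "ls i b" using actv[of b] False i(2) unfolding initial_in_def by auto
    then show False using strict_linear_orderD(4)[OF ls] by blast
  qed
qed

lemma standard_empty: "standard ls (V :: ('k::zero ^ 'n) set) {} Sy"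
  by (simp add: standard_def)

text \<open>A pair \<open>(D, D)\<close> is standard when no form is supported on \<open>D\<close>, and no element of a corresponding basis
  lies in \<open>D\<close>, as it would have to be both active and passive.\<close>

lemma coord_basis_exists:
  fixes V :: "('k::field ^ 'n::finite) set" and ls :: "'n \<Rightarrow> 'n \<Rightarrow> bool"
  assumes ls: "strict_linear_order ls" and "vec.subspace V"
    and D: "\<And>f. f \<in> V \<Longrightarrow> supp f \<subseteq> D \<Longrightarrow> f = 0"
  obtains B where "coord_basis V B" "B \<inter> D = {}"
proof -
  have "standard ls V D D"
    unfolding standard_def
  proof clarify
    fix f i assume f: "f \<in> V" "i \<in> D" "initial_in ls f i" "supp f \<subseteq> insert i D"
    then have "f = 0" using D by (simp add: insert_absorb)
    then show False using f by (simp add: initial_in_def)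
  qed
  from standard_basis_exists[OF assms(1,2) this] that show ?thesis by (metis disjoint_iff)
qed

text \<open>The pivots of the reduced row echelon form of \<open>V\<close>; a basis all of whose elements are active consists
  of them.\<close>

lemma pivots_basis:
  fixes V :: "('k::field ^ 'n::finite) set"
  assumes ls: "strict_linear_order ls" and V: "vec.subspace V"
  shows "coord_basis V {i. \<exists>f\<in>V. initial_in ls f i}"
proof -
  obtain B where B: "coord_basis V B" "\<And>b. b \<in> B \<Longrightarrow> active ls V B b"
    using standard_basis_exists[OF assms standard_empty[of ls V UNIV]] by auto
  have "i \<in> B" if "f \<in> V" "initial_in ls f i" for f i
  proof (rule ccontr)
    assume "i \<notin> B"
    then have "standard ls V {i} UNIV"
      using B by (intro standard_iff_basis[OF ls V B(1)]) auto
    then show False using that unfolding standard_def by blast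
  qed
  then have "{i. \<exists>f\<in>V. initial_in ls f i} = B" using B(2) unfolding active_def by blast
  then show ?thesis using B by simp
qed

section \<open>Linear independence of standard monomials\<close>

lemma ex_strict_linear_order: "\<exists>ls :: 'n::finite \<Rightarrow> 'n \<Rightarrow> bool. strict_linear_order ls"
proof -
  obtain f :: "'n \<Rightarrow> nat" where f: "inj f"
    using finite_imp_inj_to_nat_seg[of "UNIV :: 'n set"] by auto
  show ?thesis
  proof (intro exI)
    show "strict_linear_order (\<lambda>i j. f i < f j)"
      unfolding strict_linear_order_def using f by (metis injD less_irrefl less_trans neqE)
  qed
qed

text \<open>For a linear space \<open>L\<close> this is the space of the linear forms that vanish on \<open>L\<close>, given by their coefficient
  vectors.\<close>

definition perp :: "('k::field ^ 'n) set \<Rightarrow> ('k ^ 'n) set"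
  where "perp L = {a. \<forall>v\<in>L. (\<Sum>i\<in>UNIV. a $ i * v $ i) = 0}"

lemma subspace_perp: "vec.subspace (perp (L :: ('k::field ^ 'n::finite) set))"
  unfolding vec.subspace_def perp_def
  by (auto simp: algebra_simps sum.distrib sum_distrib_left[symmetric])

lemma sum_axis_mult: "(\<Sum>i\<in>UNIV. axis e c $ i * v $ i) = (c :: 'k::field) * v $ (e :: 'n::finite)"
proof -
  have "(\<Sum>i\<in>UNIV. axis e c $ i * v $ i) = (\<Sum>i\<in>UNIV. if i = e then c * v $ i else 0)"
    by (intro sum.cong) (auto simp: axis_def)
  then show ?thesis by simp
qed

text \<open>Intersecting with a coordinate hyperplane adds only the corresponding coordinate form to the
  annihilator: subtract the multiple of it that makes the form vanish at one vector outside the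
  hyperplane.\<close>
lemma perp_hyperplane:
  fixes L :: "('k::field ^ 'n::finite) set"
  assumes L: "vec.subspace L" and f: "f \<in> perp {v\<in>L. v $ e = 0}"
  shows "\<exists>c. f - axis e c \<in> perp L"
proof (cases "\<forall>v\<in>L. v $ e = 0")
  case True
  then have "f - axis e 0 \<in> perp L" using f by (auto simp: perp_def axis_def)
  then show ?thesis by blast
next
  case False
  then obtain w where w: "w \<in> L" "w $ e \<noteq> 0" by blast
  define c where "c = (\<Sum>i\<in>UNIV. f $ i * w $ i) / w $ e"
  have "(\<Sum>i\<in>UNIV. (f - axis e c) $ i * v $ i) = 0" if v: "v \<in> L" for v
  proof -
    let ?u = "v - (v $ e / w $ e) *s w"
    have "?u \<in> {v\<in>L. v $ e = 0}"
      using L v w by (auto intro: vec.subspace_diff vec.subspace_scale)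
    then have "(\<Sum>i\<in>UNIV. f $ i * ?u $ i) = 0" using f unfolding perp_def by blast
    then have "(\<Sum>i\<in>UNIV. f $ i * v $ i) = (v $ e / w $ e) * (\<Sum>i\<in>UNIV. f $ i * w $ i)"
      by (simp add: algebra_simps sum_subtractf sum_distrib_left)
    also have "\<dots> = (\<Sum>i\<in>UNIV. axis e c $ i * v $ i)"
      unfolding sum_axis_mult c_def by simp
    finally show ?thesis by (simp add: left_diff_distrib sum_subtractf)
  qed
  then show ?thesis unfolding perp_def by blast
qed

text \<open>The restriction of \<open>f\<close> to the line through \<open>p\<close> and \<open>q\<close>.\<close>

definition line_poly :: "('v \<Rightarrow> 'k::field) \<Rightarrow> ('v \<Rightarrow> 'k) \<Rightarrow> ('v, 'k) mpoly \<Rightarrow> 'k poly"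
  where "line_poly p q f = mpoly_eval (\<lambda>c. [:c:]) (\<lambda>v. [:p v, q v - p v:]) f"

lemma poly_line_poly:
  fixes f :: "('v, 'b::field) mpoly"
  shows "poly (line_poly p q f) t = mpoly_eval id (\<lambda>v. p v + t * (q v - p v)) f"
proof -
  have 1: "coeff_hom (\<lambda>\<phi>. poly \<phi> t)" by unfold_locales auto
  have 2: "coeff_hom (\<lambda>c. [:c::'b::field:])" by unfold_locales auto
  show ?thesis
    unfolding line_poly_def hom_mpoly_eval[OF 1 2] by (simp add: id_def mult.commute)
qed

lemma poly_vanishes_infinite:
  fixes p :: "'k::field poly"
  assumes "infinite (UNIV :: 'k set)" "\<And>t. poly p t = 0"
  shows "p = 0"
proof (rule ccontr)
  assume "p \<noteq> 0"
  then have "finite {t. poly p t = 0}" by (rule poly_roots_finite)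
  then show False using assms by simp
qed

text \<open>A set that contains the line through any two of its points is irreducible: two polynomials that do
  not vanish identically on it are both nonzero on a common line, where the product of two nonzero
  univariate polynomials has only finitely many zeros.\<close>

lemma eval_product_zero:
  fixes f g :: "('v, 'k::field) mpoly"
  assumes inf: "infinite (UNIV :: 'k set)"
    and line: "\<And>p q t. p \<in> P \<Longrightarrow> q \<in> P \<Longrightarrow> (\<lambda>v. p v + t * (q v - p v)) \<in> P"
    and 0: "\<And>p. p \<in> P \<Longrightarrow> mpoly_eval id p f * mpoly_eval id p g = 0"
  shows "(\<forall>p\<in>P. mpoly_eval id p f = 0) \<or> (\<forall>p\<in>P. mpoly_eval id p g = 0)"
proof (rule ccontr)
  assume "\<not> ?thesis"
  then obtain p q where p: "p \<in> P" "mpoly_eval id p f \<noteq> 0" and q: "q \<in> P" "mpoly_eval id q g \<noteq> 0"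
    by blast
  have "line_poly p q f * line_poly p q g = 0"
    by (rule poly_vanishes_infinite[OF inf]) (use 0[OF line[OF p(1) q(1)]] in \<open>simp add: poly_line_poly\<close>)
  then have "line_poly p q f = 0 \<or> line_poly p q g = 0" by simp
  then have "poly (line_poly p q f) 0 = 0 \<or> poly (line_poly p q g) 1 = 0" by auto
  then show False using p q by (simp add: poly_line_poly)
qed

lemma mev_zero: "s e = 0 \<Longrightarrow> Poly_Mapping.lookup m e \<noteq> 0 \<Longrightarrow> mev s m = 0"
  unfolding mev_def by (rule prod_zero) (simp, intro bexI[of _ e], auto simp: in_keys_iff zero_power)

text \<open>The multidegree \<open>\<gamma>\<close> is fixed, so a monomial in \<open>x\<close> and \<open>y\<close> is given by its part \<open>a\<close> in \<open>x\<close>, and \<open>y\<^sub>i\<close> divides it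
  if \<open>a\<^sub>i < \<gamma>\<^sub>i\<close>. Restricting a relation to the hyperplane \<open>v\<^sub>e = 0\<close>, where \<open>e\<close> is the largest element that
  occurs in \<open>\<gamma>\<close>, keeps the monomials without \<open>x\<^sub>e\<close>. They are standard for the smaller space: a form that
  vanishes on it becomes a form that vanishes on \<open>L\<close> after changing its coefficient at \<open>e\<close>, and this is
  harmless since \<open>y\<^sub>e\<close> divides the monomial. So these monomials do not occur in the relation, which is
  therefore divisible by \<open>v\<^sub>e\<close>.\<close>

lemma standard_monomials_independent_aux:
  fixes L :: "('k::field ^ 'n::finite) set" and h :: "('n, 'k) mpoly" and \<gamma> :: "'n \<Rightarrow> nat"
  assumes inf: "infinite (UNIV :: 'k set)" and ls: "strict_linear_order ls"
    and "vec.subspace L"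
    and "\<And>a i. a \<in> Poly_Mapping.keys h \<Longrightarrow> Poly_Mapping.lookup a i \<le> \<gamma> i"
    and "\<And>a. a \<in> Poly_Mapping.keys h \<Longrightarrow>
      standard ls (perp L) (Poly_Mapping.keys a) {i. Poly_Mapping.lookup a i < \<gamma> i}"
    and "\<And>v. v \<in> L \<Longrightarrow> mpoly_eval id (($) v) h = 0"
  shows "h = 0"
  using assms(3-6)
proof (induction "\<Sum>i\<in>UNIV. \<gamma> i" arbitrary: L h \<gamma> rule: less_induct)
  case less
  note L = less.prems(1) and bound = less.prems(2) and std = less.prems(3) and zero = less.prems(4)
  show ?case
  proof (cases "{i. \<gamma> i > 0} = {}")
    case True
    then have "a = 0" if "a \<in> Poly_Mapping.keys h" for a
      using bound[OF that] by (intro poly_mapping_eqI) (auto simp: not_less)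
    then have h: "h = Const (Poly_Mapping.lookup h 0)"
      unfolding Const_def by (intro poly_mapping_eqI) (metis in_keys_iff lookup_single_eq lookup_single_not_eq)
    have "mpoly_eval id (($) 0) h = 0" using zero[OF vec.subspace_0[OF L]] .
    then have "Poly_Mapping.lookup h 0 = 0" by (subst (asm) h) simp
    then show ?thesis using h by simp
  next
    case False
    then obtain e where e: "\<gamma> e > 0" "\<And>i. \<gamma> i > 0 \<Longrightarrow> i \<noteq> e \<Longrightarrow> ls i e"
      using strict_linear_order_max[OF ls, of "{i. \<gamma> i > 0}"] by auto
    have small: "(\<Sum>i\<in>UNIV. (\<gamma>(e := k)) i) < (\<Sum>i\<in>UNIV. \<gamma> i)" if "k < \<gamma> e" for k
      by (rule sum_strict_mono_ex1) (use that in \<open>auto intro!: bexI[of _ e]\<close>)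
    \<comment> \<open>\<open>h1\<close> vanishes on the hyperplane, so \<open>h0\<close> is a relation there of smaller multidegree\<close>
    define h0 where "h0 = mfilter (\<lambda>a. Poly_Mapping.lookup a e = 0) h"
    define h1 where "h1 = mfilter (\<lambda>a. Poly_Mapping.lookup a e \<noteq> 0) h"
    have h: "h = h0 + h1"
      by (rule poly_mapping_eqI) (auto simp: h0_def h1_def lookup_add lookup_mfilter)
    have h1_zero: "mpoly_eval id (($) v) h1 = 0" if "v $ e = 0" for v
      unfolding id_hom.eval_superset[OF finite_keys order_refl]
      by (intro sum.neutral ballI) (auto simp: h1_def keys_mfilter that mev_zero[of _ e])
    have "h0 = 0"
    proof (rule less.hyps)
      show "(\<Sum>i\<in>UNIV. (\<gamma>(e := 0)) i) < (\<Sum>i\<in>UNIV. \<gamma> i)" using small e by blast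
      show "vec.subspace {v\<in>L. v $ e = 0}" using L by (rule subspace_contract)
      show "mpoly_eval id (($) v) h0 = 0" if "v \<in> {v\<in>L. v $ e = 0}" for v
        using that zero[of v] h1_zero[of v] h by (simp add: id_hom.eval_add)
      fix a assume "a \<in> Poly_Mapping.keys h0"
      then have a: "a \<in> Poly_Mapping.keys h" "Poly_Mapping.lookup a e = 0"
        by (auto simp: h0_def keys_mfilter)
      show "Poly_Mapping.lookup a i \<le> (\<gamma>(e := 0)) i" for i
        using bound[OF a(1), of i] a(2) by auto
      show "standard ls (perp {v\<in>L. v $ e = 0}) (Poly_Mapping.keys a)
          {i. Poly_Mapping.lookup a i < (\<gamma>(e := 0)) i}"
        unfolding standard_def
      proof clarify
        fix f i assume f: "f \<in> perp {v\<in>L. v $ e = 0}" and i: "i \<in> Poly_Mapping.keys a"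
          and ini: "initial_in ls f i"
          and sup: "supp f \<subseteq> insert i {i. Poly_Mapping.lookup a i < (\<gamma>(e := 0)) i}"
        obtain c where c: "f - axis e c \<in> perp L" using perp_hyperplane[OF L f] by blast
        have ie: "i \<noteq> e" using i a(2) by (auto simp: in_keys_iff)
        have "\<gamma> i > 0" using i bound[OF a(1), of i] by (auto simp: in_keys_iff)
        then have lsi: "ls i e" using e(2) ie by blast
        have same: "(f - axis e c) $ j = f $ j" if "j \<noteq> e" for j using that by (simp add: axis_def)
        have "initial_in ls (f - axis e c) i"
          using ini ie lsi same unfolding initial_in_def by metis
        moreover have "supp (f - axis e c) \<subseteq> insert i {i. Poly_Mapping.lookup a i < \<gamma> i}"
        proof
          fix j assume j: "j \<in> supp (f - axis e c)"
          show "j \<in> insert i {i. Poly_Mapping.lookup a i < \<gamma> i}"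
          proof (cases "j = e")
            case True then show ?thesis using a(2) e(1) by simp
          next
            case False
            then have "j \<in> supp f" using j same by (simp add: supp_def)
            then show ?thesis using sup False by auto
          qed
        qed
        ultimately show False using std[OF a(1)] c i unfolding standard_def by blast
      qed
    qed
    then have hh1: "h = h1" using h by simp
    show ?thesis
    proof (cases "\<forall>v\<in>L. v $ e = 0")
      case True
      then have ax: "axis e 1 \<in> perp L" by (simp add: perp_def sum_axis_mult)
      have "Poly_Mapping.keys h1 = {}"
      proof (rule ccontr)
        assume "Poly_Mapping.keys h1 \<noteq> {}"
        then obtain a where a: "a \<in> Poly_Mapping.keys h" "Poly_Mapping.lookup a e \<noteq> 0"
          by (auto simp: h1_def keys_mfilter)
        moreover have "initial_in ls (axis e 1 :: 'k ^ 'n) e" "supp (axis e 1 :: 'k ^ 'n) \<subseteq> {e}"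
          by (auto simp: initial_in_def supp_def axis_def)
        ultimately show False
          using std[OF a(1)] ax unfolding standard_def
          by (metis in_keys_iff insert_mono subset_insertI subset_trans empty_subsetI)
      qed
      then show ?thesis using hh1 by simp
    next
      case False
      then obtain w where w: "w \<in> L" "w $ e \<noteq> 0" by blast
      \<comment> \<open>\<open>h2\<close> is the quotient of \<open>h\<close> by \<open>v\<^sub>e\<close>; it vanishes on \<open>L\<close> because \<open>v\<^sub>e\<close> does not, and \<open>L\<close> is irreducible\<close>
      define u where "u = Poly_Mapping.single e (1::nat)"
      define h2 where "h2 = (\<Sum>a\<in>Poly_Mapping.keys h. Poly_Mapping.single (a - u) (Poly_Mapping.lookup h a))"
      have pos: "Poly_Mapping.lookup a e \<noteq> 0" if "a \<in> Poly_Mapping.keys h" for a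
      proof -
        have "a \<in> Poly_Mapping.keys h1" using that hh1 by metis
        then show ?thesis by (simp add: h1_def keys_mfilter)
      qed
      have sub: "a = u + (a - u)" if "a \<in> Poly_Mapping.keys h" for a
      proof (rule poly_mapping_eqI)
        show "Poly_Mapping.lookup a i = Poly_Mapping.lookup (u + (a - u)) i" for i
          using pos[OF that] by (auto simp: u_def lookup_add lookup_minus lookup_single when_def)
      qed
      have "Var e * h2 = (\<Sum>a\<in>Poly_Mapping.keys h. Poly_Mapping.single (u + (a - u)) (Poly_Mapping.lookup h a))"
        by (simp add: h2_def Var_def monom_of_def u_def sum_distrib_left mult_single)
      also have "\<dots> = (\<Sum>a\<in>Poly_Mapping.keys h. Poly_Mapping.single a (Poly_Mapping.lookup h a))"
        by (intro sum.cong refl) (metis sub)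
      finally have hh2: "Var e * h2 = h" using mpoly_expand[of h] by metis
      have "h2 = 0"
      proof (rule less.hyps)
        show "(\<Sum>i\<in>UNIV. (\<gamma>(e := \<gamma> e - 1)) i) < (\<Sum>i\<in>UNIV. \<gamma> i)" using small e by simp
        show "vec.subspace L" by (rule L)
        have line: "(\<lambda>i. p i + t * (q i - p i)) \<in> ($) ` L" if "p \<in> ($) ` L" "q \<in> ($) ` L" for p q t
        proof -
          from that obtain x y where xy: "x \<in> L" "p = ($) x" "y \<in> L" "q = ($) y" by blast
          then have "x + t *s (y - x) \<in> L"
            using L by (intro vec.subspace_add vec.subspace_scale vec.subspace_diff)
          moreover have "(\<lambda>i. p i + t * (q i - p i)) = ($) (x + t *s (y - x))"
            using xy by auto
          ultimately show ?thesis by blast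
        qed
        have "(\<forall>p\<in>($) ` L. mpoly_eval id p (Var e) = 0) \<or> (\<forall>p\<in>($) ` L. mpoly_eval id p h2 = 0)"
        proof (rule eval_product_zero[OF inf line])
          fix p assume "p \<in> ($) ` L"
          then show "mpoly_eval id p (Var e) * mpoly_eval id p h2 = 0"
            using zero unfolding id_hom.eval_mult[symmetric] hh2 by blast
        qed
        then show "mpoly_eval id (($) v) h2 = 0" if "v \<in> L" for v
          using w that by auto
        fix b assume b: "b \<in> Poly_Mapping.keys h2"
        then obtain a where a: "a \<in> Poly_Mapping.keys h" "b = a - u"
          using keys_sum[of "\<lambda>a. Poly_Mapping.single (a - u) (Poly_Mapping.lookup h a)" "Poly_Mapping.keys h"]
          unfolding h2_def by (auto split: if_splits)
        note pos = pos[OF a(1)]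
        have lb: "Poly_Mapping.lookup b i = (if i = e then Poly_Mapping.lookup a e - 1 else Poly_Mapping.lookup a i)" for i
          using a(2) by (simp add: u_def lookup_minus lookup_single when_def)
        show "Poly_Mapping.lookup b i \<le> (\<gamma>(e := \<gamma> e - 1)) i" for i
          using bound[OF a(1), of i] bound[OF a(1), of e] by (simp add: lb diff_le_mono)
        have 1: "Poly_Mapping.keys b \<subseteq> Poly_Mapping.keys a"
          using lb pos by (auto simp: in_keys_iff split: if_splits)
        have 2: "{i. Poly_Mapping.lookup b i < (\<gamma>(e := \<gamma> e - 1)) i} = {i. Poly_Mapping.lookup a i < \<gamma> i}"
          using bound[OF a(1), of e] pos e(1) by (auto simp: lb split: if_splits)
        show "standard ls (perp L) (Poly_Mapping.keys b) {i. Poly_Mapping.lookup b i < (\<gamma>(e := \<gamma> e - 1)) i}"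
          using std[OF a(1)] 1 unfolding 2 standard_def by blast
      qed
      then show ?thesis using hh2 by simp
    qed
  qed
qed

text \<open>For \<open>L = UNIV\<close> no nonzero form vanishes on \<open>L\<close>, so all monomials are standard.\<close>

lemma vanishing_polynomial_zero:
  fixes h :: "('n::finite, 'k::field) mpoly"
  assumes inf: "infinite (UNIV :: 'k set)" and zero: "\<And>v. mpoly_eval id v h = 0"
  shows "h = 0"
proof -
  obtain ls :: "'n \<Rightarrow> 'n \<Rightarrow> bool" where ls: "strict_linear_order ls"
    using ex_strict_linear_order by blast
  define \<gamma> where "\<gamma> i = Max (insert 0 ((\<lambda>a. Poly_Mapping.lookup a i) ` Poly_Mapping.keys h))" for i
  have "perp (UNIV :: ('k ^ 'n) set) = {0}"
  proof -
    have "f $ j = 0" if "f \<in> perp (UNIV :: ('k ^ 'n) set)" for f and j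
    proof -
      have "(\<Sum>i\<in>UNIV. f $ i * axis j 1 $ i) = 0" using that by (simp add: perp_def)
      then show ?thesis using sum_axis_mult[of j 1 f] by (simp add: mult.commute)
    qed
    then show ?thesis using vec.subspace_0[OF subspace_perp[of UNIV]] by (auto simp: vec_eq_iff)
  qed
  then have std: "standard ls (perp (UNIV :: ('k ^ 'n) set)) S T" for S T
    by (simp add: standard_def initial_in_def)
  show ?thesis
  proof (rule standard_monomials_independent_aux[OF inf ls vec.subspace_UNIV])
    show "Poly_Mapping.lookup a i \<le> \<gamma> i" if "a \<in> Poly_Mapping.keys h" for a i
      unfolding \<gamma>_def using that by (intro Max_ge) auto
  qed (use std zero in auto)
qed

definition xpart :: "'n::finite hvar mon \<Rightarrow> 'n mon"
  where "xpart m = Abs_poly_mapping (\<lambda>i. Poly_Mapping.lookup m (xv i))"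

definition ypart :: "'n::finite hvar mon \<Rightarrow> 'n mon"
  where "ypart m = Abs_poly_mapping (\<lambda>i. Poly_Mapping.lookup m (yv i))"

lemma lookup_xpart [simp]: "Poly_Mapping.lookup (xpart m) i = Poly_Mapping.lookup m (xv i)"
  and lookup_ypart [simp]: "Poly_Mapping.lookup (ypart m) i = Poly_Mapping.lookup m (yv i)"
  by (simp_all add: xpart_def ypart_def)

lemma hvar_mon_eqI:
  "(\<And>i. Poly_Mapping.lookup a (xv i) = Poly_Mapping.lookup b (xv i)) \<Longrightarrow>
   (\<And>i. Poly_Mapping.lookup a (yv i) = Poly_Mapping.lookup b (yv i)) \<Longrightarrow> a = b"
  by (rule poly_mapping_eqI) (metis hvar.exhaust)

lemma UNIV_hvar: "(UNIV :: 'n hvar set) = range xv \<union> range yv"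
  by (metis UNIV_eq_I UnCI hvar.exhaust rangeI)

lemma prod_hvar: "(\<Prod>v\<in>UNIV. g v) = (\<Prod>i\<in>UNIV. g (xv (i :: 'n::finite))) * (\<Prod>i\<in>UNIV. g (yv i))"
  unfolding UNIV_hvar by (subst prod.union_disjoint) (auto simp: prod.reindex inj_on_def)

lemma mev_hvar: "mev s m = mev (\<lambda>i. s (xv i)) (xpart m) * mev (\<lambda>i. s (yv i)) (ypart m)"
  by (simp add: mev_finite prod_hvar)

definition std_mon :: "('n::finite \<Rightarrow> 'n \<Rightarrow> bool) \<Rightarrow> ('k::field ^ 'n) set \<Rightarrow> 'n hvar mon \<Rightarrow> bool"
  where "std_mon ls V m \<longleftrightarrow>
    standard ls V {i. Poly_Mapping.lookup m (xv i) \<noteq> 0} {i. Poly_Mapping.lookup m (yv i) \<noteq> 0}"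

text \<open>For \<open>v\<close> in \<open>L\<close> these are representatives \<open>(v\<^sub>i y\<^sub>i, y\<^sub>i)\<close> of the affine points \<open>v\<close>. A multihomogeneous
  polynomial vanishes on the closure of \<open>L\<close> if and only if it vanishes at all of them, so \<open>torus_ideal\<close> is a
  description of the ideal of the closure that can be tested pointwise.\<close>

fun torus_point :: "'k::field ^ 'n \<Rightarrow> ('n \<Rightarrow> 'k) \<Rightarrow> 'n hvar \<Rightarrow> 'k"
  where "torus_point v y (xv i) = v $ i * y i"
  | "torus_point v y (yv i) = y i"

definition torus_ideal :: "('k::field ^ 'n) set \<Rightarrow> ('n hvar, 'k) mpoly set"
  where "torus_ideal L = {f. \<forall>v\<in>L. \<forall>y. mpoly_eval id (torus_point v y) f = 0}"

lemma mev_torus_point: "mev (torus_point v y) m = mev (($) v) (xpart m) * mev y (xpart m + ypart m)"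
  unfolding mev_hvar mev_add by (simp add: mev_finite power_mult_distrib prod.distrib)

text \<open>In \<open>y\<close>, the evaluation at the points \<open>(v\<^sub>i y\<^sub>i, y\<^sub>i)\<close> is a polynomial that vanishes identically. Its
  coefficients are the multihomogeneous components of the relation, evaluated at \<open>v\<close>.\<close>

lemma standard_monomials_independent:
  fixes L :: "('k::field ^ 'n::finite) set"
  assumes inf: "infinite (UNIV :: 'k set)" and ls: "strict_linear_order ls" and L: "vec.subspace L"
    and f: "f \<in> torus_ideal L" and std: "\<And>m. m \<in> Poly_Mapping.keys f \<Longrightarrow> std_mon ls (perp L) m"
  shows "f = 0"
proof (rule ccontr)
  assume "f \<noteq> 0"
  then obtain m0 where m0: "m0 \<in> Poly_Mapping.keys f" by (metis all_not_in_conv keys_eq_empty)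
  define deg where "deg m = xpart m + ypart m" for m :: "'n hvar mon"
  define F where "F = {m \<in> Poly_Mapping.keys f. deg m = deg m0}"
  define h where "h = (\<Sum>m\<in>F. Poly_Mapping.single (xpart m) (Poly_Mapping.lookup f m))"
  have finF: "finite F" unfolding F_def by simp
  have inj: "m = m'" if "m \<in> F" "m' \<in> F" "xpart m = xpart m'" for m m'
  proof (rule hvar_mon_eqI)
    show "Poly_Mapping.lookup m (xv i) = Poly_Mapping.lookup m' (xv i)" for i
      using arg_cong[OF that(3), of "\<lambda>a. Poly_Mapping.lookup a i"] by simp
    have "ypart m = ypart m'" using that unfolding F_def deg_def by (metis (mono_tags, lifting) add_left_cancel mem_Collect_eq)
    then show "Poly_Mapping.lookup m (yv i) = Poly_Mapping.lookup m' (yv i)" for i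
      by (metis lookup_ypart)
  qed
  have "mpoly_eval id (($) v) h = 0" if v: "v \<in> L" for v
  proof -
    \<comment> \<open>the values of \<open>f\<close> at the points over \<open>v\<close>, as a polynomial in \<open>y\<close>\<close>
    define \<phi> where "\<phi> = (\<Sum>m\<in>Poly_Mapping.keys f.
      Poly_Mapping.single (deg m) (Poly_Mapping.lookup f m * mev (($) v) (xpart m)))"
    have "mpoly_eval id y \<phi> = 0" for y
    proof -
      have "mpoly_eval id y \<phi> = (\<Sum>m\<in>Poly_Mapping.keys f. Poly_Mapping.lookup f m * mev (torus_point v y) m)"
        unfolding \<phi>_def id_hom.eval_sum
        by (intro sum.cong refl) (simp add: id_hom.eval_single mev_torus_point deg_def mult_ac)
      also have "\<dots> = mpoly_eval id (torus_point v y) f"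
        by (simp add: id_hom.eval_superset[of "Poly_Mapping.keys f"])
      also have "\<dots> = 0" using f v by (simp add: torus_ideal_def)
      finally show ?thesis .
    qed
    then have "\<phi> = 0" by (rule vanishing_polynomial_zero[OF inf])
    then have "0 = Poly_Mapping.lookup \<phi> (deg m0)" by simp
    also have "\<dots> = (\<Sum>m\<in>Poly_Mapping.keys f.
        if deg m = deg m0 then Poly_Mapping.lookup f m * mev (($) v) (xpart m) else 0)"
      by (simp add: \<phi>_def lookup_sum lookup_single when_def)
    also have "\<dots> = (\<Sum>m\<in>F. Poly_Mapping.lookup f m * mev (($) v) (xpart m))"
      unfolding F_def by (rule sum.inter_filter[symmetric]) simp
    also have "\<dots> = mpoly_eval id (($) v) h"
      by (simp add: h_def id_hom.eval_sum id_hom.eval_single)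
    finally show ?thesis by simp
  qed
  moreover have keys: "\<exists>m\<in>F. a = xpart m" if "a \<in> Poly_Mapping.keys h" for a
    using that keys_sum[of "\<lambda>m. Poly_Mapping.single (xpart m) (Poly_Mapping.lookup f m)" F]
    unfolding h_def by (auto split: if_splits)
  moreover have deg: "Poly_Mapping.lookup m (xv i) + Poly_Mapping.lookup m (yv i)
      = Poly_Mapping.lookup (deg m0) i" if "m \<in> F" for m i
  proof -
    have "deg m = deg m0" using that unfolding F_def by blast
    then show ?thesis unfolding deg_def by (metis lookup_add lookup_xpart lookup_ypart)
  qed
  ultimately have "h = 0"
  proof (intro standard_monomials_independent_aux[OF inf ls L, of h "Poly_Mapping.lookup (deg m0)"])
    fix a assume "a \<in> Poly_Mapping.keys h"
    then obtain m where m: "m \<in> F" "a = xpart m" using keys by blast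
    show "Poly_Mapping.lookup a i \<le> Poly_Mapping.lookup (deg m0) i" for i
      using deg[OF m(1), of i] m(2) by simp
    have 1: "Poly_Mapping.keys a = {i. Poly_Mapping.lookup m (xv i) \<noteq> 0}"
      using m(2) by (auto simp: in_keys_iff)
    have 2: "{i. Poly_Mapping.lookup a i < Poly_Mapping.lookup (deg m0) i} = {i. Poly_Mapping.lookup m (yv i) \<noteq> 0}"
      using deg[OF m(1)] m(2) by (auto simp flip: deg[OF m(1)])
    show "standard ls (perp L) (Poly_Mapping.keys a) {i. Poly_Mapping.lookup a i < Poly_Mapping.lookup (deg m0) i}"
      using std[of m] m(1) unfolding 1 2 std_mon_def F_def by blast
  qed auto
  have "m0 \<in> F" using m0 by (simp add: F_def)
  have "Poly_Mapping.lookup h (xpart m0) = (\<Sum>m\<in>F. if m = m0 then Poly_Mapping.lookup f m else 0)"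
    unfolding h_def lookup_sum lookup_single when_def
    by (intro sum.cong refl) (use inj \<open>m0 \<in> F\<close> in auto)
  also have "\<dots> = Poly_Mapping.lookup f m0" using \<open>m0 \<in> F\<close> finF by simp
  finally show False using \<open>h = 0\<close> m0 by (simp add: in_keys_iff)
qed

section \<open>Linear forms and their homogenizations\<close>

lemma single_1_inj: "Poly_Mapping.single i (1::nat) = Poly_Mapping.single j 1 \<longleftrightarrow> i = j"
  by (metis lookup_single_eq lookup_single_not_eq zero_neq_one)

lemma single_Suc_inj [simp]:
  "Poly_Mapping.single i (Suc n) = Poly_Mapping.single j (Suc n) \<longleftrightarrow> i = j"
  by (metis lookup_single_eq lookup_single_not_eq Zero_not_Suc)

lemma linear_form_alt:
  "linear_form (a :: 'k::comm_ring_1 ^ 'n::finite) = (\<Sum>i\<in>UNIV. Poly_Mapping.single (Poly_Mapping.single i 1) (a $ i))"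
  unfolding linear_form_def by (intro sum.cong refl) (simp add: Const_def Var_def monom_of_def mult_single)

lemma lookup_linear_form [simp]:
  "Poly_Mapping.lookup (linear_form (a :: 'k::comm_ring_1 ^ 'n::finite)) (Poly_Mapping.single i 1) = a $ i"
  by (simp add: linear_form_alt lookup_sum lookup_single when_def)

lemmas lookup_linear_form' [simp] = lookup_linear_form[simplified]

lemma keys_linear_form:
  "Poly_Mapping.keys (linear_form (a :: 'k::comm_ring_1 ^ 'n::finite)) = (\<lambda>i. Poly_Mapping.single i 1) ` supp a"
proof
  show "Poly_Mapping.keys (linear_form a) \<subseteq> (\<lambda>i. Poly_Mapping.single i 1) ` supp a"
    using keys_sum[of "\<lambda>i. Poly_Mapping.single (Poly_Mapping.single i 1) (a $ i)" UNIV]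
    unfolding linear_form_alt supp_def by (auto simp del: One_nat_def split: if_splits)
qed (auto simp: in_keys_iff supp_def)

lemma linear_form_vanishing:
  fixes a :: "'k::field ^ 'n::finite"
  shows "linear_form a \<in> vanishing_ideal L \<longleftrightarrow> a \<in> perp L"
  by (simp add: vanishing_ideal_def perp_def linear_form_def id_hom.eval_sum id_hom.eval_mult)

text \<open>The monomial of the homogenization of a linear form with support \<open>D\<close> that comes from \<open>x\<^sub>i\<close>.\<close>

definition lin_mon :: "'n::finite set \<Rightarrow> 'n \<Rightarrow> 'n hvar mon"
  where "lin_mon D i = Poly_Mapping.single (xv i) 1 + (\<Sum>j\<in>D - {i}. Poly_Mapping.single (yv j) 1)"

lemma lookup_lin_mon [simp]:
  "Poly_Mapping.lookup (lin_mon D i) (xv j) = (if j = i then 1 else 0)"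
  "Poly_Mapping.lookup (lin_mon D i) (yv j) = (if j \<in> D \<and> j \<noteq> i then 1 else 0)"
  by (auto simp: lin_mon_def lookup_add lookup_sum lookup_single when_def)

lemma lin_mon_inj: "lin_mon D i = lin_mon D' j \<Longrightarrow> i = j"
  using lookup_lin_mon(1)[of D i i] lookup_lin_mon(1)[of D' j i] by (metis zero_neq_one)

definition hom_form :: "'k::comm_ring_1 ^ 'n \<Rightarrow> ('n::finite hvar, 'k) mpoly"
  where "hom_form a = (\<Sum>i\<in>supp a. Poly_Mapping.single (lin_mon (supp a) i) (a $ i))"

lemma lookup_hom_form: "i \<in> supp a \<Longrightarrow> Poly_Mapping.lookup (hom_form a) (lin_mon (supp a) i) = a $ i"
proof -
  assume i: "i \<in> supp a"
  have "Poly_Mapping.lookup (hom_form a) (lin_mon (supp a) i) = (\<Sum>j\<in>supp a. if j = i then a $ j else 0)"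
    unfolding hom_form_def lookup_sum lookup_single when_def
    by (intro sum.cong refl) (auto dest: lin_mon_inj)
  then show ?thesis using i by simp
qed

lemma keys_hom_form: "Poly_Mapping.keys (hom_form a) = lin_mon (supp a) ` supp a"
proof
  show "Poly_Mapping.keys (hom_form a) \<subseteq> lin_mon (supp a) ` supp a"
    using keys_sum[of "\<lambda>i. Poly_Mapping.single (lin_mon (supp a) i) (a $ i)" "supp a"]
    unfolding hom_form_def by (auto split: if_splits)
  show "lin_mon (supp a) ` supp a \<subseteq> Poly_Mapping.keys (hom_form a)"
    by (auto simp: in_keys_iff lookup_hom_form) (simp add: supp_def)
qed

lemma homogenize_linear_form:
  fixes a :: "'k::comm_ring_1 ^ 'n::finite"
  shows "homogenize (linear_form a) = hom_form a"
proof -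
  have deg: "var_degree k (linear_form a) = (if k \<in> supp a then 1 else 0)" for k
  proof -
    have "(\<lambda>m. Poly_Mapping.lookup m k) ` Poly_Mapping.keys (linear_form a)
        = (\<lambda>i. if i = k then 1 else 0) ` supp a"
      unfolding keys_linear_form image_image by (intro image_cong refl) (auto simp: lookup_single when_def)
    moreover have "insert 0 ((\<lambda>i. if i = k then 1 else 0 :: nat) ` supp a) = (if k \<in> supp a then {0, 1} else {0})"
      by auto
    ultimately show ?thesis unfolding var_degree_def by simp
  qed
  have mon: "(\<Prod>k\<in>UNIV. Var (xv k) ^ Poly_Mapping.lookup (Poly_Mapping.single i (1::nat)) k *
      Var (yv k) ^ (var_degree k (linear_form a) - Poly_Mapping.lookup (Poly_Mapping.single i (1::nat)) k))
      = (monom_of (lin_mon (supp a) i) :: ('n hvar, 'k) mpoly)" if i: "i \<in> supp a" for i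
  proof -
    let ?m = "\<lambda>k. if k = i then Poly_Mapping.single (xv i) (1::nat)
        else if k \<in> supp a then Poly_Mapping.single (yv k) 1 else 0"
    have "(\<Prod>k\<in>UNIV. Var (xv k) ^ Poly_Mapping.lookup (Poly_Mapping.single i (1::nat)) k *
      Var (yv k) ^ (var_degree k (linear_form a) - Poly_Mapping.lookup (Poly_Mapping.single i (1::nat)) k))
      = (\<Prod>k\<in>UNIV. monom_of (?m k) :: ('n hvar, 'k) mpoly)"
      by (intro prod.cong refl) (auto simp: deg Var_def lookup_single when_def i)
    also have "\<dots> = monom_of (\<Sum>k\<in>UNIV. ?m k)" by (rule monom_of_sum[symmetric])
    also have "(\<Sum>k\<in>UNIV. ?m k) = lin_mon (supp a) i"
    proof (rule hvar_mon_eqI)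
      have "Poly_Mapping.lookup (\<Sum>k\<in>UNIV. ?m k) (xv j) = (\<Sum>k\<in>UNIV. if k = i then (if j = i then 1 else 0) else 0)" for j
        unfolding lookup_sum by (intro sum.cong refl) (auto simp: lookup_single when_def)
      then show "Poly_Mapping.lookup (\<Sum>k\<in>UNIV. ?m k) (xv j) = Poly_Mapping.lookup (lin_mon (supp a) i) (xv j)" for j
        by simp
      have "Poly_Mapping.lookup (\<Sum>k\<in>UNIV. ?m k) (yv j) = (\<Sum>k\<in>UNIV. if k = j then (if j \<in> supp a \<and> j \<noteq> i then 1 else 0) else 0)" for j
        unfolding lookup_sum by (intro sum.cong refl) (auto simp: lookup_single when_def)
      then show "Poly_Mapping.lookup (\<Sum>k\<in>UNIV. ?m k) (yv j) = Poly_Mapping.lookup (lin_mon (supp a) i) (yv j)" for j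
        by simp
    qed
    finally show ?thesis .
  qed
  have inj: "inj_on (\<lambda>i. Poly_Mapping.single i (1::nat)) (supp a)"
    by (rule inj_onI) (simp only: single_1_inj)
  show ?thesis
    unfolding homogenize_def keys_linear_form sum.reindex[OF inj] o_def hom_form_def
    by (intro sum.cong refl) (simp only: mon lookup_linear_form single_eq_Const_monom)
qed

section \<open>The matroid of a linear space\<close>

text \<open>Matroid duality. The dual family of \<open>- B\<close> consists of the equations that express the coordinates
  outside \<open>B\<close> of the vectors of \<open>L\<close> in terms of those in \<open>B\<close>.\<close>

lemma coord_basis_perp:
  fixes L :: "('k::field ^ 'n::finite) set"
  assumes L: "vec.subspace L" and B: "coord_basis L B"
  shows "coord_basis (perp L) (- B)"
proof -
  have B': "coord_indep L B" using B by (simp add: coord_basis_def)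
  show ?thesis
    unfolding coord_basis_def coord_indep_def
  proof (intro conjI ballI impI)
    fix c assume c: "c \<in> - B"
    define a where "a = (\<chi> i. if i = c then 1 else if i \<in> B then - dual_vec L B i $ c else 0)"
    have "(\<Sum>i\<in>UNIV. a $ i * v $ i) = 0" if v: "v \<in> L" for v
    proof -
      have "(\<Sum>i\<in>UNIV. a $ i * v $ i) = (\<Sum>i\<in>insert c B. a $ i * v $ i)"
        by (rule sum.mono_neutral_right) (auto simp: a_def)
      also have "\<dots> = v $ c + (\<Sum>i\<in>B. a $ i * v $ i)" using c by (simp add: a_def)
      also have "(\<Sum>i\<in>B. a $ i * v $ i) = (\<Sum>i\<in>B. - (v $ i * dual_vec L B i $ c))"
        by (rule sum.cong) (use c in \<open>auto simp: a_def\<close>)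
      also have "v $ c = (\<Sum>i\<in>B. v $ i * dual_vec L B i $ c)"
        by (subst coord_basis_expand[OF L B v]) (simp add: sum_component)
      finally show ?thesis by (simp add: sum_negf)
    qed
    then have "a \<in> perp L" by (simp add: perp_def)
    moreover have "a $ c = 1" "\<forall>j\<in>- B - {c}. a $ j = 0" by (auto simp: a_def)
    ultimately show "\<exists>f\<in>perp L. f $ c = 1 \<and> (\<forall>j\<in>- B - {c}. f $ j = 0)" by blast
  next
    fix f assume f: "f \<in> perp L" and 0: "\<forall>b\<in>- B. f $ b = 0"
    have "f $ b = 0" for b
    proof (cases "b \<in> B")
      case True
      have "(\<Sum>i\<in>UNIV. f $ i * dual_vec L B b $ i) = (\<Sum>i\<in>UNIV. if i = b then f $ i else 0)"
        by (intro sum.cong refl) (use 0 dual_vec[OF B' True] in auto)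
      moreover have "(\<Sum>i\<in>UNIV. f $ i * dual_vec L B b $ i) = 0"
        using f dual_vec(1)[OF B' True] unfolding perp_def by blast
      ultimately show ?thesis by simp
    qed (use 0 in simp)
    then show "f = 0" by (simp add: vec_eq_iff)
  qed
qed

lemma coord_basis_exists':
  fixes V :: "('k::field ^ 'n::finite) set"
  assumes "vec.subspace V"
  obtains B where "coord_basis V B"
proof -
  obtain ls :: "'n \<Rightarrow> 'n \<Rightarrow> bool" where "strict_linear_order ls"
    using ex_strict_linear_order by blast
  from standard_basis_exists[OF this assms standard_empty] that show ?thesis by blast
qed

lemma dim_perp:
  fixes L :: "('k::field ^ 'n::finite) set"
  assumes L: "vec.subspace L"
  shows "vec.dim (perp L) = CARD('n) - vec.dim L"
proof -
  obtain B where B: "coord_basis L B" using coord_basis_exists'[OF L] by blast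
  show ?thesis
    using coord_basis_card[OF L B] coord_basis_card[OF subspace_perp coord_basis_perp[OF L B]]
    by (simp add: card_Diff_subset Compl_eq_Diff_UNIV)
qed

text \<open>By induction on \<open>B\<close>: if no vector of \<open>V\<close> vanishes on \<open>B\<close> but not at \<open>b\<close>, then the coordinate at \<open>b\<close> is a
  combination of those in \<open>B\<close>, which contradicts the independence of the columns.\<close>

lemma coord_indep_iff_columns:
  fixes V :: "('k::field ^ 'n::finite) set"
  assumes V: "vec.subspace V"
  shows "coord_indep V B \<longleftrightarrow> (\<forall>c. (\<forall>f\<in>V. (\<Sum>j\<in>B. c j * f $ j) = 0) \<longrightarrow> (\<forall>j\<in>B. c j = 0))"
proof
  assume B: "coord_indep V B"
  show "\<forall>c. (\<forall>f\<in>V. (\<Sum>j\<in>B. c j * f $ j) = 0) \<longrightarrow> (\<forall>j\<in>B. c j = 0)"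
  proof (intro allI impI ballI)
    fix c b assume c: "\<forall>f\<in>V. (\<Sum>j\<in>B. c j * f $ j) = 0" and b: "b \<in> B"
    have "(\<Sum>j\<in>B. c j * dual_vec V B b $ j) = (\<Sum>j\<in>B. if j = b then c j else 0)"
      by (intro sum.cong refl) (use dual_vec[OF B b] in auto)
    moreover have "(\<Sum>j\<in>B. c j * dual_vec V B b $ j) = 0" using c dual_vec(1)[OF B b] by blast
    ultimately show "c b = 0" using b by simp
  qed
next
  have "finite B" by simp
  then show "(\<forall>c. (\<forall>f\<in>V. (\<Sum>j\<in>B. c j * f $ j) = 0) \<longrightarrow> (\<forall>j\<in>B. c j = 0)) \<Longrightarrow> coord_indep V B"
  proof (induction B)
    case empty show ?case by (simp add: coord_indep_def)
  next
    case (insert b B)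
    have "coord_indep V B"
    proof (rule insert.IH, intro allI impI ballI)
      fix c j assume c: "\<forall>f\<in>V. (\<Sum>j\<in>B. c j * f $ j) = 0" and j: "j \<in> B"
      have "(\<Sum>j\<in>insert b B. (c(b := 0)) j * f $ j) = (\<Sum>j\<in>B. c j * f $ j)" for f :: "'k ^ 'n"
        using insert.hyps by simp (intro sum.cong refl, auto)
      then have "\<forall>j\<in>insert b B. (c(b := 0)) j = 0"
        using insert.prems[rule_format, of "c(b := 0)"] c by metis
      then show "c j = 0" using j insert.hyps by (metis fun_upd_apply insertCI)
    qed
    note B = this
    let ?d = "dual_vec V B"
    have "\<exists>g\<in>V. g $ b \<noteq> 0 \<and> (\<forall>c\<in>B. g $ c = 0)"
    proof (rule ccontr)
      assume no: "\<not> ?thesis"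
      define c where "c j = (if j = b then 1 else - ?d j $ b)" for j
      have "(\<Sum>j\<in>insert b B. c j * f $ j) = 0" if f: "f \<in> V" for f
      proof -
        let ?g = "f - (\<Sum>j\<in>B. f $ j *s ?d j)"
        have "?g \<in> V" using V f coord_interpolation(1)[OF V B] by (intro vec.subspace_diff)
        moreover have "\<forall>c\<in>B. ?g $ c = 0"
          using coord_interpolation(2)[OF V B, of _ "\<lambda>j. f $ j"] by simp
        ultimately have "?g $ b = 0" using no by blast
        then have "f $ b - (\<Sum>j\<in>B. f $ j * ?d j $ b) = 0" by (simp add: sum_component)
        moreover have "(\<Sum>j\<in>B. c j * f $ j) = - (\<Sum>j\<in>B. f $ j * ?d j $ b)"
          unfolding sum_negf[symmetric] by (rule sum.cong) (use insert.hyps in \<open>auto simp: c_def\<close>)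
        ultimately show ?thesis using insert.hyps by (simp add: c_def)
      qed
      then have "c b = 0" using insert.prems by blast
      then show False by (simp add: c_def)
    qed
    then obtain g0 where g0: "g0 \<in> V" "g0 $ b \<noteq> 0" "\<forall>c\<in>B. g0 $ c = 0" by blast
    define g where "g = inverse (g0 $ b) *s g0"
    have g: "g \<in> V" "g $ b = 1" "\<And>c. c \<in> B \<Longrightarrow> g $ c = 0"
      using g0 V by (auto simp: g_def intro: vec.subspace_scale)
    show ?case
      unfolding coord_indep_def
    proof
      fix j assume j: "j \<in> insert b B"
      show "\<exists>f\<in>V. f $ j = 1 \<and> (\<forall>c\<in>insert b B - {j}. f $ c = 0)"
      proof (cases "j = b")
        case True then show ?thesis using g by (intro bexI[of _ g]) auto
      next
        case False
        then have jB: "j \<in> B" using j by simp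
        let ?f = "?d j - (?d j $ b) *s g"
        have "?f \<in> V" using V g dual_vec(1)[OF B jB] by (intro vec.subspace_diff vec.subspace_scale)
        moreover have "?f $ j = 1" using g jB dual_vec[OF B jB] by simp
        moreover have "?f $ c = 0" if "c \<in> insert b B - {j}" for c
          using that g dual_vec[OF B jB] by auto
        ultimately show ?thesis by blast
      qed
    qed
  qed
qed

text \<open>The polynomials without constant term whose linear part lies in the span of the rows form an ideal
  that contains the generators, hence all of the vanishing ideal.\<close>

lemma linear_forms_span:
  fixes A :: "nat \<Rightarrow> 'k::field ^ 'n::finite"
  assumes "ideal_gen {linear_form (A i) | i. i < r} = vanishing_ideal L"
  shows "vec.span (A ` {..<r}) = perp L"
proof
  have "A i \<in> perp L" if "i < r" for i
    unfolding linear_form_vanishing[symmetric] assms[symmetric]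
    using that by (intro ideal.span_base) blast
  then show "vec.span (A ` {..<r}) \<subseteq> perp L"
    by (intro vec.span_minimal subspace_perp) auto
  define lin where "lin f = (\<chi> i. Poly_Mapping.lookup f (Poly_Mapping.single i 1))" for f :: "('n, 'k) mpoly"
  define T where "T = {f :: ('n, 'k) mpoly. Poly_Mapping.lookup f 0 = 0 \<and> lin f \<in> vec.span (A ` {..<r})}"
  have lin_lf: "lin (linear_form a) = a" for a by (simp add: lin_def vec_eq_iff)
  have lf0: "Poly_Mapping.lookup (linear_form a) 0 = 0" for a :: "'k ^ 'n"
    unfolding linear_form_alt lookup_sum lookup_single when_def
    by (intro sum.neutral) (metis lookup_single_eq lookup_zero zero_neq_one)
  have lin_add: "lin (f + g) = lin f + lin g" for f g
    by (simp add: lin_def vec_eq_iff lookup_add)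
  have lin_mult: "lin (f * g) = Poly_Mapping.lookup f 0 *s lin g \<and> Poly_Mapping.lookup (f * g) 0 = 0"
    if g: "Poly_Mapping.lookup g 0 = 0" for f g
  proof (induction f rule: mpoly_induct)
    case (single m c)
    have *: "m' = 0" if eq: "Poly_Mapping.single i (1::nat) = m + m'" and "m \<noteq> 0" for m' i
    proof -
      obtain v where v: "Poly_Mapping.lookup m v \<noteq> 0"
        using \<open>m \<noteq> 0\<close> by (metis lookup_zero poly_mapping_eqI)
      have l: "(if j = i then 1 else 0) = Poly_Mapping.lookup m j + Poly_Mapping.lookup m' j" for j
        using arg_cong[OF eq, of "\<lambda>p. Poly_Mapping.lookup p j"]
        by (auto simp: lookup_single when_def lookup_add split: if_splits)
      have "v = i" using l[of v] v by (auto split: if_splits)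
      then have "Poly_Mapping.lookup m' j = 0" for j using l[of j] v by (cases "j = i") auto
      then show ?thesis by (intro poly_mapping_eqI) simp
    qed
    have "Poly_Mapping.lookup (Poly_Mapping.single m c * g) (Poly_Mapping.single i 1)
        = Poly_Mapping.lookup (Poly_Mapping.single m c) 0 * Poly_Mapping.lookup g (Poly_Mapping.single i 1)" for i
    proof (cases "m = 0")
      case False
      have "c * Poly_Mapping.lookup g (Poly_Mapping.single i 1 - m) = 0"
        if ex: "\<exists>m'. Poly_Mapping.single i (1::nat) = m + m'"
      proof -
        obtain m' where m': "Poly_Mapping.single i (1::nat) = m + m'" using ex by blast
        then show ?thesis using *[OF m' False] g by simp
      qed
      then show ?thesis using False
        unfolding lookup_single_mult by (simp add: lookup_single del: One_nat_def)
    qed (simp add: lookup_single_mult del: One_nat_def)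
    moreover have "Poly_Mapping.lookup (Poly_Mapping.single m c * g) 0 = 0"
    proof -
      have "0 - m = (0 :: 'n mon)" by (rule poly_mapping_eqI) (simp add: lookup_minus)
      then show ?thesis using g by (simp add: lookup_single_mult)
    qed
    ultimately show ?case by (simp add: lin_def vec_eq_iff)
  next
    case zero
    show ?case by (simp add: lin_def vec_eq_iff)
  next
    case (add f h)
    then show ?case by (simp add: lin_add lookup_add distrib_right vec.scale_left_distrib)
  qed
  have "ideal_gen {linear_form (A i) | i. i < r} \<subseteq> T"
  proof (rule ideal_gen_least)
    show "{linear_form (A i) | i. i < r} \<subseteq> T"
      by (auto simp: T_def lin_lf lf0 intro: vec.span_base)
    show "0 \<in> T" by (simp add: T_def lin_def vec.span_zero flip: zero_vec_def)
    show "a + b \<in> T" if "a \<in> T" "b \<in> T" for a b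
      using that by (auto simp: T_def lin_add lookup_add intro: vec.span_add)
    show "a * b \<in> T" if "b \<in> T" for a b
      using that lin_mult[of b a] by (auto simp: T_def intro: vec.span_scale)
  qed
  then show "perp L \<subseteq> vec.span (A ` {..<r})"
    unfolding assms T_def using linear_form_vanishing lin_lf by fastforce
qed

text \<open>Independence of columns may be tested on all forms in the row space, which is \<open>perp L\<close>.\<close>

lemma column_matroid_coord_bases:
  fixes A :: "nat \<Rightarrow> 'k::field ^ 'n::finite"
  assumes L: "vec.subspace L" and r: "r = CARD('n) - vec.dim L"
    and gen: "ideal_gen {linear_form (A i) | i. i < r} = vanishing_ideal L"
  shows "column_matroid r A = {B. coord_basis (perp L) B}"
proof -
  have "(\<forall>i<r. (\<Sum>j\<in>B. c j * A i $ j) = 0) \<longleftrightarrow> (\<forall>f\<in>perp L. (\<Sum>j\<in>B. c j * f $ j) = 0)" for B c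
  proof
    assume *: "\<forall>i<r. (\<Sum>j\<in>B. c j * A i $ j) = 0"
    have "vec.subspace {f. (\<Sum>j\<in>B. c j * f $ j) = 0}"
      unfolding vec.subspace_def
      by (auto simp: algebra_simps sum.distrib sum_distrib_left[symmetric])
    then have "vec.span (A ` {..<r}) \<subseteq> {f. (\<Sum>j\<in>B. c j * f $ j) = 0}"
      using * by (intro vec.span_minimal) auto
    then show "\<forall>f\<in>perp L. (\<Sum>j\<in>B. c j * f $ j) = 0" unfolding linear_forms_span[OF gen] by blast
  next
    assume *: "\<forall>f\<in>perp L. (\<Sum>j\<in>B. c j * f $ j) = 0"
    have "A i \<in> perp L" if "i < r" for i
      unfolding linear_forms_span[OF gen, symmetric] using that by (intro vec.span_base) simp
    then show "\<forall>i<r. (\<Sum>j\<in>B. c j * A i $ j) = 0" using * by blast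
  qed
  then have "column_matroid r A = {B. card B = r \<and> coord_indep (perp L) B}"
    unfolding column_matroid_def coord_indep_iff_columns[OF subspace_perp] by simp
  also have "\<dots> = {B. coord_basis (perp L) B}"
  proof (intro Collect_cong iffI conjI)
    fix B assume "card B = r \<and> coord_indep (perp L) B"
    then show "coord_basis (perp L) B"
      using r dim_perp[OF L] by (intro coord_basis_from_card[OF subspace_perp]) auto
  next
    fix B assume B: "coord_basis (perp L) B"
    then show "card B = r" using coord_basis_card[OF subspace_perp B] dim_perp[OF L] r by simp
    show "coord_indep (perp L) B" using B by (simp add: coord_basis_def)
  qed
  finally show ?thesis .
qed

definition coord_matroid :: "('k::field ^ 'n::finite) set \<Rightarrow> 'n set set"
  where "coord_matroid V = {B. coord_basis V B}"

text \<open>The forms whose supports are the cocircuits of the matroid.\<close>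

definition min_form :: "('k::field ^ 'n) set \<Rightarrow> 'k ^ 'n \<Rightarrow> bool"
  where "min_form V f \<longleftrightarrow> f \<in> V \<and> f \<noteq> 0 \<and> (\<forall>g\<in>V. g \<noteq> 0 \<longrightarrow> supp g \<subseteq> supp f \<longrightarrow> supp g = supp f)"

lemma supp_eq_empty [simp]: "supp f = {} \<longleftrightarrow> f = 0"
  by (auto simp: supp_def vec_eq_iff)

text \<open>If \<open>f\<close> is not minimal, a multiple of a form with smaller support can be subtracted to kill another
  coordinate while keeping the coordinate at \<open>i\<close>, or that form can be used itself.\<close>

lemma min_form_exists:
  fixes V :: "('k::field ^ 'n::finite) set"
  assumes V: "vec.subspace V" and "f \<in> V" "i \<in> supp f"
  shows "\<exists>g. min_form V g \<and> supp g \<subseteq> supp f \<and> i \<in> supp g"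
  using assms(2,3)
proof (induction "card (supp f)" arbitrary: f rule: less_induct)
  case less
  show ?case
  proof (cases "min_form V f")
    case False
    moreover have "f \<noteq> 0" using less.prems by (auto simp: supp_def)
    ultimately obtain h where h: "h \<in> V" "h \<noteq> 0" "supp h \<subset> supp f"
      using less.prems unfolding min_form_def by blast
    have "\<exists>g\<in>V. i \<in> supp g \<and> supp g \<subset> supp f"
    proof (cases "i \<in> supp h")
      case False
      obtain j where j: "j \<in> supp h" using h by (metis all_not_in_conv supp_eq_empty)
      let ?g = "f - (f $ j / h $ j) *s h"
      have "?g \<in> V" using V h less.prems by (intro vec.subspace_diff vec.subspace_scale)
      moreover have "?g $ i = f $ i" using False by (simp add: supp_def)
      moreover have "?g $ j = 0" using j by (simp add: supp_def)
      moreover have "supp ?g \<subseteq> supp f" using h(3) by (auto simp: supp_def)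
      moreover have "j \<in> supp f" using j h(3) by blast
      moreover have "i \<in> supp ?g" using \<open>?g $ i = f $ i\<close> less.prems(2) unfolding supp_def mem_Collect_eq by metis
      moreover have "j \<notin> supp ?g" using \<open>?g $ j = 0\<close> unfolding supp_def by simp
      ultimately show ?thesis by blast
    qed (use h in blast)
    then obtain g where g: "g \<in> V" "i \<in> supp g" "supp g \<subset> supp f" by blast
    then have "card (supp g) < card (supp f)" by (intro psubset_card_mono) auto
    then show ?thesis using less.hyps[of g] g by blast
  qed (use less.prems in blast)
qed

lemma avoiding_basis_iff:
  fixes V :: "('k::field ^ 'n::finite) set"
  assumes V: "vec.subspace V"
  shows "(\<exists>B\<in>coord_matroid V. C \<subseteq> - B) \<longleftrightarrow> (\<forall>f\<in>V. supp f \<subseteq> C \<longrightarrow> f = 0)"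
proof
  assume "\<exists>B\<in>coord_matroid V. C \<subseteq> - B"
  then obtain B where B: "coord_basis V B" "C \<subseteq> - B" by (auto simp: coord_matroid_def)
  show "\<forall>f\<in>V. supp f \<subseteq> C \<longrightarrow> f = 0"
  proof (intro ballI impI)
    fix f assume "f \<in> V" "supp f \<subseteq> C"
    moreover from this have "\<forall>b\<in>B. f $ b = 0" using B(2) by (auto simp: supp_def)
    ultimately show "f = 0" using B(1) unfolding coord_basis_def by blast
  qed
next
  assume *: "\<forall>f\<in>V. supp f \<subseteq> C \<longrightarrow> f = 0"
  obtain ls :: "'n \<Rightarrow> 'n \<Rightarrow> bool" where ls: "strict_linear_order ls"
    using ex_strict_linear_order by blast
  obtain B where "coord_basis V B" "B \<inter> C = {}" using coord_basis_exists[OF ls V, of C] * by blast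
  then show "\<exists>B\<in>coord_matroid V. C \<subseteq> - B" unfolding coord_matroid_def by blast
qed

text \<open>A set is independent in the dual matroid if and only if it contains the support of no nonzero form,
  so the minimal dependent sets are the minimal supports.\<close>

lemma cocircuits_coord_matroid:
  fixes V :: "('k::field ^ 'n::finite) set"
  assumes V: "vec.subspace V"
  shows "cocircuits (coord_matroid V) = supp ` {f. min_form V f}"
proof -
  have ind: "C \<in> indep_sets (dual_matroid (coord_matroid V)) \<longleftrightarrow> (\<forall>f\<in>V. supp f \<subseteq> C \<longrightarrow> f = 0)" for C
    using avoiding_basis_iff[OF V, of C] unfolding indep_sets_def dual_matroid_def by blast
  show ?thesis
  proof
    show "cocircuits (coord_matroid V) \<subseteq> supp ` {f. min_form V f}"
    proof
      fix D assume "D \<in> cocircuits (coord_matroid V)"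
      then have D: "\<not> (\<forall>f\<in>V. supp f \<subseteq> D \<longrightarrow> f = 0)"
        "\<And>C. C \<subset> D \<Longrightarrow> (\<forall>f\<in>V. supp f \<subseteq> C \<longrightarrow> f = 0)"
        unfolding cocircuits_def circuits_def ind by auto
      then obtain f where f: "f \<in> V" "f \<noteq> 0" "supp f \<subseteq> D" by blast
      have "supp g = D" if "g \<in> V" "g \<noteq> 0" "supp g \<subseteq> D" for g
        using D(2)[of "supp g"] that by blast
      then have "supp f = D" "min_form V f" using f unfolding min_form_def by auto
      then show "D \<in> supp ` {f. min_form V f}" by blast
    qed
    show "supp ` {f. min_form V f} \<subseteq> cocircuits (coord_matroid V)"
    proof clarify
      fix f assume f: "min_form V f"
      have "g = 0" if "C \<subset> supp f" "g \<in> V" "supp g \<subseteq> C" for g C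
        using f that unfolding min_form_def by blast
      then show "supp f \<in> cocircuits (coord_matroid V)"
        using f unfolding cocircuits_def circuits_def ind min_form_def by blast
    qed
  qed
qed

text \<open>A form supported on \<open>b\<close> and the complement of \<open>B\<close> is a multiple of the dual vector at \<open>b\<close>, because it
  is determined by its coordinates in \<open>B\<close>.\<close>

lemma fund_cocircuit_coord_matroid:
  fixes V :: "('k::field ^ 'n::finite) set"
  assumes V: "vec.subspace V" and B: "coord_basis V B" and b: "b \<in> B"
  shows "fund_cocircuit (coord_matroid V) B b = supp (dual_vec V B b)"
proof -
  have B': "coord_indep V B" using B by (simp add: coord_basis_def)
  note d = dual_vec[OF B' b]
  have sd: "supp (dual_vec V B b) \<subseteq> insert b (- B)" using d(3) by (auto simp: supp_def)
  have mult: "g = (g $ b) *s dual_vec V B b" if g: "g \<in> V" "supp g \<subseteq> insert b (- B)" for g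
  proof (rule coord_basis_eq[OF V B g(1)])
    show "(g $ b) *s dual_vec V B b \<in> V" using V d(1) by (rule vec.subspace_scale)
    fix c assume "c \<in> B"
    then show "g $ c = ((g $ b) *s dual_vec V B b) $ c"
      using g(2) d by (cases "c = b") (auto simp: supp_def)
  qed
  have eq: "supp g = supp (dual_vec V B b)" if g: "g \<in> V" "supp g \<subseteq> insert b (- B)" "g \<noteq> 0" for g
  proof -
    have "g $ b \<noteq> 0" using mult[OF g(1,2)] g(3) by (metis vector_smult_lzero)
    then show ?thesis by (subst mult[OF g(1,2)]) (simp add: supp_def)
  qed
  have "dual_vec V B b \<noteq> 0" using d(2) by auto
  then have "min_form V (dual_vec V B b)"
    unfolding min_form_def using d(1) eq sd by blast
  then show ?thesis
    unfolding fund_cocircuit_def cocircuits_coord_matroid[OF V]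
  proof (intro the_equality conjI sd)
    fix D assume D: "D \<in> supp ` {f. min_form V f} \<and> D \<subseteq> insert b (- B)"
    then obtain g where g: "min_form V g" "D = supp g" by blast
    then show "D = supp (dual_vec V B b)" using eq[of g] D unfolding min_form_def by blast
  qed blast
qed

lemma int_active_coord_matroid:
  fixes V :: "('k::field ^ 'n::finite) set"
  assumes V: "vec.subspace V" and B: "coord_basis V B"
  shows "int_active ls (coord_matroid V) B = {b\<in>B. active ls V B b}"
    and "int_passive ls (coord_matroid V) B = {b\<in>B. \<not> active ls V B b}"
proof -
  have "is_smallest ls b (fund_cocircuit (coord_matroid V) B b) \<longleftrightarrow> active ls V B b" if "b \<in> B" for b
    unfolding fund_cocircuit_coord_matroid[OF V B that] active_iff[OF V B that]
    by (auto simp: is_smallest_def initial_in_def supp_def)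
  then show "int_active ls (coord_matroid V) B = {b\<in>B. active ls V B b}"
    and "int_passive ls (coord_matroid V) B = {b\<in>B. \<not> active ls V B b}"
    unfolding int_active_def int_passive_def by auto
qed

text \<open>Fundamental circuits of the dual matroid are fundamental cocircuits.\<close>

lemma ext_active_dual:
  "ext_active ls (dual_matroid M) (- B) = int_active ls M B"
  "ext_passive ls (dual_matroid M) (- B) = int_passive ls M B"
  unfolding ext_active_def int_active_def ext_passive_def int_passive_def
    fund_circuit_def fund_cocircuit_def cocircuits_def by auto

text \<open>This is the matroid contraction by \<open>I\<close>: a basis of the forms that vanish on \<open>I\<close> completes \<open>I\<close>.\<close>

lemma coord_basis_extend:
  fixes V :: "('k::field ^ 'n::finite) set"
  assumes V: "vec.subspace V" and I: "coord_indep V I"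
    and B: "coord_basis {f\<in>V. \<forall>i\<in>I. f $ i = 0} B"
  shows "coord_basis V (I \<union> B)"
proof -
  let ?W = "{f\<in>V. \<forall>i\<in>I. f $ i = 0}"
  have W: "vec.subspace ?W" using V by (auto simp: vec.subspace_def)
  have B': "coord_indep ?W B" using B by (simp add: coord_basis_def)
  show "coord_basis V (I \<union> B)"
    unfolding coord_basis_def coord_indep_def
  proof (intro conjI ballI impI)
    fix b assume b: "b \<in> I \<union> B"
    show "\<exists>f\<in>V. f $ b = 1 \<and> (\<forall>c\<in>I \<union> B - {b}. f $ c = 0)"
    proof (cases "b \<in> B")
      case True
      note d = dual_vec[OF B' True]
      then show ?thesis by (intro bexI[of _ "dual_vec ?W B b"]) auto
    next
      case False
      then have bI: "b \<in> I" using b by blast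
      note d = dual_vec[OF I bI]
      \<comment> \<open>the coefficients in \<open>B\<close> are cancelled by a form that vanishes on \<open>I\<close>\<close>
      let ?h = "\<Sum>c\<in>B. dual_vec V I b $ c *s dual_vec ?W B c"
      note h = coord_interpolation[OF W B', where w = "\<lambda>c. dual_vec V I b $ c"]
      define k where "k = dual_vec V I b - ?h"
      have hI: "?h $ c = 0" if "c \<in> I" for c using h(1) that by blast
      have "k \<in> V" unfolding k_def by (rule vec.subspace_diff[OF V d(1)]) (use h(1) in blast)
      moreover have "k $ b = 1"
        unfolding k_def vector_minus_component hI[OF bI] d(2) by simp
      moreover have "k $ c = 0" if "c \<in> I \<union> B - {b}" for c
      proof (cases "c \<in> B")
        case True then show ?thesis unfolding k_def vector_minus_component h(2)[OF True] by simp
      next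
        case False
        then have "c \<in> I" "c \<noteq> b" using that by auto
        then show ?thesis unfolding k_def vector_minus_component using hI d(3) by simp
      qed
      ultimately show ?thesis by blast
    qed
  next
    fix f assume "f \<in> V" "\<forall>b\<in>I \<union> B. f $ b = 0"
    then show "f = 0" using B unfolding coord_basis_def by blast
  qed
qed

lemma indep_sets_coord_matroid:
  fixes V :: "('k::field ^ 'n::finite) set"
  assumes V: "vec.subspace V"
  shows "indep_sets (coord_matroid V) = {I. coord_indep V I}"
proof
  show "indep_sets (coord_matroid V) \<subseteq> {I. coord_indep V I}"
  proof
    fix I assume "I \<in> indep_sets (coord_matroid V)"
    then obtain B where B: "coord_indep V B" "I \<subseteq> B"
      unfolding indep_sets_def coord_matroid_def coord_basis_def by blast
    then show "I \<in> {I. coord_indep V I}" unfolding coord_indep_def by blast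
  qed
  show "{I. coord_indep V I} \<subseteq> indep_sets (coord_matroid V)"
  proof clarify
    fix I assume I: "coord_indep V I"
    have "vec.subspace {f\<in>V. \<forall>i\<in>I. f $ i = 0}" using V by (auto simp: vec.subspace_def)
    then obtain B where "coord_basis {f\<in>V. \<forall>i\<in>I. f $ i = 0} B" by (rule coord_basis_exists')
    then have "coord_basis V (I \<union> B)" by (rule coord_basis_extend[OF V I])
    then show "I \<in> indep_sets (coord_matroid V)"
      unfolding indep_sets_def coord_matroid_def by blast
  qed
qed

lemma matroid_rank_coord_matroid:
  fixes V :: "('k::field ^ 'n::finite) set"
  assumes V: "vec.subspace V"
  shows "matroid_rank (coord_matroid V) = vec.dim V"
  unfolding matroid_rank_def
proof (rule Max_eqI)
  obtain B where B: "coord_basis V B" using coord_basis_exists'[OF V] by blast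
  then show "vec.dim V \<in> card ` indep_sets (coord_matroid V)"
    using coord_basis_card[OF V B] unfolding indep_sets_def coord_matroid_def by auto
  fix k assume "k \<in> card ` indep_sets (coord_matroid V)"
  then obtain I B where "coord_basis V B" "I \<subseteq> B" "k = card I"
    unfolding indep_sets_def coord_matroid_def by blast
  then show "k \<le> vec.dim V" using coord_basis_card[OF V] by (metis card_mono finite)
qed simp

lemma matroid_coord_matroid:
  fixes V :: "('k::field ^ 'n::finite) set"
  assumes V: "vec.subspace V"
  shows "matroid (coord_matroid V)"
  unfolding matroid_def
proof (intro conjI ballI)
  show "coord_matroid V \<noteq> {}" using coord_basis_exists'[OF V] unfolding coord_matroid_def by blast
  fix B1 B2 e assume B: "B1 \<in> coord_matroid V" "B2 \<in> coord_matroid V" and e: "e \<in> B1 - B2"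
  have B1: "coord_basis V B1" "coord_indep V B1" and B2: "coord_basis V B2"
    using B by (auto simp: coord_matroid_def coord_basis_def)
  note d = dual_vec[OF B1(2), of e]
  have "dual_vec V B1 e \<noteq> 0" using d(2) e by auto
  then obtain f where f: "f \<in> B2" "dual_vec V B1 e $ f \<noteq> 0"
    using B2 d(1) e unfolding coord_basis_def by blast
  then have fB: "f \<notin> B1" using d(3)[of f] e by auto
  then show "\<exists>f\<in>B2 - B1. insert f (B1 - {e}) \<in> coord_matroid V"
    using f coord_basis_exchange[OF V B1(1) _ fB f(2)] e unfolding coord_matroid_def by blast
qed

section \<open>Term orders and reduction to standard monomials\<close>

lemma term_orderD:
  assumes "term_order tle"
  shows term_order_total: "tle a b \<or> tle b a" and term_order_antisym: "tle a b \<Longrightarrow> tle b a \<Longrightarrow> a = b"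
    and term_order_trans: "tle a b \<Longrightarrow> tle b c \<Longrightarrow> tle a c" and term_order_zero: "tle 0 a"
    and term_order_add: "tle a b \<Longrightarrow> tle (a + c) (b + c)"
    and term_order_refl: "tle a a"
    and term_order_cancel: "tle (a + c) (b + c) \<Longrightarrow> tle a b"
proof -
  note [unfolded term_order_def] = assms
  show "tle a b \<or> tle b a" "tle a b \<Longrightarrow> tle b a \<Longrightarrow> a = b" "tle a b \<Longrightarrow> tle b c \<Longrightarrow> tle a c"
    "tle 0 a" "tle a b \<Longrightarrow> tle (a + c) (b + c)" "tle a a"
    using assms unfolding term_order_def by metis+
  show "tle (a + c) (b + c) \<Longrightarrow> tle a b"
    using assms unfolding term_order_def by (metis add_right_cancel)
qed

lemma term_order_max:
  assumes "term_order tle" "finite A" "A \<noteq> {}"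
  shows "\<exists>m\<in>A. \<forall>m'\<in>A. tle m' m"
  using assms(2,3)
proof (induction A rule: finite_ne_induct)
  case (singleton x)
  then show ?case using term_order_refl[OF assms(1)] by simp
next
  case (insert x A)
  then obtain m where m: "m \<in> A" "\<forall>m'\<in>A. tle m' m" by blast
  then show ?case
    using term_order_total[OF assms(1), of x m] term_order_trans[OF assms(1)] term_order_refl[OF assms(1)]
    by (metis insert_iff)
qed

lemma lead_mon:
  assumes T: "term_order tle" and "f \<noteq> 0"
  shows "lead_mon tle f \<in> Poly_Mapping.keys f" "\<And>m. m \<in> Poly_Mapping.keys f \<Longrightarrow> tle m (lead_mon tle f)"
proof -
  have "Poly_Mapping.keys f \<noteq> {}" using assms(2) by simp
  then obtain m where m: "m \<in> Poly_Mapping.keys f" "\<forall>m'\<in>Poly_Mapping.keys f. tle m' m"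
    using term_order_max[OF T finite_keys] by blast
  have "lead_mon tle f = m"
    unfolding lead_mon_def using m term_order_antisym[OF T] by (intro the_equality) auto
  then show "lead_mon tle f \<in> Poly_Mapping.keys f" "\<And>m. m \<in> Poly_Mapping.keys f \<Longrightarrow> tle m (lead_mon tle f)"
    using m by auto
qed

lemma lead_mon_eqI:
  assumes T: "term_order tle" and "m \<in> Poly_Mapping.keys f" "\<And>m'. m' \<in> Poly_Mapping.keys f \<Longrightarrow> tle m' m"
  shows "lead_mon tle f = m"
proof -
  have "f \<noteq> 0" using assms(2) by auto
  from lead_mon[OF T this] assms(2,3) show ?thesis using term_order_antisym[OF T] by blast
qed

text \<open>In this form the order compares the terms of a homogenized linear form: a smaller index gives a
  larger term.\<close>

lemma induced_less_iff:
  "induced_less tle i j \<longleftrightarrow> i \<noteq> j \<and> tle (Poly_Mapping.single (xv j) 1 + Poly_Mapping.single (yv i) 1)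
    (Poly_Mapping.single (xv i) 1 + Poly_Mapping.single (yv j) 1)"
proof -
  have "Poly_Mapping.single (xv i) (1::nat) + Poly_Mapping.single (yv j) 1
      = Poly_Mapping.single (xv j) 1 + Poly_Mapping.single (yv i) 1 \<longleftrightarrow> i = j" (is "?a = ?b \<longleftrightarrow> _")
  proof
    assume "?a = ?b"
    then have "Poly_Mapping.lookup ?a (xv i) = Poly_Mapping.lookup ?b (xv i)" by metis
    then show "i = j" by (auto simp: lookup_add lookup_single when_def split: if_splits)
  qed simp
  then show ?thesis unfolding induced_less_def Let_def by blast
qed

lemma strict_linear_order_induced_less:
  assumes T: "term_order tle"
  shows "strict_linear_order (induced_less tle)"
proof -
  let ?x = "\<lambda>i. Poly_Mapping.single (xv i) (1::nat)" and ?y = "\<lambda>i. Poly_Mapping.single (yv i) (1::nat)"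
  have asym: "\<not> induced_less tle j i" if "induced_less tle i j" for i j
    using that term_order_antisym[OF T, of "?x j + ?y i" "?x i + ?y j"] unfolding induced_less_iff
    by (metis (no_types, lifting) induced_less_def induced_less_iff that)
  have trans: "induced_less tle i k" if ij: "induced_less tle i j" and jk: "induced_less tle j k" for i j k
  proof -
    have "i \<noteq> k" using asym ij jk by blast
    have "tle ((?x k + ?y j) + (?x j + ?y i)) ((?x j + ?y k) + (?x j + ?y i))"
      using jk unfolding induced_less_iff by (intro term_order_add[OF T]) blast
    moreover have "tle ((?x j + ?y k) + (?x j + ?y i)) ((?x i + ?y j) + (?x j + ?y k))"
      using ij unfolding induced_less_iff add.commute[of "?x j + ?y k" "?x j + ?y i"]
      by (intro term_order_add[OF T]) blast
    ultimately have "tle ((?x k + ?y j) + (?x j + ?y i)) ((?x i + ?y j) + (?x j + ?y k))"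
      by (rule term_order_trans[OF T])
    then have "tle ((?x k + ?y i) + (?x j + ?y j)) ((?x i + ?y k) + (?x j + ?y j))"
      by (simp only: add_ac)
    then show ?thesis using \<open>i \<noteq> k\<close> term_order_cancel[OF T] unfolding induced_less_iff by blast
  qed
  show ?thesis
    unfolding strict_linear_order_def
    using trans asym term_order_total[OF T] by (metis induced_less_iff)
qed

lemma lin_mon_less:
  assumes T: "term_order tle" and ls: "induced_less tle i j" and D: "i \<in> D" "j \<in> D"
  shows "tle (lin_mon D j) (lin_mon D i)"
proof -
  let ?R = "\<Sum>k\<in>D - {i, j}. Poly_Mapping.single (yv k) (1::nat)"
  have ij: "i \<noteq> j" using ls by (simp add: induced_less_iff)
  have R: "Poly_Mapping.lookup ?R (xv k) = 0" "Poly_Mapping.lookup ?R (yv k) = (if k \<in> D - {i, j} then 1 else 0)" for k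
    by (auto simp: lookup_sum lookup_single when_def)
  have "lin_mon D i = (Poly_Mapping.single (xv i) 1 + Poly_Mapping.single (yv j) 1) + ?R"
    by (rule hvar_mon_eqI; unfold lookup_add R) (use ij D in \<open>auto simp: lookup_single when_def\<close>)
  moreover have "lin_mon D j = (Poly_Mapping.single (xv j) 1 + Poly_Mapping.single (yv i) 1) + ?R"
    by (rule hvar_mon_eqI; unfold lookup_add R) (use ij D in \<open>auto simp: lookup_single when_def\<close>)
  ultimately show ?thesis using ls term_order_add[OF T] unfolding induced_less_iff by metis
qed

lemma initial_in_exists:
  fixes f :: "'k::zero ^ 'n::finite"
  assumes ls: "strict_linear_order ls" and "f \<noteq> 0"
  shows "\<exists>i. initial_in ls f i"
proof -
  have "strict_linear_order (\<lambda>i j. ls j i)" using ls unfolding strict_linear_order_def by metis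
  moreover have "{i. f $ i \<noteq> 0} \<noteq> {}" using assms(2) by (simp add: vec_eq_iff)
  ultimately obtain i where "i \<in> {i. f $ i \<noteq> 0}" "\<And>j. j \<in> {i. f $ i \<noteq> 0} \<Longrightarrow> j \<noteq> i \<Longrightarrow> ls i j"
    using strict_linear_order_max[of "\<lambda>i j. ls j i" "{i. f $ i \<noteq> 0}"] by (metis finite)
  then show ?thesis unfolding initial_in_def by blast
qed

lemma lead_mon_hom_form:
  assumes T: "term_order tle" and i: "initial_in (induced_less tle) a i"
  shows "lead_mon tle (hom_form a) = lin_mon (supp a) i"
proof (rule lead_mon_eqI[OF T])
  have iD: "i \<in> supp a" using i by (simp add: initial_in_def supp_def)
  then show "lin_mon (supp a) i \<in> Poly_Mapping.keys (hom_form a)" by (simp add: keys_hom_form)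
  fix m assume "m \<in> Poly_Mapping.keys (hom_form a)"
  then obtain j where j: "j \<in> supp a" "m = lin_mon (supp a) j" by (auto simp: keys_hom_form)
  show "tle m (lin_mon (supp a) i)"
  proof (cases "j = i")
    case True then show ?thesis using j term_order_refl[OF T] by simp
  next
    case False
    then have "induced_less tle i j" using i j by (auto simp: initial_in_def supp_def)
    then show ?thesis using lin_mon_less[OF T _ iD] j by blast
  qed
qed

text \<open>One form for each cocircuit, which fixes the scalars.\<close>

definition form_reps :: "('k::field ^ 'n) set \<Rightarrow> ('k ^ 'n) set \<Rightarrow> bool"
  where "form_reps V F \<longleftrightarrow> F \<subseteq> {f. min_form V f} \<and> (\<forall>f. min_form V f \<longrightarrow> (\<exists>g\<in>F. supp g = supp f)) \<and> inj_on supp F"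

lemma divisible_not_std:
  fixes f :: "'k::field ^ 'n::finite"
  assumes "f \<in> V" "initial_in ls f i" "mdvd (lin_mon (supp f) i) m"
  shows "\<not> std_mon ls V m"
proof -
  have x: "Poly_Mapping.lookup m (xv i) \<noteq> 0"
    using assms(3) unfolding mdvd_iff by (metis lookup_lin_mon(1) not_one_le_zero)
  have "Poly_Mapping.lookup m (yv j) \<noteq> 0" if "j \<in> supp f" "j \<noteq> i" for j
    using assms(3) that unfolding mdvd_iff by (metis lookup_lin_mon(2) not_one_le_zero)
  then have "supp f \<subseteq> insert i {i. Poly_Mapping.lookup m (yv i) \<noteq> 0}" by auto
  then show ?thesis using assms x unfolding std_mon_def standard_def by blast
qed

text \<open>A form that violates standardness may be replaced by a minimal one with the same smallest element.\<close>

lemma not_std_divisible: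
  fixes V :: "('k::field ^ 'n::finite) set"
  assumes V: "vec.subspace V" and F: "form_reps V F" and m: "\<not> std_mon ls V m"
  shows "\<exists>g\<in>F. \<exists>i. initial_in ls g i \<and> mdvd (lin_mon (supp g) i) m"
proof -
  obtain f i where f: "f \<in> V" "Poly_Mapping.lookup m (xv i) \<noteq> 0" "initial_in ls f i"
    "supp f \<subseteq> insert i {i. Poly_Mapping.lookup m (yv i) \<noteq> 0}"
    using m unfolding std_mon_def standard_def by blast
  have "i \<in> supp f" using f(3) by (simp add: initial_in_def supp_def)
  then obtain g0 where g0: "min_form V g0" "supp g0 \<subseteq> supp f" "i \<in> supp g0"
    using min_form_exists[OF V f(1)] by blast
  then obtain g where g: "g \<in> F" "supp g = supp g0" using F unfolding form_reps_def by blast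
  have gi: "g $ j \<noteq> 0 \<longleftrightarrow> j \<in> supp g0" for j using g(2) by (auto simp: supp_def)
  have "initial_in ls g i"
    using g0(2,3) f(3) unfolding initial_in_def gi by (auto simp: supp_def)
  moreover have "mdvd (lin_mon (supp g) i) m"
    unfolding mdvd_iff
  proof
    fix v show "Poly_Mapping.lookup (lin_mon (supp g) i) v \<le> Poly_Mapping.lookup m v"
    proof (cases v)
      case (xv j) then show ?thesis using f(2) by (auto simp: Suc_le_eq)
    next
      case (yv j) then show ?thesis using f(4) g(2) g0(2) by (auto simp: Suc_le_eq)
    qed
  qed
  ultimately show ?thesis using g(1) by blast
qed

definition mon_box :: "nat \<Rightarrow> 'v::finite mon set"
  where "mon_box N = {m. \<forall>v. Poly_Mapping.lookup m v \<le> N}"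

lemma card_mon_box: "finite (mon_box N :: 'v::finite mon set)" "card (mon_box N :: 'v mon set) \<le> (N + 1) ^ CARD('v)"
proof -
  have inj: "inj_on Poly_Mapping.lookup (mon_box N :: 'v mon set)"
    by (rule inj_onI) (metis poly_mapping_eqI)
  have sub: "Poly_Mapping.lookup ` (mon_box N :: 'v mon set) \<subseteq> PiE UNIV (\<lambda>_. {..N})"
    by (auto simp: mon_box_def)
  have fin: "finite (PiE (UNIV :: 'v set) (\<lambda>_. {..N}))" by (intro finite_PiE) auto
  from finite_imageD[OF finite_subset[OF sub fin] inj] show "finite (mon_box N :: 'v mon set)" .
  have "card (mon_box N :: 'v mon set) = card (Poly_Mapping.lookup ` (mon_box N :: 'v mon set))"
    by (rule card_image[OF inj, symmetric])
  also have "\<dots> \<le> card (PiE (UNIV :: 'v set) (\<lambda>_. {..N}))" by (rule card_mono[OF fin sub])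
  also have "\<dots> = (N + 1) ^ CARD('v)" by (simp add: card_PiE)
  finally show "card (mon_box N :: 'v mon set) \<le> (N + 1) ^ CARD('v)" .
qed

lemma xpart_add: "xpart (a + b) = xpart a + xpart b" and ypart_add: "ypart (a + b) = ypart a + ypart b"
  by (auto intro!: poly_mapping_eqI simp: lookup_add)

text \<open>Reduction preserves the multidegree \<open>xpart m + ypart m\<close>, so it runs through finitely many monomials
  and terminates for every term order.\<close>

lemma finite_multidegree: "finite {m :: 'n::finite hvar mon. xpart m + ypart m = g}"
proof (rule finite_subset)
  show "finite (mon_box (\<Sum>i\<in>UNIV. Poly_Mapping.lookup g i) :: 'n hvar mon set)" by (rule card_mon_box)
  show "{m :: 'n hvar mon. xpart m + ypart m = g} \<subseteq> mon_box (\<Sum>i\<in>UNIV. Poly_Mapping.lookup g i)"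
    unfolding mon_box_def
  proof clarify
    fix m :: "'n hvar mon" and v :: "'n hvar" assume g: "g = xpart m + ypart m"
    have le: "Poly_Mapping.lookup g i \<le> (\<Sum>i\<in>UNIV. Poly_Mapping.lookup g i)" for i
      by (rule member_le_sum) auto
    obtain i where i: "v = xv i \<or> v = yv i" by (cases v) auto
    then have "Poly_Mapping.lookup m v \<le> Poly_Mapping.lookup g i" by (auto simp: g lookup_add)
    also note le[of i]
    finally show "Poly_Mapping.lookup m v \<le> (\<Sum>i\<in>UNIV. Poly_Mapping.lookup (xpart m + ypart m) i)"
      by (simp add: g)
  qed
qed

lemma lin_mon_degree:
  assumes "i \<in> D" "j \<in> D"
  shows "xpart (lin_mon D i) + ypart (lin_mon D i) = xpart (lin_mon D j) + ypart (lin_mon D j)"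
  by (rule poly_mapping_eqI) (use assms in \<open>auto simp: lookup_add\<close>)

text \<open>A nonstandard monomial is a multiple of the leading monomial of the homogenization of some \<open>a \<in> F\<close>;
  subtracting the corresponding multiple replaces it by smaller monomials of the same multidegree.\<close>

lemma reduce_monomial:
  fixes V :: "('k::field ^ 'n::finite) set"
  assumes V: "vec.subspace V" and F: "form_reps V F" and T: "term_order tle"
  shows "\<exists>g. monom_of m - g \<in> ideal_gen (hom_form ` F) \<and>
    (\<forall>m'\<in>Poly_Mapping.keys g. std_mon (induced_less tle) V m' \<and> tle m' m)"
proof (induction "card {m'. xpart m' + ypart m' = xpart m + ypart m \<and> tle m' m}" arbitrary: m rule: less_induct)
  case less
  let ?I = "ideal_gen (hom_form ` F)"
  show ?case
  proof (cases "std_mon (induced_less tle) V m")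
    case True
    then show ?thesis
      using term_order_refl[OF T] by (intro exI[of _ "monom_of m"]) (simp add: ideal.span_zero)
  next
    case False
    then obtain a i p where a: "a \<in> F" "initial_in (induced_less tle) a i" "m = lin_mon (supp a) i + p"
      using not_std_divisible[OF V F] unfolding mdvd_def by blast
    let ?D = "supp a"
    have iD: "i \<in> ?D" and ai: "a $ i \<noteq> 0" using a(2) by (auto simp: initial_in_def supp_def)
    let ?m = "\<lambda>j. lin_mon ?D j + p"
    have deg: "xpart (?m j) + ypart (?m j) = xpart m + ypart m" if "j \<in> ?D" for j
      using lin_mon_degree[OF that iD] unfolding a(3) xpart_add ypart_add
      by (metis (no_types, lifting) add.assoc add.left_commute)
    have le: "tle (?m j) m \<and> ?m j \<noteq> m" if "j \<in> ?D - {i}" for j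
    proof -
      have "induced_less tle i j" using a(2) that by (auto simp: initial_in_def supp_def)
      then have "tle (?m j) m"
        using lin_mon_less[OF T _ iD] that unfolding a(3) by (intro term_order_add[OF T]) auto
      moreover have "?m j \<noteq> m" using that lin_mon_inj[of ?D j ?D i] unfolding a(3) by auto
      ultimately show ?thesis by blast
    qed
    have "\<exists>g. monom_of (?m j) - g \<in> ?I \<and>
      (\<forall>m'\<in>Poly_Mapping.keys g. std_mon (induced_less tle) V m' \<and> tle m' (?m j))" if j: "j \<in> ?D - {i}" for j
    proof (rule less.hyps, rule psubset_card_mono)
      show "finite {m'. xpart m' + ypart m' = xpart m + ypart m \<and> tle m' m}"
        by (rule finite_subset[OF _ finite_multidegree[of "xpart m + ypart m"]]) auto
      have "m \<notin> {m'. xpart m' + ypart m' = xpart (?m j) + ypart (?m j) \<and> tle m' (?m j)}"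
        using le[OF j] term_order_antisym[OF T] by auto
      then show "{m'. xpart m' + ypart m' = xpart (?m j) + ypart (?m j) \<and> tle m' (?m j)}
          \<subset> {m'. xpart m' + ypart m' = xpart m + ypart m \<and> tle m' m}"
        using deg[of j] j le[OF j] term_order_trans[OF T] term_order_refl[OF T] by auto
    qed
    then obtain G where G: "\<And>j. j \<in> ?D - {i} \<Longrightarrow> monom_of (?m j) - G j \<in> ?I"
      "\<And>j m'. j \<in> ?D - {i} \<Longrightarrow> m' \<in> Poly_Mapping.keys (G j) \<Longrightarrow> std_mon (induced_less tle) V m' \<and> tle m' (?m j)"
      by metis
    define c where "c j = - (a $ j / a $ i)" for j
    define g where "g = (\<Sum>j\<in>?D - {i}. Const (c j) * G j)"
    have "Const (inverse (a $ i)) * monom_of p * hom_form a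
        = (\<Sum>j\<in>?D. Const (inverse (a $ i) * a $ j) * monom_of (?m j))"
      unfolding hom_form_def sum_distrib_left
      by (intro sum.cong refl) (simp add: Const_def monom_of_def mult_single add_ac)
    also have "\<dots> = monom_of m + (\<Sum>j\<in>?D - {i}. Const (inverse (a $ i) * a $ j) * monom_of (?m j))"
      using iD ai a(3) by (subst sum.remove[of _ i]) (auto simp: Const_1)
    also have "(\<Sum>j\<in>?D - {i}. Const (inverse (a $ i) * a $ j) * monom_of (?m j))
        = - (\<Sum>j\<in>?D - {i}. Const (c j) * monom_of (?m j))"
      unfolding sum_negf[symmetric] c_def
      by (intro sum.cong refl) (simp add: Const_minus divide_inverse mult.commute)
    finally have "Const (inverse (a $ i)) * monom_of p * hom_form a
        = monom_of m - (\<Sum>j\<in>?D - {i}. Const (c j) * monom_of (?m j))" by simp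
    moreover have "Const (inverse (a $ i)) * monom_of p * hom_form a \<in> ?I"
      using a(1) by (intro ideal_gen_mult_left ideal.span_base imageI)
    ultimately have e: "monom_of m - (\<Sum>j\<in>?D - {i}. Const (c j) * monom_of (?m j)) \<in> ?I"
      by (simp only:)
    have "(\<Sum>j\<in>?D - {i}. Const (c j) * (monom_of (?m j) - G j)) \<in> ?I"
      using G(1) by (intro ideal.span_sum ideal_gen_mult_left) auto
    from ideal.span_add[OF e this] have "monom_of m - g \<in> ?I"
      by (simp add: g_def right_diff_distrib sum_subtractf)
    moreover have "std_mon (induced_less tle) V m' \<and> tle m' m" if m': "m' \<in> Poly_Mapping.keys g" for m'
    proof -
      obtain j where j: "j \<in> ?D - {i}" "m' \<in> Poly_Mapping.keys (Const (c j) * G j)"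
        using m' keys_sum[of "\<lambda>j. Const (c j) * G j" "?D - {i}"] unfolding g_def by blast
      then have "m' \<in> Poly_Mapping.keys (G j)" by (auto simp: in_keys_iff)
      then show ?thesis using G(2)[OF j(1)] le[OF j(1)] term_order_trans[OF T] by blast
    qed
    ultimately show ?thesis by blast
  qed
qed

lemma reduce_polynomial:
  fixes V :: "('k::field ^ 'n::finite) set"
  assumes V: "vec.subspace V" and F: "form_reps V F" and T: "term_order tle"
  shows "\<exists>g. f - g \<in> ideal_gen (hom_form ` F) \<and>
    (\<forall>m'\<in>Poly_Mapping.keys g. std_mon (induced_less tle) V m' \<and> (\<exists>m\<in>Poly_Mapping.keys f. tle m' m))"
proof -
  obtain G where G: "\<And>m. monom_of m - G m \<in> ideal_gen (hom_form ` F)"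
    "\<And>m m'. m' \<in> Poly_Mapping.keys (G m) \<Longrightarrow> std_mon (induced_less tle) V m' \<and> tle m' m"
    using reduce_monomial[OF V F T] by metis
  let ?c = "Poly_Mapping.lookup f"
  define g where "g = (\<Sum>m\<in>Poly_Mapping.keys f. Const (?c m) * G m)"
  have "f - g = (\<Sum>m\<in>Poly_Mapping.keys f. Const (?c m) * (monom_of m - G m))"
    unfolding g_def right_diff_distrib sum_subtractf by (simp flip: mpoly_expand_monom)
  then have "f - g \<in> ideal_gen (hom_form ` F)"
    using G(1) by (auto intro: ideal.span_sum ideal_gen_mult_left)
  moreover have "std_mon (induced_less tle) V m' \<and> (\<exists>m\<in>Poly_Mapping.keys f. tle m' m)"
    if m': "m' \<in> Poly_Mapping.keys g" for m'
  proof -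
    obtain m where m: "m \<in> Poly_Mapping.keys f" "m' \<in> Poly_Mapping.keys (Const (?c m) * G m)"
      using m' keys_sum[of "\<lambda>m. Const (?c m) * G m" "Poly_Mapping.keys f"] unfolding g_def by blast
    then have "m' \<in> Poly_Mapping.keys (G m)" by (auto simp: in_keys_iff)
    then show ?thesis using G(2) m by blast
  qed
  ultimately show ?thesis by blast
qed

section \<open>Generators and initial ideals of the closure\<close>

lemma torus_ideal_subspace: "is_ideal (torus_ideal L)"
  by (intro ideal.subspaceI) (auto simp: torus_ideal_def id_hom.eval_add id_hom.eval_mult)

text \<open>At the point \<open>(v\<^sub>i y\<^sub>i, y\<^sub>i)\<close> the homogenization takes the value of \<open>f\<close> at \<open>v\<close>, multiplied by a monomial in
  \<open>y\<close>.\<close>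

lemma homogenize_torus:
  assumes f: "f \<in> vanishing_ideal L"
  shows "homogenize f \<in> torus_ideal L"
  unfolding torus_ideal_def
proof clarify
  fix v y assume v: "v \<in> L"
  let ?d = "\<lambda>i. var_degree i f"
  have le: "Poly_Mapping.lookup m i \<le> ?d i" if "m \<in> Poly_Mapping.keys f" for m i
    unfolding var_degree_def using that by (intro Max_ge) auto
  have "mpoly_eval id (torus_point v y) (homogenize f)
    = (\<Sum>m\<in>Poly_Mapping.keys f. Poly_Mapping.lookup f m *
        (\<Prod>i\<in>UNIV. (v $ i * y i) ^ Poly_Mapping.lookup m i * y i ^ (?d i - Poly_Mapping.lookup m i)))"
    by (simp add: homogenize_def id_hom.eval_sum id_hom.eval_mult id_hom.eval_prod id_hom.eval_power)
  also have "\<dots> = (\<Sum>m\<in>Poly_Mapping.keys f. (\<Prod>i\<in>UNIV. y i ^ ?d i) * (Poly_Mapping.lookup f m * mev (($) v) m))"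
  proof (intro sum.cong refl)
    fix m assume m: "m \<in> Poly_Mapping.keys f"
    have "(v $ i * y i) ^ Poly_Mapping.lookup m i * y i ^ (?d i - Poly_Mapping.lookup m i)
        = y i ^ ?d i * v $ i ^ Poly_Mapping.lookup m i" for i
      using le[OF m, of i] by (simp add: power_mult_distrib mult.assoc mult.commute flip: power_add)
    then show "Poly_Mapping.lookup f m *
        (\<Prod>i\<in>UNIV. (v $ i * y i) ^ Poly_Mapping.lookup m i * y i ^ (?d i - Poly_Mapping.lookup m i))
      = (\<Prod>i\<in>UNIV. y i ^ ?d i) * (Poly_Mapping.lookup f m * mev (($) v) m)"
      by (simp add: prod.distrib mev_finite)
  qed
  also have "\<dots> = (\<Prod>i\<in>UNIV. y i ^ ?d i) * mpoly_eval id (($) v) f"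
    by (simp add: sum_distrib_left id_hom.eval_superset[of "Poly_Mapping.keys f"])
  also have "\<dots> = 0" using f v by (simp add: vanishing_ideal_def)
  finally show "mpoly_eval id (torus_point v y) (homogenize f) = 0" .
qed

text \<open>The forms generate a subideal of the ideal of the closure, which lies in \<open>torus_ideal L\<close>. An element of
  the latter reduces modulo the forms to a combination of standard monomials, which is zero by
  independence.\<close>

lemma closure_generators:
  fixes L :: "('k::field ^ 'n::finite) set"
  assumes inf: "infinite (UNIV :: 'k set)" and L: "vec.subspace L" and F: "form_reps (perp L) F"
    and T: "term_order (tle :: 'n hvar mon \<Rightarrow> _)"
  shows "closure_ideal L = torus_ideal L" "torus_ideal L = ideal_gen (hom_form ` F)"
proof -
  have 1: "closure_ideal L \<subseteq> torus_ideal L"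
    unfolding closure_ideal_def using homogenize_torus
    by (intro ideal.span_minimal torus_ideal_subspace) auto
  have "hom_form a \<in> homogenize ` vanishing_ideal L" if "a \<in> F" for a
  proof -
    have "a \<in> perp L" using F that unfolding form_reps_def min_form_def by auto
    then show ?thesis
      by (intro image_eqI[where x = "linear_form a"]) (simp_all add: homogenize_linear_form linear_form_vanishing)
  qed
  then have 2: "ideal_gen (hom_form ` F) \<subseteq> closure_ideal L"
    unfolding closure_ideal_def by (intro ideal.span_mono) auto
  have 3: "torus_ideal L \<subseteq> ideal_gen (hom_form ` F)"
  proof
    fix f assume f: "f \<in> torus_ideal L"
    obtain g where g: "f - g \<in> ideal_gen (hom_form ` F)"
      "\<forall>m\<in>Poly_Mapping.keys g. std_mon (induced_less tle) (perp L) m"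
      using reduce_polynomial[OF subspace_perp F T] by blast
    then have "f - g \<in> torus_ideal L" using 1 2 by blast
    then have "f - (f - g) \<in> torus_ideal L" by (rule ideal.subspace_diff[OF torus_ideal_subspace f])
    then have "g \<in> torus_ideal L" by simp
    then have "g = 0"
      using g(2) by (intro standard_monomials_independent[OF inf strict_linear_order_induced_less[OF T] L]) auto
    then show "f \<in> ideal_gen (hom_form ` F)" using g(1) by simp
  qed
  show "closure_ideal L = torus_ideal L" "torus_ideal L = ideal_gen (hom_form ` F)" using 1 2 3 by blast+
qed

text \<open>If it were standard, then reducing the other monomials of \<open>f\<close>, which introduces only monomials below
  the leading one, would give a nontrivial relation between standard monomials.\<close>

lemma lead_mon_not_std:
  fixes L :: "('k::field ^ 'n::finite) set"
  assumes inf: "infinite (UNIV :: 'k set)" and L: "vec.subspace L" and F: "form_reps (perp L) F"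
    and T: "term_order tle" and f: "f \<in> torus_ideal L" "f \<noteq> 0"
  shows "\<not> std_mon (induced_less tle) (perp L) (lead_mon tle f)"
proof
  let ?m = "lead_mon tle f" and ?c = "Const (Poly_Mapping.lookup f (lead_mon tle f))"
  assume std: "std_mon (induced_less tle) (perp L) ?m"
  define tail where "tail = f - ?c * monom_of ?m"
  have keys_tail: "tle m ?m \<and> m \<noteq> ?m" if "m \<in> Poly_Mapping.keys tail" for m
  proof -
    have "Poly_Mapping.lookup tail m = (if m = ?m then 0 else Poly_Mapping.lookup f m)"
      by (simp add: tail_def lookup_minus monom_of_def lookup_single when_def)
    then show ?thesis using that lead_mon(2)[OF T f(2), of m] by (auto simp: in_keys_iff split: if_splits)
  qed
  obtain g where g: "tail - g \<in> ideal_gen (hom_form ` F)"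
    "\<forall>m'\<in>Poly_Mapping.keys g. std_mon (induced_less tle) (perp L) m' \<and> (\<exists>m\<in>Poly_Mapping.keys tail. tle m' m)"
    using reduce_polynomial[OF subspace_perp F T] by blast
  have "?m \<notin> Poly_Mapping.keys g"
    using g(2) keys_tail term_order_antisym[OF T] by blast
  then have l: "Poly_Mapping.lookup (?c * monom_of ?m + g) ?m = Poly_Mapping.lookup f ?m"
    by (simp add: lookup_add in_keys_iff monom_of_def)
  have "tail - g \<in> torus_ideal L" using g(1) closure_generators(2)[OF inf L F T] by blast
  then have "f - (tail - g) \<in> torus_ideal L" by (rule ideal.subspace_diff[OF torus_ideal_subspace f(1)])
  then have "?c * monom_of ?m + g \<in> torus_ideal L" by (simp add: tail_def)
  then have "?c * monom_of ?m + g = 0"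
  proof (rule standard_monomials_independent[OF inf strict_linear_order_induced_less[OF T] L])
    fix m assume "m \<in> Poly_Mapping.keys (?c * monom_of ?m + g)"
    then have "m \<in> Poly_Mapping.keys (?c * monom_of ?m) \<or> m \<in> Poly_Mapping.keys g"
      using keys_add[of "?c * monom_of ?m" g] by blast
    then show "std_mon (induced_less tle) (perp L) m"
      using g(2) std by (auto simp: in_keys_iff monom_of_def lookup_single when_def split: if_splits)
  qed
  then show False using l lead_mon(1)[OF T f(2)] by (auto simp: in_keys_iff)
qed

text \<open>The common initial ideal of the closure for all term orders that induce the order \<open>ls\<close>.\<close>

definition nonstd_ideal :: "('n::finite \<Rightarrow> 'n \<Rightarrow> bool) \<Rightarrow> ('k::field ^ 'n) set \<Rightarrow> ('n hvar, 'k) mpoly set"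
  where "nonstd_ideal ls V = ideal_gen (monom_of ` {m. \<not> std_mon ls V m})"

lemma ideal_gen_setI:
  assumes "S \<subseteq> ideal_gen S'" "S' \<subseteq> ideal_gen S"
  shows "ideal_gen S = ideal_gen (S' :: 'a::comm_ring_1 set)"
  using assms by (simp add: ideal.span_eq)

lemma mdvd_in_ideal:
  assumes "m \<in> T" "mdvd m k"
  shows "monom_of k \<in> ideal_gen (monom_of ` T :: ('v, 'a::comm_ring_1) mpoly set)"
  using assms by (auto simp: monomial_ideal_membership)

lemma mem_nonstd_ideal:
  fixes V :: "('k::field ^ 'n::finite) set"
  assumes V: "vec.subspace V" and F: "form_reps V F"
  shows "f \<in> nonstd_ideal ls V \<longleftrightarrow> (\<forall>m\<in>Poly_Mapping.keys f. \<not> std_mon ls V m)"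
proof -
  have "\<not> std_mon ls V k" if m: "\<not> std_mon ls V m" "mdvd m k" for m k
  proof -
    obtain g i where g: "g \<in> F" "initial_in ls g i" "mdvd (lin_mon (supp g) i) m"
      using not_std_divisible[OF V F m(1)] by blast
    have "g \<in> V" using g(1) F unfolding form_reps_def min_form_def by auto
    then show ?thesis using divisible_not_std[OF _ g(2) mdvd_trans[OF g(3) m(2)]] by blast
  qed
  then show ?thesis unfolding nonstd_ideal_def monomial_ideal_membership using mdvd_refl by blast
qed

lemma lead_ideal_forms:
  fixes V :: "('k::field ^ 'n::finite) set"
  assumes V: "vec.subspace V" and F: "form_reps V F" and T: "term_order tle"
  shows "lead_ideal tle (hom_form ` F)
      = ideal_gen (monom_of ` {lin_mon (supp g) i | g i. g \<in> F \<and> initial_in (induced_less tle) g i})"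
    and "lead_ideal tle (hom_form ` F) = nonstd_ideal (induced_less tle) V"
proof -
  note ls = strict_linear_order_induced_less[OF T]
  have nz: "g \<noteq> 0 \<and> hom_form g \<noteq> 0" if "g \<in> F" for g
  proof -
    have "g \<noteq> 0" using that F unfolding form_reps_def min_form_def by auto
    moreover have "hom_form g \<noteq> 0"
    proof
      assume "hom_form g = 0"
      then show False using \<open>g \<noteq> 0\<close> keys_hom_form[of g] by simp
    qed
    ultimately show ?thesis by blast
  qed
  have eq: "{monom_of (lead_mon tle f) |f. f \<in> hom_form ` F \<and> f \<noteq> 0}
    = (monom_of ` {lin_mon (supp g) i | g i. g \<in> F \<and> initial_in (induced_less tle) g i} :: ('n hvar, 'k) mpoly set)"
    (is "?A = ?B")
  proof
    show "?A \<subseteq> ?B"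
    proof clarify
      fix g assume g: "g \<in> F"
      obtain i where i: "initial_in (induced_less tle) g i"
        using initial_in_exists[OF ls] nz[OF g] by blast
      then show "monom_of (lead_mon tle (hom_form g)) \<in> ?B"
        using lead_mon_hom_form[OF T i] g by auto
    qed
    show "?B \<subseteq> ?A"
    proof
      fix p assume "p \<in> ?B"
      then obtain g i where g: "g \<in> F" "initial_in (induced_less tle) g i" "p = monom_of (lin_mon (supp g) i)"
        by blast
      then have "p = monom_of (lead_mon tle (hom_form g))"
        using lead_mon_hom_form[OF T g(2)] by simp
      then show "p \<in> ?A" using g(1) nz by blast
    qed
  qed
  show 1: "lead_ideal tle (hom_form ` F)
      = ideal_gen (monom_of ` {lin_mon (supp g) i | g i. g \<in> F \<and> initial_in (induced_less tle) g i})"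
    unfolding lead_ideal_def eq ..
  show "lead_ideal tle (hom_form ` F) = nonstd_ideal (induced_less tle) V"
    unfolding 1 nonstd_ideal_def
  proof (rule ideal_gen_setI)
    show "monom_of ` {lin_mon (supp g) i | g i. g \<in> F \<and> initial_in (induced_less tle) g i}
      \<subseteq> (ideal_gen (monom_of ` {m. \<not> std_mon (induced_less tle) V m}) :: ('n hvar, 'k) mpoly set)"
    proof clarify
      fix g i assume g: "g \<in> F" "initial_in (induced_less tle) g i"
      then have "g \<in> V" using F unfolding form_reps_def min_form_def by auto
      then have "\<not> std_mon (induced_less tle) V (lin_mon (supp g) i)"
        using divisible_not_std[OF _ g(2) mdvd_refl] by blast
      then show "monom_of (lin_mon (supp g) i)
          \<in> (ideal_gen (monom_of ` {m. \<not> std_mon (induced_less tle) V m}) :: ('n hvar, 'k) mpoly set)"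
        by (intro ideal.span_base) blast
    qed
    show "monom_of ` {m. \<not> std_mon (induced_less tle) V m}
      \<subseteq> (ideal_gen (monom_of ` {lin_mon (supp g) i | g i. g \<in> F \<and> initial_in (induced_less tle) g i}) :: ('n hvar, 'k) mpoly set)"
      using not_std_divisible[OF V F] by (blast intro: mdvd_in_ideal)
  qed
qed

lemma initial_ideal_closure:
  fixes L :: "('k::field ^ 'n::finite) set"
  assumes inf: "infinite (UNIV :: 'k set)" and L: "vec.subspace L" and F: "form_reps (perp L) F"
    and T: "term_order tle"
  shows "initial_ideal tle (closure_ideal L) = nonstd_ideal (induced_less tle) (perp L)"
proof -
  note c = closure_generators[OF inf L F T]
  have "initial_ideal tle (torus_ideal L) \<subseteq> nonstd_ideal (induced_less tle) (perp L)"
    unfolding lead_ideal_def nonstd_ideal_def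
    using lead_mon_not_std[OF inf L F T] by (intro ideal.span_mono) blast
  moreover have "lead_ideal tle (hom_form ` F) \<subseteq> initial_ideal tle (torus_ideal L)"
    unfolding lead_ideal_def c(2) using ideal.span_superset[of "hom_form ` F"] by (intro ideal.span_mono) blast
  ultimately show ?thesis unfolding c(1) using lead_ideal_forms(2)[OF subspace_perp F T] by simp
qed

text \<open>Divisibility of one monomial of homogenized forms by another makes the supports comparable, which for
  cocircuits means that they are equal.\<close>

lemma lin_mon_dvd:
  assumes "mdvd (lin_mon D' j) (lin_mon D i)" "j \<in> D'" "i \<in> D"
  shows "D' \<subseteq> D"
proof
  have "Poly_Mapping.lookup (lin_mon D' j) (xv j) \<le> Poly_Mapping.lookup (lin_mon D i) (xv j)"
    using assms(1) unfolding mdvd_iff by blast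
  then have 1: "j = i" by (simp split: if_splits)
  fix k assume k: "k \<in> D'"
  have "Poly_Mapping.lookup (lin_mon D' j) (yv k) \<le> Poly_Mapping.lookup (lin_mon D i) (yv k)"
    using assms(1) unfolding mdvd_iff by blast
  then have le: "(if k \<in> D' \<and> k \<noteq> j then 1 else 0) \<le> (if k \<in> D \<and> k \<noteq> i then 1 else (0::nat))"
    by (simp only: lookup_lin_mon)
  show "k \<in> D"
  proof (cases "k = i")
    case True then show ?thesis using assms(3) by simp
  next
    case False
    then show ?thesis using le k 1 by (cases "k \<in> D") auto
  qed
qed

lemma form_reps_antichain:
  assumes "form_reps V F" "g \<in> F" "h \<in> F" "supp g \<subseteq> supp h"
  shows "g = h"
proof -
  have "min_form V g" "min_form V h" using assms unfolding form_reps_def by auto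
  then have "supp g = supp h" using assms(4) unfolding min_form_def by blast
  then show ?thesis using assms unfolding form_reps_def inj_on_def by blast
qed

text \<open>No form is generated by the others: by \<open>lin_mon_dvd\<close> none of its monomials is divisible by a monomial
  of another form.\<close>

lemma closure_minimal_generators:
  fixes L :: "('k::field ^ 'n::finite) set"
  assumes inf: "infinite (UNIV :: 'k set)" and L: "vec.subspace L" and F: "form_reps (perp L) F"
    and T: "term_order (tle :: 'n hvar mon \<Rightarrow> _)"
  shows "minimally_generates (hom_form ` F) (closure_ideal L)"
  unfolding minimally_generates_def
proof (intro conjI allI impI notI)
  show gen: "ideal_gen (hom_form ` F) = closure_ideal L" using closure_generators[OF inf L F T] by simp
  fix G' assume G': "G' \<subset> hom_form ` F" "ideal_gen G' = closure_ideal L"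
  then obtain h where h: "h \<in> F" "hom_form h \<notin> G'" by blast
  \<comment> \<open>compare with the monomial ideal generated by all terms of the other forms\<close>
  define S where "S = (\<Union>g\<in>F - {h}. Poly_Mapping.keys (hom_form g))"
  have "G' \<subseteq> ideal_gen (monom_of ` S)"
  proof
    fix f assume "f \<in> G'"
    then obtain g where "g \<in> F - {h}" "f = hom_form g" using G' h by blast
    then show "f \<in> ideal_gen (monom_of ` S)"
      unfolding monomial_ideal_membership S_def using mdvd_refl by blast
  qed
  then have "ideal_gen G' \<subseteq> ideal_gen (monom_of ` S)" by (intro ideal.span_minimal) auto
  moreover have "hom_form h \<in> ideal_gen G'"
    using G'(2) gen h by (metis ideal.span_base imageI)
  ultimately have *: "\<forall>k\<in>Poly_Mapping.keys (hom_form h). \<exists>m\<in>S. mdvd m k"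
    using monomial_ideal_membership by blast
  have "h \<noteq> 0" using h F unfolding form_reps_def min_form_def by auto
  then obtain i where i: "i \<in> supp h" by (metis all_not_in_conv supp_eq_empty)
  then obtain m where "m \<in> S" "mdvd m (lin_mon (supp h) i)" using * keys_hom_form by blast
  then obtain g j where g: "g \<in> F" "g \<noteq> h" "j \<in> supp g" "mdvd (lin_mon (supp g) j) (lin_mon (supp h) i)"
    unfolding S_def keys_hom_form by blast
  then show False using lin_mon_dvd[OF g(4,3) i] form_reps_antichain[OF F g(1) h(1)] by blast
qed

lemma closure_reduced_groebner:
  fixes L :: "('k::field ^ 'n::finite) set"
  assumes inf: "infinite (UNIV :: 'k set)" and L: "vec.subspace L" and F: "form_reps (perp L) F"
    and T: "term_order tle"
  shows "reduced_groebner_basis tle (hom_form ` F) (closure_ideal L)"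
proof -
  note ls = strict_linear_order_induced_less[OF T]
  have "inj_on supp F" using F by (simp add: form_reps_def)
  then have "finite F" by (rule inj_on_finite[of _ _ UNIV]) auto
  then have gb: "groebner_basis tle (hom_form ` F) (closure_ideal L)"
    unfolding groebner_basis_def
    using closure_generators[OF inf L F T] initial_ideal_closure[OF inf L F T] lead_ideal_forms(2)[OF subspace_perp F T]
      ideal.span_superset[of "hom_form ` F"] by auto
  have nz: "g \<noteq> 0" if "g \<in> F" for g using that F unfolding form_reps_def min_form_def by auto
  have "monom_of m \<notin> lead_ideal tle (hom_form ` F - {hom_form h})"
    if h: "h \<in> F" and m: "m \<in> Poly_Mapping.keys (hom_form h)" for h m
  proof
    assume "monom_of m \<in> lead_ideal tle (hom_form ` F - {hom_form h})"
    moreover have "{monom_of (lead_mon tle f) |f. f \<in> hom_form ` F - {hom_form h} \<and> f \<noteq> 0}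
      = (monom_of ` {lead_mon tle f |f. f \<in> hom_form ` F - {hom_form h} \<and> f \<noteq> 0} :: ('n hvar, 'k) mpoly set)"
      by blast
    ultimately have "monom_of m \<in> (ideal_gen (monom_of ` {lead_mon tle f |f. f \<in> hom_form ` F - {hom_form h} \<and> f \<noteq> 0}) :: ('n hvar, 'k) mpoly set)"
      unfolding lead_ideal_def by (simp only:)
    then have "\<exists>m'\<in>{lead_mon tle f |f. f \<in> hom_form ` F - {hom_form h} \<and> f \<noteq> 0}. mdvd m' m"
      unfolding monomial_ideal_membership keys_monom_of by blast
    then obtain g where g: "g \<in> F" "hom_form g \<noteq> hom_form h" "mdvd (lead_mon tle (hom_form g)) m"
      by blast
    obtain i where i: "i \<in> supp h" "m = lin_mon (supp h) i" using m by (auto simp: keys_hom_form)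
    obtain j where j: "initial_in (induced_less tle) g j" using initial_in_exists[OF ls nz[OF g(1)]] by blast
    then have "j \<in> supp g" by (simp add: initial_in_def supp_def)
    then have "supp g \<subseteq> supp h"
      using g(3) i lead_mon_hom_form[OF T j] by (intro lin_mon_dvd[of _ j _ i]) auto
    then show False using form_reps_antichain[OF F g(1) h] g(2) by blast
  qed
  moreover have "0 \<notin> hom_form ` F"
  proof
    assume "0 \<in> hom_form ` F"
    then obtain g where "g \<in> F" "Poly_Mapping.keys (hom_form g) = {}" by auto
    then show False using nz by (simp add: keys_hom_form)
  qed
  ultimately show ?thesis using gb unfolding reduced_groebner_basis_def by blast
qed

lemma cocircuit_forms_reps:
  fixes L :: "('k::field ^ 'n::finite) set"
  assumes a: "cocircuit_forms L (coord_matroid (perp L)) a"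
  shows "form_reps (perp L) (a ` cocircuits (coord_matroid (perp L)))"
    and "homogenized_cocircuits (coord_matroid (perp L)) a = hom_form ` a ` cocircuits (coord_matroid (perp L))"
proof -
  note coc = cocircuits_coord_matroid[OF subspace_perp[of L]]
  have a': "a D \<in> perp L" "supp (a D) = D" if "D \<in> cocircuits (coord_matroid (perp L))" for D
    using a that unfolding cocircuit_forms_def linear_form_vanishing supp_def by auto
  have "min_form (perp L) (a D)" if D: "D \<in> cocircuits (coord_matroid (perp L))" for D
  proof -
    obtain f where "min_form (perp L) f" "D = supp f" using D unfolding coc by blast
    moreover from this have "a D \<noteq> 0"
      using a'(2)[OF D] supp_eq_empty[of f] supp_eq_empty[of "a D"] unfolding min_form_def by metis
    ultimately show ?thesis using a'[OF D] unfolding min_form_def by simp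
  qed
  then show "form_reps (perp L) (a ` cocircuits (coord_matroid (perp L)))"
    unfolding form_reps_def using a'(2) coc by (auto simp: inj_on_def)
  show "homogenized_cocircuits (coord_matroid (perp L)) a = hom_form ` a ` cocircuits (coord_matroid (perp L))"
    unfolding homogenized_cocircuits_def homogenize_linear_form by blast
qed

lemma cocircuit_forms_exist:
  fixes L :: "('k::field ^ 'n::finite) set"
  shows "\<exists>a. cocircuit_forms L (coord_matroid (perp L)) a"
proof -
  have "\<forall>D\<in>cocircuits (coord_matroid (perp L)). \<exists>f. f \<in> perp L \<and> supp f = D"
    unfolding cocircuits_coord_matroid[OF subspace_perp] min_form_def by blast
  then obtain a where "\<forall>D\<in>cocircuits (coord_matroid (perp L)). a D \<in> perp L \<and> supp (a D) = D" by metis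
  then show ?thesis unfolding cocircuit_forms_def linear_form_vanishing supp_def by blast
qed

section \<open>Prime ideals\<close>

text \<open>By restriction to lines, a product vanishes on \<open>P\<close> only if one of the factors does.\<close>

lemma prime_vanishing_ideal:
  fixes P :: "('v \<Rightarrow> 'k::field) set"
  assumes inf: "infinite (UNIV :: 'k set)" and ne: "P \<noteq> {}"
    and line: "\<And>p q t. p \<in> P \<Longrightarrow> q \<in> P \<Longrightarrow> (\<lambda>v. p v + t * (q v - p v)) \<in> P"
  shows "is_prime_ideal {f :: ('v, 'k) mpoly. \<forall>p\<in>P. mpoly_eval id p f = 0}" (is "is_prime_ideal ?I")
  unfolding is_prime_ideal_def
proof (intro conjI allI impI)
  show "is_ideal ?I" by (intro ideal.subspaceI) (auto simp: id_hom.eval_add id_hom.eval_mult)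
  have "1 \<notin> ?I" using ne by auto
  then show "?I \<noteq> UNIV" by blast
  fix f g assume "f * g \<in> ?I"
  then have "mpoly_eval id p f * mpoly_eval id p g = 0" if "p \<in> P" for p
    using that by (simp add: id_hom.eval_mult)
  from eval_product_zero[OF inf line this] show "f \<in> ?I \<or> g \<in> ?I" by blast
qed

text \<open>The set of the points \<open>(v\<^sub>i y\<^sub>i, y\<^sub>i)\<close> does not contain the lines that join them, so products are handled
  in the parameter space of the pairs \<open>(v, y)\<close>: \<open>\<Phi>\<close> is the substitution of \<open>x\<^sub>i y\<^sub>i\<close> for \<open>x\<^sub>i\<close>, and the parameter
  space is linear.\<close>

lemma prime_torus_ideal:
  fixes L :: "('k::field ^ 'n::finite) set"
  assumes inf: "infinite (UNIV :: 'k set)" and L: "vec.subspace L"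
  shows "is_prime_ideal (torus_ideal L)"
  unfolding is_prime_ideal_def
proof (intro conjI allI impI)
  show "is_ideal (torus_ideal L)" by (rule torus_ideal_subspace)
  have "1 \<notin> torus_ideal L" using vec.subspace_0[OF L] by (auto simp: torus_ideal_def)
  then show "torus_ideal L \<noteq> UNIV" by blast
  define sub :: "'n hvar \<Rightarrow> ('n hvar, 'k) mpoly"
    where "sub w = (case w of xv i \<Rightarrow> Var (xv i) * Var (yv i) | yv i \<Rightarrow> Var (yv i))" for w
  define \<Phi> where "\<Phi> f = mpoly_eval Const sub f" for f :: "('n hvar, 'k) mpoly"
  define P where "P = {p :: 'n hvar \<Rightarrow> 'k. (\<chi> i. p (xv i)) \<in> L}"
  have ev: "mpoly_eval id p (\<Phi> f) = mpoly_eval id (torus_point (\<chi> i. p (xv i)) (\<lambda>i. p (yv i))) f" for p f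
  proof -
    have "mpoly_eval id p (\<Phi> f) = mpoly_eval (\<lambda>x. x) (\<lambda>w. mpoly_eval id p (sub w)) f"
      unfolding \<Phi>_def hom_mpoly_eval[OF id_hom.coeff_hom_eval Const_hom.coeff_hom_axioms] by simp
    also have "(\<lambda>w. mpoly_eval id p (sub w)) = torus_point (\<chi> i. p (xv i)) (\<lambda>i. p (yv i))"
      by (rule ext) (auto simp: sub_def id_hom.eval_mult split: hvar.split)
    finally show ?thesis by (simp add: id_def)
  qed
  have mem: "f \<in> torus_ideal L \<longleftrightarrow> \<Phi> f \<in> {f. \<forall>p\<in>P. mpoly_eval id p f = 0}" for f
  proof
    assume "\<Phi> f \<in> {f. \<forall>p\<in>P. mpoly_eval id p f = 0}"
    then have *: "mpoly_eval id p (\<Phi> f) = 0" if "p \<in> P" for p using that by blast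
    show "f \<in> torus_ideal L"
      unfolding torus_ideal_def
    proof clarify
      fix v y assume v: "v \<in> L"
      let ?p = "case_hvar (($) v) y"
      have "(\<chi> i. ?p (xv i)) = v" by (simp add: vec_eq_iff)
      then show "mpoly_eval id (torus_point v y) f = 0"
        using *[of ?p] v ev[of ?p f] by (simp add: P_def)
    qed
  qed (auto simp: ev torus_ideal_def P_def)
  have line: "(\<lambda>v. p v + t * (q v - p v)) \<in> P" if "p \<in> P" "q \<in> P" for p q t
  proof -
    have "(\<chi> i. p (xv i)) + t *s ((\<chi> i. q (xv i)) - (\<chi> i. p (xv i))) \<in> L"
      using that L unfolding P_def
      by (intro vec.subspace_add vec.subspace_scale vec.subspace_diff) auto
    also have "(\<chi> i. p (xv i)) + t *s ((\<chi> i. q (xv i)) - (\<chi> i. p (xv i)))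
        = (\<chi> i. p (xv i) + t * (q (xv i) - p (xv i)))"
      by (simp add: vec_eq_iff)
    finally show ?thesis by (simp add: P_def)
  qed
  have "(\<lambda>_. 0) \<in> P" using vec.subspace_0[OF L] by (simp add: P_def zero_vec_def)
  then have prime: "is_prime_ideal {f :: ('n hvar, 'k) mpoly. \<forall>p\<in>P. mpoly_eval id p f = 0}"
    by (intro prime_vanishing_ideal[OF inf _ line]) auto
  fix f g assume "f * g \<in> torus_ideal L"
  then have "\<Phi> f * \<Phi> g \<in> {f. \<forall>p\<in>P. mpoly_eval id p f = 0}"
    unfolding mem by (simp add: \<Phi>_def Const_hom.eval_mult)
  then show "f \<in> torus_ideal L \<or> g \<in> torus_ideal L"
    using prime unfolding is_prime_ideal_def mem by blast
qed

lemma mem_variable_ideal: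
  "f \<in> ideal_gen (Var ` S) \<longleftrightarrow> (\<forall>m\<in>Poly_Mapping.keys f. \<exists>v\<in>S. Poly_Mapping.lookup m v \<noteq> 0)"
  for f :: "('v, 'a::comm_ring_1) mpoly"
proof -
  have "(Var ` S :: ('v, 'a) mpoly set) = monom_of ` (\<lambda>v. Poly_Mapping.single v 1) ` S"
    by (simp add: image_image Var_def)
  moreover have "mdvd (Poly_Mapping.single v 1) m \<longleftrightarrow> Poly_Mapping.lookup m v \<noteq> 0" for v and m :: "'v mon"
    by (auto simp: mdvd_iff lookup_single when_def Suc_le_eq)
  ultimately show ?thesis by (simp add: monomial_ideal_membership del: One_nat_def)
qed

text \<open>It is the vanishing ideal of a coordinate subspace.\<close>

lemma prime_variable_ideal:
  fixes S :: "'v::finite set"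
  assumes inf: "infinite (UNIV :: 'k::field set)"
  shows "is_prime_ideal (ideal_gen (Var ` S) :: ('v, 'k) mpoly set)"
proof -
  define P where "P = {p :: 'v \<Rightarrow> 'k. \<forall>v\<in>S. p v = 0}"
  have "f \<in> ideal_gen (Var ` S) \<longleftrightarrow> (\<forall>p\<in>P. mpoly_eval id p f = 0)" for f :: "('v, 'k) mpoly"
  proof
    assume f: "f \<in> ideal_gen (Var ` S)"
    show "\<forall>p\<in>P. mpoly_eval id p f = 0"
    proof
      fix p assume p: "p \<in> P"
      have "mev p m = 0" if m: "m \<in> Poly_Mapping.keys f" for m
      proof -
        obtain v where "v \<in> S" "Poly_Mapping.lookup m v \<noteq> 0" using f m unfolding mem_variable_ideal by blast
        then show ?thesis using p by (intro mev_zero[of p v]) (auto simp: P_def)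
      qed
      then show "mpoly_eval id p f = 0"
        by (simp add: id_hom.eval_superset[OF finite_keys order_refl])
    qed
  next
    assume 0: "\<forall>p\<in>P. mpoly_eval id p f = 0"
    define g where "g = mfilter (\<lambda>m. \<forall>v\<in>S. Poly_Mapping.lookup m v = 0) f"
    have "mpoly_eval id p g = 0" for p
    proof -
      let ?q = "\<lambda>v. if v \<in> S then 0 else p v"
      have "mpoly_eval id p g = mpoly_eval id ?q g"
        unfolding id_hom.eval_superset[OF finite_keys order_refl]
      proof (intro sum.cong refl arg_cong2[where f = "(*)"])
        fix m assume "m \<in> Poly_Mapping.keys g"
        then show "mev p m = mev ?q m"
          unfolding mev_finite by (intro prod.cong refl) (auto simp: g_def keys_mfilter)
      qed
      also have "\<dots> = mpoly_eval id ?q f"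
        unfolding id_hom.eval_superset[OF finite_keys order_refl]
      proof (rule sum.mono_neutral_cong_left)
        show "\<forall>m\<in>Poly_Mapping.keys f - Poly_Mapping.keys g. id (Poly_Mapping.lookup f m) * mev ?q m = 0"
        proof
          fix m assume "m \<in> Poly_Mapping.keys f - Poly_Mapping.keys g"
          then obtain v where "v \<in> S" "Poly_Mapping.lookup m v \<noteq> 0" by (auto simp: g_def keys_mfilter)
          then show "id (Poly_Mapping.lookup f m) * mev ?q m = 0" by (simp add: mev_zero[of _ v])
        qed
      qed (auto simp: g_def keys_mfilter lookup_mfilter)
      also have "\<dots> = 0" using 0 by (auto simp: P_def)
      finally show ?thesis .
    qed
    then have "g = 0" by (rule vanishing_polynomial_zero[OF inf])
    then have "Poly_Mapping.keys g = {}" by simp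
    then show "f \<in> ideal_gen (Var ` S)" unfolding mem_variable_ideal g_def keys_mfilter by blast
  qed
  then have "ideal_gen (Var ` S) = {f :: ('v, 'k) mpoly. \<forall>p\<in>P. mpoly_eval id p f = 0}" by blast
  moreover have "is_prime_ideal {f :: ('v, 'k) mpoly. \<forall>p\<in>P. mpoly_eval id p f = 0}"
    by (intro prime_vanishing_ideal[OF inf]) (auto simp: P_def intro!: exI[of _ "\<lambda>_. 0"])
  ultimately show ?thesis by simp
qed

lemma prime_radical:
  assumes "is_prime_ideal P"
  shows "ideal_radical P = P"
proof -
  have one: "1 \<notin> P"
  proof
    assume "1 \<in> P"
    then have "a * 1 \<in> P" for a using assms unfolding is_prime_ideal_def by (blast intro: ideal.subspace_scale)
    then show False using assms unfolding is_prime_ideal_def by auto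
  qed
  have "a ^ k \<in> P \<Longrightarrow> a \<in> P" for a k
  proof (induction k)
    case (Suc k)
    then show ?case using assms unfolding is_prime_ideal_def by (metis power_Suc)
  qed (use one in simp)
  moreover have "a \<in> P \<Longrightarrow> \<exists>k. a ^ k \<in> P" for a by (metis power_one_right)
  ultimately show ?thesis unfolding ideal_radical_def by blast
qed

lemma prime_primary: "is_prime_ideal P \<Longrightarrow> is_primary_ideal P"
  unfolding is_prime_ideal_def is_primary_ideal_def by (metis power_one_right)

section \<open>The primary decomposition of the initial ideal\<close>

text \<open>The complement of a facet of the external activity complex of the dual matroid, see
  \<open>complement_of_facet\<close>.\<close>

definition activity_vars :: "('n::finite \<Rightarrow> 'n \<Rightarrow> bool) \<Rightarrow> 'n set set \<Rightarrow> 'n set \<Rightarrow> 'n hvar set"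
  where "activity_vars ls M B = xv ` int_active ls M B \<union> yv ` int_passive ls M B"

lemma std_mon_iff_basis:
  fixes V :: "('k::field ^ 'n::finite) set"
  assumes ls: "strict_linear_order ls" and V: "vec.subspace V"
  shows "std_mon ls V m \<longleftrightarrow>
    (\<exists>B\<in>coord_matroid V. \<forall>v\<in>activity_vars ls (coord_matroid V) B. Poly_Mapping.lookup m v = 0)"
proof -
  have vars: "activity_vars ls (coord_matroid V) B
      = xv ` {b\<in>B. active ls V B b} \<union> yv ` {b\<in>B. \<not> active ls V B b}" if "coord_basis V B" for B
    unfolding activity_vars_def int_active_coord_matroid[OF V that] ..
  show ?thesis
  proof
    assume "std_mon ls V m"
    then have s: "standard ls V {i. Poly_Mapping.lookup m (xv i) \<noteq> 0} {i. Poly_Mapping.lookup m (yv i) \<noteq> 0}"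
      unfolding std_mon_def .
    obtain B where B: "coord_basis V B"
      "\<And>b. b \<in> B \<Longrightarrow> b \<in> {i. Poly_Mapping.lookup m (xv i) \<noteq> 0} \<Longrightarrow> \<not> active ls V B b"
      "\<And>b. b \<in> B \<Longrightarrow> b \<in> {i. Poly_Mapping.lookup m (yv i) \<noteq> 0} \<Longrightarrow> active ls V B b"
      by (rule standard_basis_exists[OF ls V s]) blast
    have "\<forall>v\<in>activity_vars ls (coord_matroid V) B. Poly_Mapping.lookup m v = 0"
      unfolding vars[OF B(1)] using B(2,3) by blast
    then show "\<exists>B\<in>coord_matroid V. \<forall>v\<in>activity_vars ls (coord_matroid V) B. Poly_Mapping.lookup m v = 0"
      using B(1) unfolding coord_matroid_def by blast
  next
    assume "\<exists>B\<in>coord_matroid V. \<forall>v\<in>activity_vars ls (coord_matroid V) B. Poly_Mapping.lookup m v = 0"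
    then obtain B where B: "coord_basis V B"
      "\<forall>v\<in>activity_vars ls (coord_matroid V) B. Poly_Mapping.lookup m v = 0"
      unfolding coord_matroid_def by blast
    show "std_mon ls V m"
      unfolding std_mon_def
      by (rule standard_iff_basis[OF ls V B(1)]) (use B(2) vars[OF B(1)] in auto)
  qed
qed

lemma activity_ideal_alt: "activity_ideal ls M B = ideal_gen (Var ` activity_vars ls M B)"
  by (simp add: activity_ideal_def activity_vars_def)

lemma activity_vars_basis:
  "{b. xv b \<in> activity_vars ls M B \<or> yv b \<in> activity_vars ls M B} = B"
  unfolding activity_vars_def int_active_def int_passive_def by auto

text \<open>Forgetting whether a variable is an \<open>x\<close> or a \<open>y\<close> recovers the basis.\<close>

lemma activity_vars_mono:
  assumes "activity_vars ls M B' \<subseteq> activity_vars ls M B" "card B' = card (B :: 'n::finite set)"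
  shows "B' = B"
proof -
  have "B' \<subseteq> B"
    using assms(1) activity_vars_basis[of ls M B'] activity_vars_basis[of ls M B] by blast
  then show ?thesis using assms(2) by (simp add: card_subset_eq)
qed

lemma nonstd_ideal_decomposition:
  fixes V :: "('k::field ^ 'n::finite) set"
  assumes ls: "strict_linear_order ls" and V: "vec.subspace V" and F: "form_reps V F"
  shows "nonstd_ideal ls V = (\<Inter>B\<in>coord_matroid V. activity_ideal ls (coord_matroid V) B)"
  using mem_nonstd_ideal[OF V F] std_mon_iff_basis[OF ls V]
  unfolding activity_ideal_alt by (auto simp: mem_variable_ideal)

text \<open>All components are prime ideals generated by \<open>r\<close> variables. They are pairwise incomparable since
  distinct bases have activity variables that do not contain each other.\<close>

lemma nonstd_ideal_primary_decomposition:
  fixes V :: "('k::field ^ 'n::finite) set"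
  assumes inf: "infinite (UNIV :: 'k set)" and ls: "strict_linear_order ls" and V: "vec.subspace V"
    and F: "form_reps V F"
  shows "minimal_primary_decomposition (nonstd_ideal ls V)
    (activity_ideal ls (coord_matroid V) ` coord_matroid V)"
proof -
  let ?M = "coord_matroid V"
  let ?P = "\<lambda>B. activity_ideal ls ?M B :: ('n hvar, 'k) mpoly set"
  have prime: "is_prime_ideal (?P B)" for B
    unfolding activity_ideal_alt by (rule prime_variable_ideal[OF inf])
  have card: "card B = vec.dim V" if "B \<in> ?M" for B
    using that coord_basis_card[OF V] by (simp add: coord_matroid_def)
  define w where "w B = (\<Sum>v\<in>- activity_vars ls ?M B. Poly_Mapping.single v (1::nat))" for B
  have w: "Poly_Mapping.lookup (w B) v \<noteq> 0 \<longleftrightarrow> v \<notin> activity_vars ls ?M B" for B v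
    by (auto simp: w_def lookup_sum lookup_single when_def)
  have wP: "monom_of (w B) \<in> ?P B' \<longleftrightarrow> B' \<noteq> B" if "B \<in> ?M" "B' \<in> ?M" for B B'
  proof -
    have "monom_of (w B) \<in> ?P B' \<longleftrightarrow> (\<exists>v\<in>activity_vars ls ?M B'. Poly_Mapping.lookup (w B) v \<noteq> 0)"
      unfolding activity_ideal_alt mem_variable_ideal keys_monom_of by blast
    then have "monom_of (w B) \<in> ?P B' \<longleftrightarrow> \<not> activity_vars ls ?M B' \<subseteq> activity_vars ls ?M B"
      unfolding w by blast
    then show ?thesis
      using activity_vars_mono[of ls ?M B' B] card[OF that(1)] card[OF that(2)] by auto
  qed
  have inj: "inj_on ?P ?M"
    by (rule inj_onI) (metis wP)
  have "\<Inter>(?P ` ?M - {?P B}) \<noteq> nonstd_ideal ls V" if B: "B \<in> ?M" for B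
  proof -
    have "monom_of (w B) \<in> \<Inter>(?P ` ?M - {?P B})" using wP[OF B] by auto
    moreover have "monom_of (w B) \<notin> nonstd_ideal ls V"
      unfolding nonstd_ideal_decomposition[OF ls V F] using wP[OF B B] B by blast
    ultimately show ?thesis by blast
  qed
  moreover have "inj_on ideal_radical (?P ` ?M)"
    by (rule inj_onI) (use prime_radical[OF prime] in auto)
  ultimately show ?thesis
    unfolding minimal_primary_decomposition_def
    using prime_primary[OF prime] nonstd_ideal_decomposition[OF ls V F] by auto
qed

lemma complement_of_facet:
  "xv ` (- B \<union> ext_passive ls (dual_matroid M) (- B)) \<union> yv ` (- B \<union> ext_active ls (dual_matroid M) (- B))
    = - activity_vars ls M B"
proof -
  have "v \<in> xv ` (- B \<union> int_passive ls M B) \<union> yv ` (- B \<union> int_active ls M B) \<longleftrightarrow> v \<notin> activity_vars ls M B" for v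
    by (cases v) (auto simp: activity_vars_def int_active_def int_passive_def)
  then show ?thesis unfolding ext_active_dual by blast
qed

text \<open>A squarefree monomial is a non-face if and only if its support meets the complement of every facet.\<close>

lemma stanley_reisner_activity:
  fixes M :: "'n::finite set set"
  shows "(stanley_reisner_ideal (ext_activity_complex ls (dual_matroid M)) :: ('n hvar, 'k::field) mpoly set)
    = (\<Inter>B\<in>M. activity_ideal ls M B)"
proof -
  let ?C = "ext_activity_complex ls (dual_matroid M)"
  have face: "\<sigma> \<in> ?C \<longleftrightarrow> (\<exists>B\<in>M. \<sigma> \<inter> activity_vars ls M B = {})" for \<sigma>
  proof -
    have "\<sigma> \<in> ?C \<longleftrightarrow> (\<exists>B\<in>M. \<sigma> \<subseteq> xv ` (- B \<union> ext_passive ls (dual_matroid M) (- B)) \<union>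
        yv ` (- B \<union> ext_active ls (dual_matroid M) (- B)))"
      unfolding ext_activity_complex_def dual_matroid_def by blast
    then show ?thesis unfolding complement_of_facet by blast
  qed
  define mon where "mon \<sigma> = (\<Sum>v\<in>\<sigma>. Poly_Mapping.single v (1::nat))" for \<sigma> :: "'n hvar set"
  have mon: "mdvd (mon \<sigma>) m \<longleftrightarrow> \<sigma> \<subseteq> Poly_Mapping.keys m" for \<sigma> m
  proof -
    have "Poly_Mapping.lookup (mon \<sigma>) v = (if v \<in> \<sigma> then 1 else 0)" for v
      by (simp add: mon_def lookup_sum lookup_single when_def)
    then show ?thesis by (auto simp: mdvd_iff in_keys_iff Suc_le_eq split: if_splits)
  qed
  have "{\<Prod>v\<in>\<sigma>. Var v | \<sigma>. \<sigma> \<notin> ?C} = (monom_of ` mon ` (- ?C) :: ('n hvar, 'k) mpoly set)"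
    unfolding mon_def monom_of_sum image_image Var_def by blast
  then have "f \<in> stanley_reisner_ideal ?C \<longleftrightarrow> (\<forall>m\<in>Poly_Mapping.keys f. \<exists>\<sigma>. \<sigma> \<notin> ?C \<and> \<sigma> \<subseteq> Poly_Mapping.keys m)"
    for f :: "('n hvar, 'k) mpoly"
    unfolding stanley_reisner_ideal_def by (simp add: monomial_ideal_membership mon) blast
  moreover have "(\<exists>\<sigma>. \<sigma> \<notin> ?C \<and> \<sigma> \<subseteq> Poly_Mapping.keys m) \<longleftrightarrow>
      (\<forall>B\<in>M. \<exists>v\<in>activity_vars ls M B. Poly_Mapping.lookup m v \<noteq> 0)" for m :: "'n hvar mon"
  proof
    assume "\<exists>\<sigma>. \<sigma> \<notin> ?C \<and> \<sigma> \<subseteq> Poly_Mapping.keys m"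
    then obtain \<sigma> where \<sigma>: "\<forall>B\<in>M. \<sigma> \<inter> activity_vars ls M B \<noteq> {}" "\<sigma> \<subseteq> Poly_Mapping.keys m"
      unfolding face by blast
    show "\<forall>B\<in>M. \<exists>v\<in>activity_vars ls M B. Poly_Mapping.lookup m v \<noteq> 0"
    proof
      fix B assume "B \<in> M"
      then obtain v where "v \<in> \<sigma>" "v \<in> activity_vars ls M B" using \<sigma>(1) by blast
      then show "\<exists>v\<in>activity_vars ls M B. Poly_Mapping.lookup m v \<noteq> 0"
        using \<sigma>(2) by (intro bexI[of _ v]) (auto simp: in_keys_iff)
    qed
  next
    assume *: "\<forall>B\<in>M. \<exists>v\<in>activity_vars ls M B. Poly_Mapping.lookup m v \<noteq> 0"
    have "Poly_Mapping.keys m \<notin> ?C"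
      unfolding face
    proof clarify
      fix B assume B: "B \<in> M" "Poly_Mapping.keys m \<inter> activity_vars ls M B = {}"
      then obtain v where "v \<in> activity_vars ls M B" "Poly_Mapping.lookup m v \<noteq> 0" using * by blast
      then show False using B(2) by (auto simp: in_keys_iff)
    qed
    then show "\<exists>\<sigma>. \<sigma> \<notin> ?C \<and> \<sigma> \<subseteq> Poly_Mapping.keys m" by blast
  qed
  ultimately have "f \<in> stanley_reisner_ideal ?C \<longleftrightarrow>
      (\<forall>m\<in>Poly_Mapping.keys f. \<forall>B\<in>M. \<exists>v\<in>activity_vars ls M B. Poly_Mapping.lookup m v \<noteq> 0)"
    for f :: "('n hvar, 'k) mpoly" by (simp only:)
  then show ?thesis unfolding activity_ideal_alt set_eq_iff INT_iff mem_variable_ideal by blast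
qed

section \<open>The number of initial ideals\<close>

definition first_in :: "'n list \<Rightarrow> 'n set \<Rightarrow> 'n \<Rightarrow> bool"
  where "first_in xs D i \<longleftrightarrow> (\<exists>ys zs. xs = ys @ i # zs \<and> set ys \<inter> D = {} \<and> i \<in> D)"

lemma sorted_list_exists:
  assumes "strict_linear_order ls" "finite E"
  shows "\<exists>xs. distinct xs \<and> set xs = E \<and> sorted_wrt ls xs"
  using assms
proof (induction E rule: largest_element_induct)
  case (insert e E)
  then obtain xs where "distinct xs" "set xs = E" "sorted_wrt ls xs" by blast
  then show ?case using insert.hyps
    by (intro exI[of _ "xs @ [e]"]) (auto simp: sorted_wrt_append)
qed simp

text \<open>The smallest element of every support is a pivot, so it is the first element of the support
  in the list of the pivots. Hence this list determines the leading monomials of all forms.\<close>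

lemma initial_in_pivot_list:
  fixes V :: "('k::field ^ 'n::finite) set"
  assumes ls: "strict_linear_order ls" and g: "g \<in> V"
    and xs: "set xs = {i. \<exists>f\<in>V. initial_in ls f i}" "sorted_wrt ls xs"
  shows "initial_in ls g i \<longleftrightarrow> first_in xs (supp g) i"
proof
  assume i: "initial_in ls g i"
  then have "i \<in> set xs" using g xs(1) by blast
  then obtain ys zs where s: "xs = ys @ i # zs" by (meson split_list)
  have "y \<notin> supp g" if y: "y \<in> set ys" for y
  proof
    assume "y \<in> supp g"
    moreover have "ls y i" using xs(2) y unfolding s by (simp add: sorted_wrt_append)
    ultimately show False using i strict_linear_orderD(1,4)[OF ls] unfolding initial_in_def supp_def by blast
  qed
  moreover have "i \<in> supp g" using i by (simp add: initial_in_def supp_def)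
  ultimately show "first_in xs (supp g) i" unfolding first_in_def using s by blast
next
  assume "first_in xs (supp g) i"
  then obtain ys zs where s: "xs = ys @ i # zs" "set ys \<inter> supp g = {}" "i \<in> supp g"
    unfolding first_in_def by blast
  then have "g \<noteq> 0" by (auto simp: supp_def)
  then obtain k where k: "initial_in ls g k" using initial_in_exists[OF ls] by blast
  have ks: "k \<in> supp g" using k by (simp add: initial_in_def supp_def)
  have "k \<in> set xs" using k g xs(1) by blast
  then have "k = i \<or> k \<in> set zs" using s ks by auto
  moreover have "\<not> ls i k" if "k \<noteq> i"
    using k s(3) that strict_linear_orderD(4)[OF ls] unfolding initial_in_def supp_def by blast
  ultimately have "k = i" using xs(2) unfolding s(1) by (auto simp: sorted_wrt_append)
  then show "initial_in ls g i" using k by simp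
qed

lemma card_ordered_bases:
  fixes M :: "'n::finite set set"
  assumes "\<And>B. B \<in> M \<Longrightarrow> card B = r"
  shows "finite {xs. distinct xs \<and> set xs \<in> M}" "card {xs. distinct xs \<and> set xs \<in> M} \<le> fact r * card M"
proof -
  have eq: "{xs. distinct xs \<and> set xs \<in> M} = (\<Union>B\<in>M. {xs. length xs = r \<and> distinct xs \<and> set xs \<subseteq> B})"
  proof (intro equalityI subsetI)
    fix xs assume "xs \<in> (\<Union>B\<in>M. {xs. length xs = r \<and> distinct xs \<and> set xs \<subseteq> B})"
    then obtain B where B: "B \<in> M" "length xs = r" "distinct xs" "set xs \<subseteq> B" by blast
    then have "set xs = B" using assms[OF B(1)] by (metis card_subset_eq distinct_card finite)
    then show "xs \<in> {xs. distinct xs \<and> set xs \<in> M}" using B by simp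
  next
    fix xs assume "xs \<in> {xs. distinct xs \<and> set xs \<in> M}"
    then show "xs \<in> (\<Union>B\<in>M. {xs. length xs = r \<and> distinct xs \<and> set xs \<subseteq> B})"
      using assms by (auto simp: distinct_card[symmetric])
  qed
  have c: "card {xs. length xs = r \<and> distinct xs \<and> set xs \<subseteq> B} = fact r" if "B \<in> M" for B
    using card_lists_distinct_length_eq[of B r] assms[OF that] by (simp add: fact_prod)
  show "finite {xs. distinct xs \<and> set xs \<in> M}"
    unfolding eq by (intro finite_UN_I) (auto intro: finite_subset[OF _ finite_lists_length_eq[of UNIV r]])
  have "card (\<Union>B\<in>M. {xs. length xs = r \<and> distinct xs \<and> set xs \<subseteq> B})
      \<le> (\<Sum>B\<in>M. card {xs. length xs = r \<and> distinct xs \<and> set xs \<subseteq> B})"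
    by (rule card_UN_le) simp
  also have "\<dots> = fact r * card M" using c by simp
  finally show "card {xs. distinct xs \<and> set xs \<in> M} \<le> fact r * card M" unfolding eq .
qed

text \<open>By the preceding lemma the initial ideal is determined by the list of the pivots in increasing order,
  that is, by an ordering of a basis of the matroid.\<close>

lemma initial_ideals_bound:
  fixes L :: "('k::field ^ 'n::finite) set"
  assumes inf: "infinite (UNIV :: 'k set)" and L: "vec.subspace L" and F: "form_reps (perp L) F"
  defines "M \<equiv> coord_matroid (perp L)"
  shows "finite {initial_ideal tle (closure_ideal L) | tle. term_order tle}"
    and "card {initial_ideal tle (closure_ideal L) | tle. term_order tle} \<le> fact (vec.dim (perp L)) * card M"
proof -
  define \<Phi> where "\<Phi> xs = (ideal_gen (monom_of ` {lin_mon (supp g) i | g i. g \<in> F \<and> first_in xs (supp g) i})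
      :: ('n hvar, 'k) mpoly set)" for xs
  let ?I = "{initial_ideal tle (closure_ideal L) | tle. term_order tle}"
  let ?X = "{xs. distinct xs \<and> set xs \<in> M}"
  have sub: "?I \<subseteq> \<Phi> ` ?X"
  proof clarify
    fix tle :: "'n hvar mon \<Rightarrow> 'n hvar mon \<Rightarrow> bool" assume T: "term_order tle"
    note ls = strict_linear_order_induced_less[OF T]
    let ?P = "{i. \<exists>f\<in>perp L. initial_in (induced_less tle) f i}"
    obtain xs where xs: "distinct xs" "set xs = ?P" "sorted_wrt (induced_less tle) xs"
      using sorted_list_exists[OF ls, of ?P] by auto
    have "initial_in (induced_less tle) g i \<longleftrightarrow> first_in xs (supp g) i" if "g \<in> F" for g i
    proof -
      have "g \<in> perp L" using that F unfolding form_reps_def min_form_def by auto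
      then show ?thesis by (rule initial_in_pivot_list[OF ls _ xs(2,3)])
    qed
    then have "initial_ideal tle (closure_ideal L) = \<Phi> xs"
      unfolding initial_ideal_closure[OF inf L F T] lead_ideal_forms(2)[OF subspace_perp F T, symmetric]
        lead_ideal_forms(1)[OF subspace_perp F T] \<Phi>_def
      by (intro arg_cong[where f = ideal_gen] arg_cong[where f = "image monom_of"]) blast
    moreover have "xs \<in> ?X"
      using xs pivots_basis[OF ls subspace_perp] by (simp add: M_def coord_matroid_def)
    ultimately show "initial_ideal tle (closure_ideal L) \<in> \<Phi> ` ?X" by blast
  qed
  have c: "card B = vec.dim (perp L)" if "B \<in> M" for B
  proof (rule coord_basis_card[OF subspace_perp, symmetric])
    show "coord_basis (perp L) B" using that by (simp add: M_def coord_matroid_def)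
  qed
  show "finite ?I" using sub card_ordered_bases(1)[OF c] by (meson finite_imageI finite_subset)
  have "card ?I \<le> card (\<Phi> ` ?X)" using sub card_ordered_bases(1)[OF c] by (intro card_mono finite_imageI)
  also have "\<dots> \<le> card ?X" by (rule card_image_le[OF card_ordered_bases(1)[OF c]])
  also have "\<dots> \<le> fact (vec.dim (perp L)) * card M" by (rule card_ordered_bases(2)[OF c])
  finally show "card ?I \<le> fact (vec.dim (perp L)) * card M" .
qed

section \<open>The codimension of the closure\<close>

interpretation mpoly_vs: vector_space "\<lambda>c f. Const (c :: 'k::field) * (f :: ('v, 'k) mpoly)"
  by unfold_locales (simp_all add: Const_add Const_mult algebra_simps)

declare mpoly_vs.scale_scale [simp del]

definition words :: "nat \<Rightarrow> nat \<Rightarrow> nat list set"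
  where "words k s = {l. length l = k \<and> set l \<subseteq> {..<s}}"

lemma words: "finite (words k s)" "card (words k s) = s ^ k"
  using finite_lists_length_eq[of "{..<s}" k] card_lists_length_eq[of "{..<s}" k]
  by (simp_all add: words_def conj_commute)

lemma words_Suc: "words (Suc k) s = (\<lambda>(j, l). j # l) ` ({..<s} \<times> words k s)"
  by (auto simp: words_def length_Suc_conv)

text \<open>The quotient by \<open>P\<close> has at least \<open>s ^ k\<close> linearly independent elements with exponents \<open>O(s)\<close>, so
  its dimension is at least \<open>k\<close>. Indexing them by words of length \<open>k\<close> lets a step in a chain of prime
  ideals add a letter.\<close>

definition grows :: "('v::finite, 'k::field) mpoly set \<Rightarrow> nat \<Rightarrow> bool"
  where "grows P k \<longleftrightarrow> (\<exists>c. \<forall>s. \<exists>u :: nat list \<Rightarrow> ('v, 'k) mpoly.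
    (\<forall>l\<in>words k s. Poly_Mapping.keys (u l) \<subseteq> mon_box (c * s)) \<and>
    (\<forall>a. (\<Sum>l\<in>words k s. Const (a l) * u l) \<in> P \<longrightarrow> (\<forall>l\<in>words k s. a l = 0)))"

lemma keys_mult_box:
  assumes "Poly_Mapping.keys f \<subseteq> mon_box A" "Poly_Mapping.keys g \<subseteq> mon_box B"
  shows "Poly_Mapping.keys (f * g) \<subseteq> mon_box (A + B)"
proof
  fix m assume "m \<in> Poly_Mapping.keys (f * g)"
  then obtain a b where "m = a + b" "a \<in> Poly_Mapping.keys f" "b \<in> Poly_Mapping.keys g"
    using keys_mult[of f g] by blast
  then show "m \<in> mon_box (A + B)" using assms unfolding mon_box_def by (auto simp: lookup_add intro!: add_mono)
qed

lemma keys_power_box: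
  assumes "Poly_Mapping.keys (f :: ('v::finite, 'k::field) mpoly) \<subseteq> mon_box e"
  shows "Poly_Mapping.keys (f ^ j) \<subseteq> mon_box (j * e)"
proof (induction j)
  case 0 then show ?case by (simp add: mon_box_def)
next
  case (Suc j) then show ?case using keys_mult_box[OF assms Suc] by simp
qed

lemma keys_in_box: "\<exists>e. Poly_Mapping.keys (f :: ('v::finite, 'k::field) mpoly) \<subseteq> mon_box e"
proof (intro exI)
  let ?A = "(\<lambda>(m, v). Poly_Mapping.lookup m v) ` (Poly_Mapping.keys f \<times> UNIV)"
  have "finite ?A" by simp
  then show "Poly_Mapping.keys f \<subseteq> mon_box (Max ?A)"
    unfolding mon_box_def by (auto intro!: Max_ge)
qed

text \<open>For \<open>f\<close> in \<open>Q\<close> but not in \<open>P\<close>, independent elements modulo \<open>Q\<close> can be multiplied by the powers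
  of \<open>f\<close>.\<close>
lemma grows_subset:
  assumes P: "is_prime_ideal P" and Q: "is_ideal Q" and "P \<subset> Q" and g: "grows Q k"
  shows "grows P (Suc k)"
proof -
  obtain f where f: "f \<in> Q" "f \<notin> P" using assms(3) by blast
  obtain e where e: "Poly_Mapping.keys f \<subseteq> mon_box e" using keys_in_box by blast
  obtain c where c: "\<And>s. \<exists>u. (\<forall>l\<in>words k s. Poly_Mapping.keys (u l) \<subseteq> mon_box (c * s)) \<and>
    (\<forall>a. (\<Sum>l\<in>words k s. Const (a l) * u l) \<in> Q \<longrightarrow> (\<forall>l\<in>words k s. a l = 0))"
    using g unfolding grows_def by blast
  show ?thesis
    unfolding grows_def
  proof (intro exI[of _ "c + e"] allI)
    fix s
    obtain u where u: "\<forall>l\<in>words k s. Poly_Mapping.keys (u l) \<subseteq> mon_box (c * s)"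
      "\<And>a. (\<Sum>l\<in>words k s. Const (a l) * u l) \<in> Q \<Longrightarrow> (\<forall>l\<in>words k s. a l = 0)"
      using c[of s] by blast
    have ind: "(\<Sum>j<N. f ^ j * (\<Sum>l\<in>words k s. Const (b j l) * u l)) \<in> P \<Longrightarrow>
        (\<forall>j<N. \<forall>l\<in>words k s. b j l = 0)" for N and b :: "nat \<Rightarrow> nat list \<Rightarrow> 'b"
    proof (induction N arbitrary: b)
      case (Suc N)
      let ?U = "\<lambda>j. \<Sum>l\<in>words k s. Const (b j l) * u l"
      have eq: "(\<Sum>j<Suc N. f ^ j * ?U j) = ?U 0 + f * (\<Sum>j<N. f ^ j * ?U (Suc j))"
        by (subst sum.lessThan_Suc_shift) (simp add: sum_distrib_left mult.assoc)
      have 1: "?U 0 + f * (\<Sum>j<N. f ^ j * ?U (Suc j)) \<in> Q"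
        using Suc.prems assms(3) unfolding eq by blast
      have 2: "f * (\<Sum>j<N. f ^ j * ?U (Suc j)) \<in> Q"
        by (subst mult.commute) (rule ideal.subspace_scale[OF Q f(1)])
      have "?U 0 \<in> Q" using ideal.subspace_diff[OF Q 1 2] by simp
      then have 0: "\<forall>l\<in>words k s. b 0 l = 0" by (rule u(2))
      then have "?U 0 = 0" by simp
      then have "f * (\<Sum>j<N. f ^ j * ?U (Suc j)) \<in> P" using Suc.prems eq by simp
      then have "(\<Sum>j<N. f ^ j * ?U (Suc j)) \<in> P" using P f(2) unfolding is_prime_ideal_def by blast
      from Suc.IH[OF this] 0 show ?case by (metis less_Suc_eq_0_disj)
    qed simp
    have inj: "inj_on (\<lambda>(j, l). j # l) ({..<s} \<times> words k s)" by (auto simp: inj_on_def)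
    show "\<exists>u. (\<forall>l\<in>words (Suc k) s. Poly_Mapping.keys (u l) \<subseteq> mon_box ((c + e) * s)) \<and>
      (\<forall>a. (\<Sum>l\<in>words (Suc k) s. Const (a l) * u l) \<in> P \<longrightarrow> (\<forall>l\<in>words (Suc k) s. a l = 0))"
    proof (intro exI[of _ "\<lambda>l. f ^ hd l * u (tl l)"] conjI ballI allI impI)
      fix l assume "l \<in> words (Suc k) s"
      then obtain j l' where l: "l = j # l'" "j < s" "l' \<in> words k s" unfolding words_Suc by auto
      have "Poly_Mapping.keys (f ^ j * u l') \<subseteq> mon_box (j * e + c * s)"
        by (rule keys_mult_box[OF keys_power_box[OF e]]) (use u(1) l in blast)
      moreover have "j * e + c * s \<le> (c + e) * s"
        using l(2) by (simp add: algebra_simps)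
      ultimately show "Poly_Mapping.keys (f ^ hd l * u (tl l)) \<subseteq> mon_box ((c + e) * s)"
        unfolding l mon_box_def by (auto intro: order_trans)
    next
      fix a l assume *: "(\<Sum>l\<in>words (Suc k) s. Const (a l) * (f ^ hd l * u (tl l))) \<in> P"
        and l: "l \<in> words (Suc k) s"
      have "(\<Sum>l\<in>words (Suc k) s. Const (a l) * (f ^ hd l * u (tl l)))
          = (\<Sum>(j, l)\<in>{..<s} \<times> words k s. Const (a (j # l)) * (f ^ j * u l))"
        unfolding words_Suc by (subst sum.reindex[OF inj]) (simp add: o_def case_prod_unfold)
      also have "\<dots> = (\<Sum>j<s. \<Sum>l\<in>words k s. Const (a (j # l)) * (f ^ j * u l))"
        by (rule sum.cartesian_product[symmetric])
      also have "\<dots> = (\<Sum>j<s. f ^ j * (\<Sum>l\<in>words k s. Const (a (j # l)) * u l))"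
        by (simp add: sum_distrib_left mult.left_commute)
      finally have "\<forall>j<s. \<forall>l\<in>words k s. a (j # l) = 0"
        using * ind[where N = s and b = "\<lambda>j l. a (j # l)"] by simp
      then show "a l = 0" using l unfolding words_Suc by auto
    qed
  qed
qed

text \<open>For \<open>s\<close> larger than \<open>(c + 1)^N\<close> the power \<open>s^(N + 1)\<close> exceeds \<open>((c + 1) s)^N\<close>.\<close>

lemma polynomial_growth_bound:
  fixes c k N :: nat
  assumes "\<And>s. s ^ k \<le> (c * s + 1) ^ N"
  shows "k \<le> N"
proof (rule ccontr)
  assume "\<not> k \<le> N"
  define s where "s = (c + 1) ^ N + 1"
  have s: "s \<ge> 1" by (simp add: s_def)
  have "s ^ Suc N \<le> s ^ k" using s \<open>\<not> k \<le> N\<close> by (intro power_increasing) auto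
  also have "\<dots> \<le> (c * s + 1) ^ N" by (rule assms)
  also have "\<dots> \<le> ((c + 1) * s) ^ N" using s by (intro power_mono) auto
  also have "\<dots> = (c + 1) ^ N * s ^ N" by (rule power_mult_distrib)
  finally have "s \<le> (c + 1) ^ N" using s by simp
  then show False by (simp add: s_def)
qed

text \<open>There are at most \<open>(c s + 1)^n\<close> monomials with exponents at most \<open>c s\<close> in \<open>n\<close> variables.\<close>

lemma grows_bound:
  fixes P :: "('v::finite, 'k::field) mpoly set"
  assumes g: "grows P k" and 0: "0 \<in> P"
  shows "k \<le> CARD('v)"
proof -
  obtain c where c: "\<And>s. \<exists>u :: nat list \<Rightarrow> ('v, 'k) mpoly. (\<forall>l\<in>words k s. Poly_Mapping.keys (u l) \<subseteq> mon_box (c * s)) \<and>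
    (\<forall>a. (\<Sum>l\<in>words k s. Const (a l) * u l) \<in> P \<longrightarrow> (\<forall>l\<in>words k s. a l = 0))"
    using g unfolding grows_def by blast
  have "s ^ k \<le> (c * s + 1) ^ CARD('v)" for s
  proof -
    obtain u :: "nat list \<Rightarrow> ('v, 'k) mpoly"
      where u: "\<And>l. l \<in> words k s \<Longrightarrow> Poly_Mapping.keys (u l) \<subseteq> mon_box (c * s)"
      "\<And>a. (\<Sum>l\<in>words k s. Const (a l) * u l) \<in> P \<Longrightarrow> (\<forall>l\<in>words k s. a l = 0)"
      using c[of s] by blast
    have inj: "inj_on u (words k s)"
    proof (rule inj_onI, rule ccontr)
      fix l l' assume l: "l \<in> words k s" "l' \<in> words k s" "u l = u l'" "l \<noteq> l'"
      define a where "a x = (if x = l then 1 else if x = l' then - 1 else 0 :: 'k)" for x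
      have "(\<Sum>x\<in>words k s. Const (a x) * u x) = (\<Sum>x\<in>{l, l'}. Const (a x) * u x)"
        by (rule sum.mono_neutral_right) (use l words in \<open>auto simp: a_def\<close>)
      also have "\<dots> = 0" using l by (simp add: a_def Const_minus)
      finally have "a l = 0" using u(2)[of a] 0 l(1) by simp
      then show False by (simp add: a_def)
    qed
    have "mpoly_vs.independent (u ` words k s)"
    proof (rule mpoly_vs.independent_if_scalars_zero)
      fix a x assume *: "(\<Sum>x\<in>u ` words k s. Const (a x) * x) = 0" and x: "x \<in> u ` words k s"
      have "(\<Sum>l\<in>words k s. Const (a (u l)) * u l) = 0"
        using * by (simp add: sum.reindex[OF inj])
      then show "a x = 0" using u(2)[of "\<lambda>l. a (u l)"] 0 x by auto
    qed (simp add: words)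
    moreover have "u ` words k s \<subseteq> mpoly_vs.span (monom_of ` mon_box (c * s))"
    proof clarify
      fix l assume l: "l \<in> words k s"
      have "(\<Sum>m\<in>Poly_Mapping.keys (u l). Const (Poly_Mapping.lookup (u l) m) * monom_of m)
          \<in> mpoly_vs.span (monom_of ` mon_box (c * s))"
        using u(1)[OF l] by (intro mpoly_vs.span_sum mpoly_vs.span_scale mpoly_vs.span_base) blast
      then show "u l \<in> mpoly_vs.span (monom_of ` mon_box (c * s))"
        by (simp flip: mpoly_expand_monom)
    qed
    ultimately have "card (u ` words k s) \<le> card (monom_of ` (mon_box (c * s) :: 'v mon set) :: ('v, 'k) mpoly set)"
      using mpoly_vs.independent_span_bound[of "monom_of ` mon_box (c * s)"] card_mon_box(1) by blast
    also have "\<dots> \<le> card (mon_box (c * s) :: 'v mon set)" by (rule card_image_le[OF card_mon_box(1)])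
    also have "\<dots> \<le> (c * s + 1) ^ CARD('v)" by (rule card_mon_box)
    finally show ?thesis using card_image[OF inj] words by simp
  qed
  then show ?thesis by (rule polynomial_growth_bound)
qed

lemma prime_ideal_one:
  assumes "is_prime_ideal P"
  shows "1 \<notin> P"
proof
  assume "1 \<in> P"
  then have "a * 1 \<in> P" for a using assms unfolding is_prime_ideal_def by (blast intro: ideal.subspace_scale)
  then show False using assms unfolding is_prime_ideal_def by auto
qed

lemma grows_0:
  fixes P :: "('v::finite, 'k::field) mpoly set"
  assumes P: "is_prime_ideal P"
  shows "grows P 0"
  unfolding grows_def
proof (intro exI[of _ "0 :: nat"] allI)
  fix s
  have "a = 0" if "Const a * 1 \<in> P" for a :: 'k
  proof (rule ccontr)
    assume "a \<noteq> 0"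
    have "Const (inverse a) * (Const a * 1) \<in> P"
      using P that unfolding is_prime_ideal_def by (blast intro: ideal.subspace_scale)
    moreover have "Const (inverse a) * (Const a * 1) = (1 :: ('v, 'k) mpoly)"
      using \<open>a \<noteq> 0\<close> by (simp flip: Const_mult)
    ultimately show False using prime_ideal_one[OF P] by simp
  qed
  then show "\<exists>u :: nat list \<Rightarrow> ('v, 'k) mpoly. (\<forall>l\<in>words 0 s. Poly_Mapping.keys (u l) \<subseteq> mon_box (0 * s)) \<and>
    (\<forall>a. (\<Sum>l\<in>words 0 s. Const (a l) * u l) \<in> P \<longrightarrow> (\<forall>l\<in>words 0 s. a l = 0))"
  proof (intro exI[of _ "\<lambda>_. 1"])
    have w: "words 0 s = {[]}" by (auto simp: words_def)
    show "(\<forall>l\<in>words 0 s. Poly_Mapping.keys (1 :: ('v, 'k) mpoly) \<subseteq> mon_box (0 * s)) \<and>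
      (\<forall>a. (\<Sum>l\<in>words 0 s. Const (a l) * (1 :: ('v, 'k) mpoly)) \<in> P \<longrightarrow> (\<forall>l\<in>words 0 s. a l = 0))"
      if "\<And>a :: 'k. Const a * 1 \<in> P \<Longrightarrow> a = 0"
      unfolding w using that by (simp add: mon_box_def)
  qed
qed

lemma grows_chain:
  fixes C :: "nat \<Rightarrow> ('v::finite, 'k::field) mpoly set"
  assumes "\<And>i. i \<le> l \<Longrightarrow> is_prime_ideal (C i)" "\<And>i. i < l \<Longrightarrow> C i \<subset> C (Suc i)" "grows (C l) k"
  shows "grows (C 0) (k + l)"
  using assms
proof (induction l arbitrary: k)
  case (Suc l)
  have "grows (C l) (Suc k)"
    using Suc.prems by (intro grows_subset[of "C l" "C (Suc l)"]) (auto simp: is_prime_ideal_def)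
  then have "grows (C 0) (Suc k + l)" using Suc.prems by (intro Suc.IH) auto
  then show ?case by simp
qed simp

text \<open>By \<open>grows_chain\<close> a chain of length \<open>l\<close> that ends at \<open>P\<close> starts at a prime ideal whose quotient grows with
  exponent \<open>k + l\<close>, so \<open>k + l\<close> is at most the number of variables. This also bounds the set whose supremum is
  the height, so that the supremum is meaningful.\<close>

lemma prime_height_bounds:
  fixes P :: "('v::finite, 'k::field) mpoly set"
  assumes P: "is_prime_ideal P"
  shows "grows P k \<Longrightarrow> prime_height P \<le> CARD('v) - k"
    and "\<lbrakk>\<And>i. i \<le> l \<Longrightarrow> is_prime_ideal (C i); \<And>i. i < l \<Longrightarrow> C i \<subset> C (Suc i); C l = P\<rbrakk> \<Longrightarrow> l \<le> prime_height P"
proof -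
  let ?S = "{l. \<exists>C :: nat \<Rightarrow> ('v, 'k) mpoly set.
    (\<forall>i\<le>l. is_prime_ideal (C i)) \<and> (\<forall>i<l. C i \<subset> C (Suc i)) \<and> C l = P}"
  have bound: "l \<le> CARD('v) - k" if l: "l \<in> ?S" and g: "grows P k" for l k
  proof -
    obtain C where C: "\<forall>i\<le>l. is_prime_ideal (C i)" "\<forall>i<l. C i \<subset> C (Suc i)" "C l = P" using l by blast
    then have "grows (C 0) (k + l)" using g by (intro grows_chain) auto
    moreover have "0 \<in> C 0" using C(1) unfolding is_prime_ideal_def by (auto intro: ideal.subspace_0)
    ultimately have "k + l \<le> CARD('v)" by (rule grows_bound)
    then show ?thesis by simp
  qed
  have "0 \<in> ?S" using P by (intro CollectI exI[of _ "\<lambda>_. P"]) auto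
  then show "prime_height P \<le> CARD('v) - k" if "grows P k"
    unfolding prime_height_def using bound[OF _ that] by (intro cSup_least) auto
  have bdd: "bdd_above ?S" using bound[OF _ grows_0[OF P]] by (intro bdd_aboveI) blast
  show "l \<le> prime_height P" if "\<And>i. i \<le> l \<Longrightarrow> is_prime_ideal (C i)" "\<And>i. i < l \<Longrightarrow> C i \<subset> C (Suc i)" "C l = P"
    unfolding prime_height_def using that by (intro cSup_upper[OF _ bdd]) blast
qed

lemma card_hvar: "CARD('n::finite hvar) = 2 * CARD('n)"
proof -
  have "CARD('n hvar) = card (range (xv :: 'n \<Rightarrow> _)) + card (range (yv :: 'n \<Rightarrow> _))"
    unfolding UNIV_hvar by (rule card_Un_disjoint) auto
  then show ?thesis by (simp add: card_image inj_on_def)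
qed

lemma card_activity_vars:
  fixes B :: "'n::finite set"
  shows "card (activity_vars ls M B) = card B"
proof -
  have "card (activity_vars ls M B) = card (int_active ls M B) + card (int_passive ls M B)"
    unfolding activity_vars_def by (subst card_Un_disjoint) (auto simp: card_image inj_on_def)
  also have "\<dots> = card (int_active ls M B \<union> int_passive ls M B)"
    by (rule card_Un_disjoint[symmetric]) (auto simp: int_active_def int_passive_def)
  also have "int_active ls M B \<union> int_passive ls M B = B"
    by (auto simp: int_active_def int_passive_def)
  finally show ?thesis .
qed

text \<open>The monomials in the variables that are not activity variables of a fixed basis are standard, and there
  are \<open>2 n - r\<close> such variables.\<close>

lemma grows_torus_ideal:
  fixes L :: "('k::field ^ 'n::finite) set"
  assumes inf: "infinite (UNIV :: 'k set)" and L: "vec.subspace L"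
  shows "grows (torus_ideal L) (2 * CARD('n) - vec.dim (perp L))"
proof -
  let ?k = "2 * CARD('n) - vec.dim (perp L)" and ?M = "coord_matroid (perp L)"
  obtain ls :: "'n \<Rightarrow> 'n \<Rightarrow> bool" where ls: "strict_linear_order ls" using ex_strict_linear_order by blast
  obtain B where B: "coord_basis (perp L) B" using coord_basis_exists'[OF subspace_perp] by blast
  define W where "W = - activity_vars ls ?M B"
  have "card W = ?k"
    unfolding W_def using card_activity_vars[of ls ?M B] coord_basis_card[OF subspace_perp B]
    by (simp add: Compl_eq_Diff_UNIV card_Diff_subset card_hvar)
  then obtain w where w: "bij_betw w {..<?k} W"
    using ex_bij_betw_nat_finite[of W] by (auto simp: atLeast0LessThan)
  define mon where "mon l = (\<Sum>t<?k. Poly_Mapping.single (w t) (l ! t))" for l :: "nat list"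
  have inj_w: "w t = w t' \<longleftrightarrow> t = t'" if "t < ?k" "t' < ?k" for t t'
    using w that by (auto simp: bij_betw_def inj_on_def)
  have mon_w: "Poly_Mapping.lookup (mon l) (w t) = l ! t" if "t < ?k" for l t
  proof -
    have "Poly_Mapping.lookup (mon l) (w t) = (\<Sum>t'<?k. if t' = t then l ! t' else 0)"
      unfolding mon_def lookup_sum lookup_single when_def
      by (intro sum.cong refl) (use inj_w that in auto)
    then show ?thesis using that by simp
  qed
  have mon_0: "Poly_Mapping.lookup (mon l) v = 0" if "v \<notin> W" for l v
    unfolding mon_def lookup_sum lookup_single when_def
    by (intro sum.neutral) (use w that in \<open>auto simp: bij_betw_def\<close>)
  have std: "std_mon ls (perp L) (mon l)" for l
    unfolding std_mon_iff_basis[OF ls subspace_perp]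
    using B mon_0 by (intro bexI[of _ B]) (auto simp: W_def coord_matroid_def)
  have mon_inj: "l = l'" if "mon l = mon l'" "l \<in> words ?k s" "l' \<in> words ?k s" for l l' s
    using that mon_w by (intro nth_equalityI) (auto simp: words_def, metis)
  show ?thesis
    unfolding grows_def
  proof (intro exI[of _ "1 :: nat"] allI exI[of _ "\<lambda>l. monom_of (mon l)"] conjI ballI impI)
    fix s l assume l: "l \<in> words ?k s"
    show "Poly_Mapping.keys (monom_of (mon l) :: ('n hvar, 'k) mpoly) \<subseteq> mon_box (1 * s)"
    proof -
      have "Poly_Mapping.lookup (mon l) v \<le> s" for v
      proof (cases "v \<in> W")
        case True
        then obtain t where "t < ?k" "v = w t" using w by (auto simp: bij_betw_def)
        moreover have "l ! t < s"
        proof -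
          have "l ! t \<in> set l" using l \<open>t < ?k\<close> by (simp add: words_def)
          then show ?thesis using l by (auto simp: words_def)
        qed
        ultimately show ?thesis using mon_w by simp
      qed (simp add: mon_0)
      then show ?thesis by (simp add: mon_box_def)
    qed
  next
    fix s a l assume *: "(\<Sum>l\<in>words ?k s. Const (a l) * monom_of (mon l)) \<in> torus_ideal L" and l: "l \<in> words ?k s"
    let ?f = "\<Sum>l\<in>words ?k s. Const (a l) * monom_of (mon l)"
    have "?f = 0"
    proof (rule standard_monomials_independent[OF inf ls L *])
      fix m assume "m \<in> Poly_Mapping.keys ?f"
      then obtain l where "m \<in> Poly_Mapping.keys (Const (a l) * monom_of (mon l))"
        using keys_sum[of "\<lambda>l. Const (a l) * monom_of (mon l)" "words ?k s"] by blast
      then have "m = mon l" by (auto simp: in_keys_iff monom_of_def lookup_single when_def split: if_splits)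
      then show "std_mon ls (perp L) m" using std by simp
    qed
    moreover have "Poly_Mapping.lookup ?f (mon l) = (\<Sum>l'\<in>words ?k s. if l' = l then a l' else 0)"
      unfolding lookup_sum
      by (intro sum.cong refl) (use mon_inj[OF _ _ l] in \<open>auto simp: monom_of_def lookup_single when_def\<close>)
    ultimately show "a l = 0" using l words(1) by simp
  qed
qed

lemma perp_perp:
  fixes V :: "('k::field ^ 'n::finite) set"
  assumes V: "vec.subspace V"
  shows "perp (perp V) = V"
proof -
  have "V \<subseteq> perp (perp V)" by (auto simp: perp_def mult.commute)
  moreover have "vec.dim (perp (perp V)) = vec.dim V"
    unfolding dim_perp[OF subspace_perp] dim_perp[OF V]
    using vec.dim_subset[of V UNIV] unfolding vec_dim_card by simp
  ultimately show ?thesis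
    using V subspace_perp by (intro vec.subspace_dim_equal[symmetric]) auto
qed

lemma dim_contract:
  fixes V :: "('k::field ^ 'n::finite) set"
  assumes V: "vec.subspace V" and g: "g \<in> V" "g $ e \<noteq> 0"
  shows "vec.dim V = Suc (vec.dim {f\<in>V. f $ e = 0})"
proof -
  let ?W = "{f\<in>V. f $ e = 0}"
  have W: "vec.subspace ?W" by (rule subspace_contract[OF V])
  obtain ls :: "'n \<Rightarrow> 'n \<Rightarrow> bool" where ls: "strict_linear_order ls" using ex_strict_linear_order by blast
  have "f = 0" if "f \<in> ?W" "supp f \<subseteq> {e}" for f using that by (auto simp: supp_def vec_eq_iff)
  then obtain B where B: "coord_basis ?W B" "B \<inter> {e} = {}"
    by (rule coord_basis_exists[OF ls W, of "{e}"]) blast+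
  then have "coord_basis V (insert e B)" using coord_basis_contract[OF V B(1) _ g] by blast
  then show ?thesis using coord_basis_card[OF V] coord_basis_card[OF W B(1)] B(2) by simp
qed

text \<open>Dropping one equation from the linear space enlarges the closure strictly; the homogenization of a
  dropped equation distinguishes the ideals.\<close>

lemma torus_ideal_chain:
  fixes L :: "('k::field ^ 'n::finite) set"
  assumes inf: "infinite (UNIV :: 'k set)" and "vec.subspace L" and "vec.dim (perp L) = r"
  shows "\<exists>C. (\<forall>i\<le>r. is_prime_ideal (C i)) \<and> (\<forall>i<r. C i \<subset> C (Suc i)) \<and> C r = torus_ideal L"
  using assms(2,3)
proof (induction r arbitrary: L)
  case 0
  then show ?case using prime_torus_ideal[OF inf] by (intro exI[of _ "\<lambda>_. torus_ideal L"]) auto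
next
  case (Suc r)
  note L = Suc.prems(1)
  let ?V = "perp L"
  have "\<exists>g e. g \<in> ?V \<and> g $ e \<noteq> 0"
  proof (rule ccontr)
    assume "\<not> ?thesis"
    then have "?V \<subseteq> {0}" by (auto simp: vec_eq_iff)
    then have "vec.dim ?V = 0" by (metis vec.dim_eq_0)
    then show False using Suc.prems(2) by simp
  qed
  then obtain g e where g: "g \<in> ?V" "g $ e \<noteq> 0" by blast
  define L' where "L' = perp {f\<in>?V. f $ e = 0}"
  have sub: "vec.subspace {f\<in>?V. f $ e = 0}" by (rule subspace_contract[OF subspace_perp])
  have L': "vec.subspace L'" unfolding L'_def by (rule subspace_perp)
  have pL': "perp L' = {f\<in>?V. f $ e = 0}" unfolding L'_def by (rule perp_perp[OF sub])
  have "vec.dim (perp L') = r"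
    unfolding pL' using dim_contract[OF subspace_perp g] Suc.prems(2) by simp
  then obtain C where C: "\<forall>i\<le>r. is_prime_ideal (C i)" "\<forall>i<r. C i \<subset> C (Suc i)" "C r = torus_ideal L'"
    using Suc.IH[OF L'] by blast
  have "L \<subseteq> L'" unfolding L'_def by (auto simp: perp_def mult.commute)
  then have "torus_ideal L' \<subseteq> torus_ideal L" unfolding torus_ideal_def by blast
  moreover have "hom_form g \<in> torus_ideal L"
    using homogenize_torus[of "linear_form g" L] g(1) by (simp add: homogenize_linear_form linear_form_vanishing)
  moreover have "hom_form g \<notin> torus_ideal L'"
  proof
    assume *: "hom_form g \<in> torus_ideal L'"
    have "(\<Sum>i\<in>UNIV. g $ i * v $ i) = 0" if v: "v \<in> L'" for v
    proof -
      have "mev (torus_point v (\<lambda>_. 1)) (lin_mon D i) = v $ i" for D i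
        unfolding mev_hvar mev_finite
        by (simp add: if_distrib[of "\<lambda>k. _ ^ k"] cong: if_cong)
      then have "mpoly_eval id (torus_point v (\<lambda>_. 1)) (hom_form g) = (\<Sum>i\<in>supp g. g $ i * v $ i)"
        by (simp add: hom_form_def id_hom.eval_sum id_hom.eval_single)
      also have "\<dots> = (\<Sum>i\<in>UNIV. g $ i * v $ i)"
        by (rule sum.mono_neutral_left) (auto simp: supp_def)
      finally show ?thesis using * v by (simp add: torus_ideal_def)
    qed
    then have "g \<in> perp L'" by (simp add: perp_def)
    then show False using g(2) unfolding pL' by simp
  qed
  ultimately have "torus_ideal L' \<subset> torus_ideal L" by blast
  then show ?case
    using C prime_torus_ideal[OF inf L]
    by (intro exI[of _ "C(Suc r := torus_ideal L)"]) (auto simp: less_Suc_eq le_Suc_eq)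
qed

text \<open>The ideal is prime, so among the prime ideals that contain it, it has the smallest height.\<close>

lemma codim_torus_ideal:
  fixes L :: "('k::field ^ 'n::finite) set"
  assumes inf: "infinite (UNIV :: 'k set)" and L: "vec.subspace L"
  shows "codim (torus_ideal L) = vec.dim (perp L)"
  unfolding codim_def
proof (rule cInf_eq_minimum)
  let ?r = "vec.dim (perp L)"
  note prime = prime_torus_ideal[OF inf L]
  obtain C where C: "\<forall>i\<le>?r. is_prime_ideal (C i)" "\<forall>i<?r. C i \<subset> C (Suc i)" "C ?r = torus_ideal L"
    using torus_ideal_chain[OF inf L refl] by blast
  have "?r \<le> CARD('n)" using dim_perp[OF L] by simp
  then have "prime_height (torus_ideal L) \<le> ?r"
    using prime_height_bounds(1)[OF prime grows_torus_ideal[OF inf L]] by (simp add: card_hvar)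
  moreover have r_le: "?r \<le> prime_height (torus_ideal L)"
    using C by (intro prime_height_bounds(2)[OF prime, of ?r C]) blast+
  ultimately show "?r \<in> {prime_height P |P. is_prime_ideal P \<and> torus_ideal L \<subseteq> P}"
    using prime by force
  fix h assume "h \<in> {prime_height P |P. is_prime_ideal P \<and> torus_ideal L \<subseteq> P}"
  then obtain P where P: "is_prime_ideal P" "torus_ideal L \<subseteq> P" "h = prime_height P" by blast
  show "?r \<le> h"
  proof (cases "P = torus_ideal L")
    case True then show ?thesis using P(3) r_le by simp
  next
    case False
    have "Suc ?r \<le> prime_height P"
      using C P False
      by (intro prime_height_bounds(2)[OF P(1), of _ "C(Suc ?r := P)"]) (auto simp: less_Suc_eq le_Suc_eq)
    then show ?thesis using P(3) by simp
  qed
qed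

section \<open>The multidegree\<close>

lemma coeff_hom_to_ac: "coeff_hom (to_ac :: 'k::field \<Rightarrow> 'k alg_closure)"
  by unfold_locales auto

interpretation ac_hom: coeff_hom "to_ac :: 'k::field \<Rightarrow> 'k alg_closure"
  by (rule coeff_hom_to_ac)

lemma eval_to_ac: "mpoly_eval to_ac (\<lambda>v. to_ac (s v)) f = to_ac (mpoly_eval id s f)"
  using hom_mpoly_eval[OF coeff_hom_to_ac coeff_hom_id, of s f] by simp

lemma geometric_points_ideal_gen:
  "p \<in> geometric_points (ideal_gen S) \<longleftrightarrow> (\<forall>f\<in>S. mpoly_eval to_ac (hcoord p) f = 0)"
proof
  assume *: "\<forall>f\<in>S. mpoly_eval to_ac (hcoord p) f = 0"
  have "ideal_gen S \<subseteq> {f. mpoly_eval to_ac (hcoord p) f = 0}"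
    by (rule ideal_gen_least) (use * in \<open>auto simp: ac_hom.eval_add ac_hom.eval_mult\<close>)
  then show "p \<in> geometric_points (ideal_gen S)" unfolding geometric_points_def by blast
next
  assume "p \<in> geometric_points (ideal_gen S)"
  then show "\<forall>f\<in>S. mpoly_eval to_ac (hcoord p) f = 0"
    unfolding geometric_points_def using ideal.span_base by blast
qed

text \<open>The equations of the section force the coordinates of the points outside \<open>\<Delta>\<close> to agree with those of
  \<open>q\<close>.\<close>

lemma section_points:
  "p \<in> geometric_points (section_ideal I \<Delta> q) \<longleftrightarrow>
    (\<forall>f\<in>I. mpoly_eval to_ac (hcoord p) f = 0) \<and>
    (\<forall>i. i \<notin> \<Delta> \<longrightarrow> p i = (case q i of Fin a \<Rightarrow> Fin (to_ac a) | Infty \<Rightarrow> Infty))"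
proof -
  have "mpoly_eval to_ac (hcoord p) (Const (hcoord q (yv i)) * Var (xv i) - Const (hcoord q (xv i)) * Var (yv i)) = 0
      \<longleftrightarrow> p i = (case q i of Fin a \<Rightarrow> Fin (to_ac a) | Infty \<Rightarrow> Infty)" for i
    by (cases "p i"; cases "q i") (simp_all add: ac_hom.eval_diff ac_hom.eval_mult ac_hom.eval_minus ac_hom.hom_0 ac_hom.hom_1)
  then show ?thesis unfolding section_ideal_def geometric_points_ideal_gen by blast
qed

lemma multihomogeneous_hom_form: "multihomogeneous (hom_form a)"
  unfolding multihomogeneous_def
proof (intro exI ballI allI)
  fix m i assume "m \<in> Poly_Mapping.keys (hom_form a)"
  then obtain j where "j \<in> supp a" "m = lin_mon (supp a) j" by (auto simp: keys_hom_form)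
  then show "Poly_Mapping.lookup m (xv i) + Poly_Mapping.lookup m (yv i) = (if i \<in> supp a then 1 else 0)"
    by auto
qed

text \<open>A nonzero polynomial is nonzero at some \<open>(v\<^sub>i y\<^sub>i, y\<^sub>i)\<close>, because all monomials are standard when \<open>L\<close> is
  the whole space; by multihomogeneity \<open>y\<close> can be replaced by 1.\<close>

lemma multihomogeneous_nonvanishing:
  fixes g :: "('n::finite hvar, 'k::field) mpoly"
  assumes inf: "infinite (UNIV :: 'k set)" and g: "g \<noteq> 0" "multihomogeneous g"
  shows "\<exists>v. mpoly_eval id (torus_point v (\<lambda>_. 1)) g \<noteq> 0"
proof -
  obtain ls :: "'n \<Rightarrow> 'n \<Rightarrow> bool" where ls: "strict_linear_order ls" using ex_strict_linear_order by blast
  have "perp (UNIV :: ('k ^ 'n) set) = {0}"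
    using perp_perp[OF vec.subspace_single_0] by (simp add: perp_def)
  then have "std_mon ls (perp (UNIV :: ('k ^ 'n) set)) m" for m
    by (simp add: std_mon_def standard_def initial_in_def)
  then have "g \<notin> torus_ideal UNIV"
    using standard_monomials_independent[OF inf ls vec.subspace_UNIV] g(1) by blast
  then obtain v y where vy: "mpoly_eval id (torus_point v y) g \<noteq> 0" unfolding torus_ideal_def by blast
  obtain e where e: "\<And>m i. m \<in> Poly_Mapping.keys g \<Longrightarrow> Poly_Mapping.lookup m (xv i) + Poly_Mapping.lookup m (yv i) = e i"
    using g(2) unfolding multihomogeneous_def by metis
  have "mpoly_eval id (torus_point v y) g = (\<Prod>i\<in>UNIV. y i ^ e i) * mpoly_eval id (torus_point v (\<lambda>_. 1)) g"
    unfolding id_hom.eval_superset[OF finite_keys order_refl] sum_distrib_left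
  proof (intro sum.cong refl)
    fix m assume "m \<in> Poly_Mapping.keys g"
    then show "id (Poly_Mapping.lookup g m) * mev (torus_point v y) m =
      (\<Prod>i\<in>UNIV. y i ^ e i) * (id (Poly_Mapping.lookup g m) * mev (torus_point v (\<lambda>_. 1)) m)"
      unfolding mev_torus_point by (simp add: mev_finite[of _ "xpart m + ypart m"] lookup_add e)
  qed
  then show ?thesis using vy by auto
qed

lemma hcoord_Fin: "hcoord (\<lambda>i. Fin (v $ i)) = torus_point v (\<lambda>_. 1)"
  by (rule ext, rename_tac w, case_tac w) auto

text \<open>Two nonempty open subsets of the product of projective lines meet already in affine space.\<close>

lemma common_nonvanishing:
  fixes g h :: "('n::finite hvar, 'k::field) mpoly"
  assumes inf: "infinite (UNIV :: 'k set)"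
    and g: "g \<noteq> 0" "multihomogeneous g" and h: "h \<noteq> 0" "multihomogeneous h"
  shows "\<exists>q. mpoly_eval id (hcoord q) g \<noteq> 0 \<and> mpoly_eval id (hcoord q) h \<noteq> 0"
proof (rule ccontr)
  assume no: "\<not> ?thesis"
  let ?P = "range (\<lambda>v :: 'k ^ 'n. torus_point v (\<lambda>_. 1))"
  have "(\<forall>p\<in>?P. mpoly_eval id p g = 0) \<or> (\<forall>p\<in>?P. mpoly_eval id p h = 0)"
  proof (rule eval_product_zero[OF inf])
    fix p q t assume "p \<in> ?P" "q \<in> ?P"
    then obtain v w where "p = torus_point v (\<lambda>_. 1)" "q = torus_point w (\<lambda>_. 1)" by blast
    then have "(\<lambda>u. p u + t * (q u - p u)) = torus_point (v + t *s (w - v)) (\<lambda>_. 1)"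
      by (intro ext, rename_tac u, case_tac u) auto
    then show "(\<lambda>u. p u + t * (q u - p u)) \<in> ?P" by blast
  next
    fix p assume "p \<in> ?P"
    then obtain v where "p = hcoord (\<lambda>i. Fin (v $ i))" unfolding hcoord_Fin by blast
    then show "mpoly_eval id p g * mpoly_eval id p h = 0" using no by auto
  qed
  then show False
    using multihomogeneous_nonvanishing[OF inf g] multihomogeneous_nonvanishing[OF inf h] by blast
qed

text \<open>The count on one nonempty open set determines the section number, since any two such sets meet.\<close>

lemma section_numberI:
  fixes I :: "('n::finite hvar, 'k::field) mpoly set"
  assumes inf: "infinite (UNIV :: 'k set)" and g: "g \<noteq> 0" "multihomogeneous g"
    and "\<And>m. m \<in> Poly_Mapping.keys g \<Longrightarrow> Poly_Mapping.keys m \<subseteq> xv ` (- \<Delta>) \<union> yv ` (- \<Delta>)"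
    and N: "\<And>q. mpoly_eval id (hcoord q) g \<noteq> 0 \<Longrightarrow>
       finite (geometric_points (section_ideal I \<Delta> q)) \<and>
       (\<Sum>p\<in>geometric_points (section_ideal I \<Delta> q). point_multiplicity (section_ideal I \<Delta> q) p) = N"
  shows "section_number I \<Delta> = N"
  unfolding section_number_def
proof (rule the_equality)
  show "\<exists>g. g \<noteq> 0 \<and> multihomogeneous g \<and>
    (\<forall>m\<in>Poly_Mapping.keys g. Poly_Mapping.keys m \<subseteq> xv ` (- \<Delta>) \<union> yv ` (- \<Delta>)) \<and>
    (\<forall>q. mpoly_eval id (hcoord q) g \<noteq> 0 \<longrightarrow>
       finite (geometric_points (section_ideal I \<Delta> q)) \<and>
       (\<Sum>p\<in>geometric_points (section_ideal I \<Delta> q). point_multiplicity (section_ideal I \<Delta> q) p) = N)"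
    using assms by blast
next
  fix N'
  assume "\<exists>g. g \<noteq> 0 \<and> multihomogeneous g \<and>
    (\<forall>m\<in>Poly_Mapping.keys g. Poly_Mapping.keys m \<subseteq> xv ` (- \<Delta>) \<union> yv ` (- \<Delta>)) \<and>
    (\<forall>q. mpoly_eval id (hcoord q) g \<noteq> 0 \<longrightarrow>
       finite (geometric_points (section_ideal I \<Delta> q)) \<and>
       (\<Sum>p\<in>geometric_points (section_ideal I \<Delta> q). point_multiplicity (section_ideal I \<Delta> q) p) = N')"
  then obtain h where h: "h \<noteq> 0" "multihomogeneous h" "\<And>q. mpoly_eval id (hcoord q) h \<noteq> 0 \<Longrightarrow>
       (\<Sum>p\<in>geometric_points (section_ideal I \<Delta> q). point_multiplicity (section_ideal I \<Delta> q) p) = N'"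
    by blast
  obtain q where q: "mpoly_eval id (hcoord q) g \<noteq> 0" "mpoly_eval id (hcoord q) h \<noteq> 0"
    using common_nonvanishing[OF inf g h(1,2)] by blast
  show "N' = N" using h(3)[OF q(2)] N[OF q(1)] by simp
qed

lemma mev_lin_mon:
  fixes s :: "'n::finite hvar \<Rightarrow> 'b::comm_ring_1"
  shows "mev s (lin_mon D i) = s (xv i) * (\<Prod>j\<in>D - {i}. s (yv j))"
proof -
  have 1: "mev (\<lambda>i. s (xv i)) (xpart (lin_mon D i)) = s (xv i)"
  proof -
    have "mev (\<lambda>i. s (xv i)) (xpart (lin_mon D i)) = (\<Prod>j\<in>UNIV. if j = i then s (xv j) else 1)"
      unfolding mev_finite by (intro prod.cong refl) simp
    then show ?thesis by simp
  qed
  have 2: "mev (\<lambda>i. s (yv i)) (ypart (lin_mon D i)) = (\<Prod>j\<in>D - {i}. s (yv j))"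
  proof -
    have "mev (\<lambda>i. s (yv i)) (ypart (lin_mon D i)) = (\<Prod>j\<in>UNIV. if j \<in> D - {i} then s (yv j) else 1)"
      unfolding mev_finite by (intro prod.cong refl) simp
    also have "\<dots> = (\<Prod>j\<in>D - {i}. s (yv j))"
      by (rule prod.mono_neutral_cong_right) auto
    finally show ?thesis .
  qed
  show ?thesis unfolding mev_hvar 1 2 ..
qed

lemma (in coeff_hom) eval_hom_form:
  assumes "\<And>j. j \<in> supp a \<Longrightarrow> s (yv j) = 1"
  shows "mpoly_eval h s (hom_form a) = (\<Sum>i\<in>supp a. h (a $ i) * s (xv i))"
  unfolding hom_form_def eval_sum eval_single mev_lin_mon
  by (intro sum.cong refl) (simp add: assms)

lemma lookup_0_eval: "Poly_Mapping.lookup f 0 = mpoly_eval id (\<lambda>_. 0) f"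
  for f :: "('v, 'a::comm_ring_1) mpoly"
proof (induction f rule: mpoly_induct)
  case (single m c)
  show ?case
  proof (cases "m = 0")
    case False
    then obtain v where "Poly_Mapping.lookup m v \<noteq> 0" by (metis lookup_zero poly_mapping_eqI)
    then have "mev (\<lambda>_. 0 :: 'a) m = 0" by (intro mev_zero[of _ v]) auto
    then show ?thesis using False unfolding id_hom.eval_single by (simp add: lookup_single when_def)
  next
    case True
    then show ?thesis unfolding id_hom.eval_single by simp
  qed
next
  case zero
  show ?case by (simp only: id_hom.eval_0 lookup_zero)
next
  case (add f g)
  then show ?case by (simp only: lookup_add id_hom.eval_add)
qed

text \<open>The constants are a complement of the maximal ideal of the origin.\<close>

lemma quotient_dim_maximal:
  "quotient_dim {f :: ('v, 'f::field) mpoly. Poly_Mapping.lookup f 0 = 0} = 1"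
  unfolding quotient_dim_def
proof (rule the_equality)
  let ?m = "{f :: ('v, 'f) mpoly. Poly_Mapping.lookup f 0 = 0}"
  show "\<exists>B. finite B \<and> card B = 1 \<and> \<not> mpoly_vs.dependent B \<and> mpoly_vs.span B \<inter> ?m = {0} \<and>
    (\<forall>f. \<exists>g\<in>mpoly_vs.span B. f - g \<in> ?m)"
  proof (intro exI[of _ "{1}"] conjI allI)
    show "\<not> mpoly_vs.dependent {1 :: ('v, 'f) mpoly}"
      using mpoly_vs.independent_insert[of 1 "{}"] mpoly_vs.independent_empty by simp
    show "mpoly_vs.span {1} \<inter> ?m = {0}"
      unfolding mpoly_vs.span_singleton
      by (auto simp: Const_def lookup_single intro: image_eqI[where x = 0])
    fix f :: "('v, 'f) mpoly"
    show "\<exists>g\<in>mpoly_vs.span {1}. f - g \<in> ?m"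
      unfolding mpoly_vs.span_singleton
      by (intro bexI[of _ "Const (Poly_Mapping.lookup f 0) * 1"]) (auto simp: lookup_minus Const_def)
  qed auto
  fix d
  assume "\<exists>B. finite B \<and> card B = d \<and> \<not> mpoly_vs.dependent B \<and> mpoly_vs.span B \<inter> ?m = {0} \<and>
    (\<forall>f. \<exists>g\<in>mpoly_vs.span B. f - g \<in> ?m)"
  then obtain B where B: "finite B" "card B = d" "\<not> mpoly_vs.dependent B" "mpoly_vs.span B \<inter> ?m = {0}"
    "\<And>f. \<exists>g\<in>mpoly_vs.span B. f - g \<in> ?m" by blast
  have "B \<noteq> {}"
  proof
    assume "B = {}"
    then show False using B(5)[of 1] by (simp add: lookup_minus)
  qed
  then obtain a where a: "a \<in> B" by blast
  have nz: "Poly_Mapping.lookup x 0 \<noteq> 0" if "x \<in> B" for x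
  proof
    assume "Poly_Mapping.lookup x 0 = 0"
    then have "x \<in> mpoly_vs.span B \<inter> ?m" using that mpoly_vs.span_base by blast
    then have "0 \<in> B" using B(4) that by auto
    then show False using B(3) mpoly_vs.dependent_zero by blast
  qed
  have "b = a" if b: "b \<in> B" for b
  proof (rule ccontr)
    assume "b \<noteq> a"
    let ?c = "Poly_Mapping.lookup b 0 / Poly_Mapping.lookup a 0"
    have "b - Const ?c * a \<in> mpoly_vs.span B"
      using a b by (intro mpoly_vs.span_diff mpoly_vs.span_scale mpoly_vs.span_base)
    moreover have "b - Const ?c * a \<in> ?m" using nz[OF a] by (simp add: lookup_minus)
    ultimately have "b - Const ?c * a = 0" using B(4) by blast
    then have "b = Const ?c * a" by simp
    moreover have "Const ?c * a \<in> mpoly_vs.span (B - {b})"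
      using a \<open>b \<noteq> a\<close> by (intro mpoly_vs.span_scale mpoly_vs.span_base) auto
    ultimately have "mpoly_vs.dependent B" unfolding mpoly_vs.dependent_def using b by metis
    then show False using B(3) by blast
  qed
  then have "B = {a}" using a by blast
  then show "d = 1" using B(2) by simp
qed

text \<open>On the open set where all \<open>y\<^sub>i\<close> with \<open>i \<notin> B\<close> are nonzero, the section prescribes the coordinates outside
  \<open>B\<close>. There is exactly one \<open>v \<in> L\<close> with these coordinates, and the equations with the fundamental
  cocircuits as supports show that \<open>v\<close> is the only point: a point at infinity at \<open>b \<in> B\<close> makes the equation
  of \<open>b\<close> equal to \<open>1 = 0\<close>. In local coordinates at \<open>v\<close> these equations and those of the section generate the
  maximal ideal, so the multiplicity is 1.\<close>

lemma section_number_basis: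
  fixes L :: "('k::field ^ 'n::finite) set"
  assumes inf: "infinite (UNIV :: 'k set)" and L: "vec.subspace L" and B: "coord_basis (perp L) B"
  shows "section_number (torus_ideal L) B = 1"
proof -
  let ?V = "perp L"
  \<comment> \<open>the open set on which the coordinates outside \<open>B\<close> are finite\<close>
  define w where "w = (\<Sum>i\<in>- B. Poly_Mapping.single (yv i) (1::nat))"
  have lw: "Poly_Mapping.lookup w (xv i) = 0" "Poly_Mapping.lookup w (yv i) = (if i \<notin> B then 1 else 0)" for i
    by (auto simp: w_def lookup_sum lookup_single when_def)
  have B': "coord_indep ?V B" using B by (simp add: coord_basis_def)
  have LB: "coord_indep L (- B)"
    using coord_basis_perp[OF subspace_perp B] perp_perp[OF L] by (simp add: coord_basis_def)
  show ?thesis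
  proof (rule section_numberI[OF inf, of "monom_of w"])
    show "monom_of w \<noteq> (0 :: ('n hvar, 'k) mpoly)" by (metis keys_monom_of keys_zero insert_not_empty)
    show "multihomogeneous (monom_of w :: ('n hvar, 'k) mpoly)"
      unfolding multihomogeneous_def keys_monom_of
      by (intro exI[of _ "\<lambda>i. Poly_Mapping.lookup w (xv i) + Poly_Mapping.lookup w (yv i)"]) simp
    show "Poly_Mapping.keys m \<subseteq> xv ` (- B) \<union> yv ` (- B)"
      if "m \<in> Poly_Mapping.keys (monom_of w :: ('n hvar, 'k) mpoly)" for m
    proof
      fix u assume "u \<in> Poly_Mapping.keys m"
      then have "Poly_Mapping.lookup w u \<noteq> 0" using that by (simp add: in_keys_iff)
      then show "u \<in> xv ` (- B) \<union> yv ` (- B)" by (cases u) (auto simp: lw split: if_splits)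
    qed
    fix q :: "'n \<Rightarrow> 'k P1" assume "mpoly_eval id (hcoord q) (monom_of w) \<noteq> 0"
    then have "mev (hcoord q) w \<noteq> 0" by simp
    then have "hcoord q (yv i) \<noteq> 0" if "i \<notin> B" for i
      using mev_zero[of "hcoord q" "yv i" w] that by (auto simp: lw)
    then have "\<exists>a. q i = Fin a" if "i \<notin> B" for i using that by (cases "q i") force+
    then obtain a where a: "\<And>i. i \<notin> B \<Longrightarrow> q i = Fin (a i)" by metis
    obtain v where v: "v \<in> L" "\<And>i. i \<notin> B \<Longrightarrow> v $ i = a i"
      using coord_interpolation[OF L LB, where w = a] by blast
    define p0 where "p0 i = Fin (to_ac (v $ i))" for i
    let ?J = "section_ideal (torus_ideal L) B q"
    have h0: "hcoord p0 = (\<lambda>u. to_ac (torus_point v (\<lambda>_. 1) u))"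
      by (rule ext, rename_tac u, case_tac u) (auto simp: p0_def ac_hom.hom_1)
    have p0: "p0 \<in> geometric_points ?J"
      unfolding section_points
    proof (intro conjI ballI allI impI)
      show "mpoly_eval to_ac (hcoord p0) f = 0" if "f \<in> torus_ideal L" for f
        using that v(1) unfolding h0 eval_to_ac torus_ideal_def by (simp add: ac_hom.hom_0)
      show "p0 i = (case q i of Fin a \<Rightarrow> Fin (to_ac a) | Infty \<Rightarrow> Infty)" if "i \<notin> B" for i
        using a[OF that] v(2)[OF that] by (simp add: p0_def)
    qed
    have form: "hom_form (dual_vec ?V B b) \<in> torus_ideal L" "supp (dual_vec ?V B b) \<subseteq> insert b (- B)"
      "(\<Sum>i\<in>supp (dual_vec ?V B b). dual_vec ?V B b $ i * v $ i) = 0" "b \<in> supp (dual_vec ?V B b)"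
      if b: "b \<in> B" for b
    proof -
      note d = dual_vec[OF B' b]
      show "hom_form (dual_vec ?V B b) \<in> torus_ideal L"
        using homogenize_torus[of "linear_form (dual_vec ?V B b)" L] d(1)
        by (simp add: homogenize_linear_form linear_form_vanishing)
      show "supp (dual_vec ?V B b) \<subseteq> insert b (- B)" using d(3) by (auto simp: supp_def)
      show "b \<in> supp (dual_vec ?V B b)" using d(2) by (simp add: supp_def)
      have "(\<Sum>i\<in>supp (dual_vec ?V B b). dual_vec ?V B b $ i * v $ i)
          = (\<Sum>i\<in>UNIV. dual_vec ?V B b $ i * v $ i)"
        by (rule sum.mono_neutral_left) (auto simp: supp_def)
      also have "\<dots> = 0" using d(1) v(1) by (simp add: perp_def)
      finally show "(\<Sum>i\<in>supp (dual_vec ?V B b). dual_vec ?V B b $ i * v $ i) = 0" .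
    qed
    have unique: "p = p0" if p: "p \<in> geometric_points ?J" for p
    proof
      fix b
      have out: "p i = Fin (to_ac (v $ i))" if "i \<notin> B" for i
        using p a[OF that] v(2)[OF that] that unfolding section_points by simp
      show "p b = p0 b"
      proof (cases "b \<in> B")
        case False then show ?thesis using out by (simp add: p0_def)
      next
        case True
        note f = form[OF True] and d = dual_vec[OF B' True]
        let ?d = "dual_vec ?V B b"
        have 0: "mpoly_eval to_ac (hcoord p) (hom_form ?d) = 0"
          using p f(1) unfolding section_points by blast
        have y: "hcoord p (yv j) = 1" if "j \<in> supp ?d" "j \<noteq> b" for j
        proof -
          have "j \<notin> B" using that f(2) by blast
          then show ?thesis using out by simp
        qed
        have x: "hcoord p (xv i) = to_ac (v $ i)" if "i \<in> supp ?d - {b}" for i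
        proof -
          have "i \<notin> B" using that f(2) by blast
          then show ?thesis using out by simp
        qed
        show ?thesis
        proof (cases "p b")
          case Infty
          \<comment> \<open>every term contains \<open>y\<^sub>b = 0\<close> except the one with \<open>x\<^sub>b\<close>, which is 1\<close>
          have "mpoly_eval to_ac (hcoord p) (hom_form ?d)
              = (\<Sum>i\<in>supp ?d. to_ac (?d $ i) * mev (hcoord p) (lin_mon (supp ?d) i))"
            by (simp add: hom_form_def ac_hom.eval_sum ac_hom.eval_single)
          also have "\<dots> = (\<Sum>i\<in>supp ?d. if i = b then 1 else 0)"
          proof (intro sum.cong refl)
            fix i assume i: "i \<in> supp ?d"
            show "to_ac (?d $ i) * mev (hcoord p) (lin_mon (supp ?d) i) = (if i = b then 1 else 0)"
            proof (cases "i = b")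
              case True
              have "(\<Prod>j\<in>supp ?d - {b}. hcoord p (yv j)) = 1" using y by (intro prod.neutral) auto
              then show ?thesis using True d(2) Infty by (simp add: mev_lin_mon ac_hom.hom_1)
            next
              case False
              have "(\<Prod>j\<in>supp ?d - {i}. hcoord p (yv j)) = 0"
                using False f(4) Infty by (intro prod_zero) (auto intro!: bexI[of _ b])
              then show ?thesis using False by (simp add: mev_lin_mon)
            qed
          qed
          also have "\<dots> = 1" using f(4) by simp
          finally show ?thesis using 0 by simp
        next
          case (Fin c)
          have y': "hcoord p (yv j) = 1" if "j \<in> supp ?d" for j
            using y[OF that] Fin by (cases "j = b") auto
          have "0 = (\<Sum>i\<in>supp ?d. to_ac (?d $ i) * hcoord p (xv i))"
            using 0 ac_hom.eval_hom_form[of ?d "hcoord p", OF y'] by simp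
          also have "\<dots> = c + (\<Sum>i\<in>supp ?d - {b}. to_ac (?d $ i) * to_ac (v $ i))"
            using f(4) d(2) Fin x by (subst sum.remove[of _ b]) (auto simp: ac_hom.hom_1)
          finally have 1: "c + (\<Sum>i\<in>supp ?d - {b}. to_ac (?d $ i) * to_ac (v $ i)) = 0" by simp
          have "v $ b + (\<Sum>i\<in>supp ?d - {b}. ?d $ i * v $ i) = 0"
            using f(3,4) d(2) by (subst (asm) sum.remove[of _ b]) auto
          then have "to_ac (v $ b + (\<Sum>i\<in>supp ?d - {b}. ?d $ i * v $ i)) = 0" by (simp add: ac_hom.hom_0)
          then have "to_ac (v $ b) + (\<Sum>i\<in>supp ?d - {b}. to_ac (?d $ i) * to_ac (v $ i)) = 0"
            by (simp only: ac_hom.hom_add ac_hom.hom_sum ac_hom.hom_mult)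
          then have "c = to_ac (v $ b)" using 1 by (metis add_right_imp_eq)
          then show ?thesis using Fin by (simp add: p0_def)
        qed
      qed
    qed
    \<comment> \<open>dehomogenization in the chart around \<open>p0\<close>, with \<open>p0\<close> moved to the origin\<close>
    define \<Phi> where "\<Phi> f = mpoly_eval (\<lambda>c. Const (to_ac c) :: ('n, 'k alg_closure) mpoly) (local_coord p0) f" for f
    have hom: "coeff_hom (\<lambda>c. Const (to_ac (c :: 'k)) :: ('n, 'k alg_closure) mpoly)"
      by (rule coeff_hom_comp[OF Const_hom.coeff_hom_axioms coeff_hom_to_ac])
    let ?m = "{f :: ('n, 'k alg_closure) mpoly. Poly_Mapping.lookup f 0 = 0}"
    have "ideal_gen (\<Phi> ` ?J) \<subseteq> ?m"
    proof (rule ideal_gen_least)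
      show "\<Phi> ` ?J \<subseteq> ?m"
      proof clarify
        fix f assume f: "f \<in> ?J"
        have "(\<lambda>u. mpoly_eval id (\<lambda>_. 0) (local_coord p0 u)) = hcoord p0"
          by (rule ext, rename_tac u, case_tac u) (auto simp: p0_def id_hom.eval_add)
        then have "Poly_Mapping.lookup (\<Phi> f) 0 = mpoly_eval to_ac (hcoord p0) f"
          unfolding lookup_0_eval \<Phi>_def hom_mpoly_eval[OF id_hom.coeff_hom_eval hom] by simp
        also have "\<dots> = 0" using p0 f unfolding geometric_points_def by blast
        finally show "Poly_Mapping.lookup (\<Phi> f) 0 = 0" .
      qed
    qed (auto simp: lookup_0_eval id_hom.eval_mult id_hom.eval_add)
    moreover have "?m \<subseteq> ideal_gen (\<Phi> ` ?J)"
    proof -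
      have base: "\<Phi> f \<in> ideal_gen (\<Phi> ` ?J)" if "f \<in> ?J" for f using that by (intro ideal.span_base) blast
      have J1: "f \<in> ?J" if "f \<in> torus_ideal L" for f
        unfolding section_ideal_def using that by (intro ideal.span_base) blast
      have out: "Var i \<in> ideal_gen (\<Phi> ` ?J)" if i: "i \<notin> B" for i
      proof -
        let ?g = "Const (hcoord q (yv i)) * Var (xv i) - Const (hcoord q (xv i)) * Var (yv i)"
        have "?g \<in> ?J" unfolding section_ideal_def using i by (intro ideal.span_base) blast
        moreover have "\<Phi> ?g = Var i"
          unfolding \<Phi>_def coeff_hom.eval_diff[OF hom] coeff_hom.eval_mult[OF hom]
            coeff_hom.eval_Const[OF hom] coeff_hom.eval_Var[OF hom]
          using a[OF i] v(2)[OF i] by (simp add: p0_def ac_hom.hom_1)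
        ultimately show ?thesis using base by metis
      qed
      have "Var i \<in> ideal_gen (\<Phi> ` ?J)" for i
      proof (cases "i \<in> B")
        case True
        note f = form[OF True] and d = dual_vec[OF B' True]
        let ?d = "dual_vec ?V B i"
        have "\<Phi> (hom_form ?d) = (\<Sum>j\<in>supp ?d. Const (to_ac (?d $ j)) * (Var j + Const (to_ac (v $ j))))"
          unfolding \<Phi>_def by (subst coeff_hom.eval_hom_form[OF hom]) (auto simp: p0_def)
        also have "\<dots> = (\<Sum>j\<in>supp ?d. Const (to_ac (?d $ j)) * Var j) + Const (to_ac (\<Sum>j\<in>supp ?d. ?d $ j * v $ j))"
          by (simp add: distrib_left sum.distrib Const_sum Const_mult ac_hom.hom_sum ac_hom.hom_mult)
        also have "\<dots> = (\<Sum>j\<in>supp ?d. Const (to_ac (?d $ j)) * Var j)"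
          unfolding f(3) by (simp add: ac_hom.hom_0)
        also have "\<dots> = Var i + (\<Sum>j\<in>supp ?d - {i}. Const (to_ac (?d $ j)) * Var j)"
          using f(4) d(2) by (subst sum.remove[of _ i]) (auto simp: ac_hom.hom_1)
        finally have eq: "Var i = \<Phi> (hom_form ?d) - (\<Sum>j\<in>supp ?d - {i}. Const (to_ac (?d $ j)) * Var j)"
          by simp
        have "(\<Sum>j\<in>supp ?d - {i}. Const (to_ac (?d $ j)) * Var j) \<in> ideal_gen (\<Phi> ` ?J)"
          using f(2) out by (intro ideal.span_sum ideal_gen_mult_left) blast
        then show ?thesis unfolding eq by (intro ideal.span_diff base J1 f(1))
      qed (rule out)
      then have "ideal_gen (Var ` UNIV) \<subseteq> ideal_gen (\<Phi> ` ?J)" by (intro ideal.span_minimal) auto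
      moreover have "?m \<subseteq> ideal_gen (Var ` UNIV)"
      proof
        fix f :: "('n, 'k alg_closure) mpoly" assume f: "f \<in> ?m"
        have "\<exists>v. Poly_Mapping.lookup m v \<noteq> 0" if "m \<in> Poly_Mapping.keys f" for m
        proof (rule ccontr)
          assume "\<not> ?thesis"
          then have "m = 0" by (intro poly_mapping_eqI) simp
          then show False using that f by (simp add: in_keys_iff)
        qed
        then show "f \<in> ideal_gen (Var ` UNIV)" unfolding mem_variable_ideal by blast
      qed
      ultimately show ?thesis by blast
    qed
    ultimately have J: "ideal_gen (\<Phi> ` ?J) = ?m" by blast
    have "local_kernel ?J p0 = ?m"
    proof -
      have "local_kernel ?J p0 = {f. \<exists>u. Poly_Mapping.lookup u 0 \<noteq> 0 \<and> u * f \<in> ideal_gen (\<Phi> ` ?J)}"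
        unfolding local_kernel_def \<Phi>_def ..
      also have "\<dots> = ?m"
        unfolding J by (auto simp: lookup_0_eval id_hom.eval_mult intro: exI[of _ 1])
      finally show ?thesis .
    qed
    then have "point_multiplicity ?J p0 = 1"
      unfolding point_multiplicity_def by (simp add: quotient_dim_maximal)
    moreover have "geometric_points ?J = {p0}" using p0 unique by blast
    ultimately show "finite (geometric_points ?J) \<and> (\<Sum>p\<in>geometric_points ?J. point_multiplicity ?J p) = 1"
      by simp
  qed
qed

text \<open>Some nonzero form that vanishes on \<open>L\<close> is supported outside \<open>\<Delta>\<close>. Its homogenization is an equation of the closure
  that involves only the prescribed coordinates, and it fails for general \<open>q\<close>.\<close>

lemma section_number_dependent:
  fixes L :: "('k::field ^ 'n::finite) set"
  assumes inf: "infinite (UNIV :: 'k set)" and L: "vec.subspace L"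
    and card: "card \<Delta> = vec.dim (perp L)" and dep: "\<not> coord_basis (perp L) \<Delta>"
  shows "section_number (torus_ideal L) \<Delta> = 0"
proof -
  have "\<not> (\<exists>B\<in>coord_matroid (perp L). - \<Delta> \<subseteq> - B)"
  proof
    assume "\<exists>B\<in>coord_matroid (perp L). - \<Delta> \<subseteq> - B"
    then obtain B where B: "coord_basis (perp L) B" "B \<subseteq> \<Delta>" unfolding coord_matroid_def by blast
    then have "B = \<Delta>" using coord_basis_card[OF subspace_perp B(1)] card by (simp add: card_subset_eq)
    then show False using B dep by simp
  qed
  then obtain f where f: "f \<in> perp L" "supp f \<subseteq> - \<Delta>" "f \<noteq> 0"
    unfolding avoiding_basis_iff[OF subspace_perp] by blast
  have ft: "hom_form f \<in> torus_ideal L"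
    using homogenize_torus[of "linear_form f" L] f(1) by (simp add: homogenize_linear_form linear_form_vanishing)
  show ?thesis
  proof (rule section_numberI[OF inf _ multihomogeneous_hom_form[of f]])
    show "hom_form f \<noteq> 0" using f(3) keys_hom_form[of f] by (metis image_is_empty keys_zero supp_eq_empty)
    show "Poly_Mapping.keys m \<subseteq> xv ` (- \<Delta>) \<union> yv ` (- \<Delta>)" if "m \<in> Poly_Mapping.keys (hom_form f)" for m
    proof
      fix u assume u: "u \<in> Poly_Mapping.keys m"
      obtain j where "j \<in> supp f" "m = lin_mon (supp f) j" using \<open>m \<in> _\<close> by (auto simp: keys_hom_form)
      then show "u \<in> xv ` (- \<Delta>) \<union> yv ` (- \<Delta>)"
        using u f(2) by (cases u) (auto simp: in_keys_iff split: if_splits)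
    qed
    fix q :: "'n \<Rightarrow> 'k P1" assume q: "mpoly_eval id (hcoord q) (hom_form f) \<noteq> 0"
    have "p \<notin> geometric_points (section_ideal (torus_ideal L) \<Delta> q)" for p
    proof
      assume p: "p \<in> geometric_points (section_ideal (torus_ideal L) \<Delta> q)"
      have pq: "hcoord p (xv i) = to_ac (hcoord q (xv i))" "hcoord p (yv i) = to_ac (hcoord q (yv i))"
        if "i \<in> supp f" for i
        using p f(2) that unfolding section_points
        by (cases "q i"; force simp: ac_hom.hom_0 ac_hom.hom_1)+
      have "mev (hcoord p) (lin_mon (supp f) i) = to_ac (mev (hcoord q) (lin_mon (supp f) i))" if "i \<in> supp f" for i
        unfolding mev_lin_mon by (simp add: pq that ac_hom.hom_mult ac_hom.hom_prod del: hcoord.simps)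
      then have "mpoly_eval to_ac (hcoord p) (hom_form f) = to_ac (mpoly_eval id (hcoord q) (hom_form f))"
        by (simp add: hom_form_def ac_hom.eval_sum ac_hom.eval_single id_hom.eval_sum id_hom.eval_single
            ac_hom.hom_sum ac_hom.hom_mult)
      moreover have "mpoly_eval to_ac (hcoord p) (hom_form f) = 0"
        using p ft unfolding section_points by blast
      ultimately show False using q by simp
    qed
    then have "geometric_points (section_ideal (torus_ideal L) \<Delta> q) = {}" by blast
    then show "finite (geometric_points (section_ideal (torus_ideal L) \<Delta> q)) \<and>
      (\<Sum>p\<in>geometric_points (section_ideal (torus_ideal L) \<Delta> q).
        point_multiplicity (section_ideal (torus_ideal L) \<Delta> q) p) = 0"
      by simp
  qed
qed

lemma multidegree_torus_ideal:
  fixes L :: "('k::field ^ 'n::finite) set"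
  assumes inf: "infinite (UNIV :: 'k set)" and L: "vec.subspace L"
  shows "multidegree (torus_ideal L) = (\<Sum>B\<in>coord_matroid (perp L). \<Prod>b\<in>B. Var b)"
  unfolding multidegree_def codim_torus_ideal[OF inf L]
proof (rule sum.mono_neutral_cong_right)
  show "coord_matroid (perp L) \<subseteq> {\<Delta>. card \<Delta> = vec.dim (perp L)}"
    using coord_basis_card[OF subspace_perp[of L]] by (auto simp: coord_matroid_def)
  show "\<forall>\<Delta>\<in>{\<Delta>. card \<Delta> = vec.dim (perp L)} - coord_matroid (perp L).
    of_nat (section_number (torus_ideal L) \<Delta>) * (\<Prod>i\<in>\<Delta>. Var i) = (0 :: ('n, int) mpoly)"
    using section_number_dependent[OF inf L] by (auto simp: coord_matroid_def)
  show "of_nat (section_number (torus_ideal L) B) * (\<Prod>i\<in>B. Var i) = (\<Prod>b\<in>B. Var b :: ('n, int) mpoly)"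
    if "B \<in> coord_matroid (perp L)" for B
    using section_number_basis[OF inf L] that by (simp add: coord_matroid_def)
qed simp

section \<open>Dickson's lemma and the Hilbert basis theorem\<close>

text \<open>A monotone subsequence exists; if it is decreasing, it is eventually constant.\<close>

lemma nat_mono_subseq: "\<exists>f :: nat \<Rightarrow> nat. strict_mono f \<and> mono (\<lambda>n. s (f n) :: nat)"
proof -
  obtain f :: "nat \<Rightarrow> nat" where f: "strict_mono f" "monoseq (\<lambda>n. s (f n))"
    using seq_monosub[of s] by blast
  show ?thesis
  proof (cases "incseq (\<lambda>n. s (f n))")
    case True then show ?thesis using f(1) by blast
  next
    case False
    then have dec: "decseq (\<lambda>n. s (f n))" using f(2) by (simp add: monoseq_iff)
    define k where "k = (LEAST k. \<exists>n. s (f n) = k)"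
    obtain N where N: "s (f N) = k" unfolding k_def using LeastI_ex[of "\<lambda>k. \<exists>n. s (f n) = k"] by blast
    have "s (f (n + N)) = k" for n
    proof (rule antisym)
      show "s (f (n + N)) \<le> k" using decseqD[OF dec, of N "n + N"] N by simp
      show "k \<le> s (f (n + N))" unfolding k_def by (intro Least_le) blast
    qed
    then have "mono (\<lambda>n. s (f (n + N)))" by (simp add: mono_def)
    moreover have "strict_mono (\<lambda>n. f (n + N))" using f(1) by (simp add: strict_mono_def)
    ultimately show ?thesis by (intro exI[of _ "\<lambda>n. f (n + N)"]) simp
  qed
qed

text \<open>Pass to subsequences along which the exponents of one variable after the other increase.\<close>

lemma dickson:
  fixes m :: "nat \<Rightarrow> 'v::finite mon"
  shows "\<exists>i j. i < j \<and> mdvd (m i) (m j)"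
proof -
  have "\<exists>f :: nat \<Rightarrow> nat. strict_mono f \<and> (\<forall>v\<in>S. mono (\<lambda>n. Poly_Mapping.lookup (m (f n)) v))" if "finite S" for S
    using that
  proof (induction S)
    case empty show ?case by (intro exI[of _ id]) (simp add: strict_mono_def)
  next
    case (insert u S)
    then obtain f :: "nat \<Rightarrow> nat" where f: "strict_mono f" "\<forall>v\<in>S. mono (\<lambda>n. Poly_Mapping.lookup (m (f n)) v)"
      by blast
    obtain g :: "nat \<Rightarrow> nat" where g: "strict_mono g" "mono (\<lambda>n. Poly_Mapping.lookup (m (f (g n))) u)"
      using nat_mono_subseq[of "\<lambda>n. Poly_Mapping.lookup (m (f n)) u"] by blast
    have "strict_mono (\<lambda>n. f (g n))" using f(1) g(1) by (simp add: strict_mono_def)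
    moreover have "mono (\<lambda>n. Poly_Mapping.lookup (m (f (g n))) v)" if "v \<in> S" for v
      using f(2) that strict_mono_mono[OF g(1)] by (simp add: mono_def)
    ultimately show ?case using g(2) by (intro exI[of _ "\<lambda>n. f (g n)"]) simp
  qed
  from this[of UNIV] obtain f :: "nat \<Rightarrow> nat"
    where f: "strict_mono f" "\<And>v. mono (\<lambda>n. Poly_Mapping.lookup (m (f n)) v)" by auto
  have "mdvd (m (f 0)) (m (f 1))" unfolding mdvd_iff using f(2) by (simp add: mono_def)
  moreover have "f 0 < f 1" using f(1) by (simp add: strict_mono_def)
  ultimately show ?thesis by blast
qed

text \<open>Otherwise elements of \<open>T\<close> could be picked one after the other, none of which is divisible by an earlier
  one.\<close>

lemma dickson_basis:
  fixes T :: "'v::finite mon set"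
  shows "\<exists>F. finite F \<and> F \<subseteq> T \<and> (\<forall>m\<in>T. \<exists>f\<in>F. mdvd f m)"
proof (rule ccontr)
  assume no: "\<not> ?thesis"
  define pick where "pick F = (SOME m. m \<in> T \<and> (\<forall>f\<in>F. \<not> mdvd f m))" for F
  have pick: "pick F \<in> T \<and> (\<forall>f\<in>F. \<not> mdvd f (pick F))" if "F \<subseteq> T" "finite F" for F
  proof -
    have "\<exists>m. m \<in> T \<and> (\<forall>f\<in>F. \<not> mdvd f m)"
    proof (rule ccontr)
      assume "\<not> ?thesis"
      then have "\<forall>m\<in>T. \<exists>f\<in>F. mdvd f m" by blast
      then have "\<exists>F. finite F \<and> F \<subseteq> T \<and> (\<forall>m\<in>T. \<exists>f\<in>F. mdvd f m)"
        using that by (intro exI[of _ F] conjI)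
      with no show False by contradiction
    qed
    from someI_ex[OF this] show ?thesis unfolding pick_def .
  qed
  define F where "F = rec_nat {} (\<lambda>_ F. insert (pick F) F)"
  have F_Suc: "F (Suc n) = insert (pick (F n)) (F n)" and F_0: "F 0 = {}" for n by (simp_all add: F_def)
  have F: "F n \<subseteq> T \<and> finite (F n)" for n
    by (induction n) (use pick in \<open>auto simp: F_Suc F_0\<close>)
  have "i < j \<Longrightarrow> pick (F i) \<in> F j" for i j
    by (induction j) (auto simp: F_Suc less_Suc_eq)
  then have "\<not> mdvd (pick (F i)) (pick (F j))" if "i < j" for i j
    using pick F that by blast
  then show False using dickson[of "\<lambda>n. pick (F n)"] by blast
qed

text \<open>After enumerating the variables, the order \<open>\<le>\<close> of finitely supported functions on the natural
  numbers, which is lexicographic, becomes a term order.\<close>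

lemma term_order_exists: "\<exists>tle :: 'v::finite mon \<Rightarrow> 'v mon \<Rightarrow> bool. term_order tle"
proof -
  obtain e :: "'v \<Rightarrow> nat" where e: "inj e"
    using finite_imp_inj_to_nat_seg[of "UNIV :: 'v set"] by auto
  define enc where "enc a = (\<Sum>v\<in>UNIV. Poly_Mapping.single (e v) (Poly_Mapping.lookup a v))" for a :: "'v mon"
  have lookup_enc: "Poly_Mapping.lookup (enc a) (e v) = Poly_Mapping.lookup a v" for a v
  proof -
    have "Poly_Mapping.lookup (enc a) (e v) = (\<Sum>u\<in>UNIV. if u = v then Poly_Mapping.lookup a u else 0)"
      unfolding enc_def lookup_sum lookup_single when_def using e by (intro sum.cong refl) (auto simp: inj_def)
    then show ?thesis by simp
  qed
  have add: "enc (a + b) = enc a + enc b" for a b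
    by (simp add: enc_def lookup_add single_add sum.distrib)
  have inj: "a = b" if "enc a = enc b" for a b
    using that lookup_enc by (intro poly_mapping_eqI) metis
  have zero: "enc 0 = 0" by (simp add: enc_def)
  have pos: "0 \<le> p" for p :: "nat \<Rightarrow>\<^sub>0 nat"
  proof (rule ccontr)
    assume "\<not> 0 \<le> p"
    then have "p < 0" by simp
    then show False unfolding less_poly_mapping.rep_eq less_fun_def by simp
  qed
  show ?thesis
  proof (intro exI)
    show "term_order (\<lambda>a b. enc a \<le> enc b)"
      unfolding term_order_def add zero
      using inj pos by (auto intro: add_right_mono)
  qed
qed

lemma term_order_dvd:
  assumes "term_order tle" "mdvd a b"
  shows "tle a b"
proof -
  obtain c where "b = a + c" using assms(2) unfolding mdvd_def by blast
  then show ?thesis using term_order_add[OF assms(1) term_order_zero[OF assms(1)], of a c]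
    by (simp add: add.commute)
qed

lemma term_order_wf:
  fixes tle :: "'v::finite mon \<Rightarrow> 'v mon \<Rightarrow> bool"
  assumes T: "term_order tle"
  shows "wf {(a, b). tle a b \<and> a \<noteq> b}"
  unfolding wf_iff_no_infinite_down_chain
proof
  assume "\<exists>f. \<forall>i. (f (Suc i), f i) \<in> {(a, b). tle a b \<and> a \<noteq> b}"
  then obtain f where f: "\<And>i. tle (f (Suc i)) (f i)" "\<And>i. f (Suc i) \<noteq> f i" by blast
  have "tle (f (Suc i + k)) (f (Suc i))" for i k
  proof (induction k)
    case (Suc k) then show ?case using f(1)[of "Suc i + k"] term_order_trans[OF T] by auto
  qed (simp add: term_order_refl[OF T])
  then have mono: "tle (f j) (f (Suc i))" if "i < j" for i j
    using that by (metis Suc_leI le_add_diff_inverse)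
  obtain i j where "i < j" "mdvd (f i) (f j)" using dickson[of f] by blast
  then have "tle (f i) (f (Suc i))" using mono term_order_dvd[OF T] term_order_trans[OF T] by blast
  then show False using f term_order_antisym[OF T] by blast
qed

text \<open>Choose finitely many elements of the ideal whose leading monomials divide all other leading monomials;
  division by them terminates because term orders are well-founded.\<close>

lemma hilbert_basis:
  fixes I :: "('v::finite, 'k::field) mpoly set"
  assumes I: "is_ideal I"
  shows "\<exists>F. finite F \<and> F \<subseteq> I \<and> ideal_gen F = I"
proof -
  obtain tle :: "'v mon \<Rightarrow> 'v mon \<Rightarrow> bool" where T: "term_order tle" using term_order_exists by blast
  obtain T0 where T0: "finite T0" "T0 \<subseteq> lead_mon tle ` (I - {0})"
    "\<forall>m\<in>lead_mon tle ` (I - {0}). \<exists>t\<in>T0. mdvd t m"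
    using dickson_basis[of "lead_mon tle ` (I - {0})"] by (elim exE conjE)
  have "\<exists>F\<subseteq>I - {0}. finite F \<and> T0 = lead_mon tle ` F"
    by (rule finite_subset_image[OF T0(1,2)])
  then obtain F where F: "F \<subseteq> I - {0}" "finite F" "T0 = lead_mon tle ` F" by (elim exE conjE)
  have "f \<in> ideal_gen F" if "f \<in> I" for f
    using that
  proof (induction "lead_mon tle f" arbitrary: f rule: wf_induct_rule[OF term_order_wf[OF T]])
    case (1 f)
    show ?case
    proof (cases "f = 0")
      case True then show ?thesis by (simp add: ideal.span_zero)
    next
      case False
      then obtain g where g: "g \<in> F" "mdvd (lead_mon tle g) (lead_mon tle f)" using T0(3) F(3) 1 by blast
      then obtain c where c: "lead_mon tle f = lead_mon tle g + c" unfolding mdvd_def by blast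
      have g0: "g \<noteq> 0" "g \<in> I" using g(1) F(1) by auto
      note lf = lead_mon[OF T False] and lg = lead_mon[OF T g0(1)]
      let ?q = "Poly_Mapping.single c (Poly_Mapping.lookup f (lead_mon tle f) / Poly_Mapping.lookup g (lead_mon tle g))"
      define h where "h = f - ?q * g"
      have qg: "?q * g \<in> ideal_gen F" using g(1) by (intro ideal_gen_mult_left ideal.span_base)
      have hI: "h \<in> I" unfolding h_def
        using 1 g0 I by (intro ideal.subspace_diff[OF I] ideal.subspace_scale[OF I])
      have "h \<in> ideal_gen F"
      proof (cases "h = 0")
        case False
        have keys: "tle m (lead_mon tle f)" if "m \<in> Poly_Mapping.keys h" for m
        proof -
          have "m \<in> Poly_Mapping.keys f \<or> m \<in> Poly_Mapping.keys (?q * g)"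
            using that unfolding h_def by (auto simp: in_keys_iff lookup_minus)
          then show ?thesis
          proof
            assume "m \<in> Poly_Mapping.keys (?q * g)"
            then obtain a b where ab: "m = a + b" "a \<in> Poly_Mapping.keys ?q" "b \<in> Poly_Mapping.keys g"
              using keys_mult[of ?q g] by blast
            then have "a = c" by (auto split: if_splits)
            then show ?thesis using term_order_add[OF T lg(2)[OF ab(3)], of c] ab(1) c by (simp add: add.commute)
          qed (use lf(2) in blast)
        qed
        have "Poly_Mapping.lookup (?q * g) (lead_mon tle f) = Poly_Mapping.lookup f (lead_mon tle f)"
          unfolding c add.commute[of "lead_mon tle g"] lookup_single_mult_add using lg(1) by (simp add: in_keys_iff)
        then have "lead_mon tle f \<notin> Poly_Mapping.keys h" by (simp add: h_def in_keys_iff lookup_minus)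
        then have "tle (lead_mon tle h) (lead_mon tle f) \<and> lead_mon tle h \<noteq> lead_mon tle f"
          using lead_mon(1)[OF T False] keys by metis
        then show ?thesis using 1(1)[of h] hI by blast
      qed (simp add: ideal.span_zero)
      then have "h + ?q * g \<in> ideal_gen F" using qg by (rule ideal.span_add)
      then show ?thesis by (simp add: h_def)
    qed
  qed
  moreover have "ideal_gen F \<subseteq> I" using F(1) I by (intro ideal.span_minimal) auto
  ultimately show ?thesis using F by (intro exI[of _ F]) auto
qed

section \<open>Submodules of free modules\<close>

text \<open>Free modules of all ranks live in one type: a vector of rank \<open>r\<close> is a function on the natural
  numbers that vanishes from \<open>r\<close> on.\<close>

interpretation vmod: Modules.module "\<lambda>(a :: ('v, 'k::field) mpoly) (v :: nat \<Rightarrow> ('v, 'k) mpoly) j. a * v j"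
  by unfold_locales (auto simp: fun_eq_iff algebra_simps)

declare vmod.scale_scale [simp del]

lemma sum_apply: "(\<Sum>a\<in>A. f a) j = (\<Sum>a\<in>A. f a j)"
  for f :: "'a \<Rightarrow> 'b \<Rightarrow> 'c::comm_monoid_add"
  by (induction A rule: infinite_finite_induct) auto

text \<open>Induction on the rank: the last coordinates form an ideal, and the vectors with last coordinate 0
  form a submodule of smaller rank.\<close>

lemma submodule_finitely_generated:
  fixes U :: "(nat \<Rightarrow> ('v::finite, 'k::field) mpoly) set"
  assumes "vmod.subspace U" "\<And>v j. v \<in> U \<Longrightarrow> j \<ge> r \<Longrightarrow> v j = 0"
  shows "\<exists>F. finite F \<and> F \<subseteq> U \<and> vmod.span F = U"
  using assms
proof (induction r arbitrary: U)
  case 0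
  then have "U = {0}" using vmod.subspace_0[OF 0(1)] by (auto simp: fun_eq_iff)
  then show ?case by (intro exI[of _ "{}"]) simp
next
  case (Suc r)
  note U = Suc.prems(1)
  have ideal: "is_ideal ((\<lambda>v. v r) ` U)"
  proof (rule ideal.subspaceI)
    show "0 \<in> (\<lambda>v. v r) ` U" using vmod.subspace_0[OF U] by (intro image_eqI[where x = 0]) auto
    show "x + y \<in> (\<lambda>v. v r) ` U" if "x \<in> (\<lambda>v. v r) ` U" "y \<in> (\<lambda>v. v r) ` U" for x y
      using that by (auto intro!: image_eqI[OF _ vmod.subspace_add[OF U]])
    show "c * x \<in> (\<lambda>v. v r) ` U" if "x \<in> (\<lambda>v. v r) ` U" for c x
      using that by (auto intro!: image_eqI[OF _ vmod.subspace_scale[OF U]])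
  qed
  obtain F1 where F1: "finite F1" "F1 \<subseteq> (\<lambda>v. v r) ` U" "ideal_gen F1 = (\<lambda>v. v r) ` U"
    using hilbert_basis[OF ideal] by (elim exE conjE)
  have "\<forall>g\<in>F1. \<exists>v. v \<in> U \<and> v r = g"
  proof
    fix g assume "g \<in> F1"
    then have "g \<in> (\<lambda>v. v r) ` U" using F1(2) by (rule subsetD[rotated])
    then show "\<exists>v. v \<in> U \<and> v r = g" by (elim imageE) blast
  qed
  from bchoice[OF this] obtain h where h: "\<And>g. g \<in> F1 \<Longrightarrow> h g \<in> U \<and> h g r = g" by blast
  let ?U0 = "{v\<in>U. v r = 0}"
  have U01: "vmod.subspace ?U0"
    using U by (auto simp: vmod.subspace_def)
  have U02: "v j = 0" if "v \<in> ?U0" "j \<ge> r" for v j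
    using that Suc.prems(2)[of v j] by (cases "j = r") auto
  have "\<exists>F0. finite F0 \<and> F0 \<subseteq> ?U0 \<and> vmod.span F0 = ?U0"
    by (rule Suc.IH[OF U01]) (rule U02)
  then obtain F0 where F0: "finite F0" "F0 \<subseteq> ?U0" "vmod.span F0 = ?U0" by (elim exE conjE)
  let ?F = "h ` F1 \<union> F0"
  have sub: "?F \<subseteq> U" using h F0(2) by auto
  have "v \<in> vmod.span ?F" if v: "v \<in> U" for v
  proof -
    have "v r \<in> ideal_gen F1" using v F1(3) by blast
    then obtain a where a: "v r = (\<Sum>g\<in>F1. a g * g)" unfolding ideal.span_finite[OF F1(1)] by blast
    define u where "u = (\<Sum>g\<in>F1. (\<lambda>j. a g * h g j))"
    have uU: "u \<in> U" unfolding u_def using h by (intro vmod.subspace_sum[OF U] vmod.subspace_scale[OF U]) blast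
    have us: "u \<in> vmod.span ?F"
      unfolding u_def by (intro vmod.span_sum vmod.span_scale vmod.span_base) blast
    have "u r = v r" unfolding u_def sum_apply a using h by (intro sum.cong refl) auto
    then have "v - u \<in> ?U0" using vmod.subspace_diff[OF U v uU] by simp
    then have "v - u \<in> vmod.span ?F" using F0(3) vmod.span_mono[of F0 ?F] by auto
    from vmod.span_add[OF this us] show ?thesis by simp
  qed
  moreover have "vmod.span ?F \<subseteq> U" by (rule vmod.span_minimal[OF sub U])
  ultimately show ?case using sub F1(1) F0(1) by (intro exI[of _ ?F]) auto
qed

lemma mfilter_mult_homogeneous:
  fixes w u :: "('v, 'k::comm_ring_1) mpoly"
  assumes "\<And>a b. b \<in> Poly_Mapping.keys u \<Longrightarrow> Q (a + b) \<longleftrightarrow> P a"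
  shows "mfilter Q (w * u) = mfilter P w * u"
proof (induction w rule: mpoly_induct)
  case (single m c)
  have keys: "\<exists>b\<in>Poly_Mapping.keys u. k = m + b" if "k \<in> Poly_Mapping.keys (Poly_Mapping.single m c * u)" for k
    using that keys_mult[of "Poly_Mapping.single m c" u] by (auto split: if_splits)
  show ?case
  proof (cases "P m")
    case True
    then have "mfilter Q (Poly_Mapping.single m c * u) = Poly_Mapping.single m c * u"
      using keys assms by (intro mfilter_id) blast
    then show ?thesis using True by (simp add: mfilter_single)
  next
    case False
    then have "mfilter Q (Poly_Mapping.single m c * u) = 0"
      using keys assms by (intro mfilter_eq_0) blast
    then show ?thesis using False by (simp add: mfilter_single)
  qed
qed (simp_all add: mfilter_add distrib_right)

section \<open>Graded minimal free resolutions\<close>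

lemma bideg_add: "bideg (a + b) = bideg a + bideg b"
  by (simp add: bideg_def lookup_add sum.distrib)

lemma bideg_eq_0: "bideg m = (0, 0) \<longleftrightarrow> m = 0"
proof
  assume "bideg m = (0, 0)"
  then show "m = 0" by (intro hvar_mon_eqI) (auto simp: bideg_def)
qed (simp add: bideg_def)

text \<open>The vectors of degree \<open>d\<close> in the free module whose \<open>j\<close>-th basis vector has degree \<open>ga j\<close>; \<open>vcomp\<close> is the
  component of degree \<open>d\<close>.\<close>

definition hom_vec :: "(nat \<Rightarrow> nat \<times> nat) \<Rightarrow> nat \<times> nat \<Rightarrow> (nat \<Rightarrow> ('n::finite hvar, 'k::zero) mpoly) \<Rightarrow> bool"
  where "hom_vec ga d v \<longleftrightarrow> (\<forall>j. \<forall>x\<in>Poly_Mapping.keys (v j). ga j + bideg x = d)"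

definition vcomp :: "(nat \<Rightarrow> nat \<times> nat) \<Rightarrow> nat \<times> nat \<Rightarrow> (nat \<Rightarrow> ('n::finite hvar, 'k::comm_monoid_add) mpoly) \<Rightarrow> nat \<Rightarrow> ('n hvar, 'k) mpoly"
  where "vcomp ga d v = (\<lambda>j. mfilter (\<lambda>x. ga j + bideg x = d) (v j))"

lemma hom_vec_vcomp: "hom_vec ga d (vcomp ga d v)"
  by (simp add: hom_vec_def vcomp_def keys_mfilter)

lemma vcomp_0: "v j = 0 \<Longrightarrow> vcomp ga d v j = 0"
  by (simp add: vcomp_def)

lemma vcomp_decomposition:
  fixes v :: "nat \<Rightarrow> ('n::finite hvar, 'k::comm_monoid_add) mpoly"
  assumes "\<And>j. j \<ge> r \<Longrightarrow> v j = 0"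
  shows "\<exists>D. finite D \<and> v = (\<Sum>d\<in>D. vcomp ga d v)"
proof (intro exI conjI)
  let ?D = "\<Union>j<r. (\<lambda>x. ga j + bideg x) ` Poly_Mapping.keys (v j)"
  show "finite ?D" by simp
  show "v = (\<Sum>d\<in>?D. vcomp ga d v)"
  proof (rule ext, rule poly_mapping_eqI)
    fix j x
    have "Poly_Mapping.lookup ((\<Sum>d\<in>?D. vcomp ga d v) j) x = (\<Sum>d\<in>?D. if d = ga j + bideg x then Poly_Mapping.lookup (v j) x else 0)"
      unfolding sum_apply lookup_sum vcomp_def lookup_mfilter by (intro sum.cong refl) auto
    also have "\<dots> = (if ga j + bideg x \<in> ?D then Poly_Mapping.lookup (v j) x else 0)" by simp
    also have "\<dots> = Poly_Mapping.lookup (v j) x"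
    proof (cases "x \<in> Poly_Mapping.keys (v j)")
      case True
      then have "j < r" using assms[of j] by (cases "j < r") auto
      then show ?thesis using True by auto
    qed (simp add: in_keys_iff)
    finally show "Poly_Mapping.lookup (v j) x = Poly_Mapping.lookup ((\<Sum>d\<in>?D. vcomp ga d v) j) x" by simp
  qed
qed

definition syzygies :: "nat \<Rightarrow> (nat \<Rightarrow> nat \<Rightarrow> ('v, 'k::field) mpoly) \<Rightarrow> (nat \<Rightarrow> ('v, 'k) mpoly) set"
  where "syzygies n u = {w. (\<forall>k\<ge>n. w k = 0) \<and> (\<forall>j. (\<Sum>k<n. w k * u k j) = 0)}"

text \<open>Homogeneous generators \<open>u 0, \<dots>, u (n - 1)\<close> of degrees \<open>d k\<close>. Minimality is expressed by the absence of
  constants in the syzygies, which is the condition in the definition of minimal resolutions.\<close>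

definition minimal_generators ::
    "(nat \<Rightarrow> nat \<times> nat) \<Rightarrow> (nat \<Rightarrow> ('n::finite hvar, 'k::field) mpoly) set \<Rightarrow>
      nat \<Rightarrow> (nat \<Rightarrow> nat \<times> nat) \<Rightarrow> (nat \<Rightarrow> nat \<Rightarrow> ('n hvar, 'k) mpoly) \<Rightarrow> bool"
  where "minimal_generators ga U n d u \<longleftrightarrow>
    (\<forall>k<n. hom_vec ga (d k) (u k)) \<and>
    (\<forall>v. v \<in> U \<longleftrightarrow> (\<exists>w. \<forall>j. v j = (\<Sum>k<n. w k * u k j))) \<and>
    (\<forall>w\<in>syzygies n u. \<forall>k. Poly_Mapping.lookup (w k) 0 = 0)"

lemma minimal_generators_mem:
  "minimal_generators ga U n d u \<Longrightarrow> v \<in> U \<longleftrightarrow> (\<exists>w. \<forall>j. v j = (\<Sum>k<n. w k * u k j))"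
  unfolding minimal_generators_def by blast

text \<open>Syzygies of homogeneous generators are graded by the degrees of the generators.\<close>

lemma vcomp_syzygy:
  fixes u :: "nat \<Rightarrow> nat \<Rightarrow> ('n::finite hvar, 'k::field) mpoly"
  assumes u: "\<And>k. k < n \<Longrightarrow> hom_vec ga (d k) (u k)" and w: "w \<in> syzygies n u"
  shows "vcomp d e w \<in> syzygies n u"
  unfolding syzygies_def
proof (intro CollectI conjI allI impI)
  show "vcomp d e w k = 0" if "k \<ge> n" for k using w that by (intro vcomp_0) (simp add: syzygies_def)
  fix j
  have "vcomp d e w k * u k j = mfilter (\<lambda>x. ga j + bideg x = e) (w k * u k j)" if k: "k < n" for k
    unfolding vcomp_def
  proof (rule mfilter_mult_homogeneous[symmetric])
    fix a b assume "b \<in> Poly_Mapping.keys (u k j)"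
    then have "ga j + bideg b = d k" using u[OF k] unfolding hom_vec_def by blast
    then show "ga j + bideg (a + b) = e \<longleftrightarrow> d k + bideg a = e" by (auto simp: bideg_add add_ac)
  qed
  then have "(\<Sum>k<n. vcomp d e w k * u k j) = mfilter (\<lambda>x. ga j + bideg x = e) (\<Sum>k<n. w k * u k j)"
    by (simp add: mfilter_sum)
  then show "(\<Sum>k<n. vcomp d e w k * u k j) = 0" using w by (simp add: syzygies_def)
qed

lemma subspace_syzygies: "vmod.subspace (syzygies n u)"
  unfolding syzygies_def
  by (intro vmod.subspaceI)
     (auto simp: distrib_right sum.distrib mult.assoc sum_distrib_left[symmetric])

text \<open>Take a homogeneous generating set with the least number of elements. If a syzygy had a nonzero constant
  in some coefficient, its homogeneous component in the degree of this generator would express the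
  generator by the others.\<close>

lemma minimal_generators_exist:
  fixes U :: "(nat \<Rightarrow> ('n::finite hvar, 'k::field) mpoly) set"
  assumes U: "vmod.subspace U" and r: "\<And>v j. v \<in> U \<Longrightarrow> j \<ge> r \<Longrightarrow> v j = 0"
    and gr: "\<And>v d. v \<in> U \<Longrightarrow> vcomp ga d v \<in> U"
  shows "\<exists>n d u. minimal_generators ga U n d u"
proof -
  define good where "good G \<longleftrightarrow> finite G \<and> (\<forall>v\<in>G. \<exists>d. hom_vec ga d v) \<and> vmod.span G = U" for G
  have "\<exists>G. good G"
  proof -
    have "\<exists>F. finite F \<and> F \<subseteq> U \<and> vmod.span F = U"
      by (rule submodule_finitely_generated[OF U]) (rule r)
    then obtain F where F: "finite F" "F \<subseteq> U" "vmod.span F = U" by blast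
    have "\<forall>v\<in>F. \<exists>D. finite D \<and> v = (\<Sum>d\<in>D. vcomp ga d v)"
      using F(2) r by (intro ballI vcomp_decomposition[of r]) blast
    then obtain D where D: "\<And>v. v \<in> F \<Longrightarrow> finite (D v) \<and> v = (\<Sum>d\<in>D v. vcomp ga d v)" by metis
    let ?G = "\<Union>v\<in>F. (\<lambda>d. vcomp ga d v) ` D v"
    have "v \<in> vmod.span ?G" if v: "v \<in> F" for v
    proof -
      have "(\<Sum>d\<in>D v. vcomp ga d v) \<in> vmod.span ?G"
        using v by (intro vmod.span_sum vmod.span_base) blast
      then show ?thesis using D[OF v] by metis
    qed
    then have "vmod.span F \<subseteq> vmod.span ?G" by (intro vmod.span_minimal) auto
    moreover have "vmod.span ?G \<subseteq> U" using F(2) gr U by (intro vmod.span_minimal) auto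
    ultimately have "good ?G" unfolding good_def using F D hom_vec_vcomp by blast
    then show ?thesis by blast
  qed
  then obtain G where G: "good G" "\<And>G'. good G' \<Longrightarrow> card G \<le> card G'"
    using ex_has_least_nat[of good _ card] by blast
  then have fin: "finite G" and span: "vmod.span G = U" and hom: "\<forall>v\<in>G. \<exists>d. hom_vec ga d v"
    unfolding good_def by auto
  obtain u where u: "bij_betw u {..<card G} G"
    using ex_bij_betw_nat_finite[OF fin] by (auto simp: atLeast0LessThan)
  have uG: "u k \<in> G" if "k < card G" for k using u that by (auto simp: bij_betw_def)
  define d where "d k = (SOME e. hom_vec ga e (u k))" for k
  have d: "hom_vec ga (d k) (u k)" if "k < card G" for k
    unfolding d_def using hom uG[OF that] by (intro someI_ex[of "\<lambda>e. hom_vec ga e (u k)"]) blast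
  have reidx: "(\<Sum>g\<in>G. (\<lambda>j. a g * g j)) = (\<lambda>j. \<Sum>k<card G. a (u k) * u k j)" for a
    by (rule ext) (simp add: sum_apply sum.reindex_bij_betw[OF u, symmetric])
  have "minimal_generators ga U (card G) d u"
    unfolding minimal_generators_def
  proof (intro conjI allI impI ballI iffI)
    show "hom_vec ga (d k) (u k)" if "k < card G" for k using d[OF that] .
    fix v assume "v \<in> U"
    then obtain a where "v = (\<Sum>g\<in>G. (\<lambda>j. a g * g j))"
      unfolding span[symmetric] vmod.span_finite[OF fin] by blast
    then show "\<exists>w. \<forall>j. v j = (\<Sum>k<card G. w k * u k j)"
      unfolding reidx by (intro exI[of _ "\<lambda>k. a (u k)"]) simp
  next
    fix v assume "\<exists>w. \<forall>j. v j = (\<Sum>k<card G. w k * u k j)"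
    then obtain w where w: "\<And>j. v j = (\<Sum>k<card G. w k * u k j)" by blast
    then have "v = (\<Sum>k<card G. (\<lambda>j. w k * u k j))" by (intro ext) (simp add: sum_apply)
    also have "\<dots> \<in> U"
      unfolding span[symmetric] using uG by (intro vmod.span_sum vmod.span_scale vmod.span_base) auto
    finally show "v \<in> U" .
  next
    fix w k0 assume w: "w \<in> syzygies (card G) u"
    show "Poly_Mapping.lookup (w k0) 0 = 0"
    proof (rule ccontr)
      assume nz: "Poly_Mapping.lookup (w k0) 0 \<noteq> 0"
      have k0: "k0 < card G"
      proof (rule ccontr)
        assume "\<not> k0 < card G"
        then have "w k0 = 0" using w by (simp add: syzygies_def)
        then show False using nz by simp
      qed
      define c where "c = Poly_Mapping.lookup (w k0) 0"
      \<comment> \<open>in this degree, the coefficient of the generator \<open>u k0\<close> is a constant\<close>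
      define w' where "w' = vcomp d (d k0) w"
      have w': "(\<Sum>k<card G. w' k * u k j) = 0" for j
        using vcomp_syzygy[OF d w, of "d k0"] by (simp add: w'_def syzygies_def)
      have "w' k0 = Const c"
      proof (rule poly_mapping_eqI)
        fix x :: "'n hvar mon"
        have "d k0 + bideg x = d k0 \<longleftrightarrow> x = 0" using bideg_eq_0[of x] by (auto simp: prod_eq_iff zero_prod_def)
        then show "Poly_Mapping.lookup (w' k0) x = Poly_Mapping.lookup (Const c) x"
          by (simp add: w'_def vcomp_def lookup_mfilter Const_def lookup_single when_def c_def)
      qed
      then have "Const c * u k0 j + (\<Sum>k\<in>{..<card G} - {k0}. w' k * u k j) = 0" for j
        using w'[of j] k0 by (subst (asm) sum.remove[of _ k0]) auto
      then have "Const c * u k0 j = - (\<Sum>k\<in>{..<card G} - {k0}. w' k * u k j)" for j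
        by (simp add: eq_neg_iff_add_eq_0)
      then have "Const (- inverse c) * (\<Sum>k\<in>{..<card G} - {k0}. w' k * u k j) = Const (inverse c) * (Const c * u k0 j)" for j
        by (simp add: Const_minus)
      moreover have "Const (inverse c) * (Const c * u k0 j) = u k0 j" for j
        using nz by (simp add: c_def mult.assoc[symmetric] flip: Const_mult)
      ultimately have "u k0 = (\<lambda>j. Const (- inverse c) * (\<Sum>k\<in>{..<card G} - {k0}. (\<lambda>j. w' k * u k j)) j)"
        by (intro ext) (simp add: sum_apply)
      also have "\<dots> \<in> vmod.span (G - {u k0})"
      proof (intro vmod.span_scale vmod.span_sum vmod.span_base)
        fix k assume k: "k \<in> {..<card G} - {k0}"
        then have "u k \<noteq> u k0" using u k0 by (auto simp: bij_betw_def inj_on_def)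
        then show "u k \<in> G - {u k0}" using uG k by auto
      qed
      finally have "u k0 \<in> vmod.span (G - {u k0})" .
      then have "G \<subseteq> vmod.span (G - {u k0})" by (auto intro: vmod.span_base)
      then have "vmod.span (G - {u k0}) = vmod.span G"
        by (intro antisym vmod.span_mono vmod.span_minimal) auto
      then have "good (G - {u k0})" using G(1) unfolding good_def by auto
      then have "card G \<le> card (G - {u k0})" by (rule G(2))
      then show False using uG[OF k0] fin by (metis card_Diff1_less not_le)
    qed
  qed
  then show ?thesis by blast
qed

text \<open>Choose minimal generators of the ideal, of their syzygies, and so on. Since \<open>1\<close> does not lie in \<open>I\<close>, the
  augmentation from a free module of rank 1 is minimal as well.\<close>

lemma minimal_free_resolution_exists:
  fixes I :: "('n::finite hvar, 'k::field) mpoly set"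
  assumes I: "is_ideal I" and one: "1 \<notin> I" and gr: "\<And>f d. f \<in> I \<Longrightarrow> mfilter (\<lambda>x. bideg x = d) f \<in> I"
  shows "\<exists>F. minimal_free_resolution I F"
proof -
  define U0 where "U0 = {v :: nat \<Rightarrow> ('n hvar, 'k) mpoly. (\<forall>j\<ge>1. v j = 0) \<and> v 0 \<in> I}"
  define dg0 where "dg0 = (\<lambda>_ :: nat. (0 :: nat, 0 :: nat))"
  have dg0: "dg0 j + e = e" for j e by (simp add: dg0_def prod_eq_iff)
  have U0: "vmod.subspace U0"
    unfolding U0_def using ideal.subspace_0[OF I] ideal.subspace_add[OF I] ideal.subspace_scale[OF I]
    by (intro vmod.subspaceI) auto
  have "vcomp dg0 e v \<in> U0" if "v \<in> U0" for v e
    using that gr unfolding U0_def vcomp_def dg0 by auto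
  then obtain n0 d0 u0 where init: "minimal_generators dg0 U0 n0 d0 u0"
    using minimal_generators_exist[OF U0, of 1 dg0] unfolding U0_def by auto
  \<comment> \<open>the stages of the construction: number, degrees and coordinates of the chosen generators\<close>
  define okay where "okay s = (case s of (n, d, u) \<Rightarrow> \<exists>ga. \<forall>k<n. hom_vec ga (d k) (u k))"
    for s :: "nat \<times> (nat \<Rightarrow> nat \<times> nat) \<times> (nat \<Rightarrow> nat \<Rightarrow> ('n hvar, 'k) mpoly)"
  define step where "step s s' = (case s of (n, d, u) \<Rightarrow> case s' of (n', d', u') \<Rightarrow>
      minimal_generators d (syzygies n u) n' d' u')"
    for s s' :: "nat \<times> (nat \<Rightarrow> nat \<times> nat) \<times> (nat \<Rightarrow> nat \<Rightarrow> ('n hvar, 'k) mpoly)"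
  have ex: "\<exists>s'. okay s' \<and> step s s'" if oks: "okay s" for s
  proof -
    obtain n d u where s: "s = (n, d, u)" by (cases s)
    obtain ga where "\<forall>k<n. hom_vec ga (d k) (u k)" using oks unfolding okay_def s by auto
    then have ga: "\<And>k. k < n \<Longrightarrow> hom_vec ga (d k) (u k)" by blast
    have "\<exists>n' d' u'. minimal_generators d (syzygies n u) n' d' u'"
    proof (rule minimal_generators_exist[OF subspace_syzygies])
      show "v j = 0" if "v \<in> syzygies n u" "j \<ge> n" for v j using that by (simp add: syzygies_def)
      show "vcomp d e v \<in> syzygies n u" if "v \<in> syzygies n u" for v e by (rule vcomp_syzygy[OF ga that])
    qed
    then obtain n' d' u' where "minimal_generators d (syzygies n u) n' d' u'" by blast
    then show ?thesis
      by (intro exI[of _ "(n', d', u')"]) (auto simp: okay_def step_def s minimal_generators_def)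
  qed
  have "\<exists>S. \<forall>i. (okay (S i) \<and> (i = 0 \<longrightarrow> S i = (n0, d0, u0))) \<and> step (S i) (S (Suc i))"
  proof (rule dependent_nat_choice)
    show "\<exists>s. okay s \<and> (0 = (0::nat) \<longrightarrow> s = (n0, d0, u0))"
      using init by (auto simp: okay_def minimal_generators_def)
    show "\<exists>s'. (okay s' \<and> (Suc i = 0 \<longrightarrow> s' = (n0, d0, u0))) \<and> step s s'"
      if "okay s \<and> (i = 0 \<longrightarrow> s = (n0, d0, u0))" for s i
      using ex[of s] that by simp
  qed
  then obtain S where S: "S 0 = (n0, d0, u0)" "\<And>i. step (S i) (S (Suc i))" by metis
  define n where "n i = fst (S i)" for i
  define d where "d i = fst (snd (S i))" for i
  define u where "u i = snd (snd (S i))" for i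
  have Seq: "S i = (n i, d i, u i)" for i by (simp add: n_def d_def u_def)
  define F where "F = \<lparr>rk = (\<lambda>i. case i of 0 \<Rightarrow> 1 | Suc i \<Rightarrow> n i),
    dg = (\<lambda>i. case i of 0 \<Rightarrow> dg0 | Suc i \<Rightarrow> d i), aug = (\<lambda>_. 1),
    dif = (\<lambda>i j k. u i k j)\<rparr>"
  have F0: "rk F 0 = 1" "dg F 0 = dg0" "aug F j = 1" and F1: "rk F (Suc i) = n i" "dg F (Suc i) = d i" "dif F i j k = u i k j"
    for i j k by (auto simp: F_def)
  have mg0: "minimal_generators dg0 U0 (n 0) (d 0) (u 0)" using init S(1) Seq[of 0] by simp
  have mgS: "minimal_generators (d i) (syzygies (n i) (u i)) (n (Suc i)) (d (Suc i)) (u (Suc i))" for i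
    using S(2)[of i] by (simp add: Seq step_def)
  have mem: "u i k \<in> W" if "minimal_generators g W (n i) (d i) (u i)" "k < n i" for g W i k
  proof -
    have "u i k j = (\<Sum>k'<n i. (if k' = k then 1 else 0) * u i k' j)" for j
    proof -
      have "(\<Sum>k'<n i. (if k' = k then 1 else 0) * u i k' j) = (\<Sum>k'<n i. if k' = k then u i k' j else 0)"
        by (intro sum.cong refl) auto
      then show ?thesis using that(2) by simp
    qed
    then show ?thesis using that(1) unfolding minimal_generators_def by (auto intro!: exI[of _ "\<lambda>k'. if k' = k then 1 else 0"])
  qed
  have "minimal_free_resolution I F"
    unfolding minimal_free_resolution_def
  proof (intro conjI allI impI ballI)
    show "bideg m = dg F 0 j" if "m \<in> Poly_Mapping.keys (aug F j)" for j m
      using that by (simp add: F0 dg0_def bideg_def)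
    show "dg F i j + bideg m = dg F (Suc i) k"
      if k: "k < rk F (Suc i)" and m: "m \<in> Poly_Mapping.keys (dif F i j k)" for i j k m
    proof (cases i)
      case 0
      then show ?thesis using k m mg0 unfolding minimal_generators_def hom_vec_def by (auto simp: F0 F1)
    next
      case (Suc i')
      then show ?thesis using k m mgS[of i'] unfolding minimal_generators_def hom_vec_def by (auto simp: F1)
    qed
    show "\<exists>v. f - (\<Sum>j<rk F 0. v j * aug F j) \<in> I" for f
      by (intro exI[of _ "\<lambda>_. f"]) (simp add: F0 ideal.subspace_0[OF I])
    show "(\<Sum>j<rk F 0. v j * aug F j) \<in> I \<longleftrightarrow> (\<exists>w. \<forall>j<rk F 0. v j = (\<Sum>k<rk F 1. dif F 0 j k * w k))" for v
    proof -
      let ?v = "\<lambda>j. if j = 0 then v 0 else 0"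
      have "(\<Sum>j<rk F 0. v j * aug F j) \<in> I \<longleftrightarrow> ?v \<in> U0" by (simp add: F0 U0_def)
      also have "\<dots> \<longleftrightarrow> (\<exists>w. \<forall>j. ?v j = (\<Sum>k<n 0. w k * u 0 k j))"
        by (rule minimal_generators_mem[OF mg0])
      also have "\<dots> \<longleftrightarrow> (\<exists>w. v 0 = (\<Sum>k<n 0. w k * u 0 k 0))"
      proof -
        have "u 0 k j = 0" if "k < n 0" "j \<noteq> 0" for k j
          using mem[OF mg0 that(1)] that(2) by (auto simp: U0_def)
        then have "(\<Sum>k<n 0. w k * u 0 k j) = 0" if "j \<noteq> 0" for w j using that by simp
        then show ?thesis by (intro ex_cong1) (metis (full_types))
      qed
      finally show ?thesis using F1[of 0] by (simp add: F0 mult.commute)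
    qed
    show "(\<forall>j<rk F i. (\<Sum>k<rk F (Suc i). dif F i j k * v k) = 0) \<longleftrightarrow>
       (\<exists>w. \<forall>k<rk F (Suc i). v k = (\<Sum>l<rk F (Suc (Suc i)). dif F (Suc i) k l * w l))" for i v
    proof -
      let ?v = "\<lambda>k. if k < n i then v k else 0"
      have u_out: "u i k j = 0" if "k < n i" "\<not> j < rk F i" for k j
      proof (cases i)
        case 0
        then show ?thesis using mem[of dg0 U0 0 k] mg0 that by (simp add: U0_def F0)
      next
        case (Suc i')
        then show ?thesis using mem[OF mgS[of i'], of k] that by (simp add: syzygies_def F1)
      qed
      have sv: "(\<Sum>k<n i. ?v k * u i k j) = (\<Sum>k<rk F (Suc i). dif F i j k * v k)" for j
        unfolding F1 by (intro sum.cong refl) (simp add: mult.commute)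
      have "(\<forall>j<rk F i. (\<Sum>k<rk F (Suc i). dif F i j k * v k) = 0) \<longleftrightarrow> (\<forall>j. (\<Sum>k<n i. ?v k * u i k j) = 0)"
      proof -
        have "(\<Sum>k<n i. ?v k * u i k j) = 0" if "\<not> j < rk F i" for j
          using u_out that by (intro sum.neutral) auto
        then show ?thesis unfolding sv by blast
      qed
      also have "\<dots> \<longleftrightarrow> ?v \<in> syzygies (n i) (u i)" by (simp add: syzygies_def)
      also have "\<dots> \<longleftrightarrow> (\<exists>w. \<forall>k. ?v k = (\<Sum>l<n (Suc i). w l * u (Suc i) l k))"
        by (rule minimal_generators_mem[OF mgS])
      also have "\<dots> \<longleftrightarrow> (\<exists>w. \<forall>k<n i. v k = (\<Sum>l<n (Suc i). w l * u (Suc i) l k))"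
      proof -
        have "(\<Sum>l<n (Suc i). w l * u (Suc i) l k) = 0" if "\<not> k < n i" for w k
          using mem[OF mgS[of i]] that by (intro sum.neutral) (auto simp: syzygies_def)
        then show ?thesis by (intro ex_cong1) (metis (full_types))
      qed
      finally show ?thesis by (simp add: F1 mult.commute)
    qed
    show "Poly_Mapping.lookup (dif F i j k) 0 = 0" if jk: "j < rk F i" "k < rk F (Suc i)" for i j k
    proof (cases i)
      case 0
      have k: "k < n 0" using jk 0 by (simp add: F1)
      have "u 0 k \<in> U0" by (rule mem[OF mg0 k])
      show ?thesis
      proof (rule ccontr)
        assume nz: "Poly_Mapping.lookup (dif F i j k) 0 \<noteq> 0"
        have j: "j = 0" using jk 0 by (simp add: F0)
        define f where "f = u 0 k 0"
        have fI: "f \<in> I" using \<open>u 0 k \<in> U0\<close> by (simp add: U0_def f_def)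
        have "Poly_Mapping.lookup f 0 \<noteq> 0" using nz j 0 by (simp add: F1 f_def)
        define c where "c = Poly_Mapping.lookup f 0"
        have "mfilter (\<lambda>x. bideg x = (0, 0)) f = Const c"
          by (rule poly_mapping_eqI) (simp add: lookup_mfilter bideg_eq_0 Const_def lookup_single when_def c_def)
        then have "Const c \<in> I" using gr[OF fI, of "(0, 0)"] by simp
        then have "Const (inverse c) * Const c \<in> I" by (rule ideal.subspace_scale[OF I])
        then show False using one \<open>Poly_Mapping.lookup f 0 \<noteq> 0\<close> by (simp add: c_def flip: Const_mult)
      qed
    next
      case (Suc i')
      then have k: "k < n (Suc i')" using jk by (simp add: F1)
      have "u (Suc i') k \<in> syzygies (n i') (u i')" by (rule mem[OF mgS k])
      moreover have "\<forall>w\<in>syzygies (n i') (u i'). \<forall>k. Poly_Mapping.lookup (w k) 0 = 0"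
        using mg0 mgS[of "i' - 1"] unfolding minimal_generators_def by (cases i') auto
      ultimately show ?thesis using Suc by (simp add: F1)
    qed
  qed
  then show ?thesis by blast
qed

section \<open>Betti numbers and the Hilbert function\<close>

text \<open>Modulo \<open>Z\<close> the \<open>u t\<close> are a basis of \<open>V\<close>, so they complete a basis of \<open>Z\<close> to one of \<open>V\<close>.\<close>

lemma (in vector_space) dim_complement:
  assumes Z: "subspace Z" "Z \<subseteq> span A" "finite A" and T: "finite T"
    and V: "Z \<subseteq> V" "\<And>t. t \<in> T \<Longrightarrow> u t \<in> V" "subspace V"
    and ind: "\<And>c. (\<Sum>t\<in>T. scale (c t) (u t)) \<in> Z \<Longrightarrow> \<forall>t\<in>T. c t = 0"
    and gen: "\<And>v. v \<in> V \<Longrightarrow> \<exists>c. v - (\<Sum>t\<in>T. scale (c t) (u t)) \<in> Z"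
  shows "dim V = dim Z + card T"
proof -
  obtain B where B: "B \<subseteq> Z" "independent B" "Z \<subseteq> span B" "card B = dim Z"
    using basis_exists by blast
  have finB: "finite B" using independent_span_bound[OF Z(3) B(2)] B(1) Z(2) by blast
  have spanB: "span B \<subseteq> Z" using B(1) Z(1) by (rule span_minimal)
  have one: "u t \<notin> Z" if t: "t \<in> T" for t
  proof
    assume "u t \<in> Z"
    moreover have "(\<Sum>t'\<in>T. scale (if t' = t then 1 else 0) (u t')) = (\<Sum>t'\<in>T. if t' = t then u t' else 0)"
      by (intro sum.cong refl) auto
    ultimately have "(\<Sum>t'\<in>T. scale (if t' = t then 1 else 0) (u t')) \<in> Z" using t T by simp
    from ind[OF this] t show False by auto
  qed
  have inj: "inj_on u T"
  proof (rule inj_onI, rule ccontr)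
    fix s t assume st: "s \<in> T" "t \<in> T" "u s = u t" "s \<noteq> t"
    let ?c = "\<lambda>x. if x = s then 1 else if x = t then - 1 else 0"
    have "(\<Sum>x\<in>T. scale (?c x) (u x)) = (\<Sum>x\<in>{s, t}. scale (?c x) (u x))"
      by (rule sum.mono_neutral_right) (use st T in auto)
    also have "\<dots> = 0" using st by simp
    finally have "(\<Sum>x\<in>T. scale (?c x) (u x)) \<in> Z" using subspace_0[OF Z(1)] by simp
    from ind[OF this] st(1) show False by auto
  qed
  have disj: "B \<inter> u ` T = {}" using one B(1) by blast
  have "independent (B \<union> u ` T)"
  proof (rule independent_if_scalars_zero)
    show "finite (B \<union> u ` T)" using finB T by simp
    fix f x assume 0: "(\<Sum>x\<in>B \<union> u ` T. scale (f x) x) = 0" and x: "x \<in> B \<union> u ` T"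
    have split: "(\<Sum>x\<in>B. scale (f x) x) + (\<Sum>t\<in>T. scale (f (u t)) (u t)) = 0"
      using 0 finB T disj by (simp add: sum.union_disjoint sum.reindex[OF inj])
    have SB: "(\<Sum>x\<in>B. scale (f x) x) \<in> Z"
      using B(1) by (intro subspace_sum[OF Z(1)] subspace_scale[OF Z(1)]) blast
    have "(\<Sum>t\<in>T. scale (f (u t)) (u t)) = - (\<Sum>x\<in>B. scale (f x) x)"
      using split by (simp add: eq_neg_iff_add_eq_0 add.commute)
    then have "(\<Sum>t\<in>T. scale (f (u t)) (u t)) \<in> Z" using subspace_neg[OF Z(1) SB] by simp
    then have fT: "\<forall>t\<in>T. f (u t) = 0" by (rule ind)
    then have "(\<Sum>x\<in>B. scale (f x) x) = 0" using split by simp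
    then have "\<forall>x\<in>B. f x = 0" using independentD[OF B(2) finB order_refl] by blast
    then show "f x = 0" using fT x by blast
  qed
  moreover have "V \<subseteq> span (B \<union> u ` T)"
  proof
    fix v assume "v \<in> V"
    then obtain c where c: "v - (\<Sum>t\<in>T. scale (c t) (u t)) \<in> Z" using gen by blast
    then have "v - (\<Sum>t\<in>T. scale (c t) (u t)) \<in> span (B \<union> u ` T)"
      using B(3) span_mono[of B "B \<union> u ` T"] by auto
    moreover have "(\<Sum>t\<in>T. scale (c t) (u t)) \<in> span (B \<union> u ` T)"
      by (intro span_sum span_scale span_base) blast
    ultimately have "(v - (\<Sum>t\<in>T. scale (c t) (u t))) + (\<Sum>t\<in>T. scale (c t) (u t)) \<in> span (B \<union> u ` T)" by (rule span_add)
    then show "v \<in> span (B \<union> u ` T)" by simp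
  qed
  moreover have "B \<union> u ` T \<subseteq> V" using B(1) V(1,2) by blast
  ultimately have "card (B \<union> u ` T) = dim V" by (intro basis_card_eq_dim)
  then show ?thesis using finB T disj B(4) by (simp add: card_Un_disjoint card_image[OF inj])
qed

text \<open>Stated with \<open>V\<close> in a finitely generated subspace because the ambient space is infinite-dimensional.\<close>

lemma (in vector_space) rank_nullity:
  assumes V: "subspace V" "V \<subseteq> span A" "finite A"
    and add: "\<And>x y. f (x + y) = f x + f y" and scl: "\<And>c x. f (scale c x) = scale c (f x)"
  shows "dim V = dim {v\<in>V. f v = 0} + dim (f ` V)"
proof -
  have f0: "f 0 = 0" using scl[of 0 0] by simp
  have fsum: "f (\<Sum>t\<in>T. scale (c t) (g t)) = (\<Sum>t\<in>T. scale (c t) (f (g t)))" for T :: "'z set" and c g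
    by (induction T rule: infinite_finite_induct) (auto simp: f0 add scl)
  have fdiff: "f (x - y) = f x - f y" for x y
    using add[of "x - y" y] by simp
  obtain T where T: "T \<subseteq> f ` V" "independent T" "f ` V \<subseteq> span T" "card T = dim (f ` V)"
    using basis_exists by blast
  have "f ` V \<subseteq> span (f ` A)"
  proof clarify
    fix v assume "v \<in> V"
    then obtain c where "v = (\<Sum>a\<in>A. scale (c a) a)" using V(2) unfolding span_finite[OF V(3)] by blast
    then have "f v = (\<Sum>a\<in>A. scale (c a) (f a))" using fsum[of c "\<lambda>a. a" A] by simp
    then show "f v \<in> span (f ` A)" by (simp add: span_sum span_scale span_base)
  qed
  then have finT: "finite T" using independent_span_bound[of "f ` A" T] T(1,2) V(3) by blast
  define u where "u t = (SOME v. v \<in> V \<and> f v = t)" for t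
  have u: "u t \<in> V \<and> f (u t) = t" if "t \<in> T" for t
  proof -
    have "\<exists>v. v \<in> V \<and> f v = t" using that T(1) by blast
    from someI_ex[OF this] show ?thesis unfolding u_def .
  qed
  have fu: "f (\<Sum>t\<in>T. scale (c t) (u t)) = (\<Sum>t\<in>T. scale (c t) t)" for c
    unfolding fsum using u by (intro sum.cong refl) simp
  have "dim V = dim {v\<in>V. f v = 0} + card T"
  proof (rule dim_complement[where u = u])
    show "subspace {v\<in>V. f v = 0}" using V(1) by (auto simp: subspace_def f0 add scl)
    show "{v\<in>V. f v = 0} \<subseteq> span A" using V(2) by blast
    show "\<forall>t\<in>T. c t = 0" if "(\<Sum>t\<in>T. scale (c t) (u t)) \<in> {v\<in>V. f v = 0}" for c
    proof -
      have "(\<Sum>t\<in>T. scale (c t) t) = 0" using that fu[of c] by simp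
      then show ?thesis using independentD[OF T(2) finT order_refl] by blast
    qed
    show "\<exists>c. v - (\<Sum>t\<in>T. scale (c t) (u t)) \<in> {v\<in>V. f v = 0}" if v: "v \<in> V" for v
    proof -
      have "f v \<in> span T" using v T(3) by blast
      then obtain c where c: "f v = (\<Sum>t\<in>T. scale (c t) t)" unfolding span_finite[OF finT] by blast
      have "(\<Sum>t\<in>T. scale (c t) (u t)) \<in> V"
        using u by (intro subspace_sum[OF V(1)] subspace_scale[OF V(1)]) blast
      then show ?thesis
        using subspace_diff[OF V(1) v] fdiff fu[of c] c by (intro exI[of _ c]) simp
    qed
  qed (use u V finT in auto)
  then show ?thesis using T(4) by simp
qed

interpretation vvs: vector_space "\<lambda>(c :: 'k::field) (v :: nat \<Rightarrow> ('v, 'k) mpoly) j. Const c * v j"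
  by unfold_locales (auto simp: fun_eq_iff algebra_simps Const_add Const_mult)

declare vvs.scale_scale [simp del]

lemma finite_bideg: "finite {x :: 'n::finite hvar mon. e + bideg x = d}"
proof (rule finite_subset)
  show "finite (mon_box (fst d + snd d) :: 'n hvar mon set)" by (rule card_mon_box)
  show "{x. e + bideg x = d} \<subseteq> (mon_box (fst d + snd d) :: 'n hvar mon set)"
    unfolding mon_box_def
  proof clarify
    fix x :: "'n hvar mon" and v
    have "Poly_Mapping.lookup x (xv i) \<le> fst (bideg x)" "Poly_Mapping.lookup x (yv i) \<le> snd (bideg x)" for i
      unfolding bideg_def fst_conv snd_conv
      using member_le_sum[of i UNIV "\<lambda>i. Poly_Mapping.lookup x (xv i)"]
        member_le_sum[of i UNIV "\<lambda>i. Poly_Mapping.lookup x (yv i)"] by auto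
    then show "Poly_Mapping.lookup x v \<le> fst (e + bideg x) + snd (e + bideg x)"
      by (cases v) (simp_all add: trans_le_add1 trans_le_add2 le_SucI add_increasing add_increasing2)
  qed
qed

text \<open>Minimality makes the entries of the differentials have positive degree, and no column of a differential
  is zero, since a zero column would put a basis vector into the image of the next differential, whose
  entries have no constant terms. So the degrees grow by at least 1 in each step,
  and only finitely many modules matter in a given degree.\<close>

lemma res_degree:
  assumes F: "minimal_free_resolution I F" and j: "j < rk F i"
  shows "i \<le> fst (dg F i j) + snd (dg F i j)"
  using j
proof (induction i arbitrary: j)
  case (Suc i)
  note [simp del] = One_nat_def
  have "\<exists>j'<rk F i. dif F i j' j \<noteq> 0"
  proof (rule ccontr)
    assume "\<not> ?thesis"
    then have "\<forall>j'<rk F i. (\<Sum>k<rk F (Suc i). dif F i j' k * (if k = j then 1 else 0)) = 0"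
      by (auto intro!: sum.neutral)
    then have "\<exists>w. \<forall>k<rk F (Suc i). (if k = j then 1 else 0)
        = (\<Sum>l<rk F (Suc (Suc i)). dif F (Suc i) k l * w l)"
      using F unfolding minimal_free_resolution_def by (auto simp del: sum.lessThan_Suc)
    then obtain w where w: "1 = (\<Sum>l<rk F (Suc (Suc i)). dif F (Suc i) j l * w l)"
      using Suc.prems by (metis (full_types))
    have "Poly_Mapping.lookup (dif F (Suc i) j l) 0 = 0" if "l < rk F (Suc (Suc i))" for l
      using F Suc.prems that unfolding minimal_free_resolution_def by blast
    then have "Poly_Mapping.lookup (\<Sum>l<rk F (Suc (Suc i)). dif F (Suc i) j l * w l) 0 = 0"
      unfolding lookup_sum by (intro sum.neutral ballI) (simp add: lookup_0_eval id_hom.eval_mult)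
    then show False unfolding w[symmetric] by simp
  qed
  then obtain j' where "j' < rk F i" "Poly_Mapping.keys (dif F i j' j) \<noteq> {}" by auto
  then obtain m where j': "j' < rk F i" "m \<in> Poly_Mapping.keys (dif F i j' j)" by blast
  have "dg F i j' + bideg m = dg F (Suc i) j" "Poly_Mapping.lookup (dif F i j' j) 0 = 0"
    using F j' Suc.prems unfolding minimal_free_resolution_def by blast+
  moreover from this have "m \<noteq> 0" using j'(2) by (auto simp: in_keys_iff)
  then have "fst (bideg m) + snd (bideg m) \<noteq> 0" using bideg_eq_0[of m] by (auto simp: prod_eq_iff)
  ultimately show ?case using Suc.IH[OF j'(1)] by (auto simp flip: \<open>dg F i j' + bideg m = dg F (Suc i) j\<close>)
qed simp

text \<open>In degree \<open>d\<close> the resolution is an exact sequence of finite-dimensional vector spaces \<open>W i\<close>, which ends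
  in the component of the quotient with the basis \<open>T\<close>. The map \<open>cut\<close> takes the component of degree \<open>d\<close>; it
  commutes with the differentials, so exactness passes to this degree.\<close>

lemma euler_characteristic:
  fixes I :: "('n::finite hvar, 'k::field) mpoly set"
  assumes F: "minimal_free_resolution I F" and I: "is_ideal I"
    and gr: "\<And>f d. f \<in> I \<Longrightarrow> mfilter (\<lambda>x. bideg x = d) f \<in> I"
    and T: "finite T" "\<And>t. t \<in> T \<Longrightarrow> bideg t = d"
    and ind: "\<And>c. (\<Sum>t\<in>T. Const (c t) * monom_of t) \<in> I \<Longrightarrow> \<forall>t\<in>T. c t = 0"
    and gen: "\<And>f. (\<And>x. x \<in> Poly_Mapping.keys f \<Longrightarrow> bideg x = d) \<Longrightarrow> \<exists>c. f - (\<Sum>t\<in>T. Const (c t) * monom_of t) \<in> I"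
    and N: "fst d + snd d \<le> N"
  shows "int (card T) = (\<Sum>i\<le>N. (- 1) ^ i * int (card {(j, x). j < rk F i \<and> dg F i j + bideg (x :: 'n hvar mon) = d}))"
proof -
  define W where "W i = {v :: nat \<Rightarrow> ('n hvar, 'k) mpoly. (\<forall>j\<ge>rk F i. v j = 0) \<and>
    (\<forall>j<rk F i. \<forall>x\<in>Poly_Mapping.keys (v j). dg F i j + bideg x = d)}" for i
  define Bs where "Bs i = {(j, x). j < rk F i \<and> dg F i j + bideg (x :: 'n hvar mon) = d}" for i
  define e where "e p = (\<lambda>j. if j = fst p then monom_of (snd p) else 0 :: ('n hvar, 'k) mpoly)" for p :: "nat \<times> 'n hvar mon"
  define \<delta> where "\<delta> i v = (\<lambda>j. if j < rk F i then \<Sum>k<rk F (Suc i). dif F i j k * v k else 0)" for i v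
  define cut where "cut i w = (\<lambda>j. if j < rk F i then mfilter (\<lambda>x. dg F i j + bideg x = d) (w j) else 0)"
    for i and w :: "nat \<Rightarrow> ('n hvar, 'k) mpoly"
  have cutW: "cut i w \<in> W i" for i w by (auto simp: cut_def W_def keys_mfilter)
  have finBs: "finite (Bs i)" for i
  proof (rule finite_subset)
    show "Bs i \<subseteq> (\<Union>j<rk F i. Pair j ` {x. dg F i j + bideg x = d})" by (auto simp: Bs_def)
    show "finite (\<Union>j<rk F i. Pair j ` {x :: 'n hvar mon. dg F i j + bideg x = d})"
      by (intro finite_UN_I finite_imageI finite_bideg) simp
  qed
  have W: "vvs.subspace (W i)" for i
  proof (rule vvs.subspaceI)
    show "0 \<in> W i" by (simp add: W_def)
    show "x + y \<in> W i" if "x \<in> W i" "y \<in> W i" for x y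
      unfolding W_def
    proof (intro CollectI conjI allI impI ballI)
      show "(x + y) j = 0" if "j \<ge> rk F i" for j
        using \<open>x \<in> W i\<close> \<open>y \<in> W i\<close> that by (simp add: W_def)
      fix j z assume j: "j < rk F i" and "z \<in> Poly_Mapping.keys ((x + y) j)"
      then have "z \<in> Poly_Mapping.keys (x j) \<or> z \<in> Poly_Mapping.keys (y j)"
        using keys_add[of "x j" "y j"] by auto
      then show "dg F i j + bideg z = d" using that j unfolding W_def by blast
    qed
    show "(\<lambda>j. Const c * x j) \<in> W i" if "x \<in> W i" for c x
      using that unfolding W_def by (auto simp: in_keys_iff)
  qed
  have eW: "e p \<in> W i" if "p \<in> Bs i" for p i
    using that by (auto simp: e_def W_def Bs_def)
  have sum_e: "Poly_Mapping.lookup ((\<Sum>p\<in>Bs i. (\<lambda>j. Const (c p) * e p j)) j) x = (if (j, x) \<in> Bs i then c (j, x) else 0)"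
    for c i j x
  proof -
    have "Poly_Mapping.lookup ((\<Sum>p\<in>Bs i. (\<lambda>j. Const (c p) * e p j)) j) x
        = (\<Sum>p\<in>Bs i. if p = (j, x) then c p else 0)"
      unfolding sum_apply lookup_sum
      by (intro sum.cong refl) (auto simp: e_def monom_of_def lookup_single when_def)
    then show ?thesis using finBs by simp
  qed
  have expand: "v = (\<Sum>p\<in>Bs i. (\<lambda>j. Const (Poly_Mapping.lookup (v (fst p)) (snd p)) * e p j))" if v: "v \<in> W i" for v i
  proof (rule ext, rule poly_mapping_eqI)
    fix j x
    have "Poly_Mapping.lookup (v j) x = 0" if "(j, x) \<notin> Bs i"
    proof (rule ccontr)
      assume "Poly_Mapping.lookup (v j) x \<noteq> 0"
      then have k: "x \<in> Poly_Mapping.keys (v j)" by (simp add: in_keys_iff)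
      then have "j < rk F i" using v unfolding W_def by (cases "j < rk F i") auto
      then show False using v k that unfolding W_def Bs_def by blast
    qed
    then show "Poly_Mapping.lookup (v j) x = Poly_Mapping.lookup ((\<Sum>p\<in>Bs i. (\<lambda>j. Const (Poly_Mapping.lookup (v (fst p)) (snd p)) * e p j)) j) x"
      unfolding sum_e by simp
  qed
  have spanW: "W i \<subseteq> vvs.span (e ` Bs i)" for i
  proof
    fix v assume "v \<in> W i"
    from expand[OF this] show "v \<in> vvs.span (e ` Bs i)"
      by (rule ssubst) (intro vvs.span_sum vvs.span_scale vvs.span_base imageI)
  qed
  have dimW: "vvs.dim (W i) = card (Bs i)" for i
  proof -
    have "vvs.dim (W i) = vvs.dim {0 :: nat \<Rightarrow> ('n hvar, 'k) mpoly} + card (Bs i)"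
    proof (rule vvs.dim_complement[where u = e and A = "{}"])
      show "\<forall>p\<in>Bs i. c p = 0" if "(\<Sum>p\<in>Bs i. (\<lambda>j. Const (c p) * e p j)) \<in> {0}" for c
      proof
        fix p assume p: "p \<in> Bs i"
        have "(\<Sum>p\<in>Bs i. (\<lambda>j. Const (c p) * e p j)) = 0" using that by blast
        then show "c p = 0" using sum_e[of c i "fst p" "snd p"] p by simp
      qed
      show "\<exists>c. v - (\<Sum>p\<in>Bs i. (\<lambda>j. Const (c p) * e p j)) \<in> {0}" if "v \<in> W i" for v
        using expand[OF that] by (intro exI[of _ "\<lambda>p. Poly_Mapping.lookup (v (fst p)) (snd p)"]) simp
    qed (use finBs eW W vvs.subspace_0[OF W] in auto)
    moreover have "vvs.dim {0 :: nat \<Rightarrow> ('n hvar, 'k) mpoly} = 0"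
      by (rule vvs.dim_unique[of "{}"]) (simp_all add: vvs.independent_empty)
    ultimately show ?thesis by simp
  qed
  have dif_hom: "dg F i j + bideg m = dg F (Suc i) k" if "j < rk F i" "k < rk F (Suc i)" "m \<in> Poly_Mapping.keys (dif F i j k)" for i j k m
    using F that unfolding minimal_free_resolution_def by blast
  have aug_hom: "bideg m = dg F 0 j" if "j < rk F 0" "m \<in> Poly_Mapping.keys (aug F j)" for j m
    using F that unfolding minimal_free_resolution_def by blast
  have cut_dif: "\<delta> i (cut (Suc i) w) = cut i (\<delta> i w)" for i w
  proof
    fix j
    show "\<delta> i (cut (Suc i) w) j = cut i (\<delta> i w) j"
    proof (cases "j < rk F i")
      case True
      have "dif F i j k * cut (Suc i) w k = mfilter (\<lambda>x. dg F i j + bideg x = d) (dif F i j k * w k)"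
        if k: "k < rk F (Suc i)" for k
      proof -
        have "mfilter (\<lambda>x. dg F i j + bideg x = d) (w k * dif F i j k)
            = mfilter (\<lambda>x. dg F (Suc i) k + bideg x = d) (w k) * dif F i j k"
        proof (rule mfilter_mult_homogeneous)
          fix a b assume "b \<in> Poly_Mapping.keys (dif F i j k)"
          from dif_hom[OF True k this] show "dg F i j + bideg (a + b) = d \<longleftrightarrow> dg F (Suc i) k + bideg a = d"
            by (simp add: bideg_add add_ac flip: dif_hom[OF True k \<open>b \<in> _\<close>])
        qed
        then show ?thesis using k by (simp add: cut_def mult.commute)
      qed
      then show ?thesis using True by (simp add: \<delta>_def cut_def mfilter_sum)
    qed (simp add: \<delta>_def cut_def)
  qed
  have cut_id: "cut i v = v" if "v \<in> W i" for i v
  proof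
    fix j show "cut i v j = v j"
      using that unfolding W_def cut_def by (cases "j < rk F i") (auto intro!: mfilter_id)
  qed
  have exact: "(\<forall>j<rk F i. (\<Sum>k<rk F (Suc i). dif F i j k * v k) = 0) \<longleftrightarrow>
       (\<exists>w. \<forall>k<rk F (Suc i). v k = (\<Sum>l<rk F (Suc (Suc i)). dif F (Suc i) k l * w l))" for i v
    using F unfolding minimal_free_resolution_def by blast
  have kernel: "{v\<in>W (Suc i). \<delta> i v = 0} = \<delta> (Suc i) ` W (Suc (Suc i))" for i
  proof (intro equalityI subsetI)
    fix v assume v: "v \<in> {v\<in>W (Suc i). \<delta> i v = 0}"
    have "(\<Sum>k<rk F (Suc i). dif F i j k * v k) = 0" if "j < rk F i" for j
    proof -
      have "\<delta> i v j = 0" using v by simp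
      then show ?thesis using that by (simp add: \<delta>_def)
    qed
    then obtain w where w: "\<And>k. k < rk F (Suc i) \<Longrightarrow> v k = (\<Sum>l<rk F (Suc (Suc i)). dif F (Suc i) k l * w l)"
      using exact by blast
    have "v = \<delta> (Suc i) w"
    proof
      fix k show "v k = \<delta> (Suc i) w k"
        using v w[of k] by (cases "k < rk F (Suc i)") (auto simp: \<delta>_def W_def)
    qed
    then have "\<delta> (Suc i) (cut (Suc (Suc i)) w) = v" using v cut_id[of v "Suc i"] by (simp add: cut_dif)
    then show "v \<in> \<delta> (Suc i) ` W (Suc (Suc i))" using cutW by blast
  next
    fix v assume "v \<in> \<delta> (Suc i) ` W (Suc (Suc i))"
    then obtain w where w: "w \<in> W (Suc (Suc i))" "v = \<delta> (Suc i) w" by blast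
    have "v = cut (Suc i) v" using w by (metis cut_dif cut_id)
    then have "v \<in> W (Suc i)" using cutW by metis
    moreover have "\<delta> i v = 0"
    proof
      fix j
      have "\<exists>w. \<forall>k<rk F (Suc i). v k = (\<Sum>l<rk F (Suc (Suc i)). dif F (Suc i) k l * w l)"
        using w(2) by (intro exI[of _ w]) (simp add: \<delta>_def)
      then show "\<delta> i v j = 0 j" unfolding exact[symmetric] by (simp add: \<delta>_def)
    qed
    ultimately show "v \<in> {v\<in>W (Suc i). \<delta> i v = 0}" by blast
  qed
  let ?aug = "\<lambda>v. \<Sum>j<rk F 0. v j * aug F j"
  have cut_aug: "?aug (cut 0 v) = mfilter (\<lambda>x. bideg x = d) (?aug v)" for v
  proof -
    have "cut 0 v j * aug F j = mfilter (\<lambda>x. bideg x = d) (v j * aug F j)" if j: "j < rk F 0" for j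
    proof -
      have "mfilter (\<lambda>x. bideg x = d) (v j * aug F j) = mfilter (\<lambda>x. dg F 0 j + bideg x = d) (v j) * aug F j"
        by (rule mfilter_mult_homogeneous) (use aug_hom[OF j] in \<open>auto simp: bideg_add add_ac\<close>)
      then show ?thesis using j by (simp add: cut_def)
    qed
    then show ?thesis by (simp add: mfilter_sum)
  qed
  have exact0: "?aug v \<in> I \<longleftrightarrow> (\<exists>w. \<forall>j<rk F 0. v j = (\<Sum>k<rk F 1. dif F 0 j k * w k))" for v
    using F unfolding minimal_free_resolution_def by blast
  have kernel0: "{v\<in>W 0. ?aug v \<in> I} = \<delta> 0 ` W 1"
  proof (intro equalityI subsetI)
    fix v assume v: "v \<in> {v\<in>W 0. ?aug v \<in> I}"
    then obtain w where w: "\<And>j. j < rk F 0 \<Longrightarrow> v j = (\<Sum>k<rk F 1. dif F 0 j k * w k)"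
      using exact0 by blast
    have "v = \<delta> 0 w"
    proof
      fix k show "v k = \<delta> 0 w k"
        using v w[of k] by (cases "k < rk F 0") (auto simp: \<delta>_def W_def)
    qed
    then have "\<delta> 0 (cut 1 w) = v" using v cut_id[of v 0] cut_dif[of 0 w] by simp
    then show "v \<in> \<delta> 0 ` W 1" using cutW by blast
  next
    fix v assume "v \<in> \<delta> 0 ` W 1"
    then obtain w where w: "w \<in> W 1" "v = \<delta> 0 w" by blast
    have "v = cut 0 v" using w cut_dif[of 0 w] cut_id[of w 1] by simp
    then have "v \<in> W 0" using cutW by metis
    moreover have "?aug v \<in> I"
      unfolding exact0 using w(2) by (intro exI[of _ w]) (simp add: \<delta>_def)
    ultimately show "v \<in> {v\<in>W 0. ?aug v \<in> I}" by blast
  qed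
  have aug_add: "?aug (v + w) = ?aug v + ?aug w" and aug_scale: "?aug (\<lambda>j. Const c * v j) = Const c * ?aug v" for v w c
    by (simp_all add: distrib_right sum.distrib sum_distrib_left mult.assoc)
  have aug_sum: "?aug (\<Sum>t\<in>A. (\<lambda>j. Const (c t) * u t j)) = (\<Sum>t\<in>A. Const (c t) * ?aug (u t))" for A :: "'n hvar mon set" and c u
  proof (induction A rule: infinite_finite_induct)
    case (insert x A)
    show ?case
      unfolding sum.insert[OF insert.hyps] aug_add aug_scale insert.IH ..
  qed simp_all
  have aug_diff: "?aug (v - w) = ?aug v - ?aug w" for v w
    by (simp add: left_diff_distrib sum_subtractf)
  \<comment> \<open>preimages \<open>u t\<close> of the monomials \<open>t\<close> complement the kernel of the augmentation\<close>
  have dim0: "vvs.dim (W 0) = vvs.dim (\<delta> 0 ` W 1) + card T"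
  proof -
    have ex_u: "\<exists>v. v \<in> W 0 \<and> monom_of t - ?aug v \<in> I" if t: "t \<in> T" for t
    proof -
      obtain v where v: "monom_of t - ?aug v \<in> I"
        using F unfolding minimal_free_resolution_def by blast
      have "mfilter (\<lambda>x. bideg x = d) (monom_of t - ?aug v) \<in> I" using gr[OF v] .
      moreover have "mfilter (\<lambda>x. bideg x = d) (monom_of t - ?aug v) = monom_of t - ?aug (cut 0 v)"
        unfolding cut_aug
        by (rule poly_mapping_eqI) (use T(2)[OF t] in \<open>auto simp: lookup_mfilter lookup_minus monom_of_def lookup_single when_def\<close>)
      ultimately show ?thesis using cutW by metis
    qed
    define u where "u t = (SOME v. v \<in> W 0 \<and> monom_of t - ?aug v \<in> I)" for t
    have "u t \<in> W 0 \<and> monom_of t - ?aug (u t) \<in> I" if "t \<in> T" for t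
      using someI_ex[OF ex_u[OF that]] unfolding u_def .
    then have u: "\<And>t. t \<in> T \<Longrightarrow> u t \<in> W 0" "\<And>t. t \<in> T \<Longrightarrow> monom_of t - ?aug (u t) \<in> I" by blast+
    have diffI: "(\<Sum>t\<in>T. Const (c t) * monom_of t) - (\<Sum>t\<in>T. Const (c t) * ?aug (u t)) \<in> I" for c
    proof -
      have "(\<Sum>t\<in>T. Const (c t) * (monom_of t - ?aug (u t))) \<in> I"
        using u(2) by (intro ideal.subspace_sum[OF I] ideal.subspace_scale[OF I])
      then show ?thesis by (simp only: right_diff_distrib sum_subtractf)
    qed
    show ?thesis
      unfolding kernel0[symmetric]
    proof (rule vvs.dim_complement[where u = u and A = "e ` Bs 0"])
      show "vvs.subspace {v\<in>W 0. ?aug v \<in> I}"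
      proof (rule vvs.subspaceI)
        show "0 \<in> {v\<in>W 0. ?aug v \<in> I}"
          using vvs.subspace_0[OF W] ideal.subspace_0[OF I] by simp
        show "x + y \<in> {v\<in>W 0. ?aug v \<in> I}" if "x \<in> {v\<in>W 0. ?aug v \<in> I}" "y \<in> {v\<in>W 0. ?aug v \<in> I}" for x y
          unfolding mem_Collect_eq aug_add
          using that vvs.subspace_add[OF W] ideal.subspace_add[OF I] by blast
        show "(\<lambda>j. Const c * x j) \<in> {v\<in>W 0. ?aug v \<in> I}" if "x \<in> {v\<in>W 0. ?aug v \<in> I}" for c x
          unfolding mem_Collect_eq aug_scale
          using that vvs.subspace_scale[OF W] ideal.subspace_scale[OF I] by blast
      qed
      show "\<forall>t\<in>T. c t = 0" if "(\<Sum>t\<in>T. (\<lambda>j. Const (c t) * u t j)) \<in> {v\<in>W 0. ?aug v \<in> I}" for c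
      proof (rule ind)
        have "(\<Sum>t\<in>T. Const (c t) * ?aug (u t)) \<in> I" using that unfolding mem_Collect_eq aug_sum by blast
        from ideal.subspace_add[OF I diffI[of c] this] show "(\<Sum>t\<in>T. Const (c t) * monom_of t) \<in> I" by simp
      qed
      show "\<exists>c. v - (\<Sum>t\<in>T. (\<lambda>j. Const (c t) * u t j)) \<in> {v\<in>W 0. ?aug v \<in> I}" if v: "v \<in> W 0" for v
      proof -
        have "bideg x = d" if "x \<in> Poly_Mapping.keys (?aug v)" for x
        proof -
          have "mfilter (\<lambda>x. bideg x = d) (?aug v) = ?aug v" by (simp only: cut_aug[symmetric] cut_id[OF v])
          then have "x \<in> Poly_Mapping.keys (mfilter (\<lambda>x. bideg x = d) (?aug v))" using that by simp
          then show ?thesis unfolding keys_mfilter by blast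
        qed
        from gen[OF this] obtain c where c: "?aug v - (\<Sum>t\<in>T. Const (c t) * monom_of t) \<in> I" by blast
        have "v - (\<Sum>t\<in>T. (\<lambda>j. Const (c t) * u t j)) \<in> W 0"
          using u(1) v by (intro vvs.subspace_diff[OF W] vvs.subspace_sum[OF W] vvs.subspace_scale[OF W])
        moreover have "?aug (v - (\<Sum>t\<in>T. (\<lambda>j. Const (c t) * u t j))) \<in> I"
          unfolding aug_diff aug_sum using ideal.subspace_add[OF I c diffI[of c]] by simp
        ultimately show ?thesis by blast
      qed
    qed (use T u W subsetD[OF spanW[of 0]] finBs in auto)
  qed
  have dimS: "vvs.dim (W (Suc i)) = vvs.dim (\<delta> (Suc i) ` W (Suc (Suc i))) + vvs.dim (\<delta> i ` W (Suc i))" for i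
    unfolding kernel[symmetric]
  proof (rule vvs.rank_nullity[OF W spanW finite_imageI[OF finBs]])
    show "\<delta> i (x + y) = \<delta> i x + \<delta> i y" for x y
      by (rule ext) (simp add: \<delta>_def distrib_left sum.distrib)
    show "\<delta> i (\<lambda>j. Const c * x j) = (\<lambda>j. Const c * \<delta> i x j)" for c x
      by (rule ext) (simp add: \<delta>_def sum_distrib_left mult.left_commute)
  qed
  have telescope: "(\<Sum>i\<le>M. (- 1) ^ i * int (card (Bs i))) = int (card T) + (- 1) ^ M * int (vvs.dim (\<delta> M ` W (Suc M)))" for M
  proof (induction M)
    case 0 then show ?case using dim0 by (simp add: dimW)
  next
    case (Suc M)
    have "int (card (Bs (Suc M))) = int (vvs.dim (\<delta> (Suc M) ` W (Suc (Suc M)))) + int (vvs.dim (\<delta> M ` W (Suc M)))"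
      using dimS[of M] by (simp add: dimW)
    then show ?case using Suc by (simp add: algebra_simps)
  qed
  have "Bs (Suc N) = {}"
  proof -
    have "Suc N \<le> fst d + snd d" if "(j, x) \<in> Bs (Suc N)" for j x
      using res_degree[OF F, of j "Suc N"] that by (auto simp: Bs_def)
    then show ?thesis using N by fastforce
  qed
  then have "vvs.dim (\<delta> N ` W (Suc N)) = 0" using dimS[of N] by (simp add: dimW)
  then show ?thesis using telescope[of N] by (simp add: Bs_def)
qed

definition euler_betti :: "('n::finite hvar, 'k::field) mpoly set \<Rightarrow> nat \<times> nat \<Rightarrow> int"
  where "euler_betti I d = Sum_any (\<lambda>i. (- 1) ^ i * int (betti I i d))"

text \<open>The monomials with \<open>P\<close> form a basis of the quotient. The Euler characteristic in degree \<open>d\<close>, grouped by the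
  degrees \<open>e\<close> of the basis elements of the resolution, becomes a convolution of the alternating sums of
  Betti numbers with the Hilbert function of the polynomial ring.\<close>

lemma hilbert_function_resolution:
  fixes I :: "('n::finite hvar, 'k::field) mpoly set"
  assumes I: "is_ideal I" and one: "1 \<notin> I"
    and gr: "\<And>f d. f \<in> I \<Longrightarrow> mfilter (\<lambda>x. bideg x = d) f \<in> I"
    and ind: "\<And>f. f \<in> I \<Longrightarrow> (\<forall>m\<in>Poly_Mapping.keys f. P m) \<Longrightarrow> f = 0"
    and gen: "\<And>f. \<exists>g. f - g \<in> I \<and> (\<forall>m\<in>Poly_Mapping.keys g. P m)"
  shows "int (card {m. P m \<and> bideg m = d}) =
    (\<Sum>e\<in>{..fst d} \<times> {..snd d}. euler_betti I e * int (card {x :: 'n hvar mon. e + bideg x = d}))"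
proof -
  define F where "F = (SOME F. minimal_free_resolution I F)"
  have F: "minimal_free_resolution I F"
    unfolding F_def using minimal_free_resolution_exists[OF I one gr] by (rule someI_ex)
  let ?N = "fst d + snd d" and ?E = "{..fst d} \<times> {..snd d}"
  define b where "b i e = card {j. j < rk F i \<and> dg F i j = e}" for i e
  have betti: "betti I i e = b i e" for i e unfolding betti_def Let_def F_def[symmetric] b_def ..
  have b0: "b i e = 0" if "fst e + snd e < i" for i e
  proof -
    have "{j. j < rk F i \<and> dg F i j = e} = {}" using res_degree[OF F] that by fastforce
    then show ?thesis by (simp add: b_def)
  qed
  have euler: "euler_betti I e = (\<Sum>i\<le>?N. (- 1) ^ i * int (b i e))" if e: "e \<in> ?E" for e
    unfolding euler_betti_def betti
  proof (rule Sum_any.expand_superset)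
    show "{i. (- 1) ^ i * int (b i e) \<noteq> 0} \<subseteq> {..?N}"
    proof
      fix i assume "i \<in> {i. (- 1) ^ i * int (b i e) \<noteq> 0}"
      then have "b i e \<noteq> 0" by auto
      then have "i \<le> fst e + snd e" using b0[of e i] by (meson not_less)
      also have "\<dots> \<le> ?N" using e by auto
      finally show "i \<in> {..?N}" by simp
    qed
  qed simp
  define T where "T = {m. P m \<and> bideg m = d}"
  have finT: "finite T"
    by (rule finite_subset[OF _ finite_bideg[of "(0, 0)" d]]) (auto simp: T_def prod_eq_iff)
  have lookT: "Poly_Mapping.lookup (\<Sum>t\<in>T. Const (c t) * monom_of t) m = (if m \<in> T then c m else 0)"
    for c :: "'n hvar mon \<Rightarrow> 'k" and m
  proof -
    have "Poly_Mapping.lookup (\<Sum>t\<in>T. Const (c t) * monom_of t) m = (\<Sum>t\<in>T. if t = m then c t else 0)"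
      unfolding lookup_sum by (intro sum.cong refl) (simp add: monom_of_def lookup_single when_def)
    then show ?thesis using finT by simp
  qed
  have "int (card T) = (\<Sum>i\<le>?N. (- 1) ^ i * int (card {(j, x :: 'n hvar mon). j < rk F i \<and> dg F i j + bideg x = d}))"
  proof (rule euler_characteristic[OF F I gr finT _ _ _ order_refl])
    show "bideg t = d" if "t \<in> T" for t using that by (simp add: T_def)
    show "\<forall>t\<in>T. c t = 0" if "(\<Sum>t\<in>T. Const (c t) * monom_of t) \<in> I" for c
    proof -
      have "\<forall>m\<in>Poly_Mapping.keys (\<Sum>t\<in>T. Const (c t) * monom_of t). P m"
      proof
        fix m assume "m \<in> Poly_Mapping.keys (\<Sum>t\<in>T. Const (c t) * monom_of t)"
        then have "m \<in> T" unfolding in_keys_iff lookT by (simp split: if_splits)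
        then show "P m" by (simp add: T_def)
      qed
      then have 0: "(\<Sum>t\<in>T. Const (c t) * monom_of t) = 0" using ind that by blast
      show ?thesis
      proof
        fix t assume "t \<in> T"
        then show "c t = 0" using lookT[of c t] unfolding 0 by simp
      qed
    qed
    show "\<exists>c. f - (\<Sum>t\<in>T. Const (c t) * monom_of t) \<in> I" if f: "\<And>x. x \<in> Poly_Mapping.keys f \<Longrightarrow> bideg x = d" for f
    proof -
      obtain g where g: "f - g \<in> I" "\<forall>m\<in>Poly_Mapping.keys g. P m" using gen by blast
      have "mfilter (\<lambda>x. bideg x = d) (f - g) = f - (\<Sum>t\<in>T. Const (Poly_Mapping.lookup g t) * monom_of t)"
      proof (rule poly_mapping_eqI)
        fix m
        have "bideg m \<noteq> d \<Longrightarrow> Poly_Mapping.lookup f m = 0" using f[of m] by (auto simp: in_keys_iff)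
        moreover have "\<not> P m \<Longrightarrow> Poly_Mapping.lookup g m = 0" using g(2) by (auto simp: in_keys_iff)
        ultimately show "Poly_Mapping.lookup (mfilter (\<lambda>x. bideg x = d) (f - g)) m =
            Poly_Mapping.lookup (f - (\<Sum>t\<in>T. Const (Poly_Mapping.lookup g t) * monom_of t)) m"
          unfolding lookup_mfilter lookup_minus lookT by (auto simp: T_def)
      qed
      then have "f - (\<Sum>t\<in>T. Const (Poly_Mapping.lookup g t) * monom_of t) \<in> I"
        using gr[OF g(1), of d] by simp
      then show ?thesis by blast
    qed
  qed
  also have "\<dots> = (\<Sum>i\<le>?N. \<Sum>e\<in>?E. (- 1) ^ i * int (b i e) * int (card {x :: 'n hvar mon. e + bideg x = d}))"
  proof (rule sum.cong[OF refl])
    fix i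
    let ?A = "\<lambda>e. {j. j < rk F i \<and> dg F i j = e} \<times> {x :: 'n hvar mon. e + bideg x = d}"
    have "{(j, x :: 'n hvar mon). j < rk F i \<and> dg F i j + bideg x = d} = (\<Union>e\<in>?E. ?A e)"
    proof (intro equalityI subsetI)
      fix p assume "p \<in> {(j, x :: 'n hvar mon). j < rk F i \<and> dg F i j + bideg x = d}"
      then obtain j x where p: "p = (j, x)" "j < rk F i" "dg F i j + bideg x = d" by blast
      have "dg F i j \<in> ?E"
        using arg_cong[OF p(3), of fst] arg_cong[OF p(3), of snd] by (simp add: mem_Times_iff)
      then show "p \<in> (\<Union>e\<in>?E. ?A e)" using p by (intro UN_I[of "dg F i j"]) auto
    qed auto
    moreover have "card (\<Union>e\<in>?E. ?A e) = (\<Sum>e\<in>?E. card (?A e))"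
      by (rule card_UN_disjoint) (auto simp: finite_bideg)
    ultimately have "card {(j, x :: 'n hvar mon). j < rk F i \<and> dg F i j + bideg x = d}
        = (\<Sum>e\<in>?E. b i e * card {x :: 'n hvar mon. e + bideg x = d})"
      by (simp add: card_cartesian_product b_def)
    then show "(- 1) ^ i * int (card {(j, x :: 'n hvar mon). j < rk F i \<and> dg F i j + bideg x = d})
        = (\<Sum>e\<in>?E. (- 1) ^ i * int (b i e) * int (card {x :: 'n hvar mon. e + bideg x = d}))"
      by (simp add: sum_distrib_left mult.assoc)
  qed
  also have "\<dots> = (\<Sum>e\<in>?E. \<Sum>i\<le>?N. (- 1) ^ i * int (b i e) * int (card {x :: 'n hvar mon. e + bideg x = d}))"
    by (rule sum.swap)
  also have "\<dots> = (\<Sum>e\<in>?E. euler_betti I e * int (card {x :: 'n hvar mon. e + bideg x = d}))"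
    by (intro sum.cong refl) (simp add: euler sum_distrib_right)
  finally show ?thesis by (simp add: T_def)
qed

section \<open>The h-polynomial counts bases by internal activity\<close>

lemma subspace_vanishing:
  "vec.subspace V \<Longrightarrow> vec.subspace {f\<in>V. \<forall>i\<in>I. f $ i = 0}"
  by (auto simp: vec.subspace_def)

text \<open>Active elements are pivots, and the pivots form a basis.\<close>

lemma all_active_pivots:
  fixes V :: "('k::field ^ 'n::finite) set"
  assumes ls: "strict_linear_order ls" and V: "vec.subspace V" and C: "coord_basis V C"
    and act: "\<And>b. b \<in> C \<Longrightarrow> active ls V C b"
  shows "C = {i. \<exists>f\<in>V. initial_in ls f i}"
proof (rule card_subset_eq)
  show "C \<subseteq> {i. \<exists>f\<in>V. initial_in ls f i}" using act unfolding active_def by blast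
  show "card C = card {i. \<exists>f\<in>V. initial_in ls f i}"
    using coord_basis_card[OF V C] coord_basis_card[OF V pivots_basis[OF ls V]] by simp
qed simp

text \<open>A basis \<open>B\<close> that contains \<open>I\<close> corresponds to the basis \<open>B - I\<close> of the forms that vanish on \<open>I\<close>, with the
  same activities. So the elements outside \<open>I\<close> are all active only if they are the pivots of these forms.\<close>

lemma active_extension_unique:
  fixes V :: "('k::field ^ 'n::finite) set"
  assumes ls: "strict_linear_order ls" and V: "vec.subspace V" and I: "coord_indep V I"
  shows "\<exists>!B. coord_basis V B \<and> I \<subseteq> B \<and> (\<forall>b\<in>B - I. active ls V B b)"
proof -
  let ?W = "{f\<in>V. \<forall>i\<in>I. f $ i = 0}"
  have W: "vec.subspace ?W" by (rule subspace_vanishing[OF V])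
  have act: "active ls V B b \<longleftrightarrow> active ls ?W (B - I) b" if "I \<subseteq> B" "b \<in> B - I" for B b
    unfolding active_def using that by auto
  have basis: "coord_basis V B \<longleftrightarrow> coord_basis ?W (B - I)" if IB: "I \<subseteq> B" for B
  proof
    assume B: "coord_basis V B"
    then have ind: "coord_indep V B" by (simp add: coord_basis_def)
    have "coord_indep ?W (B - I)"
      unfolding coord_indep_def
    proof
      fix b assume b: "b \<in> B - I"
      then obtain f where f: "f \<in> V" "f $ b = 1" "\<forall>c\<in>B - {b}. f $ c = 0"
        using ind unfolding coord_indep_def by blast
      then show "\<exists>f\<in>?W. f $ b = 1 \<and> (\<forall>c\<in>B - I - {b}. f $ c = 0)"
        using b IB by (intro bexI[of _ f]) auto
    qed
    then show "coord_basis ?W (B - I)"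
      using B unfolding coord_basis_def by auto
  next
    assume B: "coord_basis ?W (B - I)"
    from coord_basis_extend[OF V I this] show "coord_basis V B" using IB by (simp add: Un_absorb1)
  qed
  obtain C where C: "coord_basis ?W C" "\<And>b. b \<in> C \<Longrightarrow> b \<in> UNIV \<Longrightarrow> active ls ?W C b"
    by (rule standard_basis_exists[OF ls W standard_empty[of ls ?W UNIV]], rule that, assumption, blast)
  have CI: "C \<inter> I = {}"
  proof (rule ccontr)
    assume "C \<inter> I \<noteq> {}"
    then obtain b where "b \<in> C" "b \<in> I" by blast
    moreover from this obtain f where "f \<in> ?W" "f $ b = 1"
      using C(1) unfolding coord_basis_def coord_indep_def by blast
    ultimately show False by simp
  qed
  show ?thesis
  proof (rule ex1I[of _ "C \<union> I"])
    have diff: "(C \<union> I) - I = C" using CI by blast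
    have "coord_basis V (C \<union> I)" using basis[of "C \<union> I"] C(1) diff by simp
    moreover have "\<forall>b\<in>(C \<union> I) - I. active ls V (C \<union> I) b"
      using act[of "C \<union> I"] C(2) diff by simp
    ultimately show "coord_basis V (C \<union> I) \<and> I \<subseteq> C \<union> I \<and> (\<forall>b\<in>C \<union> I - I. active ls V (C \<union> I) b)"
      by blast
    fix B assume B: "coord_basis V B \<and> I \<subseteq> B \<and> (\<forall>b\<in>B - I. active ls V B b)"
    have "B - I = {i. \<exists>f\<in>?W. initial_in ls f i}"
      by (rule all_active_pivots[OF ls W]) (use B basis act in auto)
    moreover have "C = {i. \<exists>f\<in>?W. initial_in ls f i}"
      by (rule all_active_pivots[OF ls W C(1)]) (use C(2) in auto)
    ultimately show "B = C \<union> I" using B by blast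
  qed
qed

lemma sum_powers_subsets:
  fixes x :: "'a::comm_ring_1"
  assumes "finite A"
  shows "(\<Sum>S\<in>Pow A. x ^ (card A - card S)) = (x + 1) ^ card A"
proof -
  have "(\<Prod>a\<in>A. 1 + x) = (\<Sum>S\<in>Pow A. (\<Prod>a\<in>S. 1) * (\<Prod>a\<in>A - S. x))"
    using assms by (rule prod_add)
  also have "\<dots> = (\<Sum>S\<in>Pow A. x ^ (card A - card S))"
    using assms by (intro sum.cong refl) (auto simp: card_Diff_subset finite_subset)
  finally show ?thesis by (simp add: add.commute)
qed

text \<open>The intervals \<open>[IP(B), B]\<close> partition the independent sets, and the interval of \<open>B\<close> contributes
  \<open>((x - 1) + 1) ^ |IA(B)|\<close>.\<close>

lemma h_polynomial_activity:
  fixes V :: "('k::field ^ 'n::finite) set"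
  assumes ls: "strict_linear_order ls" and V: "vec.subspace V"
  shows "h_polynomial (coord_matroid V) = (\<Sum>B\<in>coord_matroid V. [:0, 1:] ^ card {b\<in>B. active ls V B b})"
proof -
  let ?r = "vec.dim V" and ?x = "[:-1, 1:] :: int poly"
  let ?J = "{I. coord_indep V I}" and ?M = "coord_matroid V"
  define ext where "ext I = (THE B. coord_basis V B \<and> I \<subseteq> B \<and> (\<forall>b\<in>B - I. active ls V B b))" for I
  have ext: "coord_basis V (ext I) \<and> I \<subseteq> ext I \<and> (\<forall>b\<in>ext I - I. active ls V (ext I) b)" if "coord_indep V I" for I
    unfolding ext_def by (rule theI'[OF active_extension_unique[OF ls V that]])
  have ext_eq: "ext I = B" if "coord_indep V I" "coord_basis V B" "I \<subseteq> B" "\<forall>b\<in>B - I. active ls V B b" for I B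
    unfolding ext_def by (rule the1_equality[OF active_extension_unique[OF ls V that(1)]]) (use that in blast)
  have cardB: "card B = ?r" if "coord_basis V B" for B using coord_basis_card[OF V that] by simp
  have le: "card I \<le> ?r" if "coord_indep V I" for I
    using ext[OF that] cardB card_mono[of "ext I" I] by auto
  have "h_polynomial ?M = (\<Sum>i\<le>?r. \<Sum>I | I \<in> ?J \<and> card I = i. ?x ^ (?r - card I))"
    unfolding h_polynomial_def matroid_rank_coord_matroid[OF V] indep_sets_coord_matroid[OF V] by simp
  also have "\<dots> = (\<Sum>I\<in>?J. ?x ^ (?r - card I))"
    by (rule sum.group) (use le in auto)
  also have "\<dots> = (\<Sum>B\<in>?M. \<Sum>I | I \<in> ?J \<and> ext I = B. ?x ^ (?r - card I))"
    by (rule sum.group[symmetric]) (use ext in \<open>auto simp: coord_matroid_def\<close>)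
  also have "\<dots> = (\<Sum>B\<in>?M. [:0, 1:] ^ card {b\<in>B. active ls V B b})"
  proof (rule sum.cong[OF refl])
    fix B assume "B \<in> ?M"
    then have B: "coord_basis V B" by (simp add: coord_matroid_def)
    let ?A = "{b\<in>B. active ls V B b}"
    have fib: "{I \<in> ?J. ext I = B} = (\<lambda>S. B - ?A \<union> S) ` Pow ?A"
    proof (intro equalityI subsetI)
      fix I assume "I \<in> {I \<in> ?J. ext I = B}"
      then have "I \<subseteq> B" "\<forall>b\<in>B - I. active ls V B b" using ext by auto
      then show "I \<in> (\<lambda>S. B - ?A \<union> S) ` Pow ?A" by (intro image_eqI[of _ _ "I \<inter> ?A"]) auto
    next
      fix I assume "I \<in> (\<lambda>S. B - ?A \<union> S) ` Pow ?A"
      then have I: "I \<subseteq> B" "\<forall>b\<in>B - I. active ls V B b" by auto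
      have "coord_indep V I"
        using B I(1) indep_sets_coord_matroid[OF V] unfolding indep_sets_def coord_matroid_def by blast
      then show "I \<in> {I \<in> ?J. ext I = B}" using ext_eq[OF _ B I] by simp
    qed
    have inj: "inj_on (\<lambda>S. B - ?A \<union> S) (Pow ?A)" by (auto simp: inj_on_def)
    have card: "?r - card (B - ?A \<union> S) = card ?A - card S" if "S \<in> Pow ?A" for S
    proof -
      have "card (B - ?A \<union> S) = card (B - ?A) + card S" using that by (intro card_Un_disjoint) auto
      moreover have "card (B - ?A) = card B - card ?A" by (rule card_Diff_subset) auto
      moreover have "card ?A \<le> card B" by (rule card_mono) auto
      ultimately show ?thesis using cardB[OF B] by simp
    qed
    have "(\<Sum>I | I \<in> ?J \<and> ext I = B. ?x ^ (?r - card I)) = (\<Sum>S\<in>Pow ?A. ?x ^ (card ?A - card S))"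
      unfolding fib sum.reindex[OF inj] o_def by (intro sum.cong refl) (simp only: card)
    also have "\<dots> = (?x + 1) ^ card ?A" by (rule sum_powers_subsets) simp
    also have "?x + 1 = [:0, 1:]" by (simp add: one_pCons)
    finally show "(\<Sum>I | I \<in> ?J \<and> ext I = B. ?x ^ (?r - card I)) = [:0, 1:] ^ card ?A" .
  qed
  finally show ?thesis .
qed

section \<open>The K-polynomial\<close>

definition degree_var :: "'n hvar \<Rightarrow> st"
  where "degree_var v = (case v of xv _ \<Rightarrow> S_var | yv _ \<Rightarrow> T_var)"

definition st_mon :: "nat \<times> nat \<Rightarrow> st mon"
  where "st_mon e = Poly_Mapping.single S_var (fst e) + Poly_Mapping.single T_var (snd e)"

definition st_deg :: "st mon \<Rightarrow> nat \<times> nat"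
  where "st_deg m = (Poly_Mapping.lookup m S_var, Poly_Mapping.lookup m T_var)"

lemma st_deg_add: "st_deg (a + b) = st_deg a + st_deg b"
  by (simp add: st_deg_def lookup_add)

lemma st_mon_deg: "st_mon (st_deg m) = m"
proof (rule poly_mapping_eqI)
  fix v show "Poly_Mapping.lookup (st_mon (st_deg m)) v = Poly_Mapping.lookup m v"
    by (cases v) (simp_all add: st_mon_def st_deg_def lookup_add lookup_single)
qed

lemma st_deg_mon: "st_deg (st_mon e) = e"
  by (simp add: st_mon_def st_deg_def lookup_add lookup_single)

lemma st_deg_single_degree_var:
  "st_deg (Poly_Mapping.single (degree_var v) 1) = bideg (Poly_Mapping.single (v :: 'n::finite hvar) 1)"
  by (cases v) (simp_all add: st_deg_def bideg_def degree_var_def lookup_single when_def)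

text \<open>The coefficients of the product of \<open>K\<close> with the Hilbert series of the span of \<open>A\<close>.\<close>

definition hilbert_coeff :: "(st, int) mpoly \<Rightarrow> 'n::finite hvar mon set \<Rightarrow> nat \<times> nat \<Rightarrow> int"
  where "hilbert_coeff K A d = (\<Sum>e\<in>{..fst d} \<times> {..snd d}.
    Poly_Mapping.lookup K (st_mon e) * int (card {x\<in>A. e + bideg x = d}))"

lemma hilbert_coeff_add: "hilbert_coeff (K + K') A d = hilbert_coeff K A d + hilbert_coeff K' A d"
  by (simp add: hilbert_coeff_def lookup_add distrib_right sum.distrib)

lemma hilbert_coeff_0: "hilbert_coeff 0 A d = 0"
  by (simp add: hilbert_coeff_def)

lemma hilbert_coeff_diff: "hilbert_coeff (K - K') A d = hilbert_coeff K A d - hilbert_coeff K' A d"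
  by (simp add: hilbert_coeff_def lookup_minus left_diff_distrib sum_subtractf)

lemma hilbert_coeff_sum: "hilbert_coeff (\<Sum>i\<in>J. K i) A d = (\<Sum>i\<in>J. hilbert_coeff (K i) A d)"
  by (induction J rule: infinite_finite_induct) (auto simp: hilbert_coeff_0 hilbert_coeff_add)

lemma hilbert_coeff_single:
  "hilbert_coeff (Poly_Mapping.single m c) A d = c * int (card {x\<in>A. st_deg m + bideg x = d})"
proof -
  have "hilbert_coeff (Poly_Mapping.single m c) A d = (\<Sum>e\<in>{..fst d} \<times> {..snd d}.
      if e = st_deg m then c * int (card {x\<in>A. st_deg m + bideg x = d}) else 0)"
    unfolding hilbert_coeff_def
    by (intro sum.cong refl) (auto simp: lookup_single when_def st_mon_deg st_deg_mon)
  also have "\<dots> = c * int (card {x\<in>A. st_deg m + bideg x = d})"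
  proof (cases "st_deg m \<in> {..fst d} \<times> {..snd d}")
    case False
    then have empty: "{x\<in>A. st_deg m + bideg x = d} = {}" by (auto simp: mem_Times_iff)
    show ?thesis unfolding empty by simp
  qed simp
  finally show ?thesis .
qed

lemma hilbert_coeff_1: "hilbert_coeff 1 A d = int (card {x\<in>A. bideg x = d})"
proof -
  have "st_deg 0 = 0" by (simp add: st_deg_def zero_prod_def)
  then show ?thesis using hilbert_coeff_single[of 0 1 A d] by simp
qed

lemma hilbert_coeff_Diff:
  assumes "B \<subseteq> A"
  shows "hilbert_coeff K (A - B) d = hilbert_coeff K A d - hilbert_coeff K B d"
proof -
  have fin: "finite {x\<in>A. e + bideg x = d}" for e by (rule finite_subset[OF _ finite_bideg[of e d]]) auto
  have "int (card {x\<in>A - B. e + bideg x = d}) = int (card {x\<in>A. e + bideg x = d}) - int (card {x\<in>B. e + bideg x = d})" for e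
  proof -
    have "{x\<in>A - B. e + bideg x = d} = {x\<in>A. e + bideg x = d} - {x\<in>B. e + bideg x = d}" by auto
    moreover have "{x\<in>B. e + bideg x = d} \<subseteq> {x\<in>A. e + bideg x = d}" using assms by auto
    ultimately show ?thesis
      using fin[of e] by (simp add: card_Diff_subset card_mono finite_subset of_nat_diff)
  qed
  then show ?thesis by (simp only: hilbert_coeff_def right_diff_distrib sum_subtractf)
qed

text \<open>Multiplying \<open>K\<close> by the degree of a variable has the same effect as multiplying all monomials of \<open>A\<close> by
  this variable.\<close>

lemma hilbert_coeff_mult_var:
  fixes A :: "'a::finite hvar mon set"
  shows "hilbert_coeff (K * Var (degree_var v)) A d = hilbert_coeff K ((+) (Poly_Mapping.single v 1) ` A) d"
proof (induction K rule: mpoly_induct)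
  case (single m c)
  let ?s = "Poly_Mapping.single v 1 :: 'a hvar mon"
  have "{x \<in> (+) ?s ` A. st_deg m + bideg x = d}
      = (+) ?s ` {x\<in>A. st_deg (m + Poly_Mapping.single (degree_var v) 1) + bideg x = d}"
    unfolding st_deg_add st_deg_single_degree_var by (auto simp: bideg_add add_ac simp del: One_nat_def)
  moreover have "inj_on ((+) ?s) B" for B by (simp add: inj_on_def)
  ultimately have "card {x \<in> (+) ?s ` A. st_deg m + bideg x = d}
      = card {x\<in>A. st_deg (m + Poly_Mapping.single (degree_var v) 1) + bideg x = d}"
    by (simp only: card_image)
  then show ?case unfolding Var_def monom_of_def mult_single hilbert_coeff_single by simp
next
  case zero
  show ?case by (simp add: hilbert_coeff_0)
next
  case (add f g)
  then show ?case by (simp only: hilbert_coeff_add distrib_right)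
qed

lemma shift_by_variable:
  "m \<in> (+) (Poly_Mapping.single v 1) ` A \<longleftrightarrow>
    v \<in> Poly_Mapping.keys m \<and> m - Poly_Mapping.single v (1 :: nat) \<in> A"
proof
  assume "m \<in> (+) (Poly_Mapping.single v 1) ` A"
  then obtain a where "a \<in> A" "m = Poly_Mapping.single v 1 + a" by blast
  then show "v \<in> Poly_Mapping.keys m \<and> m - Poly_Mapping.single v 1 \<in> A"
    by (simp add: in_keys_iff lookup_add lookup_single)
next
  assume *: "v \<in> Poly_Mapping.keys m \<and> m - Poly_Mapping.single v 1 \<in> A"
  then have "m = Poly_Mapping.single v 1 + (m - Poly_Mapping.single v 1)"
    by (intro poly_mapping_eqI) (auto simp: in_keys_iff lookup_add lookup_minus lookup_single when_def)
  then show "m \<in> (+) (Poly_Mapping.single v 1) ` A" using * by blast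
qed

lemma keys_minus_single:
  "w \<noteq> v \<Longrightarrow> w \<in> Poly_Mapping.keys (m - Poly_Mapping.single v (1 :: nat)) \<longleftrightarrow> w \<in> Poly_Mapping.keys m"
  by (simp add: in_keys_iff lookup_minus lookup_single)

text \<open>A factor \<open>Var (degree_var v)\<close> forces \<open>v\<close> into the support of the monomials; subtracting the monomials
  that contain \<open>v\<close>, the factor \<open>1 - Var (degree_var v)\<close> keeps it out.\<close>

lemma hilbert_coeff_support:
  fixes P N :: "'n::finite hvar set"
  assumes "P \<inter> N = {}"
  shows "hilbert_coeff (K * ((\<Prod>v\<in>P. Var (degree_var v)) * (\<Prod>v\<in>N. 1 - Var (degree_var v)))) (UNIV :: 'n hvar mon set) d
    = hilbert_coeff K {m. P \<subseteq> Poly_Mapping.keys m \<and> N \<inter> Poly_Mapping.keys m = {}} d"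
proof -
  have pos: "hilbert_coeff (K * (\<Prod>v\<in>P. Var (degree_var v))) (UNIV :: 'n hvar mon set) d
      = hilbert_coeff K {m :: 'n hvar mon. P \<subseteq> Poly_Mapping.keys m} d" if "finite P" for K P
    using that
  proof (induction P arbitrary: K)
    case (insert v P)
    let ?A = "{m :: 'n hvar mon. P \<subseteq> Poly_Mapping.keys m}"
    have k: "w \<in> Poly_Mapping.keys (m - Poly_Mapping.single v (1 :: nat)) \<longleftrightarrow> w \<in> Poly_Mapping.keys m" if "w \<in> P" for w m
      using keys_minus_single[of w v m] insert.hyps that by blast
    have "(+) (Poly_Mapping.single v 1) ` ?A = {m. insert v P \<subseteq> Poly_Mapping.keys m}"
      unfolding set_eq_iff shift_by_variable by (auto simp: subset_eq k simp del: One_nat_def)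
    then show ?case
      unfolding prod.insert[OF insert.hyps] mult.assoc[symmetric] insert.IH hilbert_coeff_mult_var by simp
  qed simp
  have "hilbert_coeff (K * ((\<Prod>v\<in>N. 1 - Var (degree_var v)) * (\<Prod>v\<in>P. Var (degree_var v)))) (UNIV :: 'n hvar mon set) d
      = hilbert_coeff K {m. P \<subseteq> Poly_Mapping.keys m \<and> N \<inter> Poly_Mapping.keys m = {}} d"
    if "finite N" "P \<inter> N = {}" for K N
    using that
  proof (induction N arbitrary: K)
    case empty
    show ?case using pos[of P K] by simp
  next
    case (insert v N)
    let ?A = "{m :: 'n hvar mon. P \<subseteq> Poly_Mapping.keys m \<and> N \<inter> Poly_Mapping.keys m = {}}"
    have vP: "v \<notin> P" "P \<inter> N = {}" using insert.prems by auto
    have k: "w \<in> Poly_Mapping.keys (m - Poly_Mapping.single v (1 :: nat)) \<longleftrightarrow> w \<in> Poly_Mapping.keys m"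
      if "w \<in> P \<or> w \<in> N" for w m
      using keys_minus_single[of w v m] insert.hyps vP that by blast
    have sub: "(+) (Poly_Mapping.single v 1) ` ?A = {m\<in>?A. v \<in> Poly_Mapping.keys m}"
      unfolding set_eq_iff shift_by_variable by (auto simp: subset_eq disjoint_iff k simp del: One_nat_def)
    have "hilbert_coeff (K * ((\<Prod>v\<in>insert v N. 1 - Var (degree_var v)) * (\<Prod>v\<in>P. Var (degree_var v)))) (UNIV :: 'n hvar mon set) d
        = hilbert_coeff (K * (1 - Var (degree_var v)) * ((\<Prod>v\<in>N. 1 - Var (degree_var v)) * (\<Prod>v\<in>P. Var (degree_var v)))) (UNIV :: 'n hvar mon set) d"
      using insert.hyps by (simp add: mult.assoc)
    also have "\<dots> = hilbert_coeff (K * (1 - Var (degree_var v))) ?A d" by (rule insert.IH[OF vP(2)])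
    also have "\<dots> = hilbert_coeff K ?A d - hilbert_coeff K {m\<in>?A. v \<in> Poly_Mapping.keys m} d"
      unfolding right_diff_distrib mult_1_right hilbert_coeff_diff hilbert_coeff_mult_var sub ..
    also have "\<dots> = hilbert_coeff K (?A - {m\<in>?A. v \<in> Poly_Mapping.keys m}) d"
      by (rule hilbert_coeff_Diff[symmetric]) blast
    also have "?A - {m\<in>?A. v \<in> Poly_Mapping.keys m} = {m. P \<subseteq> Poly_Mapping.keys m \<and> insert v N \<inter> Poly_Mapping.keys m = {}}"
      by auto
    finally show ?case .
  qed
  from this[of N K] assms show ?thesis by (simp add: mult.commute)
qed

text \<open>This is the numerator of the generating function by bidegree of the monomials with support exactly \<open>P\<close>,
  over the denominator of the Hilbert series of the polynomial ring.\<close>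

definition support_series :: "'n::finite hvar set \<Rightarrow> (st, int) mpoly"
  where "support_series P = (\<Prod>v\<in>P. Var (degree_var v)) * (\<Prod>v\<in>- P. 1 - Var (degree_var v))"

lemma hilbert_coeff_support_series:
  fixes \<P> :: "'n::finite hvar set set"
  shows "hilbert_coeff (\<Sum>P\<in>\<P>. support_series P) (UNIV :: 'n hvar mon set) d
    = int (card {m. Poly_Mapping.keys m \<in> \<P> \<and> bideg m = d})"
proof -
  have "hilbert_coeff (support_series P) (UNIV :: 'n hvar mon set) d
      = int (card {m. Poly_Mapping.keys m = P \<and> bideg m = d})" for P :: "'n hvar set"
  proof -
    have "hilbert_coeff (support_series P) (UNIV :: 'n hvar mon set) d
        = hilbert_coeff 1 {m. P \<subseteq> Poly_Mapping.keys m \<and> - P \<inter> Poly_Mapping.keys m = {}} d"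
      using hilbert_coeff_support[of P "- P" 1 d] by (simp add: support_series_def)
    also have "{m. P \<subseteq> Poly_Mapping.keys m \<and> - P \<inter> Poly_Mapping.keys m = {}} = {m :: 'n hvar mon. Poly_Mapping.keys m = P}"
      by auto
    finally show ?thesis unfolding hilbert_coeff_1 by simp
  qed
  then have "hilbert_coeff (\<Sum>P\<in>\<P>. support_series P) (UNIV :: 'n hvar mon set) d
      = int (\<Sum>P\<in>\<P>. card {m :: 'n hvar mon. Poly_Mapping.keys m = P \<and> bideg m = d})"
    by (simp add: hilbert_coeff_sum)
  also have "(\<Sum>P\<in>\<P>. card {m :: 'n hvar mon. Poly_Mapping.keys m = P \<and> bideg m = d})
      = card (\<Union>P\<in>\<P>. {m. Poly_Mapping.keys m = P \<and> bideg m = d})"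
  proof (rule card_UN_disjoint[symmetric])
    have "finite {m :: 'n hvar mon. Poly_Mapping.keys m = P \<and> bideg m = d}" for P
      by (rule finite_subset[OF _ finite_bideg[of 0 d]]) auto
    then show "\<forall>P\<in>\<P>. finite {m :: 'n hvar mon. Poly_Mapping.keys m = P \<and> bideg m = d}" by blast
  qed auto
  also have "(\<Union>P\<in>\<P>. {m. Poly_Mapping.keys m = P \<and> bideg m = d}) = {m :: 'n hvar mon. Poly_Mapping.keys m \<in> \<P> \<and> bideg m = d}"
    by auto
  finally show ?thesis .
qed

text \<open>The Hilbert series of the polynomial ring has constant term 1, so it can be cancelled.\<close>

lemma hilbert_convolution_cancel:
  fixes p q :: "nat \<times> nat \<Rightarrow> int"
  assumes eq: "\<And>d. (\<Sum>e\<in>{..fst d} \<times> {..snd d}. p e * int (card {x :: 'n::finite hvar mon. e + bideg x = d}))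
    = (\<Sum>e\<in>{..fst d} \<times> {..snd d}. q e * int (card {x :: 'n hvar mon. e + bideg x = d}))"
  shows "p d = q d"
proof (induction "fst d + snd d" arbitrary: d rule: less_induct)
  case less
  let ?E = "{..fst d} \<times> {..snd d}" and ?c = "\<lambda>e. int (card {x :: 'n hvar mon. e + bideg x = d})"
  have "{x :: 'n hvar mon. d + bideg x = d} = {0}" using bideg_eq_0 by (auto simp: zero_prod_def)
  then have c: "?c d = 1" by simp
  have split: "sum g ?E = g d + sum g (?E - {d})" for g :: "nat \<times> nat \<Rightarrow> int"
    by (rule sum.remove) (auto simp: mem_Times_iff)
  have "p d * ?c d + (\<Sum>e\<in>?E - {d}. p e * ?c e) = q d * ?c d + (\<Sum>e\<in>?E - {d}. q e * ?c e)"
    using eq[of d] by (simp only: split)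
  moreover have "(\<Sum>e\<in>?E - {d}. p e * ?c e) = (\<Sum>e\<in>?E - {d}. q e * ?c e)"
  proof (rule sum.cong[OF refl])
    fix e assume "e \<in> ?E - {d}"
    then have "fst e \<le> fst d" "snd e \<le> snd d" "e \<noteq> d" by auto
    then have "fst e + snd e < fst d + snd d" by (cases e, cases d) auto
    then show "p e * ?c e = q e * ?c e" using less by simp
  qed
  ultimately show ?case unfolding c by simp
qed

text \<open>The ideal is generated by the homogenized linear forms, which are bihomogeneous.\<close>

lemma torus_ideal_bigraded:
  fixes L :: "('k::field ^ 'n::finite) set"
  assumes inf: "infinite (UNIV :: 'k set)" and L: "vec.subspace L" and f: "f \<in> torus_ideal L"
  shows "mfilter (\<lambda>m. bideg m = d) f \<in> torus_ideal L"
proof -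
  note I = torus_ideal_subspace[of L]
  obtain tle :: "'n hvar mon \<Rightarrow> 'n hvar mon \<Rightarrow> bool" where T: "term_order tle" using term_order_exists by blast
  obtain F where F: "form_reps (perp L) F" using cocircuit_forms_exist cocircuit_forms_reps(1) by blast
  note gen = closure_generators(2)[OF inf L F T]
  define J where "J = {g :: ('n hvar, 'k) mpoly. \<forall>d. mfilter (\<lambda>m. bideg m = d) g \<in> torus_ideal L}"
  have "ideal_gen (hom_form ` F) \<subseteq> J"
  proof (rule ideal_gen_least)
    show "hom_form ` F \<subseteq> J"
    proof
      fix g assume "g \<in> hom_form ` F"
      then obtain a where a: "a \<in> F" "g = hom_form a" by blast
      have deg: "bideg m = (1, card (supp a) - 1)" if "m \<in> Poly_Mapping.keys g" for m
      proof -
        from that obtain i where i: "i \<in> supp a" "m = lin_mon (supp a) i" unfolding a(2) keys_hom_form by blast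
        have "(\<Sum>j\<in>UNIV. if j \<in> supp a \<and> j \<noteq> i then 1 else 0) = card (supp a - {i})"
          by (simp add: sum.If_cases Collect_conj_eq Collect_neg_eq Diff_eq)
        then show ?thesis using i(1) unfolding i(2) bideg_def lookup_lin_mon by simp
      qed
      have g: "g \<in> torus_ideal L" unfolding gen using a by (intro ideal.span_base) blast
      have "mfilter (\<lambda>m. bideg m = e) g \<in> torus_ideal L" for e
      proof (cases "e = (1, card (supp a) - 1)")
        case True
        then have "mfilter (\<lambda>m. bideg m = e) g = g" using deg by (intro mfilter_id) simp
        then show ?thesis using g by simp
      next
        case False
        then have "mfilter (\<lambda>m. bideg m = e) g = 0" using deg by (intro mfilter_eq_0) auto
        then show ?thesis using ideal.subspace_0[OF I] by simp
      qed
      then show "g \<in> J" by (simp add: J_def)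
    qed
    show "0 \<in> J" using ideal.subspace_0[OF I] by (simp add: J_def)
    show "a + b \<in> J" if "a \<in> J" "b \<in> J" for a b
      using that ideal.subspace_add[OF I] by (simp add: J_def mfilter_add)
    show "a * b \<in> J" if b: "b \<in> J" for a b
    proof (induction a rule: mpoly_induct)
      case zero
      show ?case using ideal.subspace_0[OF I] by (simp add: J_def)
    next
      case (add f g)
      then show ?case using ideal.subspace_add[OF I] by (simp add: J_def mfilter_add distrib_right)
    next
      case (single m c)
      have "mfilter (\<lambda>x. bideg x = e) (Poly_Mapping.single m c * b) \<in> torus_ideal L" for e
      proof (cases "\<exists>e'. e = e' + bideg m")
        case True
        then obtain e' where e': "e = e' + bideg m" by blast
        have "mfilter (\<lambda>x. bideg x = e) (b * Poly_Mapping.single m c) = mfilter (\<lambda>x. bideg x = e') b * Poly_Mapping.single m c"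
          by (rule mfilter_mult_homogeneous) (auto simp: bideg_add e' split: if_splits)
        then have "mfilter (\<lambda>x. bideg x = e) (Poly_Mapping.single m c * b) = Poly_Mapping.single m c * mfilter (\<lambda>x. bideg x = e') b"
          by (simp only: mult.commute[of "Poly_Mapping.single m c"])
        moreover have "mfilter (\<lambda>x. bideg x = e') b \<in> torus_ideal L" using b by (simp only: J_def mem_Collect_eq)
        ultimately show ?thesis using ideal.subspace_scale[OF I] by metis
      next
        case False
        have "mfilter (\<lambda>x. bideg x = e) (b * Poly_Mapping.single m c) = mfilter (\<lambda>x. False) b * Poly_Mapping.single m c"
        proof (rule mfilter_mult_homogeneous)
          fix a b assume "b \<in> Poly_Mapping.keys (Poly_Mapping.single m c)"
          then have "b = m" by (simp split: if_splits)
          then show "bideg (a + b) = e \<longleftrightarrow> False" using False bideg_add by blast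
        qed
        also have "mfilter (\<lambda>x. False) b = 0" by (rule mfilter_eq_0) simp
        finally show ?thesis using ideal.subspace_0[OF I] by (simp add: mult.commute)
      qed
      then show ?case by (simp add: J_def)
    qed
  qed
  then show ?thesis using f unfolding gen J_def by blast
qed

definition standard_supports :: "('n \<Rightarrow> 'n \<Rightarrow> bool) \<Rightarrow> ('k::field ^ 'n::finite) set \<Rightarrow> 'n hvar set set"
  where "standard_supports ls V = {P. standard ls V {i. xv i \<in> P} {i. yv i \<in> P}}"

text \<open>The Hilbert function of the quotient counts the standard monomials. Being standard depends only on the
  support of a monomial, so their generating function is a sum of the series of the standard supports,
  and the K-polynomial is determined by the Hilbert function.\<close>

lemma K_polynomial_torus_ideal:
  fixes L :: "('k::field ^ 'n::finite) set" and tle :: "'n hvar mon \<Rightarrow> 'n hvar mon \<Rightarrow> bool"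
  assumes inf: "infinite (UNIV :: 'k set)" and L: "vec.subspace L" and T: "term_order tle"
  shows "K_polynomial (torus_ideal L) = (\<Sum>P\<in>standard_supports (induced_less tle) (perp L). support_series P)"
    (is "_ = ?K")
proof -
  let ?ls = "induced_less tle" and ?V = "perp L"
  note I = torus_ideal_subspace[of L]
  have ls: "strict_linear_order ?ls" by (rule strict_linear_order_induced_less[OF T])
  obtain F where F: "form_reps ?V F" using cocircuit_forms_exist cocircuit_forms_reps(1) by blast
  have std: "std_mon ?ls ?V m \<longleftrightarrow> Poly_Mapping.keys m \<in> standard_supports ?ls ?V" for m
    by (simp add: std_mon_def standard_supports_def in_keys_iff)
  have "0 \<in> L" using L by (rule vec.subspace_0)
  then have one: "1 \<notin> torus_ideal L" by (auto simp: torus_ideal_def)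
  have "euler_betti (torus_ideal L) d = Poly_Mapping.lookup ?K (st_mon d)" for d
  proof (rule hilbert_convolution_cancel)
    fix d
    have "int (card {m. std_mon ?ls ?V m \<and> bideg m = d}) =
        (\<Sum>e\<in>{..fst d} \<times> {..snd d}. euler_betti (torus_ideal L) e * int (card {x :: 'n hvar mon. e + bideg x = d}))"
    proof (rule hilbert_function_resolution[OF I one])
      show "mfilter (\<lambda>m. bideg m = d) f \<in> torus_ideal L" if "f \<in> torus_ideal L" for f d
        using torus_ideal_bigraded[OF inf L that] .
      show "f = 0" if "f \<in> torus_ideal L" "\<forall>m\<in>Poly_Mapping.keys f. std_mon ?ls ?V m" for f
        using standard_monomials_independent[OF inf ls L that(1)] that(2) by blast
      show "\<exists>g. f - g \<in> torus_ideal L \<and> (\<forall>m\<in>Poly_Mapping.keys g. std_mon ?ls ?V m)" for f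
        using reduce_polynomial[OF subspace_perp F T, of f] unfolding closure_generators(2)[OF inf L F T] by blast
    qed
    then have "(\<Sum>e\<in>{..fst d} \<times> {..snd d}. euler_betti (torus_ideal L) e * int (card {x :: 'n hvar mon. e + bideg x = d}))
        = int (card {m. std_mon ?ls ?V m \<and> bideg m = d})" by (rule sym)
    also have "\<dots> = hilbert_coeff ?K (UNIV :: 'n hvar mon set) d"
      unfolding std by (rule hilbert_coeff_support_series[symmetric])
    finally show "(\<Sum>e\<in>{..fst d} \<times> {..snd d}. euler_betti (torus_ideal L) e * int (card {x :: 'n hvar mon. e + bideg x = d}))
        = (\<Sum>e\<in>{..fst d} \<times> {..snd d}. Poly_Mapping.lookup ?K (st_mon e) * int (card {x :: 'n hvar mon. e + bideg x = d}))"
      unfolding hilbert_coeff_def by (simp only: UNIV_I simp_thms)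
  qed
  then have "Poly_Mapping.lookup ?K m = Sum_any (\<lambda>i. (- 1) ^ i *
      int (betti (torus_ideal L) i (Poly_Mapping.lookup m S_var, Poly_Mapping.lookup m T_var)))" for m
    unfolding euler_betti_def st_deg_def[symmetric] by (simp add: st_mon_deg)
  then have "K_polynomial (torus_ideal L) = Abs_poly_mapping (Poly_Mapping.lookup ?K)"
    unfolding K_polynomial_def by presburger
  then show ?thesis by (simp add: Poly_Mapping.lookup_inverse)
qed


section \<open>The bidegree\<close>

lemma degree_part_mfilter: "degree_part r f = mfilter (\<lambda>m. mon_degree m = r) f"
  by (simp add: degree_part_def mfilter_def)

lemma mon_degree_st: "mon_degree (m :: st mon) = Poly_Mapping.lookup m S_var + Poly_Mapping.lookup m T_var"
proof -
  have "v = S_var \<or> v = T_var" for v by (cases v) auto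
  then have "mon_degree m = (\<Sum>v\<in>{S_var, T_var}. Poly_Mapping.lookup m v)"
    unfolding mon_degree_def by (intro sum.mono_neutral_left) (auto simp: in_keys_iff)
  then show ?thesis by simp
qed

lemma mon_degree_st_add: "mon_degree (a + b :: st mon) = mon_degree a + mon_degree b"
  by (simp add: mon_degree_st lookup_add)

text \<open>The factor \<open>\<Prod>v\<in>P. 1 - Var (degree_var v)\<close> has constant term 1, so the part of lowest degree of the product
  is that of the other factor.\<close>

lemma degree_part_support:
  fixes P N :: "'n::finite hvar set"
  assumes r: "r \<le> card N"
  shows "degree_part r ((\<Prod>v\<in>N. Var (degree_var v)) * (\<Prod>v\<in>P. 1 - Var (degree_var v)) :: (st, int) mpoly)
    = (if card N = r then \<Prod>v\<in>N. Var (degree_var v) else 0)"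
proof -
  define w where "w = (\<Sum>v\<in>N. Poly_Mapping.single (degree_var v) (1 :: nat))"
  define q where "q = (\<Prod>v\<in>P. 1 - Var (degree_var v) :: (st, int) mpoly)"
  have w: "(\<Prod>v\<in>N. Var (degree_var v)) = (Poly_Mapping.single w 1 :: (st, int) mpoly)"
    unfolding w_def monom_of_def[symmetric] monom_of_sum Var_def ..
  have deg: "mon_degree w = card N"
  proof -
    have "mon_degree (\<Sum>v\<in>A. Poly_Mapping.single (degree_var v) (1 :: nat)) = card A" if "finite A" for A :: "'n hvar set"
      using that
    proof (induction A)
      case (insert v A)
      have "mon_degree (Poly_Mapping.single (degree_var v) (1 :: nat)) = 1"
        by (cases v) (simp_all add: mon_degree_st degree_var_def lookup_single)
      then show ?case using insert by (simp add: mon_degree_st_add del: One_nat_def)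
    qed (simp add: mon_degree_st)
    then show ?thesis by (simp add: w_def)
  qed
  have q: "Poly_Mapping.lookup q 0 = 1"
    unfolding lookup_0_eval q_def id_hom.eval_prod by (simp add: id_hom.eval_diff)
  have key: "Poly_Mapping.lookup (Poly_Mapping.single w 1 * q) m = (if m = w then 1 else 0)" if m: "mon_degree m = r" for m
  proof (cases "\<exists>m'. m = w + m'")
    case True
    then obtain m' where m': "m = w + m'" by blast
    then have "mon_degree m' = 0" using m deg r by (simp add: mon_degree_st_add)
    then have "Poly_Mapping.lookup m' v = 0" for v unfolding mon_degree_st by (cases v) auto
    then have "m' = 0" by (intro poly_mapping_eqI) simp
    then show ?thesis using q m' by (simp add: lookup_single_mult)
  next
    case False
    then show ?thesis by (metis add.right_neutral lookup_single_mult)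
  qed
  have "degree_part r (Poly_Mapping.single w 1 * q) = (if card N = r then Poly_Mapping.single w 1 else 0)"
    unfolding degree_part_mfilter
    by (rule poly_mapping_eqI) (use key deg in \<open>auto simp: lookup_mfilter lookup_single when_def\<close>)
  then show ?thesis unfolding w q_def .
qed

lemma homogenize_st_sum: "homogenize_st r (\<Sum>i\<in>J. h i) = (\<Sum>i\<in>J. homogenize_st r (h i))"
proof (induction J rule: infinite_finite_induct)
  case (insert i J)
  then show ?case by (simp add: homogenize_st_def Const_add distrib_right sum.distrib)
qed (simp_all add: homogenize_st_def)

lemma homogenize_st_power:
  assumes "a \<le> r"
  shows "homogenize_st r ([:0, 1:] ^ a) = Var S_var ^ a * Var T_var ^ (r - a)"
proof -
  have "homogenize_st r ([:0, 1:] ^ a) = (\<Sum>k\<le>r. if k = a then Var S_var ^ a * Var T_var ^ (r - a) else 0)"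
    unfolding homogenize_st_def monom_altdef[of 1 a, simplified, symmetric]
    by (intro sum.cong refl) auto
  then show ?thesis using assms by simp
qed

text \<open>The set \<open>C B\<close> consists of the activity variables of \<open>B\<close>, so the facets of the complex of standard
  supports correspond to the bases.\<close>

lemma standard_support_complement:
  fixes V :: "('k::field ^ 'n::finite) set"
  assumes ls: "strict_linear_order ls" and V: "vec.subspace V"
  defines "C B \<equiv> xv ` {b\<in>B. active ls V B b} \<union> yv ` {b\<in>B. \<not> active ls V B b}"
  shows "P \<in> standard_supports ls V \<longleftrightarrow> (\<exists>B\<in>coord_matroid V. C B \<subseteq> - P)"
proof
  assume "P \<in> standard_supports ls V"
  then have "standard ls V {i. xv i \<in> P} {i. yv i \<in> P}" by (simp add: standard_supports_def)
  then obtain B where "coord_basis V B" "\<And>b. b \<in> B \<Longrightarrow> b \<in> {i. xv i \<in> P} \<Longrightarrow> \<not> active ls V B b"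
    "\<And>b. b \<in> B \<Longrightarrow> b \<in> {i. yv i \<in> P} \<Longrightarrow> active ls V B b"
    using standard_basis_exists[OF ls V] by metis
  then show "\<exists>B\<in>coord_matroid V. C B \<subseteq> - P"
    unfolding C_def coord_matroid_def by (intro bexI[of _ B]) auto
next
  assume "\<exists>B\<in>coord_matroid V. C B \<subseteq> - P"
  then obtain B where B: "coord_basis V B" "C B \<subseteq> - P" unfolding coord_matroid_def by blast
  have "standard ls V {i. xv i \<in> P} {i. yv i \<in> P}"
    by (rule standard_iff_basis[OF ls V B(1)]) (use B(2) in \<open>auto simp: C_def\<close>)
  then show "P \<in> standard_supports ls V" by (simp add: standard_supports_def)
qed

text \<open>Substituting \<open>1 - s\<close> and \<open>1 - t\<close> into the series of a standard support \<open>P\<close> gives a polynomial whose lowest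
  term has degree \<open>card (- P)\<close>. This is at least \<open>r\<close>, and equality holds for the complements of the sets of
  activity variables of the bases.\<close>

lemma bidegree_torus_ideal:
  fixes L :: "('k::field ^ 'n::finite) set"
  assumes inf: "infinite (UNIV :: 'k set)" and L: "vec.subspace L"
  shows "bidegree (torus_ideal L) = homogenize_st (vec.dim (perp L)) (h_polynomial (coord_matroid (perp L)))"
proof -
  obtain tle :: "'n hvar mon \<Rightarrow> 'n hvar mon \<Rightarrow> bool" where T: "term_order tle" using term_order_exists by blast
  let ?ls = "induced_less tle" and ?V = "perp L"
  let ?r = "vec.dim ?V" and ?St = "standard_supports ?ls ?V" and ?M = "coord_matroid ?V"
  let ?D = "\<lambda>N :: 'n hvar set. (\<Prod>v\<in>N. Var (degree_var v)) :: (st, int) mpoly"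
  have ls: "strict_linear_order ?ls" by (rule strict_linear_order_induced_less[OF T])
  define IA where "IA B = {b\<in>B. active ?ls ?V B b}" for B
  define IP where "IP B = {b\<in>B. \<not> active ?ls ?V B b}" for B
  define C where "C B = xv ` IA B \<union> yv ` IP B" for B
  have St: "P \<in> ?St \<longleftrightarrow> (\<exists>B\<in>?M. C B \<subseteq> - P)" for P
    using standard_support_complement[OF ls subspace_perp[of L], of P] unfolding C_def IA_def IP_def .
  have card_split: "card (IA B) + card (IP B) = ?r" if "B \<in> ?M" for B
  proof -
    have "card B = ?r" using that coord_basis_card[OF subspace_perp] unfolding coord_matroid_def by force
    moreover have "B = IA B \<union> IP B" "IA B \<inter> IP B = {}" by (auto simp: IA_def IP_def)
    ultimately show ?thesis by (metis card_Un_disjoint finite_code)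
  qed
  have D_C: "?D (C B) = Var S_var ^ card (IA B) * Var T_var ^ card (IP B)" for B
  proof -
    have "?D (C B) = ?D (xv ` IA B) * ?D (yv ` IP B)"
      unfolding C_def by (rule prod.union_disjoint) auto
    then show ?thesis by (simp add: prod.reindex inj_on_def degree_var_def)
  qed
  have card_C: "card (C B) = ?r" if "B \<in> ?M" for B
  proof -
    have "card (C B) = card (xv ` IA B) + card (yv ` IP B)"
      unfolding C_def by (rule card_Un_disjoint) auto
    then show ?thesis using card_split[OF that] by (simp add: card_image inj_on_def)
  qed
  have inj: "inj_on C ?M"
  proof (rule inj_onI)
    fix B B' assume "C B = C B'"
    moreover have "B = {b. xv b \<in> C B \<or> yv b \<in> C B}" for B by (auto simp: C_def IA_def IP_def)
    ultimately show "B = B'" by metis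
  qed
  have ge: "?r \<le> card (- P)" if "P \<in> ?St" for P
    using that card_C unfolding St by (metis card_mono finite_code)
  have facets: "{P\<in>?St. card (- P) = ?r} = (\<lambda>B. - C B) ` ?M"
  proof (intro equalityI subsetI)
    fix P assume "P \<in> {P\<in>?St. card (- P) = ?r}"
    then obtain B where B: "B \<in> ?M" "C B \<subseteq> - P" "card (- P) = ?r" unfolding St by blast
    then have "C B = - P" using card_C[OF B(1)] by (intro card_subset_eq) auto
    then show "P \<in> (\<lambda>B. - C B) ` ?M" using B(1) by force
  next
    fix P assume "P \<in> (\<lambda>B. - C B) ` ?M"
    then show "P \<in> {P\<in>?St. card (- P) = ?r}" using card_C St by auto
  qed
  have ev: "mpoly_eval Const (\<lambda>v. 1 - Var v) (support_series P) = ?D (- P) * (\<Prod>v\<in>P. 1 - Var (degree_var v))"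
    for P :: "'n hvar set"
    by (simp add: support_series_def Const_hom.eval_mult Const_hom.eval_prod Const_hom.eval_diff mult.commute)
  have "bidegree (torus_ideal L) = (\<Sum>P\<in>?St. degree_part ?r (?D (- P) * (\<Prod>v\<in>P. 1 - Var (degree_var v))))"
    unfolding bidegree_def codim_torus_ideal[OF inf L] K_polynomial_torus_ideal[OF inf L T]
      Const_hom.eval_sum degree_part_mfilter mfilter_sum ev ..
  also have "\<dots> = (\<Sum>P\<in>?St. if card (- P) = ?r then ?D (- P) else 0)"
    by (intro sum.cong refl degree_part_support ge)
  also have "\<dots> = (\<Sum>P\<in>{P\<in>?St. card (- P) = ?r}. ?D (- P))"
    by (rule sum.inter_filter[symmetric]) simp
  also have "\<dots> = (\<Sum>B\<in>?M. ?D (C B))"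
    unfolding facets by (subst sum.reindex) (use inj in \<open>auto simp: inj_on_def\<close>)
  also have "\<dots> = (\<Sum>B\<in>?M. homogenize_st ?r ([:0, 1:] ^ card (IA B)))"
  proof (rule sum.cong[OF refl])
    fix B assume "B \<in> ?M"
    then have "card (IA B) \<le> ?r" "?r - card (IA B) = card (IP B)" using card_split[of B] by auto
    then show "?D (C B) = homogenize_st ?r ([:0, 1:] ^ card (IA B))"
      unfolding D_C by (simp add: homogenize_st_power)
  qed
  also have "\<dots> = homogenize_st ?r (h_polynomial ?M)"
    unfolding h_polynomial_activity[OF ls subspace_perp] homogenize_st_sum IA_def ..
  finally show ?thesis .
qed

section \<open>The closure of a linear space in a product of projective lines\<close>

theorem theorem1p3:
  fixes L :: "('k::field ^ 'n::finite) set"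
    and d r :: nat
    and A :: "nat \<Rightarrow> 'k ^ 'n"
    and M :: "'n set set"
  assumes "infinite (UNIV :: 'k set)"
    and "vec.subspace L"
    and "vec.dim L = d"
    and "r = CARD('n) - d"
    and "ideal_gen {linear_form (A i) | i. i < r} = vanishing_ideal L"
    and "M = column_matroid r A"
  shows
    "matroid M \<and> matroid_rank M = r \<and>
     (\<exists>a. cocircuit_forms L M a) \<and>
     \<comment> \<open>(a)\<close>
     (\<forall>a. cocircuit_forms L M a \<longrightarrow>
        minimally_generates (homogenized_cocircuits M a) (closure_ideal L)) \<and>
     \<comment> \<open>(b)\<close>
     (\<forall>a. cocircuit_forms L M a \<longrightarrow>
        universal_groebner_basis (homogenized_cocircuits M a) (closure_ideal L) \<and>
        (\<forall>tle. term_order tle \<longrightarrow>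
           reduced_groebner_basis tle (homogenized_cocircuits M a) (closure_ideal L))) \<and>
     \<comment> \<open>(c)\<close>
     multidegree (closure_ideal L) = (\<Sum>B\<in>M. \<Prod>b\<in>B. Var b) \<and>
     \<comment> \<open>(d)\<close>
     bidegree (closure_ideal L) = homogenize_st r (h_polynomial M) \<and>
     \<comment> \<open>(e)\<close>
     finite {initial_ideal tle (closure_ideal L) | tle. term_order tle} \<and>
     card {initial_ideal tle (closure_ideal L) | tle. term_order tle} \<le> fact r * card M \<and>
     \<comment> \<open>(f)\<close>
     (\<forall>tle. term_order tle \<longrightarrow>
        initial_ideal tle (closure_ideal L) =
          stanley_reisner_ideal (ext_activity_complex (induced_less tle) (dual_matroid M)) \<and>
        initial_ideal tle (closure_ideal L) =
          (\<Inter>B\<in>M. activity_ideal (induced_less tle) M B) \<and>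
        minimal_primary_decomposition (initial_ideal tle (closure_ideal L))
          (activity_ideal (induced_less tle) M ` M))"
proof -
  note inf = assms(1) and L = assms(2)
  have r: "r = CARD('n) - vec.dim L" using assms(3,4) by simp
  have M: "M = coord_matroid (perp L)"
    unfolding assms(6) column_matroid_coord_bases[OF L r assms(5)] coord_matroid_def ..
  have dim: "vec.dim (perp L) = r" unfolding r by (rule dim_perp[OF L])
  obtain a where a: "cocircuit_forms L (coord_matroid (perp L)) a" using cocircuit_forms_exist by blast
  note F = cocircuit_forms_reps(1)[OF a]
  obtain tle0 :: "'n hvar mon \<Rightarrow> 'n hvar mon \<Rightarrow> bool" where T0: "term_order tle0"
    using term_order_exists by blast
  note closure = closure_generators(1)[OF inf L F T0]
  have reduced: "reduced_groebner_basis tle (homogenized_cocircuits M b) (closure_ideal L)"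
    if b: "cocircuit_forms L M b" and T: "term_order tle" for b and tle :: "'n hvar mon \<Rightarrow> 'n hvar mon \<Rightarrow> bool"
    using closure_reduced_groebner[OF inf L cocircuit_forms_reps(1)[OF b[unfolded M]] T]
    unfolding M cocircuit_forms_reps(2)[OF b[unfolded M]] .
  have min: "minimally_generates (homogenized_cocircuits M b) (closure_ideal L)"
    if b: "cocircuit_forms L M b" for b
    using closure_minimal_generators[OF inf L cocircuit_forms_reps(1)[OF b[unfolded M]] T0]
    unfolding M cocircuit_forms_reps(2)[OF b[unfolded M]] .
  have universal: "universal_groebner_basis (homogenized_cocircuits M b) (closure_ideal L)"
    if b: "cocircuit_forms L M b" for b
    unfolding universal_groebner_basis_def using reduced[OF b] unfolding reduced_groebner_basis_def by blast
  have initial: "initial_ideal tle (closure_ideal L) =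
      stanley_reisner_ideal (ext_activity_complex (induced_less tle) (dual_matroid M)) \<and>
    initial_ideal tle (closure_ideal L) = (\<Inter>B\<in>M. activity_ideal (induced_less tle) M B) \<and>
    minimal_primary_decomposition (initial_ideal tle (closure_ideal L)) (activity_ideal (induced_less tle) M ` M)"
    if T: "term_order tle" for tle :: "'n hvar mon \<Rightarrow> 'n hvar mon \<Rightarrow> bool"
  proof -
    note ls = strict_linear_order_induced_less[OF T]
    have eq: "initial_ideal tle (closure_ideal L) = (\<Inter>B\<in>M. activity_ideal (induced_less tle) M B)"
      unfolding initial_ideal_closure[OF inf L F T] M by (rule nonstd_ideal_decomposition[OF ls subspace_perp F])
    moreover have "minimal_primary_decomposition (initial_ideal tle (closure_ideal L)) (activity_ideal (induced_less tle) M ` M)"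
      unfolding initial_ideal_closure[OF inf L F T] M
      by (rule nonstd_ideal_primary_decomposition[OF inf ls subspace_perp F])
    ultimately show ?thesis unfolding stanley_reisner_activity by blast
  qed
  have multi: "multidegree (closure_ideal L) = (\<Sum>B\<in>M. \<Prod>b\<in>B. Var b)"
    unfolding closure M by (rule multidegree_torus_ideal[OF inf L])
  have bi: "bidegree (closure_ideal L) = homogenize_st r (h_polynomial M)"
    unfolding closure M bidegree_torus_ideal[OF inf L] dim ..
  note count = initial_ideals_bound[OF inf L F, unfolded dim, folded M]
  have "matroid M" "matroid_rank M = r"
    unfolding M using matroid_coord_matroid[OF subspace_perp] matroid_rank_coord_matroid[OF subspace_perp] dim by auto
  moreover have "\<exists>a. cocircuit_forms L M a" using a unfolding M by blast
  ultimately show ?thesis using min universal reduced multi bi count initial by (intro conjI allI impI) blast+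
qed

end
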